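(* Let $d\ge1$ and $\kappa,\rho\in[0,\infty)$. (i) For all $n\in\mathbb N$, $\lim_{p\to\infty}\lambda_p^{(n)}(\kappa,\rho)=n\,\mu(\kappa/n)$. (ii) For all $p\in\mathbb N$ with $p>\rho/G_d(0)$, $\lim_{n\to\infty}\lambda_p^{(n)}(\kappa,\rho)=+\infty$. (iii) For all $p\in\mathbb N$ with $p\le\rho/G_d(0)$ and all $n\in\mathbb N$, $\lambda_p^{(n)}(\kappa,\rho)=0$.
   Context: $\mathbb N=\{1,2,\dots\}$. $\Delta$ is the discrete Laplacian on $\mathbb Z^d$: $\Delta f(x)=\sum_{y\sim x}[f(y)-f(x)]$, the sum being over nearest neighbours $y$ of $x$. A simple random walk on $\mathbb Z^d$ with step rate $2d\nu$ ($\nu\ge0$) is the continuous-time Markov process with generator $\nu\Delta$ (it jumps to each nearest neighbour at rate $\nu$; it does not move if $\nu=0$). Let $Y_1^\rho,\dots,Y_n^\rho$ be independent simple random walks on $\mathbb Z^d$ with step rate $2d\rho$, all starting from $0$; $\mathbb E_0^{\otimes n}$ is expectation with respect to them. Put $\xi(x,t)=\sum_{k=1}^n\delta_x(Y_k^\rho(t))$, where $\delta_x(y)=1$ if $y=x$ and $0$ otherwise. Let $u$ be the solution of the parabolic Anderson model $\partial_t u(x,t)=\kappa\Delta u(x,t)+\xi(x,t)u(x,t)$, $u(x,0)=1$, given by the Feynman–Kac formula $u(x,t)=\mathrm E_x\big(\exp[\int_0^t\xi(X^\kappa(s),t-s)\,ds]\big)$, where $X^\kappa$ is a simple random walk with step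 rate $2d\kappa$, independent of $\xi$, started at $x$ under $\mathrm E_x$. The $p$-th annealed Lyapunov exponent is $\lambda_p^{(n)}(\kappa,\rho)=\lim_{t\to\infty}\frac1{pt}\log\mathbb E_0^{\otimes n}\big([u(x,t)]^p\big)$; the limit exists, is finite, and does not depend on $x$ if $(\kappa,\rho)\ne(0,0)$ (for $(\kappa,\rho)=(0,0)$ take $x=0$). $G_d(x)$ is the Green function at $x$ of simple random walk on $\mathbb Z^d$ with step rate $2d$ started at $0$ (expected total time spent at $x$); $G_d(0)=\infty$ for $d=1,2$ (and then $\rho/G_d(0)=0$) and $G_d(0)<\infty$ for $d\ge3$. $\mu(\kappa)=\sup\mathrm{Sp}(\kappa\Delta+\delta_0)$ is the supremum of the spectrum of $\kappa\Delta+\delta_0$ on $\ell^2(\mathbb Z^d)$, where $\delta_0$ acts as multiplication by the indicator function of $0$. *)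

theory Defs
  imports "HOL-Probability.Probability"
begin

text \<open>
  The lattice of dimension \<open>d\<close> is the type \<open>int ^ 'd\<close> with \<open>d = CARD('d)\<close>; \<open>d \<ge> 1\<close> holds
  automatically.
\<close>

definition unit_steps :: "(int ^ 'd) set" where
  "unit_steps = {e. (\<Sum>i\<in>UNIV. \<bar>e $ i\<bar>) = 1}"

definition laplacian :: "(int ^ 'd \<Rightarrow> 'b::ab_group_add) \<Rightarrow> int ^ 'd \<Rightarrow> 'b" where
  "laplacian f x = (\<Sum>y | y - x \<in> unit_steps. f y - f x)"


section \<open>Simple random walk in continuous time\<close>

text \<open>
  The Markov process with generator \<open>\<nu>\<Delta>\<close>, built from its jump chain and holding times. A sample
  point \<open>\<omega>\<close> is a sequence of independent pairs (standard exponential variable, uniform unit step).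
  Exponential variables of mean 1 are the holding times after the time change \<open>t \<mapsto> 2d\<nu>t\<close>, so
  that the walk has jump rate \<open>2d\<nu>\<close>, and the degenerate case \<open>\<nu> = 0\<close> (no motion) needs no
  separate treatment. The set of jump times up to a given time is almost surely a finite initial
  segment; the value of \<open>card\<close> on the exceptional null set is irrelevant.
\<close>

definition walk_space :: "(nat \<Rightarrow> real \<times> (int ^ 'd)) measure" where
  "walk_space = (\<Pi>\<^sub>M k\<in>UNIV.
     density lborel (\<lambda>s. ennreal (exponential_density 1 s)) \<Otimes>\<^sub>M measure_pmf (pmf_of_set unit_steps))"

definition num_jumps :: "(nat \<Rightarrow> real \<times> (int ^ 'd)) \<Rightarrow> real \<Rightarrow> nat" where
  "num_jumps \<omega> s = card {k. (\<Sum>i\<le>k. fst (\<omega> i)) \<le> s}"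

definition walk ::
    "real \<Rightarrow> int ^ 'd \<Rightarrow> real \<Rightarrow> (nat \<Rightarrow> real \<times> (int ^ 'd)) \<Rightarrow> int ^ 'd" where
  "walk \<nu> x t \<omega> = x + (\<Sum>k<num_jumps \<omega> (2 * real CARD('d) * \<nu> * t). snd (\<omega> k))"

text \<open>
  Expected total time at \<open>x\<close> of the walk with step rate \<open>2d\<close> started at \<open>0\<close>. The value is an
  extended nonnegative real, where \<open>r / \<infinity> = 0\<close>.
\<close>

definition green :: "int ^ 'd \<Rightarrow> ennreal" where
  "green x = (\<integral>\<^sup>+\<omega>. emeasure lborel {t. 0 \<le> t \<and> walk 1 0 t \<omega> = x} \<partial>walk_space)"


section \<open>The parabolic Anderson model with finitely many catalysts\<close>

definition catalysts_space :: "nat \<Rightarrow> (nat \<Rightarrow> nat \<Rightarrow> real \<times> (int ^ 'd)) measure" where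
  "catalysts_space n = (\<Pi>\<^sub>M k\<in>{1..n}. walk_space)"

definition catalyst_field ::
    "nat \<Rightarrow> real \<Rightarrow> (nat \<Rightarrow> nat \<Rightarrow> real \<times> (int ^ 'd)) \<Rightarrow> int ^ 'd \<Rightarrow> real \<Rightarrow> real" where
  "catalyst_field n \<rho> \<eta> x t = (\<Sum>k=1..n. if walk \<rho> 0 t (\<eta> k) = x then 1 else 0)"

text \<open>The Feynman--Kac solution with initial condition 1, for the realisation \<open>\<eta>\<close> of the catalysts.\<close>

definition pam_solution ::
    "nat \<Rightarrow> real \<Rightarrow> real \<Rightarrow> (nat \<Rightarrow> nat \<Rightarrow> real \<times> (int ^ 'd)) \<Rightarrow> int ^ 'd \<Rightarrow> real \<Rightarrow> real" where
  "pam_solution n \<kappa> \<rho> \<eta> x t =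
     (\<integral>\<omega>. exp (LINT s:{0..t}|lborel. catalyst_field n \<rho> \<eta> (walk \<kappa> x s \<omega>) (t - s)) \<partial>walk_space)"

definition lyapunov :: "nat \<Rightarrow> nat \<Rightarrow> real \<Rightarrow> real \<Rightarrow> int ^ 'd \<Rightarrow> real" where
  "lyapunov n p \<kappa> \<rho> x =
     Lim at_top (\<lambda>t. 1 / (real p * t) *
       ln (\<integral>\<eta>. pam_solution n \<kappa> \<rho> \<eta> x t ^ p \<partial>catalysts_space n))"


section \<open>Spectrum of operators on square-summable functions\<close>

definition l2 :: "('a \<Rightarrow> complex) set" where
  "l2 = {f. (\<lambda>x. (cmod (f x))\<^sup>2) summable_on UNIV}"

definition l2_norm :: "('a \<Rightarrow> complex) \<Rightarrow> real" where
  "l2_norm f = sqrt (\<Sum>\<^sub>\<infinity>x. (cmod (f x))\<^sup>2)"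

text \<open>
  \<open>z\<close> is in the resolvent set if \<open>A - z\<close> is a bijection of \<open>\<ell>\<^sup>2\<close> with bounded inverse.
\<close>

definition l2_spectrum :: "(('a \<Rightarrow> complex) \<Rightarrow> 'a \<Rightarrow> complex) \<Rightarrow> complex set" where
  "l2_spectrum A = {z. \<not> (bij_betw (\<lambda>f x. A f x - z * f x) l2 l2 \<and>
     (\<exists>C. \<forall>f\<in>l2. l2_norm f \<le> C * l2_norm (\<lambda>x. A f x - z * f x)))}"

definition anderson_operator :: "real \<Rightarrow> (int ^ 'd \<Rightarrow> complex) \<Rightarrow> int ^ 'd \<Rightarrow> complex" where
  "anderson_operator \<kappa> f x = complex_of_real \<kappa> * laplacian f x + (if x = 0 then 1 else 0) * f x"

text \<open>
  The operator is bounded and self-adjoint, so its spectrum consists of real numbers and is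
  nonempty and bounded.
\<close>

definition spectral_sup :: "'d::finite itself \<Rightarrow> real \<Rightarrow> real" where
  "spectral_sup _ \<kappa> =
     Sup {r. complex_of_real r \<in> l2_spectrum (anderson_operator \<kappa> :: (int ^ 'd \<Rightarrow> complex) \<Rightarrow> _)}"

end

theory Submission
  imports Defs
begin

text \<open>
  Writing \<open>u\<^sup>p\<close> with \<open>p\<close> independent copies of \<open>X\<close>, the \<open>p\<close>-th moment becomes the exponential moment of the
  total time that pairs (walk, catalyst) spend together. Convexity of \<open>exp\<close> decouples the \<open>n\<close> catalysts,
  and a walk collides with a given path at most as often as with the origin, so the moment is at most
  the \<open>p\<close>-th power of the exponential moment of \<open>n\<close> times the local time of \<open>X\<close> at \<open>0\<close>; keeping all
  catalysts at the origin costs a factor \<open>exp (- 2 d \<rho> n t)\<close> and gives a matching lower bound. By a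
  renewal argument that local time moment grows at rate \<open>n \<mu>(\<kappa>/n)\<close>, because \<open>\<mu>(\<kappa>)\<close>, if positive, is the
  \<open>\<theta>\<close> at which the resolvent kernel of \<open>\<kappa>\<Delta>\<close> equals \<open>1\<close> on the diagonal. Hence
  \<open>n \<mu>(\<kappa>/n) - 2 d \<rho> n / p \<le> \<lambda>\<^sub>p \<le> n \<mu>(\<kappa>/n)\<close>, which yields (i). The moment is symmetric under exchanging
  \<open>(\<kappa>, p)\<close> with \<open>(\<rho>, n)\<close>, so also \<open>n \<mu>(\<rho>/p) - 2 d \<kappa> \<le> \<lambda>\<^sub>p \<le> n \<mu>(\<rho>/p)\<close>, and (ii) and (iii) follow since
  \<open>\<mu>(\<rho>/p) > 0\<close> exactly if \<open>\<rho>/p < G\<^sub>d(0)\<close>. The limit defining \<open>\<lambda>\<^sub>p\<close> exists because the moments with pinned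
  end points form a supermultiplicative kernel, symmetric by time reversal, whose diagonal therefore
  controls all its entries; the walks stay in a box of side \<open>O(t)\<close> up to a negligible error.
\<close>

section \<open>The walk as a function of its jump sequence\<close>

text \<open>The walks are given through jump chains and holding times, so even the Markov property
  has to be earned: since the exponential law is memoryless, a path that follows one sample up to a
  deterministic time and an independent one afterwards has the law of a single sample. The
  comparison with the origin rests on one inequality, that a symmetric transition probability is
  largest at displacement \<open>0\<close>; it reaches exponentials of collision times through
  Riemann sums. The supremum of the spectrum is located by hand: the resolvent kernel of
  \<open>\<kappa>\<Delta>\<close> is an eigenfunction where its diagonal value is \<open>1\<close>
  and a weight for the Schur test where that value is at most \<open>1\<close>; if \<open>1\<close>
  is never reached, slowly varying functions far from the origin put \<open>0\<close> into the
  spectrum. Existence of the limit is a genuine obstacle: \<open>lyapunov\<close> is defined by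
  \<open>Lim\<close>, whose value says nothing without convergence, and for
  \<open>\<kappa>, \<rho> > 0\<close> the upper and lower bounds at fixed \<open>p\<close> and
  \<open>n\<close> need not meet.\<close>

lemma unit_steps_eq: "(unit_steps :: (int ^ 'd) set) = (\<lambda>(i, s). axis i s) ` (UNIV \<times> {1, -1})"
proof (intro equalityI subsetI)
  fix e :: "int ^ 'd" assume "e \<in> unit_steps"
  then have *: "(\<Sum>i\<in>UNIV. \<bar>e $ i\<bar>) = 1" by (simp add: unit_steps_def)
  then obtain i where i: "e $ i \<noteq> 0"
    by (metis (no_types, lifting) abs_zero sum.neutral zero_neq_one)
  have **: "\<bar>e $ i\<bar> + (\<Sum>j\<in>UNIV - {i}. \<bar>e $ j\<bar>) = 1"
    using * by (subst (asm) sum.remove[of _ i]) auto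
  have "0 \<le> (\<Sum>j\<in>UNIV - {i}. \<bar>e $ j\<bar>)" by (intro sum_nonneg) auto
  with ** i have i1: "\<bar>e $ i\<bar> = 1" and "(\<Sum>j\<in>UNIV - {i}. \<bar>e $ j\<bar>) = 0" by linarith+
  then have "e $ j = 0" if "j \<noteq> i" for j
    using that by (subst (asm) sum_nonneg_eq_0_iff) auto
  then have "e = axis i (e $ i)" by (simp add: vec_eq_iff axis_def)
  moreover have "e $ i \<in> {1, -1}" using i1 by auto
  ultimately show "e \<in> (\<lambda>(i, s). axis i s) ` (UNIV \<times> {1, -1})" by force
next
  fix e :: "int ^ 'd" assume "e \<in> (\<lambda>(i, s). axis i s) ` (UNIV \<times> {1, -1})"
  then show "e \<in> unit_steps"
    by (auto simp: unit_steps_def axis_def if_distrib[of abs] cong: if_cong)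
qed

lemma finite_unit_steps [simp]: "finite (unit_steps :: (int ^ 'd) set)"
  by (simp add: unit_steps_eq)

lemma unit_steps_nonempty [simp]: "(unit_steps :: (int ^ 'd) set) \<noteq> {}"
  by (simp add: unit_steps_eq)

lemma card_unit_steps: "card (unit_steps :: (int ^ 'd) set) = 2 * CARD('d)"
proof -
  have "inj_on (\<lambda>(i, s). axis i s :: int ^ 'd) (UNIV \<times> {1, -1})"
    by (auto simp: inj_on_def axis_eq_axis)
  then show ?thesis
    by (simp add: unit_steps_eq card_image card_cartesian_product)
qed

lemma uminus_unit_steps [simp]: "- e \<in> unit_steps \<longleftrightarrow> e \<in> unit_steps"
  by (simp add: unit_steps_def)

section \<open>Law of a single step and of the sequence of steps\<close>

definition step_law :: "(real \<times> (int ^ 'd)) measure" where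
  "step_law = density lborel (\<lambda>s. ennreal (exponential_density 1 s)) \<Otimes>\<^sub>M measure_pmf (pmf_of_set unit_steps)"

lemma walk_space_eq: "walk_space = (\<Pi>\<^sub>M k\<in>UNIV. step_law)"
  by (simp add: walk_space_def step_law_def)

lemma sets_step_law [measurable_cong]:
  "sets (step_law :: (real \<times> (int ^ 'd)) measure) = sets (borel \<Otimes>\<^sub>M count_space UNIV)"
  unfolding step_law_def by (intro sets_pair_measure_cong) auto

lemma space_step_law [simp]: "space step_law = UNIV"
  by (simp add: step_law_def space_pair_measure)

lemma sets_walk_space [measurable_cong]:
  "sets (walk_space :: (nat \<Rightarrow> real \<times> (int ^ 'd)) measure) = sets (\<Pi>\<^sub>M k\<in>UNIV. borel \<Otimes>\<^sub>M count_space UNIV)"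
  unfolding walk_space_eq by (intro sets_PiM_cong) (auto simp: sets_step_law)

lemma space_walk_space [simp]: "space walk_space = UNIV"
  by (simp add: walk_space_eq space_PiM)

interpretation step_law: prob_space "step_law :: (real \<times> (int ^ 'd)) measure"
proof -
  interpret E: prob_space "density lborel (\<lambda>s. ennreal (exponential_density 1 s))"
    by (rule prob_space_exponential_density) simp
  interpret P: pair_prob_space "density lborel (\<lambda>s. ennreal (exponential_density 1 s))"
    "measure_pmf (pmf_of_set (unit_steps :: (int ^ 'd) set))" ..
  show "prob_space (step_law :: (real \<times> (int ^ 'd)) measure)"
    unfolding step_law_def by (rule P.prob_space_axioms)
qed

interpretation walk_seq: sequence_space "step_law :: (real \<times> (int ^ 'd)) measure" ..

interpretation walk_space: prob_space "walk_space :: (nat \<Rightarrow> real \<times> (int ^ 'd)) measure"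
  unfolding walk_space_eq by (rule walk_seq.P.prob_space_axioms)

lemma nn_integral_step_law:
  fixes F :: "real \<times> (int ^ 'd) \<Rightarrow> ennreal"
  assumes F: "F \<in> borel_measurable step_law"
  shows "(\<integral>\<^sup>+\<sigma>. F \<sigma> \<partial>step_law) = (\<integral>\<^sup>+s. ennreal (exponential_density 1 s) *
    ((\<Sum>e\<in>unit_steps. F (s, e)) / of_nat (card (unit_steps :: (int ^ 'd) set))) \<partial>lborel)"
proof -
  have F': "F \<in> borel_measurable (density lborel (\<lambda>s. ennreal (exponential_density 1 s)) \<Otimes>\<^sub>M measure_pmf (pmf_of_set unit_steps))"
    using F by (simp add: step_law_def)
  have [measurable]: "F \<in> borel_measurable (borel \<Otimes>\<^sub>M count_space UNIV)" using F
    by (simp cong: measurable_cong_sets add: sets_step_law)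
  have [measurable]: "(\<lambda>s. F (s, e)) \<in> borel_measurable borel" for e by measurable
  show ?thesis
    unfolding step_law_def
    by (subst measure_pmf.nn_integral_fst[OF F', symmetric], subst nn_integral_pmf_of_set, simp_all,
        subst nn_integral_density, simp_all)
qed

text \<open>An i.i.d. sequence is its head together with an independent copy of itself. The
  recursions over jumps below start from this decomposition: the transforms of arrival times, the
  law of spliced sequences and the first-jump equation of \<open>heat\<close>.\<close>

lemma nn_integral_walk_space_first_step:
  fixes F :: "(nat \<Rightarrow> real \<times> (int ^ 'd)) \<Rightarrow> ennreal"
  assumes F [measurable]: "F \<in> borel_measurable walk_space"
  shows "(\<integral>\<^sup>+\<omega>. F \<omega> \<partial>walk_space) = (\<integral>\<^sup>+\<sigma>. \<integral>\<^sup>+\<omega>. F (case_nat \<sigma> \<omega>) \<partial>walk_space \<partial>step_law)"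
proof -
  have "(\<integral>\<^sup>+\<omega>. F \<omega> \<partial>walk_space) = (\<integral>\<^sup>+\<omega>. F \<omega> \<partial>distr (step_law \<Otimes>\<^sub>M walk_space) walk_space (\<lambda>(s, \<omega>). case_nat s \<omega>))"
    unfolding walk_space_eq by (subst walk_seq.PiM_iter) simp
  also have "\<dots> = (\<integral>\<^sup>+x. F (case x of (s, \<omega>) \<Rightarrow> case_nat s \<omega>) \<partial>(step_law \<Otimes>\<^sub>M walk_space))"
    by (subst nn_integral_distr) (auto simp: walk_space_eq)
  also have "\<dots> = (\<integral>\<^sup>+\<sigma>. \<integral>\<^sup>+\<omega>. F (case_nat \<sigma> \<omega>) \<partial>walk_space \<partial>step_law)"
    by (subst walk_space.nn_integral_fst[symmetric]) (auto simp: walk_space_eq)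
  finally show ?thesis .
qed

lemma AE_walk_space_component:
  fixes P :: "real \<times> (int ^ 'd) \<Rightarrow> bool"
  assumes "AE \<sigma> in step_law. P \<sigma>"
  shows "AE \<omega> in walk_space. P (\<omega> k)"
  unfolding walk_space_eq by (rule walk_seq.AE_component) (use assms in auto)

lemma AE_step_law_pos: "AE \<sigma> in (step_law :: (real \<times> (int ^ 'd)) measure). 0 < fst \<sigma>"
proof -
  let ?N = "{\<sigma> :: real \<times> (int ^ 'd). \<not> 0 < fst \<sigma>}"
  have "{\<sigma> \<in> space step_law. \<not> 0 < fst \<sigma>} \<in> sets (step_law :: (real \<times> (int ^ 'd)) measure)"
    by measurable
  then have N [measurable]: "?N \<in> sets step_law" by simp
  have "emeasure step_law ?N = (\<integral>\<^sup>+\<sigma>. indicator ?N \<sigma> \<partial>step_law)"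
    by (subst nn_integral_indicator) (use N in auto)
  also have "\<dots> = 0"
  proof (subst nn_integral_step_law)
    show "indicator ?N \<in> borel_measurable step_law"
      by measurable
    have "AE s in lborel. s \<noteq> (0::real)" by (rule AE_lborel_singleton)
    then have "AE s in lborel. ennreal (exponential_density 1 s) *
          ((\<Sum>e\<in>unit_steps. indicator ?N (s, e)) / of_nat (card (unit_steps :: (int ^ 'd) set))) = 0"
      by eventually_elim (auto simp: exponential_density_def indicator_def)
    then show "(\<integral>\<^sup>+s. ennreal (exponential_density 1 s) *
          ((\<Sum>e\<in>unit_steps. indicator ?N (s, e)) / of_nat (card (unit_steps :: (int ^ 'd) set))) \<partial>lborel) = 0"
      by (simp add: nn_integral_cong_AE[where v="\<lambda>_. 0"])
  qed
  finally show ?thesis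
    by (intro AE_I[of _ _ ?N]) (use N in auto)
qed

section \<open>Arrival times and the walk of unit jump rate\<close>

definition arrival :: "(nat \<Rightarrow> real \<times> (int ^ 'd)) \<Rightarrow> nat \<Rightarrow> real" where
  "arrival \<omega> k = (\<Sum>i\<le>k. fst (\<omega> i))"

text \<open>The walk from \<open>0\<close> with total jump rate \<open>1\<close>. By
  \<open>walk_eq\<close> every walk of the model is a translate of it on the clock
  \<open>2 * real CARD('d) * \<nu> * t\<close>, so all estimates are made for this one
  process.\<close>

definition unit_walk :: "(nat \<Rightarrow> real \<times> (int ^ 'd)) \<Rightarrow> real \<Rightarrow> int ^ 'd" where
  "unit_walk \<omega> u = (\<Sum>k<num_jumps \<omega> u. snd (\<omega> k))"

text \<open>The almost sure event on which pathwise identities hold: positive holding times make the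
  arrivals increase, and finiteness makes the cardinality in \<open>num_jumps\<close> a true count
  (\<open>card\<close> of an infinite set is \<open>0\<close>).\<close>

definition regular :: "(nat \<Rightarrow> real \<times> (int ^ 'd)) \<Rightarrow> bool" where
  "regular \<omega> \<longleftrightarrow> (\<forall>k. 0 < fst (\<omega> k)) \<and> (\<forall>u. finite {k. arrival \<omega> k \<le> u})"

lemma num_jumps_eq: "num_jumps \<omega> u = card {k. arrival \<omega> k \<le> u}"
  by (simp add: num_jumps_def arrival_def)

lemma walk_eq: "walk \<nu> x t \<omega> = x + unit_walk (\<omega> :: nat \<Rightarrow> real \<times> (int ^ 'd)) (2 * real CARD('d) * \<nu> * t)"
  by (simp add: walk_def unit_walk_def)

lemma case_nat_eta: "case_nat (\<omega> 0) (\<lambda>k. \<omega> (Suc k)) = \<omega>"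
  by (auto simp: fun_eq_iff split: nat.split)

lemma arrival_case_nat:
  "arrival (case_nat \<sigma> \<omega>) 0 = fst \<sigma>"
  "arrival (case_nat \<sigma> \<omega>) (Suc k) = fst \<sigma> + arrival \<omega> k"
  by (simp_all add: arrival_def sum.atMost_Suc_shift del: sum.atMost_Suc)

lemma arrival_le_set_case_nat:
  "{k. arrival (case_nat \<sigma> \<omega>) k \<le> u} = (if fst \<sigma> \<le> u then {0} else {}) \<union> Suc ` {k. arrival \<omega> k \<le> u - fst \<sigma>}"
proof (rule set_eqI)
  fix k show "k \<in> {k. arrival (case_nat \<sigma> \<omega>) k \<le> u} \<longleftrightarrow>
    k \<in> (if fst \<sigma> \<le> u then {0} else {}) \<union> Suc ` {k. arrival \<omega> k \<le> u - fst \<sigma>}"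
    by (cases k) (auto simp: arrival_case_nat)
qed

lemma arrival_pos: "regular \<omega> \<Longrightarrow> 0 < arrival \<omega> k"
  by (auto simp: regular_def arrival_def intro!: sum_pos)

lemma regular_case_nat: "regular (case_nat \<sigma> \<omega>) \<longleftrightarrow> 0 < fst \<sigma> \<and> regular \<omega>"
proof -
  have "(\<forall>u. finite {k. arrival (case_nat \<sigma> \<omega>) k \<le> u}) \<longleftrightarrow> (\<forall>u. finite {k. arrival \<omega> k \<le> u})"
    unfolding arrival_le_set_case_nat
  proof (intro iffI allI)
    fix u assume *: "\<forall>u. finite ((if fst \<sigma> \<le> u then {0} else {}) \<union> Suc ` {k. arrival \<omega> k \<le> u - fst \<sigma>})"
    show "finite {k. arrival \<omega> k \<le> u}"
      using *[rule_format, of "u + fst \<sigma>"] by (simp add: finite_image_iff)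
  qed auto
  then show ?thesis
    by (auto simp: regular_def split: nat.splits)
qed

lemma num_jumps_case_nat:
  assumes "regular (case_nat \<sigma> \<omega>)"
  shows "num_jumps (case_nat \<sigma> \<omega>) u = (if fst \<sigma> \<le> u then Suc (num_jumps \<omega> (u - fst \<sigma>)) else 0)"
proof -
  have r: "regular \<omega>" using assms by (simp add: regular_case_nat)
  then have "finite {k. arrival \<omega> k \<le> u - fst \<sigma>}" by (simp add: regular_def)
  moreover have "{k. arrival \<omega> k \<le> u - fst \<sigma>} = {}" if "\<not> fst \<sigma> \<le> u"
    using arrival_pos[OF r] that by (auto simp: not_le) (smt (verit))
  ultimately show ?thesis
    by (auto simp: num_jumps_eq arrival_le_set_case_nat card_image)
qed

lemma unit_walk_case_nat:
  assumes "regular (case_nat \<sigma> \<omega>)"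
  shows "unit_walk (case_nat \<sigma> \<omega>) u = (if fst \<sigma> \<le> u then snd \<sigma> + unit_walk \<omega> (u - fst \<sigma>) else 0)"
  by (auto simp: unit_walk_def num_jumps_case_nat[OF assms] sum.lessThan_Suc_shift simp del: sum.lessThan_Suc)

lemma num_jumps_0: "regular \<omega> \<Longrightarrow> u \<le> 0 \<Longrightarrow> num_jumps \<omega> u = 0"
  by (auto simp: num_jumps_eq) (metis (mono_tags, lifting) Collect_empty_eq arrival_pos card.empty less_le_not_le order_trans)

lemma unit_walk_0: "regular \<omega> \<Longrightarrow> u \<le> 0 \<Longrightarrow> unit_walk \<omega> u = 0"
  by (simp add: unit_walk_def num_jumps_0)

lemma measurable_fst_step [measurable]: "(\<lambda>\<omega>. fst (\<omega> k)) \<in> borel_measurable walk_space"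
  by measurable

lemma measurable_snd_step [measurable]: "(\<lambda>\<omega>. snd (\<omega> k)) \<in> measurable walk_space (count_space UNIV)"
  by measurable

lemma measurable_arrival [measurable]: "(\<lambda>\<omega>. arrival \<omega> k) \<in> borel_measurable walk_space"
  unfolding arrival_def by measurable

lemma measurable_regular [measurable]: "Measurable.pred walk_space regular"
proof -
  \<comment> \<open>Finiteness up to integer times is enough, because the index sets grow with
    \<open>u\<close>; this leaves countably many conditions.\<close>
  have *: "regular \<omega> \<longleftrightarrow> (\<forall>k. 0 < fst (\<omega> k)) \<and> (\<forall>n::nat. finite {k. arrival \<omega> k \<le> real n})" for \<omega> :: "nat \<Rightarrow> real \<times> (int ^ 'd)"
  proof -
    have "finite {k. arrival \<omega> k \<le> u}" if "\<forall>n::nat. finite {k. arrival \<omega> k \<le> real n}" for u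
    proof -
      obtain n :: nat where "u \<le> real n" using real_arch_simple by blast
      then have "{k. arrival \<omega> k \<le> u} \<subseteq> {k. arrival \<omega> k \<le> real n}" by auto
      then show ?thesis using that finite_subset by blast
    qed
    then show ?thesis by (auto simp: regular_def)
  qed
  show ?thesis
    unfolding * by measurable
qed

lemma measurable_num_jumps [measurable (raw)]:
  assumes [measurable]: "f \<in> measurable M walk_space" "g \<in> borel_measurable M"
  shows "(\<lambda>x. num_jumps (f x) (g x)) \<in> measurable M (count_space UNIV)"
proof -
  have [measurable]: "(\<lambda>x. arrival (f x) k) \<in> borel_measurable M" for k
    by (rule measurable_compose[OF assms(1) measurable_arrival])
  show ?thesis
    unfolding num_jumps_eq by (rule measurable_card) (simp, measurable)
qed

text \<open>The codomain is countable, so one may fix the value of \<open>f\<close> and glue the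
  countably many translates of \<open>g\<close>.\<close>

lemma measurable_plus_count_space [measurable (raw)]:
  fixes f g :: "'a \<Rightarrow> 'b :: {plus, countable}"
  assumes "f \<in> measurable M (count_space UNIV)" "g \<in> measurable M (count_space UNIV)"
  shows "(\<lambda>x. f x + g x) \<in> measurable M (count_space UNIV)"
  by (rule measurable_compose_countable[where f="\<lambda>a x. a + g x", OF _ assms(1)])
    (rule measurable_compose[OF assms(2) measurable_count_space])

lemma measurable_unit_walk [measurable (raw)]:
  assumes [measurable]: "f \<in> measurable M walk_space" "g \<in> borel_measurable M"
  shows "(\<lambda>x. unit_walk (f x) (g x)) \<in> measurable M (count_space UNIV)"
proof -
  have *: "(\<lambda>x. \<Sum>k<n. snd (f x k)) \<in> measurable M (count_space UNIV)" for n
    by (induction n) (auto intro!: measurable_plus_count_space measurable_compose[OF assms(1) measurable_snd_step])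
  show ?thesis
    unfolding unit_walk_def
    by (rule measurable_compose_countable[where f="\<lambda>n x. \<Sum>k<n. snd (f x k)" and g="\<lambda>x. num_jumps (f x) (g x)"])
      (use * in measurable)
qed

section \<open>Exponential moments of arrival times and almost sure regularity\<close>

lemma nn_integral_step_law_fst:
  fixes f :: "real \<Rightarrow> ennreal"
  assumes [measurable]: "f \<in> borel_measurable borel"
  shows "(\<integral>\<^sup>+\<sigma>. f (fst \<sigma>) \<partial>(step_law :: (real \<times> (int ^ 'd)) measure)) =
    (\<integral>\<^sup>+s. ennreal (exponential_density 1 s) * f s \<partial>lborel)"
proof -
  have "(\<lambda>\<sigma>. f (fst \<sigma>)) \<in> borel_measurable (step_law :: (real \<times> (int ^ 'd)) measure)"
    by measurable
  then show ?thesis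
    by (subst nn_integral_step_law)
      (auto simp: mult.commute[of "of_nat _"] ennreal_mult_divide_eq intro!: nn_integral_cong)
qed

text \<open>Tilting the exponential density of rate \<open>1\<close> by
  \<open>exp (- \<theta> * s)\<close> gives the density of rate \<open>1 + \<theta>\<close> up to
  the factor \<open>1 / (1 + \<theta>)\<close>, so normalisation evaluates the transform.\<close>

lemma nn_integral_exp_holding:
  assumes \<theta>: "0 \<le> \<theta>"
  shows "(\<integral>\<^sup>+\<sigma>. ennreal (exp (- \<theta> * fst \<sigma>)) \<partial>(step_law :: (real \<times> (int ^ 'd)) measure)) = ennreal (1 / (1 + \<theta>))"
proof -
  have "prob_space (density lborel (\<lambda>s. ennreal (exponential_density (1 + \<theta>) s)))"
    by (rule prob_space_exponential_density) (use \<theta> in simp)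
  then have 1: "(\<integral>\<^sup>+s. ennreal (exponential_density (1 + \<theta>) s) \<partial>lborel) = 1"
    using prob_space.emeasure_space_1 by (fastforce simp: emeasure_density)
  have "(\<integral>\<^sup>+s. ennreal (exponential_density 1 s) * ennreal (exp (- \<theta> * s)) \<partial>lborel) =
    (\<integral>\<^sup>+s. ennreal (1 / (1 + \<theta>)) * ennreal (exponential_density (1 + \<theta>) s) \<partial>lborel)"
    using \<theta> by (intro nn_integral_cong)
      (auto simp: exponential_density_def ennreal_mult[symmetric] exp_add[symmetric] field_simps)
  also have "\<dots> = ennreal (1 / (1 + \<theta>))"
    by (subst nn_integral_cmult) (simp_all add: 1)
  finally show ?thesis
    using nn_integral_step_law_fst[where 'd='d, of "\<lambda>s. ennreal (exp (- \<theta> * s))"] by simp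
qed

lemma nn_integral_exp_arrival:
  assumes \<theta>: "0 \<le> \<theta>"
  shows "(\<integral>\<^sup>+\<omega>. ennreal (exp (- \<theta> * arrival \<omega> k)) \<partial>(walk_space :: (nat \<Rightarrow> real \<times> (int ^ 'd)) measure)) =
    ennreal ((1 / (1 + \<theta>)) ^ Suc k)"
proof (induction k)
  case 0
  show ?case
    using \<theta> by (subst nn_integral_walk_space_first_step)
      (auto simp: arrival_case_nat nn_integral_exp_holding[simplified] walk_space.emeasure_space_1[simplified])
next
  case (Suc k)
  have "(\<integral>\<^sup>+\<omega>. ennreal (exp (- \<theta> * arrival \<omega> (Suc k))) \<partial>(walk_space :: (nat \<Rightarrow> real \<times> (int ^ 'd)) measure)) =
    (\<integral>\<^sup>+\<sigma>. ennreal (exp (- \<theta> * fst \<sigma>)) * (\<integral>\<^sup>+\<omega>. ennreal (exp (- \<theta> * arrival \<omega> k)) \<partial>(walk_space :: (nat \<Rightarrow> real \<times> (int ^ 'd)) measure)) \<partial>(step_law :: (real \<times> (int ^ 'd)) measure))"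
    by (subst nn_integral_walk_space_first_step)
      (auto simp: arrival_case_nat algebra_simps exp_diff exp_minus divide_inverse ennreal_mult nn_integral_cmult[symmetric] intro!: nn_integral_cong)
  also have "\<dots> = ennreal ((1 / (1 + \<theta>)) ^ Suc (Suc k))"
    using \<theta> unfolding Suc by (subst nn_integral_multc) (auto simp: nn_integral_exp_holding[simplified] ennreal_mult[symmetric])
  finally show ?case .
qed

text \<open>Exponential Markov inequality. The parameter stays free because two values are used:
  \<open>\<theta> = 1\<close> for regularity and \<open>\<theta> = exp 1 - 1\<close> for the tail of
  the displacement.\<close>

lemma emeasure_arrival_le:
  assumes \<theta>: "0 \<le> \<theta>"
  shows "emeasure (walk_space :: (nat \<Rightarrow> real \<times> (int ^ 'd)) measure) {\<omega>. arrival \<omega> k \<le> u} \<le>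
    ennreal (exp (\<theta> * u) * (1 / (1 + \<theta>)) ^ Suc k)"
proof -
  have "{\<omega> \<in> space walk_space. arrival \<omega> k \<le> u} \<in> sets (walk_space :: (nat \<Rightarrow> real \<times> (int ^ 'd)) measure)"
    by measurable
  then have "emeasure (walk_space :: (nat \<Rightarrow> real \<times> (int ^ 'd)) measure) {\<omega>. arrival \<omega> k \<le> u} =
      (\<integral>\<^sup>+\<omega>. indicator {\<omega>. arrival \<omega> k \<le> u} \<omega> \<partial>(walk_space :: (nat \<Rightarrow> real \<times> (int ^ 'd)) measure))"
    by (subst nn_integral_indicator) auto
  also have "\<dots> \<le> (\<integral>\<^sup>+\<omega>. ennreal (exp (\<theta> * u)) * ennreal (exp (- \<theta> * arrival \<omega> k)) \<partial>(walk_space :: (nat \<Rightarrow> real \<times> (int ^ 'd)) measure))"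
    using \<theta> by (intro nn_integral_mono)
      (auto simp: indicator_def ennreal_mult[symmetric] exp_add[symmetric] mult_left_mono simp flip: ennreal_1 intro!: ennreal_leI)
  also have "\<dots> = ennreal (exp (\<theta> * u) * (1 / (1 + \<theta>)) ^ Suc k)"
    using \<theta> by (subst nn_integral_cmult) (auto simp: nn_integral_exp_arrival[simplified] ennreal_mult[symmetric])
  finally show ?thesis .
qed

lemma arrival_mono: "(\<And>i. 0 < fst (\<omega> i)) \<Longrightarrow> k \<le> l \<Longrightarrow> arrival \<omega> k \<le> arrival \<omega> l"
  unfolding arrival_def by (intro sum_mono2) (auto intro: less_imp_le)

text \<open>The exponential bound with \<open>\<theta> = 1\<close> gives probability at most
  \<open>exp n / 2 ^ Suc k\<close> to \<open>arrival \<omega> k \<le> n\<close>, so almost surely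
  the arrivals exceed every integer; their monotonicity leaves finitely many indices below each
  level.\<close>

lemma AE_regular: "AE \<omega> in (walk_space :: (nat \<Rightarrow> real \<times> (int ^ 'd)) measure). regular \<omega>"
proof -
  have 1: "AE \<omega> in (walk_space :: (nat \<Rightarrow> real \<times> (int ^ 'd)) measure). \<forall>k. 0 < fst (\<omega> k)"
    unfolding AE_all_countable by (intro allI AE_walk_space_component AE_step_law_pos)
  have 2: "AE \<omega> in (walk_space :: (nat \<Rightarrow> real \<times> (int ^ 'd)) measure). \<forall>n::nat. \<exists>k. real n < arrival \<omega> k"
    unfolding AE_all_countable
  proof
    fix n :: nat
    let ?N = "{\<omega> :: nat \<Rightarrow> real \<times> (int ^ 'd). \<forall>k. arrival \<omega> k \<le> real n}"
    have "{\<omega> \<in> space walk_space. \<forall>k. arrival \<omega> k \<le> real n} \<in> sets (walk_space :: (nat \<Rightarrow> real \<times> (int ^ 'd)) measure)"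
      by measurable
    then have N: "?N \<in> sets walk_space" by simp
    have "emeasure walk_space ?N \<le> ennreal (exp n * (1 / 2) ^ Suc k)" for k
    proof -
      have "{\<omega> \<in> space walk_space. arrival \<omega> k \<le> n} \<in> sets (walk_space :: (nat \<Rightarrow> real \<times> (int ^ 'd)) measure)"
        by measurable
      then have "emeasure walk_space ?N \<le> emeasure (walk_space :: (nat \<Rightarrow> real \<times> (int ^ 'd)) measure) {\<omega>. arrival \<omega> k \<le> n}"
        by (intro emeasure_mono) auto
      also note emeasure_arrival_le[of 1]
      finally show ?thesis by simp
    qed
    moreover have "(\<lambda>k. ennreal (exp n * (1 / 2) ^ Suc k)) \<longlonglongrightarrow> ennreal 0"
      by (intro tendsto_ennrealI tendsto_mult_right_zero LIMSEQ_Suc LIMSEQ_realpow_zero) auto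
    ultimately have "emeasure walk_space ?N \<le> 0"
      by (intro LIMSEQ_le_const[where X="\<lambda>k. ennreal (exp n * (1 / 2) ^ Suc k)"]) auto
    then show "AE \<omega> in (walk_space :: (nat \<Rightarrow> real \<times> (int ^ 'd)) measure). \<exists>k. real n < arrival \<omega> k"
      using N by (intro AE_I[of _ _ ?N]) (auto simp: not_less)
  qed
  show ?thesis
    using 1 2
  proof eventually_elim
    case (elim \<omega>)
    have "finite {k. arrival \<omega> k \<le> u}" for u
    proof -
      obtain n :: nat where "u \<le> real n" using real_arch_simple by blast
      moreover obtain k where k: "real n < arrival \<omega> k" using elim by blast
      ultimately have "{k. arrival \<omega> k \<le> u} \<subseteq> {..k}"
        using arrival_mono[of \<omega> k] elim by (smt (verit) atMost_iff mem_Collect_eq nle_le subsetI)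
      then show ?thesis by (rule finite_subset) simp
    qed
    with elim show ?case by (simp add: regular_def)
  qed
qed

section \<open>The Markov property\<close>

text \<open>The jump sequence of the walk that follows \<open>\<omega>\<close> up to time \<open>u\<close> and the increments of \<open>\<omega>'\<close> from then on.\<close>

fun splice :: "real \<Rightarrow> (nat \<Rightarrow> real \<times> (int ^ 'd)) \<Rightarrow> (nat \<Rightarrow> real \<times> (int ^ 'd)) \<Rightarrow> nat \<Rightarrow> real \<times> (int ^ 'd)" where
  "splice u \<omega> \<omega>' 0 = (if fst (\<omega> 0) \<le> u then \<omega> 0 else (u + fst (\<omega>' 0), snd (\<omega>' 0)))"
| "splice u \<omega> \<omega>' (Suc k) = (if fst (\<omega> 0) \<le> u then splice (u - fst (\<omega> 0)) (\<lambda>k. \<omega> (Suc k)) \<omega>' k else \<omega>' (Suc k))"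

lemma splice_case_nat:
  "splice u (case_nat \<sigma> \<omega>) \<omega>' = (if fst \<sigma> \<le> u then case_nat \<sigma> (splice (u - fst \<sigma>) \<omega> \<omega>')
    else case_nat (u + fst (\<omega>' 0), snd (\<omega>' 0)) (\<lambda>k. \<omega>' (Suc k)))"
proof
  fix k show "splice u (case_nat \<sigma> \<omega>) \<omega>' k = (if fst \<sigma> \<le> u then case_nat \<sigma> (splice (u - fst \<sigma>) \<omega> \<omega>')
    else case_nat (u + fst (\<omega>' 0), snd (\<omega>' 0)) (\<lambda>k. \<omega>' (Suc k))) k"
    by (cases k) simp_all
qed

text \<open>Induction on the number of jumps of \<open>\<omega>\<close> up to \<open>u\<close>. If
  the first holding time fits into \<open>u\<close>, the splice shares this step with
  \<open>\<omega>\<close> and the remaining sequences are spliced at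
  \<open>u - fst \<sigma>\<close>; otherwise the splice is \<open>\<omega>'\<close> with its first
  holding time prolonged by \<open>u\<close>.\<close>

lemma splice_properties:
  assumes "regular \<omega>" "regular \<omega>'" "0 \<le> u"
  shows "regular (splice u \<omega> \<omega>')
    \<and> (\<forall>r\<le>u. unit_walk (splice u \<omega> \<omega>') r = unit_walk \<omega> r)
    \<and> (\<forall>r\<ge>0. unit_walk (splice u \<omega> \<omega>') (u + r) = unit_walk \<omega> u + unit_walk \<omega>' r)"
  using assms
proof (induction "num_jumps \<omega> u" arbitrary: \<omega> u rule: less_induct)
  case less
  define \<sigma> \<omega>1 where "\<sigma> = \<omega> 0" and "\<omega>1 = (\<lambda>k. \<omega> (Suc k))"
  define \<sigma>' \<omega>1' where "\<sigma>' = \<omega>' 0" and "\<omega>1' = (\<lambda>k. \<omega>' (Suc k))"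
  have \<omega>: "\<omega> = case_nat \<sigma> \<omega>1" by (simp add: \<sigma>_def \<omega>1_def case_nat_eta)
  have \<omega>': "\<omega>' = case_nat \<sigma>' \<omega>1'" by (simp add: \<sigma>'_def \<omega>1'_def case_nat_eta)
  have reg: "0 < fst \<sigma>" "regular \<omega>1" "0 < fst \<sigma>'" "regular \<omega>1'"
    using less.prems by (simp_all add: \<omega> \<omega>' regular_case_nat)
  note nj = num_jumps_case_nat[OF less.prems(1)[unfolded \<omega>]]
  note uw = unit_walk_case_nat[OF less.prems(1)[unfolded \<omega>]]
  note uw' = unit_walk_case_nat[OF less.prems(2)[unfolded \<omega>']]
  show ?case
  proof (cases "fst \<sigma> \<le> u")
    case True
    let ?s = "splice (u - fst \<sigma>) \<omega>1 \<omega>'"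
    have "num_jumps \<omega>1 (u - fst \<sigma>) < num_jumps \<omega> u"
      using True by (simp add: \<omega> nj)
    from less.hyps[OF this reg(2) less.prems(2)] True
    have IH: "regular ?s" "\<And>r. r \<le> u - fst \<sigma> \<Longrightarrow> unit_walk ?s r = unit_walk \<omega>1 r"
      "\<And>r. 0 \<le> r \<Longrightarrow> unit_walk ?s (u - fst \<sigma> + r) = unit_walk \<omega>1 (u - fst \<sigma>) + unit_walk \<omega>' r"
      by auto
    have s: "splice u \<omega> \<omega>' = case_nat \<sigma> ?s" using True by (simp add: \<omega> splice_case_nat)
    have rs: "regular (case_nat \<sigma> ?s)" using reg IH by (simp add: regular_case_nat)
    have "unit_walk ?s (u + r - fst \<sigma>) = unit_walk \<omega>1 (u - fst \<sigma>) + unit_walk \<omega>' r" if "0 \<le> r" for r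
      using IH(3)[OF that] by (simp add: algebra_simps)
    then show ?thesis
      using True rs IH(2) unfolding s unit_walk_case_nat[OF rs] by (auto simp: \<omega> uw)
  next
    case False
    let ?s = "case_nat (u + fst \<sigma>', snd \<sigma>') \<omega>1'"
    have s: "splice u \<omega> \<omega>' = ?s" using False by (simp add: \<omega> splice_case_nat \<sigma>'_def \<omega>1'_def)
    have rs: "regular ?s" using reg less.prems by (simp add: regular_case_nat)
    show ?thesis
      using False rs reg unfolding s unit_walk_case_nat[OF rs] by (auto simp: \<omega> \<omega>' uw uw')
  qed
qed

lemmas regular_splice = splice_properties[THEN conjunct1]
lemmas unit_walk_splice_before = splice_properties[THEN conjunct2, THEN conjunct1, rule_format]
lemmas unit_walk_splice_after = splice_properties[THEN conjunct2, THEN conjunct2, rule_format]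

lemma measurable_walk_space_iff:
  fixes f :: "'a \<Rightarrow> nat \<Rightarrow> real \<times> (int ^ 'd)"
  shows "f \<in> measurable M walk_space \<longleftrightarrow> (\<forall>k. (\<lambda>x. f x k) \<in> measurable M (borel \<Otimes>\<^sub>M count_space UNIV))"
proof
  assume f: "f \<in> measurable M walk_space"
  have [measurable]: "(\<lambda>\<omega> :: nat \<Rightarrow> real \<times> (int ^ 'd). \<omega> k) \<in> measurable walk_space (borel \<Otimes>\<^sub>M count_space UNIV)" for k
    using measurable_component_singleton[of k UNIV "\<lambda>_. borel \<Otimes>\<^sub>M count_space UNIV"]
    by (simp cong: measurable_cong_sets add: sets_walk_space)
  show "\<forall>k. (\<lambda>x. f x k) \<in> measurable M (borel \<Otimes>\<^sub>M count_space UNIV)"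
    using f by (auto intro: measurable_compose)
next
  assume "\<forall>k. (\<lambda>x. f x k) \<in> measurable M (borel \<Otimes>\<^sub>M count_space UNIV)"
  then have "f \<in> measurable M (\<Pi>\<^sub>M k\<in>UNIV. borel \<Otimes>\<^sub>M count_space UNIV)"
    by (intro measurable_PiM_single') (auto simp: space_pair_measure)
  then show "f \<in> measurable M walk_space" by (simp cong: measurable_cong_sets add: sets_walk_space)
qed

lemma measurable_tail:
  assumes "f \<in> measurable M (walk_space :: (nat \<Rightarrow> real \<times> (int ^ 'd)) measure)"
  shows "(\<lambda>x k. f x (Suc k)) \<in> measurable M walk_space"
  using assms by (simp add: measurable_walk_space_iff)

lemma measurable_splice_component:
  fixes f g :: "'a \<Rightarrow> nat \<Rightarrow> real \<times> (int ^ 'd)"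
  assumes "u \<in> borel_measurable M" "f \<in> measurable M walk_space" "g \<in> measurable M walk_space"
  shows "(\<lambda>x. splice (u x) (f x) (g x) k) \<in> measurable M (borel \<Otimes>\<^sub>M count_space UNIV)"
  using assms
proof (induction k arbitrary: u f)
  case 0
  note [measurable] = 0 0(2,3)[unfolded measurable_walk_space_iff, rule_format, of 0]
  show ?case by simp measurable
next
  case (Suc k)
  note [measurable] = Suc.prems measurable_tail[OF Suc.prems(2)]
    Suc.prems(2)[unfolded measurable_walk_space_iff, rule_format, of 0]
    Suc.prems(3)[unfolded measurable_walk_space_iff, rule_format, of "Suc k"]
  have [measurable]: "(\<lambda>x. splice (u x - fst (f x 0)) (\<lambda>k. f x (Suc k)) (g x) k) \<in> measurable M (borel \<Otimes>\<^sub>M count_space UNIV)"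
    by (rule Suc.IH) measurable
  show ?case by simp measurable
qed

lemma measurable_splice [measurable (raw)]:
  fixes f g :: "'a \<Rightarrow> nat \<Rightarrow> real \<times> (int ^ 'd)"
  assumes "u \<in> borel_measurable M" "f \<in> measurable M walk_space" "g \<in> measurable M walk_space"
  shows "(\<lambda>x. splice (u x) (f x) (g x)) \<in> measurable M walk_space"
  unfolding measurable_walk_space_iff using measurable_splice_component[OF assms] by simp

lemma measurable_step_component:
  fixes f :: "'a \<Rightarrow> nat \<Rightarrow> real \<times> (int ^ 'd)"
  assumes "f \<in> measurable M walk_space"
  shows "(\<lambda>x. f x k) \<in> measurable M step_law"
  using assms[unfolded measurable_walk_space_iff] by (simp cong: measurable_cong_sets add: sets_step_law)

lemma measurable_splice_step:
  fixes f g :: "'a \<Rightarrow> nat \<Rightarrow> real \<times> (int ^ 'd)"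
  assumes "u \<in> borel_measurable M" "f \<in> measurable M walk_space" "g \<in> measurable M walk_space"
  shows "(\<lambda>x. splice (u x) (f x) (g x) k) \<in> measurable M step_law"
  using measurable_splice_component[OF assms] by (simp cong: measurable_cong_sets add: sets_step_law)

interpretation step_walk: pair_prob_space "step_law :: (real \<times> (int ^ 'd)) measure"
  "walk_space :: (nat \<Rightarrow> real \<times> (int ^ 'd)) measure" ..

interpretation walk_walk: pair_prob_space "walk_space :: (nat \<Rightarrow> real \<times> (int ^ 'd)) measure"
  "walk_space :: (nat \<Rightarrow> real \<times> (int ^ 'd)) measure" ..

section \<open>Spliced sequences have the law of a single sequence\<close>

lemma nn_integral_step_prod_indicator:
  assumes "\<And>i. A i \<in> sets (step_law :: (real \<times> (int ^ 'd)) measure)"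
  shows "(\<integral>\<^sup>+\<omega>. (\<Prod>i<k. indicator (A i) (\<omega> i)) \<partial>walk_space) = (\<Prod>i<k. emeasure step_law (A i) :: ennreal)"
  using assms
proof (induction k arbitrary: A)
  case 0
  then show ?case by (simp add: walk_space.emeasure_space_1[simplified])
next
  case (Suc k)
  note [measurable] = Suc.prems
  have [measurable]: "(\<lambda>\<omega>. indicator (A i) (\<omega> j) :: ennreal) \<in> borel_measurable walk_space" for i j
    unfolding walk_space_eq by measurable
  have "(\<integral>\<^sup>+\<omega>. (\<Prod>i<Suc k. indicator (A i) (\<omega> i)) \<partial>walk_space) =
    (\<integral>\<^sup>+\<sigma>. \<integral>\<^sup>+\<omega>. indicator (A 0) \<sigma> * (\<Prod>i<k. indicator (A (Suc i)) (\<omega> i) :: ennreal) \<partial>walk_space \<partial>step_law)"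
    by (subst nn_integral_walk_space_first_step) (auto simp: prod.lessThan_Suc_shift simp del: prod.lessThan_Suc)
  also have "\<dots> = (\<integral>\<^sup>+\<sigma>. indicator (A 0) \<sigma> * (\<Prod>i<k. emeasure step_law (A (Suc i))) \<partial>step_law)"
    by (subst nn_integral_cmult) (auto simp: Suc)
  also have "\<dots> = emeasure step_law (A 0) * (\<Prod>i<k. emeasure step_law (A (Suc i)))"
    by (subst nn_integral_multc) (auto simp: Suc.prems)
  finally show ?case
    by (simp add: prod.lessThan_Suc_shift del: prod.lessThan_Suc)
qed

text \<open>Cylinders determine the product measure, and those over arbitrary finite index sets are
  reduced to initial segments \<open>{..<k}\<close>, the form that suits induction on the head of a
  sequence.\<close>

lemma distr_eq_walk_spaceI:
  fixes f :: "'a \<Rightarrow> nat \<Rightarrow> real \<times> (int ^ 'd)"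
  assumes f: "f \<in> measurable M walk_space"
    and eq: "\<And>A k. (\<And>i. A i \<in> sets step_law) \<Longrightarrow>
      (\<integral>\<^sup>+x. (\<Prod>i<k. indicator (A i) (f x i)) \<partial>M) = (\<Prod>i<k. emeasure step_law (A i) :: ennreal)"
  shows "distr M walk_space f = walk_space"
  unfolding walk_space_eq
proof (rule walk_seq.PiM_eq)
  fix J :: "nat set" and E :: "nat \<Rightarrow> (real \<times> (int ^ 'd)) set"
  assume J: "finite J" "J \<subseteq> UNIV" and E: "\<And>j. j \<in> J \<Longrightarrow> E j \<in> sets step_law"
  have "\<exists>k. J \<subseteq> {..<k}" using finite_nat_bounded[OF J(1)] .
  then obtain k where k: "J \<subseteq> {..<k}" ..
  \<comment> \<open>Coordinates below \<open>k\<close> outside \<open>J\<close> are padded with the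
    whole space, which has measure \<open>1\<close>.\<close>
  define A where "A = (\<lambda>i. if i \<in> J then E i else UNIV)"
  have UNIV_sets: "UNIV \<in> sets (step_law :: (real \<times> (int ^ 'd)) measure)"
    using sets.top[of "step_law :: (real \<times> (int ^ 'd)) measure"] by simp
  have A: "A i \<in> sets step_law" for i using E UNIV_sets by (auto simp: A_def)
  let ?X = "prod_emb UNIV (\<lambda>i. step_law) J (Pi\<^sub>E J E)"
  have X: "?X \<in> sets walk_space" unfolding walk_space_eq using J E by (intro sets_PiM_I) auto
  have Xeq: "?X = {\<omega>. \<forall>i\<in>J. \<omega> i \<in> E i}"
    by (auto simp: prod_emb_def PiE_def Pi_def extensional_def)
  have "emeasure (distr M walk_space f) ?X = (\<integral>\<^sup>+y. indicator ?X y \<partial>distr M walk_space f)"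
    using X by (subst nn_integral_indicator) auto
  also have "\<dots> = (\<integral>\<^sup>+x. indicator ?X (f x) \<partial>M)"
    using X by (intro nn_integral_distr[OF f]) auto
  also have "\<dots> = (\<integral>\<^sup>+x. (\<Prod>i<k. indicator (A i) (f x i)) \<partial>M)"
  proof (intro nn_integral_cong)
    fix x
    have "(\<Prod>i<k. indicator (A i) (f x i)) = (if \<forall>i<k. f x i \<in> A i then 1 else 0 :: ennreal)"
      by (auto simp: indicator_def intro: prod.neutral intro!: prod_zero)
    moreover have "(\<forall>i<k. f x i \<in> A i) \<longleftrightarrow> f x \<in> ?X"
      using k by (auto simp: Xeq A_def)
    ultimately show "(indicator ?X (f x) :: ennreal) = (\<Prod>i<k. indicator (A i) (f x i))"
      by (simp add: indicator_def)
  qed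
  also have "\<dots> = (\<Prod>i<k. emeasure step_law (A i))" by (rule eq) (rule A)
  also have "\<dots> = (\<Prod>i\<in>J. emeasure step_law (A i))"
    by (rule prod.mono_neutral_right)
      (use k step_law.emeasure_space_1[simplified] in \<open>auto simp: A_def\<close>)
  also have "\<dots> = (\<Prod>i\<in>J. emeasure step_law (E i))"
    by (intro prod.cong) (auto simp: A_def)
  finally show "emeasure (distr M (Pi\<^sub>M UNIV (\<lambda>k. step_law)) f) ?X = (\<Prod>i\<in>J. emeasure step_law (E i))"
    by (simp add: walk_space_eq)
qed auto

text \<open>Memorylessness: the shift \<open>s \<mapsto> u + s\<close> in the exponential density
  costs the factor \<open>exp (- u)\<close> and otherwise reproduces the density.\<close>

lemma nn_integral_step_law_memoryless:
  fixes F :: "real \<times> (int ^ 'd) \<Rightarrow> ennreal"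
  assumes [measurable]: "F \<in> borel_measurable step_law" and u: "0 \<le> u"
  shows "(\<integral>\<^sup>+\<sigma>. (if fst \<sigma> \<le> u then 0 else F \<sigma>) \<partial>step_law) =
    ennreal (exp (- u)) * (\<integral>\<^sup>+\<sigma>. F (u + fst \<sigma>, snd \<sigma>) \<partial>step_law)"
proof -
  define g where "g = (\<lambda>s. (\<Sum>e\<in>unit_steps. F (s, e)) / of_nat (card (unit_steps :: (int ^ 'd) set)))"
  have F [measurable]: "F \<in> borel_measurable (borel \<Otimes>\<^sub>M count_space UNIV)" using assms(1)
    by (simp cong: measurable_cong_sets add: sets_step_law)
  have [measurable]: "(\<lambda>s. F (s, e)) \<in> borel_measurable borel" for e by measurable
  have [measurable]: "g \<in> borel_measurable borel" unfolding g_def by measurable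
  have "(\<integral>\<^sup>+\<sigma>. (if fst \<sigma> \<le> u then 0 else F \<sigma>) \<partial>step_law) =
    (\<integral>\<^sup>+s. ennreal (exponential_density 1 s) * (if s \<le> u then 0 else g s) \<partial>lborel)"
    by (subst nn_integral_step_law) (auto simp: g_def intro!: nn_integral_cong)
  also have "\<dots> = (\<integral>\<^sup>+s. ennreal (exponential_density 1 (u + s)) * (if u + s \<le> u then 0 else g (u + s)) \<partial>lborel)"
    by (subst nn_integral_real_affine[of _ 1 u]) (auto intro!: nn_integral_cong)
  also have "\<dots> = (\<integral>\<^sup>+s. ennreal (exp (- u)) * (ennreal (exponential_density 1 s) * g (u + s)) \<partial>lborel)"
  proof (rule nn_integral_cong_AE)
    \<comment> \<open>At \<open>s = 0\<close> the integrands may differ: the left one asks for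
      \<open>u + s > u\<close>, while the density on the right is already positive there.\<close>
    have "AE s in lborel. s \<noteq> (0::real)" by (rule AE_lborel_singleton)
    then show "AE s in lborel. ennreal (exponential_density 1 (u + s)) * (if u + s \<le> u then 0 else g (u + s)) =
      ennreal (exp (- u)) * (ennreal (exponential_density 1 s) * g (u + s))"
      by eventually_elim (use u in \<open>auto simp: exponential_density_def mult.assoc[symmetric] ennreal_mult[symmetric] exp_add[symmetric]\<close>)
  qed
  also have "\<dots> = ennreal (exp (- u)) * (\<integral>\<^sup>+s. ennreal (exponential_density 1 s) * g (u + s) \<partial>lborel)"
    by (subst nn_integral_cmult) auto
  also have "(\<integral>\<^sup>+s. ennreal (exponential_density 1 s) * g (u + s) \<partial>lborel) = (\<integral>\<^sup>+\<sigma>. F (u + fst \<sigma>, snd \<sigma>) \<partial>step_law)"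
    by (subst nn_integral_step_law) (auto simp: g_def)
  finally show ?thesis .
qed

lemma emeasure_holding_gt:
  assumes u: "0 \<le> u"
  shows "(\<integral>\<^sup>+\<sigma>. (if fst \<sigma> \<le> u then 0 else 1) \<partial>(step_law :: (real \<times> (int ^ 'd)) measure)) = ennreal (exp (- u))"
  using nn_integral_step_law_memoryless[OF _ u, where 'd='d, of "\<lambda>_. 1"] by (simp add: step_law.emeasure_space_1[simplified])

text \<open>The core of the Markov property. Condition on the first step of \<open>\<omega>\<close>:
  if it falls before \<open>u\<close>, the splice keeps it and the rest is the same problem with
  \<open>u\<close> reduced; if it falls later, the splice consists of the steps of
  \<open>\<omega>'\<close>, the first one delayed by \<open>u\<close>. The integral over
  \<open>\<omega>\<close> stands inside so that this case split is made with
  \<open>\<omega>'\<close> fixed.\<close>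

lemma nn_integral_splice_prod_indicator:
  fixes A :: "nat \<Rightarrow> (real \<times> (int ^ 'd)) set"
  assumes "\<And>i. A i \<in> sets step_law" "0 \<le> u"
  shows "(\<integral>\<^sup>+\<omega>'. \<integral>\<^sup>+\<omega>. (\<Prod>i<k. indicator (A i) (splice u \<omega> \<omega>' i)) \<partial>walk_space \<partial>walk_space) =
    (\<Prod>i<k. emeasure step_law (A i) :: ennreal)"
  using assms
proof (induction k arbitrary: u A)
  case 0
  then show ?case by (simp add: walk_space.emeasure_space_1[simplified])
next
  case (Suc k)
  note [measurable] = Suc.prems(1) and u = Suc.prems(2)
  note [measurable (raw)] = measurable_splice_step measurable_step_component
  define I where "I = (\<lambda>i \<sigma>. indicator (A i) \<sigma> :: ennreal)"
  have [measurable]: "I i \<in> borel_measurable step_law" for i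
    unfolding I_def by measurable
  \<comment> \<open>\<open>P\<close> collects the factors after the first, common to both cases;
    \<open>J\<close> is the first factor for a holding time delayed by \<open>u\<close>, and
    \<open>H\<close> is the integrand when the first step of \<open>\<omega>\<close> overshoots
    \<open>u\<close>.\<close>
  define P where "P = (\<Prod>i<k. emeasure step_law (A (Suc i)))"
  define J where "J = (\<integral>\<^sup>+\<sigma>. I 0 (u + fst \<sigma>, snd \<sigma>) \<partial>step_law)"
  define G where "G = (\<lambda>(\<sigma> :: real \<times> (int ^ 'd)) \<omega>'. \<integral>\<^sup>+\<omega>. (\<Prod>i<k. I (Suc i) (splice (u - fst \<sigma>) \<omega> \<omega>' i)) \<partial>walk_space)"
  define H where "H = (\<lambda>\<omega>'. I 0 (u + fst (\<omega>' 0), snd (\<omega>' 0)) * (\<Prod>i<k. I (Suc i) (\<omega>' (Suc i))))"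
  have shift [measurable]: "(\<lambda>x. (u + fst (f x), snd (f x))) \<in> measurable M step_law"
    if [measurable]: "f \<in> measurable M step_law" for f :: "'z \<Rightarrow> real \<times> (int ^ 'd)" and M
  proof -
    have [measurable]: "f \<in> measurable M (borel \<Otimes>\<^sub>M count_space UNIV)"
      using that by (simp cong: measurable_cong_sets add: sets_step_law)
    have "(\<lambda>x. (u + fst (f x), snd (f x))) \<in> measurable M (borel \<Otimes>\<^sub>M count_space UNIV)" by measurable
    then show ?thesis by (simp cong: measurable_cong_sets add: sets_step_law)
  qed
  have G_m [measurable]: "(\<lambda>(\<sigma>, \<omega>'). G \<sigma> \<omega>') \<in> borel_measurable (step_law \<Otimes>\<^sub>M walk_space)"
    unfolding G_def by measurable
  have G_m2 [measurable]: "(\<lambda>\<omega>'. G \<sigma> \<omega>') \<in> borel_measurable walk_space" for \<sigma>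
    unfolding G_def by measurable
  have H_m [measurable]: "H \<in> borel_measurable walk_space"
    unfolding H_def by measurable
  have inner: "(\<integral>\<^sup>+\<omega>. (\<Prod>i<Suc k. indicator (A i) (splice u \<omega> \<omega>' i)) \<partial>walk_space) =
    (\<integral>\<^sup>+\<sigma>. (if fst \<sigma> \<le> u then I 0 \<sigma> * G \<sigma> \<omega>' else H \<omega>') \<partial>step_law)" for \<omega>'
  proof -
    have "(\<integral>\<^sup>+\<omega>. (\<Prod>i<Suc k. indicator (A i) (splice u \<omega> \<omega>' i)) \<partial>walk_space) =
      (\<integral>\<^sup>+\<sigma>. \<integral>\<^sup>+\<omega>. (\<Prod>i<Suc k. I i (splice u (case_nat \<sigma> \<omega>) \<omega>' i)) \<partial>walk_space \<partial>step_law)"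
      unfolding I_def by (rule nn_integral_walk_space_first_step) measurable
    also have "\<dots> = (\<integral>\<^sup>+\<sigma>. (if fst \<sigma> \<le> u then I 0 \<sigma> * G \<sigma> \<omega>' else H \<omega>') \<partial>step_law)"
    proof (intro nn_integral_cong)
      fix \<sigma> :: "real \<times> (int ^ 'd)"
      have [measurable]: "(\<lambda>\<omega>. \<Prod>i<k. I (Suc i) (splice (u - fst \<sigma>) \<omega> \<omega>' i)) \<in> borel_measurable walk_space"
        by measurable
      show "(\<integral>\<^sup>+\<omega>. (\<Prod>i<Suc k. I i (splice u (case_nat \<sigma> \<omega>) \<omega>' i)) \<partial>walk_space) =
        (if fst \<sigma> \<le> u then I 0 \<sigma> * G \<sigma> \<omega>' else H \<omega>')"
        unfolding splice_case_nat
        by (auto simp: prod.lessThan_Suc_shift G_def H_def nn_integral_cmult walk_space.emeasure_space_1[simplified]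
            simp del: prod.lessThan_Suc)
    qed
    finally show ?thesis .
  qed
  have intH: "(\<integral>\<^sup>+\<omega>'. H \<omega>' \<partial>walk_space) = J * P"
  proof -
    have "(\<integral>\<^sup>+\<omega>'. H \<omega>' \<partial>walk_space) = (\<integral>\<^sup>+\<sigma>. \<integral>\<^sup>+\<omega>'. I 0 (u + fst \<sigma>, snd \<sigma>) * (\<Prod>i<k. I (Suc i) (\<omega>' i)) \<partial>walk_space \<partial>step_law)"
      by (subst nn_integral_walk_space_first_step) (auto simp: H_def)
    also have "\<dots> = (\<integral>\<^sup>+\<sigma>. I 0 (u + fst \<sigma>, snd \<sigma>) * P \<partial>step_law)"
      by (subst nn_integral_cmult) (auto simp: P_def I_def nn_integral_step_prod_indicator Suc.prems)
    also have "\<dots> = J * P" unfolding J_def by (rule nn_integral_multc) measurable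
    finally show ?thesis .
  qed
  have intG: "(\<integral>\<^sup>+\<omega>'. G \<sigma> \<omega>' \<partial>walk_space) = P" if "fst \<sigma> \<le> u" for \<sigma> :: "real \<times> (int ^ 'd)"
    unfolding G_def P_def I_def by (rule Suc.IH) (use Suc.prems that in auto)
  have mem: "(\<integral>\<^sup>+\<sigma>. (if fst \<sigma> \<le> u then 0 else I 0 \<sigma>) \<partial>step_law) = ennreal (exp (- u)) * J"
    unfolding J_def by (rule nn_integral_step_law_memoryless) (use u in auto)
  have "(\<integral>\<^sup>+\<omega>'. \<integral>\<^sup>+\<omega>. (\<Prod>i<Suc k. indicator (A i) (splice u \<omega> \<omega>' i)) \<partial>walk_space \<partial>walk_space) =
    (\<integral>\<^sup>+\<sigma>. \<integral>\<^sup>+\<omega>'. (if fst \<sigma> \<le> u then I 0 \<sigma> * G \<sigma> \<omega>' else H \<omega>') \<partial>walk_space \<partial>step_law)"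
    unfolding inner by (rule step_walk.Fubini') measurable
  also have "\<dots> = (\<integral>\<^sup>+\<sigma>. (if fst \<sigma> \<le> u then I 0 \<sigma> * P else J * P) \<partial>step_law)"
    by (intro nn_integral_cong) (auto simp: nn_integral_cmult intG intH)
  also have "\<dots> = (\<integral>\<^sup>+\<sigma>. (if fst \<sigma> \<le> u then I 0 \<sigma> else 0) * P + (if fst \<sigma> \<le> u then 0 else 1) * (J * P) \<partial>step_law)"
    by (intro nn_integral_cong) auto
  also have "\<dots> = (\<integral>\<^sup>+\<sigma>. (if fst \<sigma> \<le> u then I 0 \<sigma> else 0) \<partial>step_law) * P + ennreal (exp (- u)) * J * P"
    by (subst nn_integral_add)
      (auto simp: nn_integral_multc emeasure_holding_gt[OF u] mult.assoc)
  \<comment> \<open>By memorylessness the overshoot case contributes exactly the part of the first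
    factor with holding time above \<open>u\<close>, so the two parts add up to the full first
    factor.\<close>
  also have "\<dots> = ((\<integral>\<^sup>+\<sigma>. (if fst \<sigma> \<le> u then I 0 \<sigma> else 0) \<partial>step_law) + (\<integral>\<^sup>+\<sigma>. (if fst \<sigma> \<le> u then 0 else I 0 \<sigma>) \<partial>step_law)) * P"
    by (simp add: mem distrib_right)
  also have "\<dots> = (\<integral>\<^sup>+\<sigma>. I 0 \<sigma> \<partial>step_law) * P"
    by (subst nn_integral_add[symmetric]) (auto intro!: arg_cong[where f="\<lambda>x. x * P"] nn_integral_cong)
  also have "\<dots> = (\<Prod>i<Suc k. emeasure step_law (A i))"
    by (simp add: P_def I_def prod.lessThan_Suc_shift Suc.prems del: prod.lessThan_Suc)
  finally show ?case .
qed

text \<open>The Markov property at a deterministic time: after \<open>u\<close> the increments may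
  be taken from an independent sample. With \<open>splice_properties\<close> it becomes a statement
  about paths.\<close>

theorem nn_integral_splice:
  fixes F :: "(nat \<Rightarrow> real \<times> (int ^ 'd)) \<Rightarrow> ennreal"
  assumes [measurable]: "F \<in> borel_measurable walk_space" and u: "0 \<le> u"
  shows "(\<integral>\<^sup>+\<omega>. F \<omega> \<partial>walk_space) = (\<integral>\<^sup>+\<omega>. \<integral>\<^sup>+\<omega>'. F (splice u \<omega> \<omega>') \<partial>walk_space \<partial>walk_space)"
proof -
  have m [measurable]: "(\<lambda>(\<omega>, \<omega>'). splice u \<omega> \<omega>') \<in> measurable (walk_space \<Otimes>\<^sub>M walk_space) (walk_space :: (nat \<Rightarrow> real \<times> (int ^ 'd)) measure)"
    by measurable
  have "distr (walk_space \<Otimes>\<^sub>M walk_space) walk_space (\<lambda>(\<omega>, \<omega>'). splice u \<omega> \<omega>') =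
    (walk_space :: (nat \<Rightarrow> real \<times> (int ^ 'd)) measure)"
  proof (rule distr_eq_walk_spaceI[OF m])
    fix A :: "nat \<Rightarrow> (real \<times> (int ^ 'd)) set" and k :: nat
    assume A [measurable]: "\<And>i. A i \<in> sets step_law"
    note [measurable (raw)] = measurable_splice_step
    have "(\<integral>\<^sup>+x. (\<Prod>i<k. indicator (A i) ((case x of (\<omega>, \<omega>') \<Rightarrow> splice u \<omega> \<omega>') i)) \<partial>(walk_space \<Otimes>\<^sub>M walk_space)) =
      (\<integral>\<^sup>+\<omega>'. \<integral>\<^sup>+\<omega>. (\<Prod>i<k. indicator (A i) (splice u \<omega> \<omega>' i) :: ennreal) \<partial>walk_space \<partial>walk_space)"
      by (subst walk_walk.nn_integral_snd[symmetric]) (auto simp: split_beta')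
    then show "(\<integral>\<^sup>+x. (\<Prod>i<k. indicator (A i) ((case x of (\<omega>, \<omega>') \<Rightarrow> splice u \<omega> \<omega>') i)) \<partial>(walk_space \<Otimes>\<^sub>M walk_space)) =
      (\<Prod>i<k. emeasure step_law (A i) :: ennreal)"
      using nn_integral_splice_prod_indicator[OF A u] by simp
  qed
  then have "(\<integral>\<^sup>+\<omega>. F \<omega> \<partial>walk_space) = (\<integral>\<^sup>+x. F x \<partial>distr (walk_space \<Otimes>\<^sub>M walk_space) walk_space (\<lambda>(\<omega>, \<omega>'). splice u \<omega> \<omega>'))"
    by simp
  also have "\<dots> = (\<integral>\<^sup>+\<omega>. \<integral>\<^sup>+\<omega>'. F (splice u \<omega> \<omega>') \<partial>walk_space \<partial>walk_space)"
    by (subst nn_integral_distr) (auto simp: walk_space.nn_integral_fst[symmetric] split_beta')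
  finally show ?thesis .
qed

section \<open>Reflection of the walk, and integration up to null sets\<close>

definition flip :: "(nat \<Rightarrow> real \<times> (int ^ 'd)) \<Rightarrow> nat \<Rightarrow> real \<times> (int ^ 'd)" where
  "flip \<omega> k = (fst (\<omega> k), - snd (\<omega> k))"

lemma arrival_flip [simp]: "arrival (flip \<omega>) k = arrival \<omega> k"
  by (simp add: arrival_def flip_def)

lemma unit_walk_flip: "unit_walk (flip \<omega>) u = - unit_walk \<omega> u"
  by (simp add: unit_walk_def num_jumps_eq flip_def sum_negf)

lemma measurable_uminus_snd [measurable]:
  "(\<lambda>\<sigma>. (fst \<sigma>, - snd \<sigma>)) \<in> measurable step_law (step_law :: (real \<times> (int ^ 'd)) measure)"
proof -
  have "(\<lambda>\<sigma>. (fst \<sigma>, - snd \<sigma>)) \<in> measurable (borel \<Otimes>\<^sub>M count_space UNIV) (borel \<Otimes>\<^sub>M count_space (UNIV :: (int ^ 'd) set))"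
    by (intro measurable_Pair measurable_compose[OF measurable_snd measurable_count_space]) auto
  then show ?thesis by (simp cong: measurable_cong_sets add: sets_step_law)
qed

lemma nn_integral_step_law_uminus:
  fixes F :: "real \<times> (int ^ 'd) \<Rightarrow> ennreal"
  assumes [measurable]: "F \<in> borel_measurable step_law"
  shows "(\<integral>\<^sup>+\<sigma>. F (fst \<sigma>, - snd \<sigma>) \<partial>step_law) = (\<integral>\<^sup>+\<sigma>. F \<sigma> \<partial>step_law)"
proof -
  have "(\<Sum>e\<in>unit_steps. F (s, - e)) = (\<Sum>e\<in>unit_steps. F (s, e))" for s
    by (rule sum.reindex_bij_witness[of _ uminus uminus]) auto
  then show ?thesis
    by (simp add: nn_integral_step_law)
qed

lemma measurable_flip [measurable]: "flip \<in> measurable walk_space (walk_space :: (nat \<Rightarrow> real \<times> (int ^ 'd)) measure)"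
proof -
  have "(\<lambda>\<omega>. flip \<omega> k) \<in> measurable walk_space (step_law :: (real \<times> (int ^ 'd)) measure)" for k
    unfolding flip_def by (rule measurable_compose[OF measurable_step_component measurable_uminus_snd]) auto
  then show ?thesis
    unfolding measurable_walk_space_iff by (simp cong: measurable_cong_sets add: sets_step_law)
qed

text \<open>The step distribution is symmetric, hence so is the law of the whole sequence; this is
  the source of the symmetry of \<open>heat\<close>.\<close>

lemma nn_integral_flip:
  fixes F :: "(nat \<Rightarrow> real \<times> (int ^ 'd)) \<Rightarrow> ennreal"
  assumes [measurable]: "F \<in> borel_measurable walk_space"
  shows "(\<integral>\<^sup>+\<omega>. F (flip \<omega>) \<partial>walk_space) = (\<integral>\<^sup>+\<omega>. F \<omega> \<partial>walk_space)"
proof -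
  have "distr walk_space walk_space flip = (walk_space :: (nat \<Rightarrow> real \<times> (int ^ 'd)) measure)"
  proof (rule distr_eq_walk_spaceI[OF measurable_flip])
    fix A :: "nat \<Rightarrow> (real \<times> (int ^ 'd)) set" and k :: nat
    assume A [measurable]: "\<And>i. A i \<in> sets step_law"
    have "(\<Prod>i<k. indicator (A i) (flip \<omega> i)) = (\<Prod>i<k. indicator ((\<lambda>\<sigma>. (fst \<sigma>, - snd \<sigma>)) -` A i) (\<omega> i) :: ennreal)" for \<omega>
      by (simp add: flip_def indicator_def)
    moreover have B [measurable]: "(\<lambda>\<sigma>. (fst \<sigma>, - snd \<sigma>)) -` A i \<in> sets step_law" for i
      using measurable_sets[OF measurable_uminus_snd A] by simp
    moreover have "emeasure step_law ((\<lambda>\<sigma>. (fst \<sigma>, - snd \<sigma>)) -` A i) = emeasure step_law (A i)" for i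
    proof -
      have "indicator ((\<lambda>\<sigma>. (fst \<sigma>, - snd \<sigma>)) -` A i) \<sigma> = (indicator (A i) (fst \<sigma>, - snd \<sigma>) :: ennreal)" for \<sigma>
        by (simp add: indicator_def)
      then show ?thesis
        using nn_integral_step_law_uminus[of "indicator (A i)"] A B by (simp flip: nn_integral_indicator)
    qed
    ultimately show "(\<integral>\<^sup>+\<omega>. (\<Prod>i<k. indicator (A i) (flip \<omega> i)) \<partial>walk_space) = (\<Prod>i<k. emeasure step_law (A i) :: ennreal)"
      by (simp add: nn_integral_step_prod_indicator)
  qed
  then have "(\<integral>\<^sup>+\<omega>. F \<omega> \<partial>walk_space) = (\<integral>\<^sup>+\<omega>. F \<omega> \<partial>distr walk_space walk_space flip)" by simp
  then show ?thesis by (simp add: nn_integral_distr)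
qed

text \<open>Packages the Markov property with its null sets: the integrand has to be evaluated only
  for regular sequences, where the splice has its pathwise description.\<close>

lemma nn_integral_splice_cong:
  fixes F :: "(nat \<Rightarrow> real \<times> (int ^ 'd)) \<Rightarrow> ennreal"
  assumes "F \<in> borel_measurable walk_space" "0 \<le> u"
    and eq: "\<And>\<omega> \<omega>'. regular \<omega> \<Longrightarrow> regular \<omega>' \<Longrightarrow> F (splice u \<omega> \<omega>') = G \<omega> \<omega>'"
  shows "(\<integral>\<^sup>+\<omega>. F \<omega> \<partial>walk_space) = (\<integral>\<^sup>+\<omega>. \<integral>\<^sup>+\<omega>'. G \<omega> \<omega>' \<partial>walk_space \<partial>walk_space)"
proof -
  have "(\<integral>\<^sup>+\<omega>. \<integral>\<^sup>+\<omega>'. F (splice u \<omega> \<omega>') \<partial>walk_space \<partial>walk_space) = (\<integral>\<^sup>+\<omega>. \<integral>\<^sup>+\<omega>'. G \<omega> \<omega>' \<partial>walk_space \<partial>walk_space)"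
  proof (rule nn_integral_cong_AE)
    show "AE \<omega> in walk_space. (\<integral>\<^sup>+\<omega>'. F (splice u \<omega> \<omega>') \<partial>walk_space) = (\<integral>\<^sup>+\<omega>'. G \<omega> \<omega>' \<partial>walk_space)"
      using AE_regular
    proof eventually_elim
      case (elim \<omega>)
      show ?case
        by (rule nn_integral_cong_AE) (use AE_regular in eventually_elim, use elim eq in simp)
    qed
  qed
  then show ?thesis using nn_integral_splice[OF assms(1,2)] by simp
qed

lemma nn_integral_first_step_cong:
  fixes F :: "(nat \<Rightarrow> real \<times> (int ^ 'd)) \<Rightarrow> ennreal"
  assumes "F \<in> borel_measurable walk_space"
    and eq: "\<And>\<sigma> \<omega>. regular \<omega> \<Longrightarrow> 0 < fst \<sigma> \<Longrightarrow> F (case_nat \<sigma> \<omega>) = G \<sigma> \<omega>"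
  shows "(\<integral>\<^sup>+\<omega>. F \<omega> \<partial>walk_space) = (\<integral>\<^sup>+\<sigma>. \<integral>\<^sup>+\<omega>. G \<sigma> \<omega> \<partial>walk_space \<partial>step_law)"
proof -
  have "(\<integral>\<^sup>+\<sigma>. \<integral>\<^sup>+\<omega>. F (case_nat \<sigma> \<omega>) \<partial>walk_space \<partial>step_law) = (\<integral>\<^sup>+\<sigma>. \<integral>\<^sup>+\<omega>. G \<sigma> \<omega> \<partial>walk_space \<partial>step_law)"
  proof (rule nn_integral_cong_AE)
    show "AE \<sigma> in step_law. (\<integral>\<^sup>+\<omega>. F (case_nat \<sigma> \<omega>) \<partial>walk_space) = (\<integral>\<^sup>+\<omega>. G \<sigma> \<omega> \<partial>walk_space)"
      using AE_step_law_pos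
    proof eventually_elim
      case (elim \<sigma>)
      show ?case
        by (rule nn_integral_cong_AE) (use AE_regular in eventually_elim, use elim eq in simp)
    qed
  qed
  then show ?thesis using nn_integral_walk_space_first_step[OF assms(1)] by simp
qed

lemma measurable_indicator_count_space [measurable (raw)]:
  "f \<in> measurable M (count_space UNIV) \<Longrightarrow> (\<lambda>x. indicator A (f x) :: 'b :: {topological_space, zero_neq_one}) \<in> borel_measurable M"
  by (rule measurable_compose[OF _ borel_measurable_count_space])

section \<open>Transition probabilities\<close>

text \<open>Heat kernel of the walk with total jump rate \<open>1\<close>, that is, of the generator
  \<open>\<Delta> / (2 d)\<close>.\<close>

definition heat :: "real \<Rightarrow> int ^ 'd \<Rightarrow> real" where
  "heat u z = measure walk_space {\<omega>. unit_walk \<omega> u = z}"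

lemma sets_unit_walk_eq [measurable]: "{\<omega> :: nat \<Rightarrow> real \<times> (int ^ 'd). unit_walk \<omega> u = z} \<in> sets walk_space"
proof -
  have "{\<omega> \<in> space walk_space. unit_walk \<omega> u = (z :: int ^ 'd)} \<in> sets walk_space" by measurable
  then show ?thesis by simp
qed

lemma nn_integral_heat:
  "(\<integral>\<^sup>+\<omega>. indicator {z} (unit_walk \<omega> u) \<partial>walk_space) = ennreal (heat u (z :: int ^ 'd))"
proof -
  have "indicator {z} (unit_walk \<omega> u) = (indicator {\<omega>. unit_walk \<omega> u = z} \<omega> :: ennreal)" for \<omega>
    by (simp add: indicator_def)
  then show ?thesis
    by (simp add: heat_def walk_space.emeasure_eq_measure)
qed

lemma heat_nonneg [simp]: "0 \<le> heat u z" by (simp add: heat_def)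
lemma heat_le_1: "heat u z \<le> 1" by (simp add: heat_def)

lemma heat_0:
  assumes "u \<le> 0"
  shows "heat u (z :: int ^ 'd) = indicator {0} z"
proof -
  have "AE \<omega> in walk_space. unit_walk \<omega> u = (0 :: int ^ 'd)"
    using AE_regular by eventually_elim (simp add: unit_walk_0 assms)
  then have "(\<integral>\<^sup>+\<omega>. indicator {z} (unit_walk \<omega> u) \<partial>(walk_space :: (nat \<Rightarrow> real \<times> (int ^ 'd)) measure)) =
    (\<integral>\<^sup>+\<omega>. indicator {z} 0 \<partial>(walk_space :: (nat \<Rightarrow> real \<times> (int ^ 'd)) measure))"
    by (intro nn_integral_cong_AE) auto
  then have "ennreal (heat u z) = indicator {z} 0"
    unfolding nn_integral_heat by (simp add: walk_space.emeasure_space_1[simplified])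
  then show ?thesis
    by (cases "z = 0") auto
qed

lemma heat_uminus: "heat u (- z) = heat u z"
proof -
  have "ennreal (heat u z) = (\<integral>\<^sup>+\<omega>. indicator {z} (unit_walk (flip \<omega>) u) \<partial>walk_space)"
    by (subst nn_integral_flip[where F="\<lambda>\<omega>. indicator {z} (unit_walk \<omega> u)"]) (auto simp: nn_integral_heat)
  also have "\<dots> = (\<integral>\<^sup>+\<omega>. indicator {- z} (unit_walk \<omega> u) \<partial>walk_space)"
    by (intro nn_integral_cong) (auto simp: unit_walk_flip indicator_def)
  finally show ?thesis by (simp add: nn_integral_heat)
qed

lemma nn_integral_unit_walk:
  fixes g :: "int ^ 'd \<Rightarrow> ennreal"
  shows "(\<integral>\<^sup>+\<omega>. g (unit_walk \<omega> u) \<partial>walk_space) = (\<integral>\<^sup>+w. ennreal (heat u w) * g w \<partial>count_space UNIV)"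
proof -
  interpret C: sigma_finite_measure "count_space (UNIV :: (int ^ 'd) set)"
    by (rule sigma_finite_measure_count_space)
  interpret P: pair_sigma_finite "walk_space :: (nat \<Rightarrow> real \<times> (int ^ 'd)) measure" "count_space (UNIV :: (int ^ 'd) set)" ..
  have "(\<integral>\<^sup>+\<omega>. g (unit_walk \<omega> u) \<partial>walk_space) =
    (\<integral>\<^sup>+\<omega>. \<integral>\<^sup>+w. indicator {w} (unit_walk \<omega> u) * g w \<partial>count_space UNIV \<partial>walk_space)"
  proof (intro nn_integral_cong)
    fix \<omega> :: "nat \<Rightarrow> real \<times> (int ^ 'd)"
    have "(\<integral>\<^sup>+w. indicator {w} (unit_walk \<omega> u) * g w \<partial>count_space UNIV) =
      (\<integral>\<^sup>+w. g w * indicator {unit_walk \<omega> u} w \<partial>count_space UNIV)"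
      by (intro nn_integral_cong) (auto simp: indicator_def)
    then show "g (unit_walk \<omega> u) = (\<integral>\<^sup>+w. indicator {w} (unit_walk \<omega> u) * g w \<partial>count_space UNIV)"
      by (simp add: nn_integral_indicator_singleton)
  qed
  also have "\<dots> = (\<integral>\<^sup>+w. \<integral>\<^sup>+\<omega>. indicator {w} (unit_walk \<omega> u) * g w \<partial>walk_space \<partial>count_space UNIV)"
  proof (rule P.Fubini'[symmetric])
    have "(\<lambda>x. indicator {w} (unit_walk (fst x) u) * g w :: ennreal) \<in> borel_measurable (walk_space \<Otimes>\<^sub>M count_space UNIV)" for w
      by measurable
    then show "(\<lambda>(\<omega>, w). indicator {w} (unit_walk \<omega> u) * g w) \<in> borel_measurable (walk_space \<Otimes>\<^sub>M count_space UNIV)"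
      unfolding split_beta'
      by (rule measurable_compose_countable[where f="\<lambda>w x. indicator {w} (unit_walk (fst x) u) * g w" and g=snd]) measurable
  qed
  also have "\<dots> = (\<integral>\<^sup>+w. ennreal (heat u w) * g w \<partial>count_space UNIV)"
    by (simp add: nn_integral_multc nn_integral_heat)
  finally show ?thesis .
qed

text \<open>Chapman--Kolmogorov: splice at time \<open>u\<close> and sum over the position reached
  there.\<close>

lemma heat_add:
  fixes z :: "int ^ 'd"
  assumes "0 \<le> u" "0 \<le> v"
  shows "ennreal (heat (u + v) z) = (\<integral>\<^sup>+w. ennreal (heat u w) * ennreal (heat v (z - w)) \<partial>count_space UNIV)"
proof -
  have "ennreal (heat (u + v) z) = (\<integral>\<^sup>+\<omega>. \<integral>\<^sup>+\<omega>'. indicator {z - unit_walk \<omega> u} (unit_walk \<omega>' v) \<partial>walk_space \<partial>walk_space)"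
    unfolding nn_integral_heat[symmetric]
    by (rule nn_integral_splice_cong[where u=u]) (use assms in \<open>auto simp: unit_walk_splice_after indicator_def\<close>)
  then show ?thesis
    by (simp add: nn_integral_heat nn_integral_unit_walk[where g="\<lambda>w. ennreal (heat v (z - w))"])
qed

lemma heat_mult_le:
  fixes z w :: "int ^ 'd"
  assumes "0 \<le> u" "0 \<le> v"
  shows "heat u z * heat v w \<le> heat (u + v) (z + w)"
proof -
  have "ennreal (heat u z) * ennreal (heat v w) = (\<integral>\<^sup>+x. ennreal (heat u x) * ennreal (heat v (z + w - x)) * indicator {z} x \<partial>count_space UNIV)"
    by (simp add: nn_integral_indicator_singleton)
  also have "\<dots> \<le> ennreal (heat (u + v) (z + w))"
    unfolding heat_add[OF assms] by (intro nn_integral_mono) (auto simp: indicator_def)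
  finally show ?thesis by (simp add: ennreal_mult[symmetric])
qed

text \<open>Halve the time and apply \<open>2 * x * y \<le> x * x + y * y\<close> inside the
  convolution: both squares sum to the same value, which by the symmetry of \<open>heat\<close> is
  the return probability. The comparison of collisions with returns to the origin is built on this
  bound.\<close>

lemma heat_le_heat_0:
  fixes z :: "int ^ 'd"
  assumes "0 \<le> u"
  shows "heat u z \<le> heat u (0 :: int ^ 'd)"
proof -
  let ?h = "\<lambda>w :: int ^ 'd. ennreal (heat (u / 2) w)"
  let ?C = "count_space (UNIV :: (int ^ 'd) set)"
  have "ennreal (heat u z) = (\<integral>\<^sup>+w. ?h w * ?h (z - w) \<partial>?C)"
    using heat_add[of "u / 2" "u / 2" z] assms by simp
  also have "\<dots> \<le> (\<integral>\<^sup>+w. ennreal (1 / 2) * (?h w * ?h w) + ennreal (1 / 2) * (?h (z - w) * ?h (z - w)) \<partial>?C)"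
  proof (intro nn_integral_mono)
    fix w
    have "0 \<le> (heat (u / 2) w - heat (u / 2) (z - w))\<^sup>2" by simp
    then have "heat (u / 2) w * heat (u / 2) (z - w) \<le> 1 / 2 * (heat (u / 2) w * heat (u / 2) w) + 1 / 2 * (heat (u / 2) (z - w) * heat (u / 2) (z - w))"
      by (simp add: power2_eq_square algebra_simps)
    then have "ennreal (heat (u / 2) w * heat (u / 2) (z - w)) \<le>
      ennreal (1 / 2 * (heat (u / 2) w * heat (u / 2) w) + 1 / 2 * (heat (u / 2) (z - w) * heat (u / 2) (z - w)))"
      by (rule ennreal_leI)
    also have "\<dots> = ennreal (1 / 2) * (?h w * ?h w) + ennreal (1 / 2) * (?h (z - w) * ?h (z - w))"
      by (subst ennreal_plus) (simp_all only: ennreal_mult heat_nonneg mult_nonneg_nonneg zero_le_divide_1_iff zero_le_numeral)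
    finally show "?h w * ?h (z - w) \<le> ennreal (1 / 2) * (?h w * ?h w) + ennreal (1 / 2) * (?h (z - w) * ?h (z - w))"
      by (simp add: ennreal_mult)
  qed
  also have "\<dots> = ennreal (1 / 2) * (\<integral>\<^sup>+w. ?h w * ?h w \<partial>?C) + ennreal (1 / 2) * (\<integral>\<^sup>+w. ?h (z - w) * ?h (z - w) \<partial>?C)"
    by (simp add: nn_integral_add nn_integral_cmult)
  also have "(\<integral>\<^sup>+w. ?h (z - w) * ?h (z - w) \<partial>?C) = (\<integral>\<^sup>+w. ?h w * ?h w \<partial>?C)"
    by (rule nn_integral_bij_count_space) (rule bij_betw_byWitness[where f'="\<lambda>w. z - w"], auto)
  also have "ennreal (1 / 2) * (\<integral>\<^sup>+w. ?h w * ?h w \<partial>?C) + ennreal (1 / 2) * (\<integral>\<^sup>+w. ?h w * ?h w \<partial>?C) = (\<integral>\<^sup>+w. ?h w * ?h w \<partial>?C)"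
  proof -
    have "ennreal (1 / 2) + ennreal (1 / 2) = 1" by (subst ennreal_plus[symmetric]) simp_all
    then show ?thesis by (simp only: distrib_right[symmetric] mult_1_left)
  qed
  also have "\<dots> = ennreal (heat u (0 :: int ^ 'd))"
    using heat_add[of "u / 2" "u / 2" 0, symmetric] assms by (simp add: heat_uminus)
  finally show ?thesis by simp
qed

lemma nn_integral_no_jump:
  assumes "0 \<le> u"
  shows "(\<integral>\<^sup>+\<omega>. (if fst (\<omega> 0) \<le> u then 0 else 1) \<partial>(walk_space :: (nat \<Rightarrow> real \<times> (int ^ 'd)) measure)) = ennreal (exp (- u))"
  by (subst nn_integral_walk_space_first_step)
    (auto simp: walk_space.emeasure_space_1[simplified] emeasure_holding_gt[OF assms])

lemma unit_walk_no_jump: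
  assumes "regular \<omega>" "u < fst (\<omega> 0)" "r \<le> u"
  shows "unit_walk \<omega> r = 0"
  using unit_walk_case_nat[of "\<omega> 0" "\<lambda>k. \<omega> (Suc k)" r] assms by (simp add: case_nat_eta)

lemma heat_0_ge:
  assumes "0 \<le> u"
  shows "exp (- u) \<le> heat u (0 :: int ^ 'd)"
proof -
  have "ennreal (exp (- u)) \<le> (\<integral>\<^sup>+\<omega>. indicator {0 :: int ^ 'd} (unit_walk \<omega> u) \<partial>walk_space)"
    unfolding nn_integral_no_jump[OF assms, where 'd='d, symmetric]
    by (rule nn_integral_mono_AE) (use AE_regular in eventually_elim, auto simp: unit_walk_no_jump not_le)
  then show ?thesis by (simp add: nn_integral_heat)
qed

lemma measurable_heat [measurable]: "(\<lambda>u. heat u z) \<in> borel_measurable borel"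
proof -
  have "(\<lambda>u. \<integral>\<^sup>+\<omega>. indicator {z} (unit_walk \<omega> u) \<partial>walk_space) \<in> borel_measurable borel"
    by measurable
  then have "(\<lambda>u. enn2real (ennreal (heat u z))) \<in> borel_measurable borel"
    unfolding nn_integral_heat by measurable
  then show ?thesis by simp
qed

text \<open>Decomposition at the first jump: either there is none up to \<open>u\<close>, or it
  occurs at \<open>s\<close> and the walk restarts from \<open>e\<close> with time
  \<open>u - s\<close> left. The Laplace transform of this identity is
  \<open>green_kernel_resolvent\<close>.\<close>

lemma heat_first_step:
  fixes z :: "int ^ 'd"
  assumes "0 \<le> u"
  shows "ennreal (heat u z) = ennreal (exp (- u)) * indicator {0} z +
    (\<integral>\<^sup>+s. ennreal (exponential_density 1 s) * (indicator {..u} s *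
      (\<Sum>e\<in>unit_steps. ennreal (heat (u - s) (z - e)) / of_nat (2 * CARD('d)))) \<partial>lborel)"
proof -
  define F where "F = (\<lambda>\<sigma> :: real \<times> (int ^ 'd). if fst \<sigma> \<le> u then ennreal (heat (u - fst \<sigma>) (z - snd \<sigma>)) else 0)"
  have heat_m: "(\<lambda>\<sigma>. heat (u - fst \<sigma>) (z - snd \<sigma>)) \<in> borel_measurable (borel \<Otimes>\<^sub>M count_space (UNIV :: (int ^ 'd) set))"
    by (rule measurable_compose_countable[where f="\<lambda>w \<sigma>. heat (u - fst \<sigma>) (z - w)" and g=snd]) measurable
  then have F [measurable]: "F \<in> borel_measurable step_law"
    unfolding F_def by (simp cong: measurable_cong_sets add: sets_step_law) measurable
  have "ennreal (heat u z) = (\<integral>\<^sup>+\<sigma>. \<integral>\<^sup>+\<omega>. (if fst \<sigma> \<le> u then indicator {z - snd \<sigma>} (unit_walk \<omega> (u - fst \<sigma>)) else indicator {0} z) \<partial>walk_space \<partial>step_law)"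
    unfolding nn_integral_heat[symmetric]
    by (rule nn_integral_first_step_cong) (auto simp: unit_walk_case_nat regular_case_nat indicator_def)
  also have "\<dots> = (\<integral>\<^sup>+\<sigma>. indicator {0} z * (if fst \<sigma> \<le> u then 0 else 1) + F \<sigma> \<partial>step_law)"
    by (intro nn_integral_cong) (auto simp: nn_integral_heat F_def walk_space.emeasure_space_1[simplified])
  also have "\<dots> = ennreal (exp (- u)) * indicator {0} z + (\<integral>\<^sup>+\<sigma>. F \<sigma> \<partial>step_law)"
    by (subst nn_integral_add) (auto simp: nn_integral_cmult emeasure_holding_gt[OF assms] mult.commute)
  also have "(\<integral>\<^sup>+\<sigma>. F \<sigma> \<partial>step_law) = (\<integral>\<^sup>+s. ennreal (exponential_density 1 s) * (indicator {..u} s *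
      (\<Sum>e\<in>unit_steps. ennreal (heat (u - s) (z - e)) / of_nat (2 * CARD('d)))) \<partial>lborel)"
    by (subst nn_integral_step_law[OF F])
      (auto intro!: nn_integral_cong simp: F_def card_unit_steps indicator_def divide_ennreal_def sum_distrib_right)
  finally show ?thesis .
qed

section \<open>Irreducibility and the tail of the displacement\<close>

definition l1 :: "int ^ 'd \<Rightarrow> int" where
  "l1 z = (\<Sum>i\<in>UNIV. \<bar>z $ i\<bar>)"

lemma l1_nonneg [simp]: "0 \<le> l1 z" by (simp add: l1_def sum_nonneg)

lemma l1_triangle: "l1 (z + w) \<le> l1 z + l1 w"
  unfolding l1_def sum.distrib[symmetric] by (intro sum_mono) auto

lemma l1_zero [simp]: "l1 0 = 0" by (simp add: l1_def)

lemma l1_unit_step: "e \<in> unit_steps \<Longrightarrow> l1 e = 1"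
  by (simp add: l1_def unit_steps_def)

text \<open>Subtracting the sign of a nonzero coordinate along its axis lowers \<open>l1\<close>, so
  every site is reached from \<open>0\<close> by unit steps.\<close>

lemma int_vec_step_induct [case_names zero step]:
  fixes z :: "int ^ 'd"
  assumes "P 0" "\<And>z e. P z \<Longrightarrow> e \<in> unit_steps \<Longrightarrow> P (e + z)"
  shows "P z"
proof (induction "nat (l1 z)" arbitrary: z rule: less_induct)
  case less
  show ?case
  proof (cases "z = 0")
    case False
    then obtain i where i: "z $ i \<noteq> 0" by (auto simp: vec_eq_iff)
    define e :: "int ^ 'd" where "e = axis i (sgn (z $ i))"
    have e: "e \<in> unit_steps" using i by (auto simp: unit_steps_eq e_def sgn_if)
    have "l1 (z - e) < l1 z"
      unfolding l1_def using i by (intro sum_strict_mono_ex1) (auto simp: e_def axis_def sgn_if intro!: exI[of _ i])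
    then have "P (z - e)" using l1_nonneg[of "z - e"] by (intro less) linarith
    from assms(2)[OF this e] show ?thesis by simp
  qed (simp add: assms)
qed

text \<open>Induction along a path of unit steps: the walk makes the step \<open>e\<close> in the
  first half of the time and the displacement \<open>z\<close> in the second half.\<close>

lemma heat_pos:
  fixes z :: "int ^ 'd"
  assumes "0 < u"
  shows "0 < heat u z"
  using assms
proof (induction z arbitrary: u rule: int_vec_step_induct)
  case zero
  then show ?case using heat_0_ge[of u, where 'd='d] by (smt (verit) exp_gt_zero)
next
  case (step z e)
  have "0 < heat (u / 2) e"
  proof -
    let ?u = "u / 2"
    have u: "0 < ?u" using step by simp
    \<comment> \<open>For a path that jumps to \<open>e\<close> at time \<open>s\<close> and rests
      afterwards, the factors for waiting and resting multiply to \<open>exp (- ?u)\<close> whatever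
      \<open>s\<close> is, so the integrand is at least \<open>c\<close> on all of
      \<open>{0..?u}\<close>.\<close>
    define c where "c = exp (- ?u) / (2 * CARD('d))"
    have c: "0 < c" by (simp add: c_def)
    have "ennreal (c * ?u) = (\<integral>\<^sup>+s. ennreal c * indicator {0..?u} s \<partial>lborel)"
      using u c by (simp add: nn_integral_cmult_indicator ennreal_mult[symmetric])
    also have "\<dots> \<le> (\<integral>\<^sup>+s. ennreal (exponential_density 1 s) * (indicator {..?u} s *
      (\<Sum>x\<in>unit_steps. ennreal (heat (?u - s) (e - x)) / of_nat (2 * CARD('d)))) \<partial>lborel)"
    proof (intro nn_integral_mono)
      fix s :: real
      show "ennreal c * indicator {0..?u} s \<le> ennreal (exponential_density 1 s) * (indicator {..?u} s *
        (\<Sum>x\<in>unit_steps. ennreal (heat (?u - s) (e - x)) / of_nat (2 * CARD('d))))"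
      proof (cases "s \<in> {0..?u}")
        case True
        have "ennreal c = ennreal (exp (- s)) * (ennreal (exp (- (?u - s))) / of_nat (2 * CARD('d)))"
          by (simp add: c_def ennreal_of_nat_eq_real_of_nat divide_ennreal ennreal_mult[symmetric] exp_add[symmetric] del: of_nat_mult)
        also have "\<dots> \<le> ennreal (exp (- s)) * (ennreal (heat (?u - s) (e - e)) / of_nat (2 * CARD('d)))"
          using True heat_0_ge[of "?u - s", where 'd='d] by (intro mult_left_mono divide_right_mono_ennreal) auto
        also have "\<dots> \<le> ennreal (exp (- s)) * (\<Sum>x\<in>unit_steps. ennreal (heat (?u - s) (e - x)) / of_nat (2 * CARD('d)))"
          using step by (intro mult_left_mono member_le_sum[where f="\<lambda>x. ennreal (heat (?u - s) (e - x)) / of_nat (2 * CARD('d))"]) auto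
        finally show ?thesis using True by (simp add: exponential_density_def)
      qed simp
    qed
    also have "\<dots> \<le> ennreal (heat ?u e)"
      using heat_first_step[of ?u e] u by simp
    finally have "c * ?u \<le> heat ?u e" by simp
    then show ?thesis using c u by (smt (verit) mult_pos_pos)
  qed
  moreover have "0 < heat (u / 2) z" using step by simp
  ultimately have "0 < heat (u / 2) e * heat (u / 2) z" by simp
  also have "\<dots> \<le> heat u (e + z)"
    using heat_mult_le[of "u / 2" "u / 2" e z] step by simp
  finally show ?case .
qed

lemma AE_unit_steps: "AE \<omega> in (walk_space :: (nat \<Rightarrow> real \<times> (int ^ 'd)) measure). \<forall>k. snd (\<omega> k) \<in> unit_steps"
  unfolding AE_all_countable
proof (intro allI AE_walk_space_component)
  let ?N = "{\<sigma> :: real \<times> (int ^ 'd). snd \<sigma> \<notin> unit_steps}"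
  have "{\<sigma> \<in> space step_law. snd \<sigma> \<notin> unit_steps} \<in> sets (step_law :: (real \<times> (int ^ 'd)) measure)"
    by measurable
  then have N [measurable]: "?N \<in> sets step_law" by simp
  have "emeasure step_law ?N = (\<integral>\<^sup>+\<sigma>. indicator ?N \<sigma> \<partial>step_law)"
    by (subst nn_integral_indicator) (use N in auto)
  also have "\<dots> = 0"
    by (subst nn_integral_step_law) (auto simp: indicator_def)
  finally show "AE \<sigma> in (step_law :: (real \<times> (int ^ 'd)) measure). snd \<sigma> \<in> unit_steps"
    by (intro AE_I[of _ _ ?N]) (use N in auto)
qed

lemma l1_unit_walk_le:
  assumes "\<forall>k. snd (\<omega> k) \<in> unit_steps"
  shows "l1 (unit_walk \<omega> u) \<le> int (num_jumps \<omega> u)"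
proof -
  have "l1 (\<Sum>k<n. snd (\<omega> k)) \<le> int n" for n
  proof (induction n)
    case (Suc n)
    then show ?case
      using l1_triangle[of "\<Sum>k<n. snd (\<omega> k)" "snd (\<omega> n)"] l1_unit_step[of "snd (\<omega> n)"] assms by simp
  qed simp
  then show ?thesis by (simp add: unit_walk_def)
qed

lemma arrival_le_if_num_jumps:
  assumes "regular \<omega>" "Suc k \<le> num_jumps \<omega> u"
  shows "arrival \<omega> k \<le> u"
proof (rule ccontr)
  assume "\<not> arrival \<omega> k \<le> u"
  then have "{l. arrival \<omega> l \<le> u} \<subseteq> {..<k}"
    using arrival_mono[of \<omega> k] assms(1) unfolding regular_def
    by (smt (verit) lessThan_iff mem_Collect_eq not_less subsetI)
  then have "num_jumps \<omega> u \<le> k"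
    unfolding num_jumps_eq using card_mono[of "{..<k}"] by fastforce
  with assms show False by simp
qed

text \<open>A displacement of size \<open>k\<close> takes \<open>k\<close> jumps, and the
  \<open>k\<close>-th jump is the arrival with index \<open>k - 1\<close>, which is why
  \<open>k = 0\<close> stands apart. With \<open>\<theta> = exp 1 - 1\<close> the bound on arrivals
  has the factor \<open>exp (- k)\<close>, and \<open>exp 1 - 1 \<le> 2\<close>.\<close>

lemma emeasure_l1_unit_walk_ge:
  assumes "0 \<le> u"
  shows "(\<integral>\<^sup>+\<omega>. indicator {z. int k \<le> l1 z} (unit_walk \<omega> u) \<partial>(walk_space :: (nat \<Rightarrow> real \<times> (int ^ 'd)) measure)) \<le> ennreal (exp (2 * u - k))"
proof (cases k)
  case 0
  have "(\<integral>\<^sup>+\<omega>. indicator {z. int k \<le> l1 z} (unit_walk \<omega> u) \<partial>(walk_space :: (nat \<Rightarrow> real \<times> (int ^ 'd)) measure)) \<le>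
    (\<integral>\<^sup>+\<omega>. 1 \<partial>(walk_space :: (nat \<Rightarrow> real \<times> (int ^ 'd)) measure))"
    by (intro nn_integral_mono) (auto simp: indicator_def)
  also have "\<dots> = ennreal 1" by (simp add: walk_space.emeasure_space_1[simplified])
  also have "\<dots> \<le> ennreal (exp (2 * u - k))" using 0 assms by (intro ennreal_leI) simp
  finally show ?thesis .
next
  case (Suc l)
  have "{\<omega> \<in> space walk_space. arrival \<omega> l \<le> u} \<in> sets (walk_space :: (nat \<Rightarrow> real \<times> (int ^ 'd)) measure)"
    by measurable
  then have m: "{\<omega>. arrival \<omega> l \<le> u} \<in> sets (walk_space :: (nat \<Rightarrow> real \<times> (int ^ 'd)) measure)" by simp
  have "(\<integral>\<^sup>+\<omega>. indicator {z. int k \<le> l1 z} (unit_walk \<omega> u) \<partial>(walk_space :: (nat \<Rightarrow> real \<times> (int ^ 'd)) measure)) \<le>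
    (\<integral>\<^sup>+\<omega>. indicator {\<omega>. arrival \<omega> l \<le> u} \<omega> \<partial>(walk_space :: (nat \<Rightarrow> real \<times> (int ^ 'd)) measure))"
  proof (rule nn_integral_mono_AE)
    show "AE \<omega> in (walk_space :: (nat \<Rightarrow> real \<times> (int ^ 'd)) measure).
      indicator {z. int k \<le> l1 z} (unit_walk \<omega> u) \<le> (indicator {\<omega>. arrival \<omega> l \<le> u} \<omega> :: ennreal)"
      using AE_regular AE_unit_steps
    proof eventually_elim
      case (elim \<omega>)
      then show ?case
        using l1_unit_walk_le[of \<omega> u] arrival_le_if_num_jumps[of \<omega> l u] Suc by (auto simp: indicator_def)
    qed
  qed
  also have "\<dots> = emeasure walk_space {\<omega> :: nat \<Rightarrow> real \<times> (int ^ 'd). arrival \<omega> l \<le> u}"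
    using m by simp
  also have "\<dots> \<le> ennreal (exp ((exp 1 - 1) * u) * (1 / (1 + (exp 1 - 1))) ^ Suc l)"
    by (rule emeasure_arrival_le) simp
  also have "(1 / (1 + (exp 1 - 1))) ^ Suc l = exp (- real k)"
    by (simp add: Suc exp_minus divide_inverse power_inverse exp_of_nat_mult[symmetric] exp_add[symmetric] del: of_nat_Suc power_Suc) 
  also have "exp ((exp 1 - 1) * u) * exp (- real k) = exp ((exp 1 - 1) * u - k)"
    by (simp add: exp_add[symmetric])
  also have "ennreal \<dots> \<le> ennreal (exp (2 * u - k))"
    using assms exp_le by (intro ennreal_leI) (simp add: mult_right_mono)
  finally show ?thesis .
qed

section \<open>Finite-dimensional distributions\<close>

text \<open>Markov property at the earliest observation time: it contributes one heat kernel, and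
  the other times are counted from there.\<close>

lemma nn_integral_fdd_Min:
  fixes y :: "real \<Rightarrow> int ^ 'd"
  assumes T: "finite T" "T \<noteq> {}" "T \<subseteq> {0..}"
  shows "(\<integral>\<^sup>+\<omega>. (\<Prod>s\<in>T. indicator {y s} (x + unit_walk \<omega> s)) \<partial>walk_space) =
    ennreal (heat (Min T) (y (Min T) - x)) *
    (\<integral>\<^sup>+\<omega>. (\<Prod>s\<in>(\<lambda>s. s - Min T) ` (T - {Min T}). indicator {y (Min T + s)} (y (Min T) + unit_walk \<omega> s)) \<partial>walk_space)"
proof -
  define u where "u = Min T"
  have u: "u \<in> T" "0 \<le> u" "\<And>s. s \<in> T \<Longrightarrow> u \<le> s" using T by (auto simp: u_def)
  have "(\<integral>\<^sup>+\<omega>. (\<Prod>s\<in>T. indicator {y s} (x + unit_walk \<omega> s)) \<partial>walk_space) =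
    (\<integral>\<^sup>+\<omega>. \<integral>\<^sup>+\<omega>'. indicator {y u - x} (unit_walk \<omega> u) *
      (\<Prod>s\<in>(\<lambda>s. s - u) ` (T - {u}). indicator {y (u + s)} (y u + unit_walk \<omega>' s)) \<partial>walk_space \<partial>walk_space)"
  proof (rule nn_integral_splice_cong[where u=u])
    fix \<omega> \<omega>' :: "nat \<Rightarrow> real \<times> (int ^ 'd)"
    assume r: "regular \<omega>" "regular \<omega>'"
    have s: "unit_walk (splice u \<omega> \<omega>') s = unit_walk \<omega> u + unit_walk \<omega>' (s - u)" if "u \<le> s" for s
      using unit_walk_splice_after[OF r u(2), of "s - u"] that by simp
    have "(\<Prod>s\<in>T. indicator {y s} (x + unit_walk (splice u \<omega> \<omega>') s)) =
      indicator {y u} (x + unit_walk \<omega> u) * (\<Prod>s\<in>T - {u}. indicator {y s} (x + unit_walk (splice u \<omega> \<omega>') s) :: ennreal)"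
      using u r by (subst prod.remove[of _ u]) (auto simp: T unit_walk_splice_before)
    also have "(\<Prod>s\<in>T - {u}. indicator {y s} (x + unit_walk (splice u \<omega> \<omega>') s)) =
      (\<Prod>s\<in>T - {u}. indicator {y s} (x + unit_walk \<omega> u + unit_walk \<omega>' (s - u)) :: ennreal)"
      by (intro prod.cong) (use u s in \<open>auto simp: add.assoc\<close>)
    also have "\<dots> = (\<Prod>s\<in>(\<lambda>s. s - u) ` (T - {u}). indicator {y (u + s)} (x + unit_walk \<omega> u + unit_walk \<omega>' s))"
      by (subst prod.reindex) (auto simp: inj_on_def)
    finally have *: "(\<Prod>s\<in>T. indicator {y s} (x + unit_walk (splice u \<omega> \<omega>') s)) = indicator {y u} (x + unit_walk \<omega> u) *
      (\<Prod>s\<in>(\<lambda>s. s - u) ` (T - {u}). indicator {y (u + s)} (x + unit_walk \<omega> u + unit_walk \<omega>' s) :: ennreal)" .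
    have "indicator {y u - x} (unit_walk \<omega> u) = (indicator {y u} (x + unit_walk \<omega> u) :: ennreal)"
      by (auto simp: indicator_def algebra_simps)
    with * show "(\<Prod>s\<in>T. indicator {y s} (x + unit_walk (splice u \<omega> \<omega>') s)) = indicator {y u - x} (unit_walk \<omega> u) *
      (\<Prod>s\<in>(\<lambda>s. s - u) ` (T - {u}). indicator {y (u + s)} (y u + unit_walk \<omega>' s) :: ennreal)"
      by (cases "x + unit_walk \<omega> u = y u") simp_all
  qed (use u in auto)
  then show ?thesis
    by (simp add: nn_integral_cmult nn_integral_multc nn_integral_heat u_def)
qed

text \<open>A finite-dimensional probability is a product of heat kernels over successive time gaps,
  and each factor is largest at displacement \<open>0\<close>.\<close>

theorem nn_integral_fdd_le:
  fixes y :: "real \<Rightarrow> int ^ 'd"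
  assumes "finite T" "T \<subseteq> {0..}"
  shows "(\<integral>\<^sup>+\<omega>. (\<Prod>s\<in>T. indicator {y s} (x + unit_walk \<omega> s)) \<partial>walk_space) \<le>
    (\<integral>\<^sup>+\<omega>. (\<Prod>s\<in>T. indicator {0 :: int ^ 'd} (unit_walk \<omega> s) :: ennreal) \<partial>walk_space)"
  using assms
proof (induction "card T" arbitrary: T x y)
  case 0
  then show ?case by simp
next
  case (Suc n)
  have T: "finite T" "T \<noteq> {}" "T \<subseteq> {0..}" using Suc by auto
  define u where "u = Min T"
  define T' where "T' = (\<lambda>s. s - u) ` (T - {u})"
  have u: "u \<in> T" "0 \<le> u" "\<And>s. s \<in> T \<Longrightarrow> u \<le> s" using T by (auto simp: u_def)
  have "card T' = n"
    unfolding T'_def using Suc.hyps(2) T u by (subst card_image) (auto simp: inj_on_def)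
  moreover have "finite T'" "T' \<subseteq> {0..}" using T u by (auto simp: T'_def)
  ultimately have IH: "(\<integral>\<^sup>+\<omega>. (\<Prod>s\<in>T'. indicator {y (u + s)} (y u + unit_walk \<omega> s)) \<partial>walk_space) \<le>
    (\<integral>\<^sup>+\<omega>. (\<Prod>s\<in>T'. indicator {0 :: int ^ 'd} (unit_walk \<omega> s) :: ennreal) \<partial>walk_space)"
    by (intro Suc.hyps(1)) auto
  have "(\<integral>\<^sup>+\<omega>. (\<Prod>s\<in>T. indicator {y s} (x + unit_walk \<omega> s)) \<partial>walk_space) =
    ennreal (heat u (y u - x)) * (\<integral>\<^sup>+\<omega>. (\<Prod>s\<in>T'. indicator {y (u + s)} (y u + unit_walk \<omega> s)) \<partial>walk_space)"
    unfolding u_def T'_def by (rule nn_integral_fdd_Min[OF T])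
  also have "\<dots> \<le> ennreal (heat u (0 :: int ^ 'd)) * (\<integral>\<^sup>+\<omega>. (\<Prod>s\<in>T'. indicator {0 :: int ^ 'd} (unit_walk \<omega> s) :: ennreal) \<partial>walk_space)"
    using u by (intro mult_mono IH ennreal_leI heat_le_heat_0) auto
  also have "\<dots> = (\<integral>\<^sup>+\<omega>. (\<Prod>s\<in>T. indicator {0 :: int ^ 'd} (unit_walk \<omega> s) :: ennreal) \<partial>walk_space)"
    using nn_integral_fdd_Min[OF T, of "\<lambda>_. 0 :: int ^ 'd" 0] by (simp add: u_def T'_def)
  finally show ?case .
qed

text \<open>Repeated use of the Markov property on an equidistant grid. The grid point
  \<open>0\<close> belongs to the product and yields the condition on the start. Time reversal of
  the walk is later read off from this formula.\<close>

theorem nn_integral_grid: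
  fixes z :: "nat \<Rightarrow> int ^ 'd"
  assumes h: "0 \<le> h"
  shows "(\<integral>\<^sup>+\<omega>. (\<Prod>m\<le>N. indicator {z m} (x + unit_walk \<omega> (real m * h))) \<partial>walk_space) =
    indicator {z 0} x * (\<Prod>m<N. ennreal (heat h (z (Suc m) - z m)))"
proof (induction N arbitrary: x z)
  case 0
  have "(\<integral>\<^sup>+\<omega>. (indicator {z 0} (x + unit_walk \<omega> 0) :: ennreal) \<partial>(walk_space :: (nat \<Rightarrow> real \<times> (int ^ 'd)) measure)) =
    (\<integral>\<^sup>+\<omega>. indicator {z 0} x \<partial>(walk_space :: (nat \<Rightarrow> real \<times> (int ^ 'd)) measure))"
    by (rule nn_integral_cong_AE) (use AE_regular in eventually_elim, simp add: unit_walk_0)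
  then show ?case by (simp add: walk_space.emeasure_space_1[simplified])
next
  case (Suc N)
  have "(\<integral>\<^sup>+\<omega>. (\<Prod>m\<le>Suc N. indicator {z m} (x + unit_walk \<omega> (real m * h))) \<partial>walk_space) =
    (\<integral>\<^sup>+\<omega>. \<integral>\<^sup>+\<omega>'. indicator {z 0} x * (\<Prod>m\<le>N. indicator {z (Suc m)} (x + unit_walk \<omega> h + unit_walk \<omega>' (real m * h))) \<partial>walk_space \<partial>walk_space)"
  proof (rule nn_integral_splice_cong[where u=h])
    fix \<omega> \<omega>' :: "nat \<Rightarrow> real \<times> (int ^ 'd)"
    assume r: "regular \<omega>" "regular \<omega>'"
    have "unit_walk (splice h \<omega> \<omega>') (real (Suc m) * h) = unit_walk \<omega> h + unit_walk \<omega>' (real m * h)" for m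
      using unit_walk_splice_after[OF r h, of "real m * h"] h by (simp add: algebra_simps)
    moreover have "unit_walk (splice h \<omega> \<omega>') 0 = 0"
      using r h by (simp add: unit_walk_0 regular_splice)
    ultimately show "(\<Prod>m\<le>Suc N. indicator {z m} (x + unit_walk (splice h \<omega> \<omega>') (real m * h))) =
      indicator {z 0} x * (\<Prod>m\<le>N. indicator {z (Suc m)} (x + unit_walk \<omega> h + unit_walk \<omega>' (real m * h)) :: ennreal)"
      by (simp add: prod.atMost_Suc_shift add.assoc del: prod.atMost_Suc of_nat_Suc)
  qed (use h in auto)
  also have "\<dots> = (\<integral>\<^sup>+\<omega>. indicator {z 0} x * (indicator {z 1 - x} (unit_walk \<omega> h) * (\<Prod>m<N. ennreal (heat h (z (Suc (Suc m)) - z (Suc m))))) \<partial>walk_space)"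
  proof (intro nn_integral_cong)
    fix \<omega> :: "nat \<Rightarrow> real \<times> (int ^ 'd)"
    have "indicator {z 1 - x} (unit_walk \<omega> h) = (indicator {z (Suc 0)} (x + unit_walk \<omega> h) :: ennreal)"
      by (auto simp: indicator_def algebra_simps)
    then show "(\<integral>\<^sup>+\<omega>'. indicator {z 0} x * (\<Prod>m\<le>N. indicator {z (Suc m)} (x + unit_walk \<omega> h + unit_walk \<omega>' (real m * h))) \<partial>walk_space) =
      indicator {z 0} x * (indicator {z 1 - x} (unit_walk \<omega> h) * (\<Prod>m<N. ennreal (heat h (z (Suc (Suc m)) - z (Suc m)))))"
      by (subst nn_integral_cmult) (simp_all add: Suc.IH[of "\<lambda>m. z (Suc m)"])
  qed
  also have "\<dots> = indicator {z 0} x * (ennreal (heat h (z 1 - x)) * (\<Prod>m<N. ennreal (heat h (z (Suc (Suc m)) - z (Suc m)))))"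
    by (simp add: nn_integral_cmult nn_integral_multc nn_integral_heat)
  also have "\<dots> = indicator {z 0} x * (\<Prod>m<Suc N. ennreal (heat h (z (Suc m) - z m)))"
    by (cases "x = z 0") (simp_all add: prod.lessThan_Suc_shift del: prod.lessThan_Suc)
  finally show ?case .
qed

section \<open>Collisions with a prescribed path\<close>

text \<open>This regularity serves twice: Riemann sums of such a path converge, and its indefinite
  integral is differentiable off a finite set. Neighbourhoods are two-sided, so jump times count as
  exceptional.\<close>

definition step_path :: "real \<Rightarrow> (real \<Rightarrow> 'b) \<Rightarrow> bool" where
  "step_path t g \<longleftrightarrow> finite {s \<in> {0..t}. \<not> (\<forall>\<^sub>F r in nhds s. g r = g s)}"

lemma step_path_const [simp]: "step_path t (\<lambda>_. c)"
  by (simp add: step_path_def)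

lemma step_path_map2:
  assumes "step_path t f" "step_path t g"
  shows "step_path t (\<lambda>s. h (f s) (g s))"
proof -
  have "{s \<in> {0..t}. \<not> (\<forall>\<^sub>F r in nhds s. h (f r) (g r) = h (f s) (g s))} \<subseteq>
    {s \<in> {0..t}. \<not> (\<forall>\<^sub>F r in nhds s. f r = f s)} \<union> {s \<in> {0..t}. \<not> (\<forall>\<^sub>F r in nhds s. g r = g s)}"
  proof safe
    fix s assume "\<not> (\<forall>\<^sub>F r in nhds s. h (f r) (g r) = h (f s) (g s))" "\<forall>\<^sub>F r in nhds s. g r = g s" "\<forall>\<^sub>F r in nhds s. f r = f s"
    moreover from this(2,3) have "\<forall>\<^sub>F r in nhds s. h (f r) (g r) = h (f s) (g s)"
      by eventually_elim simp
    ultimately show False by simp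
  qed
  then show ?thesis
    using assms unfolding step_path_def by (meson finite_Un finite_subset)
qed

lemma step_path_map: "step_path t f \<Longrightarrow> step_path t (\<lambda>s. h (f s))"
  using step_path_map2[of t f f "\<lambda>x _. h x"] by simp

lemma unit_walk_locally_constant:
  assumes "regular \<omega>" "\<And>k. arrival \<omega> k \<noteq> u"
  shows "\<forall>\<^sub>F v in nhds u. unit_walk \<omega> v = unit_walk \<omega> u"
proof -
  \<comment> \<open>Arrivals after \<open>u + 1\<close> play no part for \<open>v < u + 1\<close>,
    so finitely many conditions decide whether the set of past arrivals changes.\<close>
  have fin: "finite {k. arrival \<omega> k \<le> u + 1}" using assms by (simp add: regular_def)
  have "\<forall>\<^sub>F v in nhds u. (arrival \<omega> k \<le> v) = (arrival \<omega> k \<le> u)" for k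
  proof (cases "arrival \<omega> k < u")
    case True
    have "\<forall>\<^sub>F v in nhds u. arrival \<omega> k < v"
      using True by (intro eventually_nhds_in_open[of "{arrival \<omega> k<..}", simplified]) auto
    then show ?thesis by eventually_elim (use True in auto)
  next
    case False
    then have "u < arrival \<omega> k" using assms(2)[of k] by simp
    then have "\<forall>\<^sub>F v in nhds u. v < arrival \<omega> k"
      by (intro eventually_nhds_in_open[of "{..<arrival \<omega> k}", simplified]) auto
    then show ?thesis by eventually_elim (use False assms(2)[of k] in auto)
  qed
  then have "\<forall>\<^sub>F v in nhds u. \<forall>k\<in>{k. arrival \<omega> k \<le> u + 1}. (arrival \<omega> k \<le> v) = (arrival \<omega> k \<le> u)"
    by (intro eventually_ball_finite fin) auto
  moreover have "\<forall>\<^sub>F v in nhds u. v < u + 1"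
    by (intro eventually_nhds_in_open[of "{..<u + 1}", simplified]) auto
  ultimately show ?thesis
  proof eventually_elim
    case (elim v)
    have "{k. arrival \<omega> k \<le> v} = {k. arrival \<omega> k \<le> u}"
    proof (rule set_eqI)
      fix k show "k \<in> {k. arrival \<omega> k \<le> v} \<longleftrightarrow> k \<in> {k. arrival \<omega> k \<le> u}"
        using elim by (cases "arrival \<omega> k \<le> u + 1") auto
    qed
    then show ?case by (simp add: unit_walk_def num_jumps_eq)
  qed
qed

text \<open>The affine clock \<open>c + b * s\<close> covers walks run forwards and catalysts run
  backwards. Exceptional times are preimages of the finitely many arrivals below
  \<open>\<bar>c\<bar> + \<bar>b\<bar> * t\<close>.\<close>

lemma step_path_unit_walk:
  assumes r: "regular \<omega>"
  shows "step_path t (\<lambda>s. unit_walk \<omega> (c + b * s))"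
proof (cases "b = 0")
  case False
  define J where "J = {k. arrival \<omega> k \<le> \<bar>c\<bar> + \<bar>b\<bar> * t}"
  have "finite J" using r by (simp add: J_def regular_def)
  moreover have "{s \<in> {0..t}. \<not> (\<forall>\<^sub>F r in nhds s. unit_walk \<omega> (c + b * r) = unit_walk \<omega> (c + b * s))} \<subseteq>
    (\<lambda>k. (arrival \<omega> k - c) / b) ` J"
  proof
    fix s assume "s \<in> {s \<in> {0..t}. \<not> (\<forall>\<^sub>F r in nhds s. unit_walk \<omega> (c + b * r) = unit_walk \<omega> (c + b * s))}"
    then have s: "s \<in> {0..t}" and *: "\<not> (\<forall>\<^sub>F r in nhds s. unit_walk \<omega> (c + b * r) = unit_walk \<omega> (c + b * s))" by auto
    have "\<exists>k. arrival \<omega> k = c + b * s"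
    proof (rule ccontr)
      assume "\<nexists>k. arrival \<omega> k = c + b * s"
      then have ev: "\<forall>\<^sub>F v in nhds (c + b * s). unit_walk \<omega> v = unit_walk \<omega> (c + b * s)"
        by (intro unit_walk_locally_constant r) auto
      have "filterlim (\<lambda>r. c + b * r) (nhds (c + b * s)) (nhds s)"
        by (intro tendsto_intros) (simp add: filterlim_ident)
      from filterlim_cong[THEN iffD1, OF refl refl _ this] eventually_compose_filterlim[OF ev this] * show False by simp
    qed
    then obtain k where k: "arrival \<omega> k = c + b * s" ..
    have "b * s \<le> \<bar>b\<bar> * t"
      using s by (smt (verit) abs_ge_self atLeastAtMost_iff mult_left_mono mult_right_mono abs_ge_zero)
    then have "k \<in> J" using k by (simp add: J_def)
    moreover have "s = (arrival \<omega> k - c) / b" using k False by (simp add: field_simps)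
    ultimately show "s \<in> (\<lambda>k. (arrival \<omega> k - c) / b) ` J" by auto
  qed
  ultimately show ?thesis
    unfolding step_path_def by (meson finite_imageI finite_subset)
qed simp

section \<open>Riemann sums and an identity for exponentials of integrals\<close>

text \<open>Left-endpoint step functions converge to \<open>g\<close> wherever \<open>g\<close> is
  locally constant, hence almost everywhere, and are bounded by \<open>1\<close>. The grid point
  \<open>m = N\<close> is kept in the sum so that the index range is invariant under
  \<open>m \<mapsto> N - m\<close>.\<close>

lemma riemann_sum_tendsto:
  fixes g :: "real \<Rightarrow> real"
  assumes g: "step_path t g" "\<And>s. 0 \<le> g s" "\<And>s. g s \<le> 1" and [measurable]: "g \<in> borel_measurable borel" and t: "0 < t"
  shows "(\<lambda>N. t / real N * (\<Sum>m\<le>N. g (real m * (t / real N)))) \<longlonglongrightarrow> (LINT s:{0..t}|lborel. g s)"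
proof -
  define h where "h = (\<lambda>N. t / real N)"
  define G where "G = (\<lambda>N s. \<Sum>m<N. g (real m * h N) * indicator {real m * h N..<real (Suc m) * h N} s)"
  have h: "0 < h N" if "0 < N" for N using that t by (simp add: h_def)
  have idx: "indicator {real m * h N..<real (Suc m) * h N} s = (if m = nat \<lfloor>s / h N\<rfloor> then 1 else 0 :: real)"
    if "0 < N" "0 \<le> s" for N m s
  proof -
    have "s \<in> {real m * h N..<real (Suc m) * h N} \<longleftrightarrow> real m \<le> s / h N \<and> s / h N < real m + 1"
      using h[OF that(1)] by (simp add: field_simps)
    also have "\<dots> \<longleftrightarrow> \<lfloor>s / h N\<rfloor> = int m" by (auto simp: floor_eq_iff)
    also have "\<dots> \<longleftrightarrow> m = nat \<lfloor>s / h N\<rfloor>"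
      using that h[OF that(1)] by auto
    finally show ?thesis by (simp add: indicator_def)
  qed
  have Geq: "G N s = g (real (nat \<lfloor>s / h N\<rfloor>) * h N)" if "0 < N" "0 \<le> s" "s < t" for N s
  proof -
    have "s / h N < real N" using that by (simp add: h_def field_simps)
    then have "nat \<lfloor>s / h N\<rfloor> < N" using that h[OF that(1)] by (simp add: floor_less_iff nat_less_iff)
    then show ?thesis
      unfolding G_def idx[OF that(1,2)] by (simp add: if_distrib cong: if_cong)
  qed
  have G0: "G N s = 0" if "s < 0 \<or> t \<le> s" "0 < N" for N s
    unfolding G_def
  proof (rule sum.neutral, rule ballI)
    fix m assume m: "m \<in> {..<N}"
    then have "real (Suc m) * h N \<le> real N * h N" using h[OF that(2)] by (intro mult_right_mono) auto
    also have "\<dots> = t" using that by (simp add: h_def)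
    finally have "real (Suc m) * h N \<le> t" .
    moreover have "0 \<le> real m * h N" using h[OF that(2)] by simp
    ultimately show "g (real m * h N) * indicator {real m * h N..<real (Suc m) * h N} s = 0"
      using that by (auto simp: indicator_def)
  qed
  have int: "(\<integral>s. G N s \<partial>lborel) = h N * (\<Sum>m<N. g (real m * h N))" if "0 < N" for N
  proof -
    have "(\<integral>s. G N s \<partial>lborel) = (\<Sum>m<N. g (real m * h N) * h N)"
      unfolding G_def using h[OF that]
      by (subst Bochner_Integration.integral_sum) (auto simp: algebra_simps emeasure_lborel_Ico intro!: integrable_real_mult_indicator)
    then show ?thesis by (simp add: sum_distrib_left mult.commute)
  qed
  have lim: "(\<lambda>N. \<integral>s. G N s \<partial>lborel) \<longlonglongrightarrow> (\<integral>s. indicator {0..t} s * g s \<partial>lborel)"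
  \<comment> \<open>The shift avoids \<open>N = 0\<close>, where the mesh \<open>t / real N\<close>
    is \<open>0\<close>.\<close>
  proof (rule LIMSEQ_offset[where k=1], rule integral_dominated_convergence)
    show "integrable lborel (indicator {0..t} :: real \<Rightarrow> real)"
      by (intro integrable_real_indicator) (auto simp: emeasure_lborel_Icc_eq)
    show "G (N + 1) \<in> borel_measurable lborel" for N unfolding G_def by measurable
    show "(\<lambda>s. indicator {0..t} s * g s) \<in> borel_measurable lborel" by measurable
    show "AE s in lborel. norm (G (N + 1) s) \<le> indicator {0..t} s" for N
    proof (rule AE_I2)
      fix s show "norm (G (N + 1) s) \<le> indicator {0..t} s"
        by (cases "0 \<le> s \<and> s < t") (use g(2,3) in \<open>auto simp: Geq G0 not_less not_le indicator_def\<close>)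
    qed
    define X where "X = {s \<in> {0..t}. \<not> (\<forall>\<^sub>F r in nhds s. g r = g s)} \<union> {t}"
    have "finite X" using g(1) by (simp add: X_def step_path_def)
    then have "AE s in lborel. s \<notin> X" using AE_not_in[of X lborel] countable_imp_null_set_lborel countable_finite by blast
    then show "AE s in lborel. (\<lambda>N. G (N + 1) s) \<longlonglongrightarrow> indicator {0..t} s * g s"
    proof eventually_elim
      case (elim s)
      show ?case
      proof (cases "0 \<le> s \<and> s < t")
        case True
        then have ev: "\<forall>\<^sub>F r in nhds s. g r = g s" using elim by (auto simp: X_def)
        have hlim: "(\<lambda>N. h (N + 1)) \<longlonglongrightarrow> 0"
          unfolding h_def by (rule LIMSEQ_ignore_initial_segment) (rule lim_const_over_n)
        have "(\<lambda>N. real (nat \<lfloor>s / h (N + 1)\<rfloor>) * h (N + 1)) \<longlonglongrightarrow> s"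
        proof (rule tendsto_sandwich)
          show "\<forall>\<^sub>F N in sequentially. s - h (N + 1) \<le> real (nat \<lfloor>s / h (N + 1)\<rfloor>) * h (N + 1)"
          proof (rule always_eventually, rule allI)
            fix N
            have p: "0 < h (N + 1)" by (rule h) simp
            have "s / h (N + 1) - 1 \<le> real (nat \<lfloor>s / h (N + 1)\<rfloor>)" using True p by linarith
            then have "(s / h (N + 1) - 1) * h (N + 1) \<le> real (nat \<lfloor>s / h (N + 1)\<rfloor>) * h (N + 1)"
              using p by (intro mult_right_mono) auto
            then show "s - h (N + 1) \<le> real (nat \<lfloor>s / h (N + 1)\<rfloor>) * h (N + 1)" using p by (simp add: field_simps)
          qed
          show "\<forall>\<^sub>F N in sequentially. real (nat \<lfloor>s / h (N + 1)\<rfloor>) * h (N + 1) \<le> s"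
          proof (rule always_eventually, rule allI)
            fix N
            have p: "0 < h (N + 1)" by (rule h) simp
            have "0 \<le> s / h (N + 1)" using True p by simp
            then have "real (nat \<lfloor>s / h (N + 1)\<rfloor>) \<le> s / h (N + 1)" by linarith
            then show "real (nat \<lfloor>s / h (N + 1)\<rfloor>) * h (N + 1) \<le> s" using p by (simp add: field_simps)
          qed
          show "(\<lambda>N. s - h (N + 1)) \<longlonglongrightarrow> s" using tendsto_diff[OF tendsto_const hlim, of s] by simp
        qed simp
        then have "\<forall>\<^sub>F N in sequentially. g (real (nat \<lfloor>s / h (N + 1)\<rfloor>) * h (N + 1)) = g s"
          using ev eventually_compose_filterlim by fastforce
        then have "(\<lambda>N. G (N + 1) s) \<longlonglongrightarrow> g s"
          using True by (intro tendsto_eventually) (auto simp: Geq elim!: eventually_mono)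
        then show ?thesis using True by simp
      next
        case False
        then have "s < 0 \<or> t < s" using elim by (auto simp: X_def)
        then show ?thesis by (auto simp: G0)
      qed
    qed
  qed
  \<comment> \<open>The extra grid point \<open>m = N\<close> has weight \<open>h N\<close> and
    disappears in the limit.\<close>
  have "(\<lambda>N. h N * g t) \<longlonglongrightarrow> 0 * g t"
    unfolding h_def by (intro tendsto_mult lim_const_over_n tendsto_const)
  from tendsto_add[OF lim this]
  have "(\<lambda>N. (\<integral>s. G N s \<partial>lborel) + h N * g t) \<longlonglongrightarrow> (LINT s:{0..t}|lborel. g s)"
    by (simp add: set_lebesgue_integral_def)
  moreover have "\<forall>\<^sub>F N in sequentially. (\<integral>s. G N s \<partial>lborel) + h N * g t = t / real N * (\<Sum>m\<le>N. g (real m * (t / real N)))"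
    using eventually_gt_at_top[of 0]
  proof eventually_elim
    case (elim N)
    then have "real N * h N = t" by (simp add: h_def)
    then show ?case
      using int[OF elim] by (simp add: lessThan_Suc_atMost[symmetric] distrib_left h_def)
  qed
  ultimately show ?thesis
    by (blast intro: Lim_transform_eventually)
qed

lemma set_integral_bounds:
  fixes g :: "real \<Rightarrow> real"
  assumes "\<And>s. 0 \<le> g s" "\<And>s. g s \<le> 1" and [measurable]: "g \<in> borel_measurable borel" and t: "a \<le> b"
  shows "set_integrable lborel {a..b} g" "0 \<le> (LINT s:{a..b}|lborel. g s)" "(LINT s:{a..b}|lborel. g s) \<le> b - a"
proof -
  show i: "set_integrable lborel {a..b} g"
    unfolding set_integrable_def
    by (rule Bochner_Integration.integrable_bound[where f="indicator {a..b} :: real \<Rightarrow> real"])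
      (use assms in \<open>auto simp: indicator_def\<close>)
  show "0 \<le> (LINT s:{a..b}|lborel. g s)"
    unfolding set_lebesgue_integral_def using assms by (intro integral_nonneg_AE) auto
  have "(LINT s:{a..b}|lborel. g s) \<le> (\<integral>s. indicator {a..b} s \<partial>lborel)"
    unfolding set_lebesgue_integral_def
  proof (rule integral_mono)
    show "integrable lborel (\<lambda>s. indicator {a..b} s *\<^sub>R g s)" using i by (simp add: set_integrable_def)
    show "integrable lborel (indicator {a..b} :: real \<Rightarrow> real)"
      by (intro integrable_real_indicator) (auto simp: emeasure_lborel_Icc_eq)
  qed (use assms in \<open>auto simp: indicator_def\<close>)
  then show "(LINT s:{a..b}|lborel. g s) \<le> b - a" using t by simp
qed

lemma set_integral_shift:
  fixes g :: "real \<Rightarrow> real"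
  shows "(LINT r:{s..t}|lborel. g r) = (LINT r:{0..t - s}|lborel. g (s + r))"
  unfolding set_lebesgue_integral_def
  by (subst lborel_integral_real_affine[of 1 _ s]) (auto intro!: Bochner_Integration.integral_cong simp: indicator_def)

lemma set_integral_reflect:
  fixes g :: "real \<Rightarrow> real"
  shows "(LINT r:{0..t}|lborel. g r) = (LINT r:{0..t}|lborel. g (t - r))"
  unfolding set_lebesgue_integral_def
  by (subst lborel_integral_real_affine[of "-1" _ t]) (auto intro!: Bochner_Integration.integral_cong simp: indicator_def)

text \<open>Fundamental theorem of calculus for
  \<open>s \<mapsto> - exp (\<Phi> t - \<Phi> s)\<close>, whose derivative is the integrand off the
  finitely many exceptional points. Its expectation, with \<open>g\<close> the indicator of a visit
  at \<open>0\<close>, is the renewal equation.\<close>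

lemma exp_integral_identity:
  fixes g :: "real \<Rightarrow> real"
  assumes g: "step_path t g" "\<And>s. 0 \<le> g s" "\<And>s. g s \<le> 1" and [measurable]: "g \<in> borel_measurable borel" and t: "0 \<le> t"
  shows "ennreal (exp (LINT r:{0..t}|lborel. g r)) =
    1 + (\<integral>\<^sup>+s. indicator {0..t} s * ennreal (g s * exp (LINT r:{s..t}|lborel. g r)) \<partial>lborel)"
proof -
  have int: "g integrable_on {a..b}" and eqi: "(LINT r:{a..b}|lborel. g r) = integral {a..b} g" if "a \<le> b" for a b
    using set_borel_integral_eq_integral[OF set_integral_bounds(1)[OF g(2,3) _ that]] by auto
  define \<Phi> where "\<Phi> = (\<lambda>s. integral {0..s} g)"
  have tail: "(LINT r:{s..t}|lborel. g r) = \<Phi> t - \<Phi> s" if "s \<in> {0..t}" for s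
    using that Henstock_Kurzweil_Integration.integral_combine[of 0 s t g] int[of 0 t] t by (simp add: eqi \<Phi>_def)
  define X where "X = {s \<in> {0..t}. \<not> (\<forall>\<^sub>F r in nhds s. g r = g s)}"
  have X: "finite X" using g(1) by (simp add: X_def step_path_def)
  have "((\<lambda>s. g s * exp (\<Phi> t - \<Phi> s)) has_integral (- exp (\<Phi> t - \<Phi> t)) - (- exp (\<Phi> t - \<Phi> 0))) {0..t}"
  proof (rule fundamental_theorem_of_calculus_interior_strong[OF X t])
    fix s assume s: "s \<in> {0<..<t} - X"
    then have "\<forall>\<^sub>F r in nhds s. g r = g s" by (auto simp: X_def)
    then have "isCont g s" by (subst isCont_cong[where g="\<lambda>_. g s"]) auto
    then have "continuous (at s within {0..t} - {}) g" by (rule continuous_at_imp_continuous_at_within)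
    from integral_has_vector_derivative_continuous_at[OF int[OF t] _ _ this] s
    have "(\<Phi> has_vector_derivative g s) (at s within {0..t})" by (simp add: \<Phi>_def)
    then have "(\<Phi> has_vector_derivative g s) (at s)"
      using s by (simp add: at_within_Icc_at)
    then have "(\<Phi> has_real_derivative g s) (at s)"
      by (simp add: has_real_derivative_iff_has_vector_derivative)
    then have "((\<lambda>s. - exp (\<Phi> t - \<Phi> s)) has_real_derivative g s * exp (\<Phi> t - \<Phi> s)) (at s)"
      by (auto intro!: derivative_eq_intros)
    then show "((\<lambda>s. - exp (\<Phi> t - \<Phi> s)) has_vector_derivative g s * exp (\<Phi> t - \<Phi> s)) (at s)"
      by (simp add: has_real_derivative_iff_has_vector_derivative)
  next
    show "continuous_on {0..t} (\<lambda>s. - exp (\<Phi> t - \<Phi> s))"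
      unfolding \<Phi>_def by (intro continuous_intros indefinite_integral_continuous_1 int t)
  qed
  moreover have "\<Phi> 0 = 0" by (simp add: \<Phi>_def)
  ultimately have hi: "((\<lambda>s. g s * exp (\<Phi> t - \<Phi> s)) has_integral (exp (\<Phi> t) - 1)) {0..t}" by simp
  have "(\<integral>\<^sup>+s. indicator {0..t} s * ennreal (g s * exp (LINT r:{s..t}|lborel. g r)) \<partial>lborel) =
    (\<integral>\<^sup>+s. ennreal (g s * exp (\<Phi> t - \<Phi> s)) * indicator {0..t} s \<partial>lborel)"
    by (intro nn_integral_cong) (auto simp: indicator_def tail)
  also have "\<dots> = ennreal (exp (\<Phi> t) - 1)"
    by (rule nn_integral_has_integral_lebesgue'[OF _ hi]) (use g in auto)
  finally have "1 + (\<integral>\<^sup>+s. indicator {0..t} s * ennreal (g s * exp (LINT r:{s..t}|lborel. g r)) \<partial>lborel) =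
    ennreal 1 + ennreal (exp (\<Phi> t) - 1)" by simp
  also have "\<dots> = ennreal (exp (\<Phi> t))"
    using set_integral_bounds(2)[of g, OF g(2,3) assms(4) t] tail[of 0] t \<open>\<Phi> 0 = 0\<close> by (subst ennreal_plus[symmetric]) auto
  finally show ?thesis using tail[of 0] t \<open>\<Phi> 0 = 0\<close> by simp
qed

lemma measurable_indicator_eq [measurable (raw)]:
  fixes f g :: "'a \<Rightarrow> 'b :: countable"
  assumes "f \<in> measurable M (count_space UNIV)" "g \<in> measurable M (count_space UNIV)"
  shows "(\<lambda>x. indicator {f x} (g x) :: 'c :: {topological_space, zero_neq_one}) \<in> borel_measurable M"
  by (rule measurable_compose_countable[where f="\<lambda>a x. indicator {a} (g x)", OF _ assms(1)])
    (rule measurable_indicator_count_space[OF assms(2)])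

lemma measurable_minus_count_space [measurable (raw)]:
  fixes f g :: "'a \<Rightarrow> 'b :: {minus, countable}"
  assumes "f \<in> measurable M (count_space UNIV)" "g \<in> measurable M (count_space UNIV)"
  shows "(\<lambda>x. f x - g x) \<in> measurable M (count_space UNIV)"
  by (rule measurable_compose_countable[where f="\<lambda>a x. a - g x", OF _ assms(1)])
    (rule measurable_compose[OF assms(2) measurable_count_space])

lemma measurable_coincidence_time:
  fixes p q :: "'a \<Rightarrow> real \<Rightarrow> 'b :: countable"
  assumes "(\<lambda>x. p (fst x) (snd x)) \<in> measurable (M \<Otimes>\<^sub>M borel) (count_space UNIV)"
    "(\<lambda>x. q (fst x) (snd x)) \<in> measurable (M \<Otimes>\<^sub>M borel) (count_space UNIV)"
  shows "(\<lambda>x. LINT s:{\<alpha>..\<beta>}|lborel. indicator {p x s} (q x s) :: real) \<in> borel_measurable M"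
proof -
  have [measurable]: "(\<lambda>x. indicator {p (fst x) (snd x)} (q (fst x) (snd x)) :: real) \<in> borel_measurable (M \<Otimes>\<^sub>M borel)"
    by (rule measurable_indicator_eq[OF assms])
  have [measurable]: "(\<lambda>x. indicator {\<alpha>..\<beta>} (snd x) *\<^sub>R (indicator {p (fst x) (snd x)} (q (fst x) (snd x)) :: real)) \<in> borel_measurable (M \<Otimes>\<^sub>M borel)"
    by measurable
  show ?thesis
    unfolding set_lebesgue_integral_def
    by (rule lborel.borel_measurable_lebesgue_integral) (simp add: split_beta')
qed

lemma measurable_return_time [measurable (raw)]:
  assumes [measurable]: "f \<in> measurable M (walk_space :: (nat \<Rightarrow> real \<times> (int ^ 'd)) measure)"
  shows "(\<lambda>x. LINT s:{\<alpha>..\<beta>}|lborel. indicator {z} (unit_walk (f x) (a * s)) :: real) \<in> borel_measurable M"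
  by (rule measurable_coincidence_time) measurable

text \<open>Exponential moment, with weight \<open>c\<close>, of the local time at \<open>0\<close>
  of the walk with total jump rate \<open>a\<close>. The type argument supplies the dimension, which
  the value does not show.\<close>

definition return_moment :: "'d::finite itself \<Rightarrow> real \<Rightarrow> real \<Rightarrow> real \<Rightarrow> ennreal" where
  "return_moment _ a c t = (\<integral>\<^sup>+\<omega>. ennreal (exp (c * (LINT s:{0..t}|lborel. indicator {0 :: int ^ 'd} (unit_walk \<omega> (a * s))))) \<partial>walk_space)"

text \<open>
  Expanding the product of the factors \<open>1 + \<epsilon> * indicator\<close>, every term becomes a probability of visiting
  prescribed sites at finitely many times, and this is largest if all sites are \<open>0\<close>.
\<close>

lemma riemann_exp_le:
  fixes q :: "real \<Rightarrow> int ^ 'd"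
  assumes a: "0 < a" and c: "0 \<le> c" and h: "0 < h"
  shows "(\<integral>\<^sup>+\<omega>. ennreal (exp (c * (h * (\<Sum>m\<le>N. indicator {q (real m * h)} (unit_walk \<omega> (a * (real m * h))))))) \<partial>walk_space) \<le>
    (\<integral>\<^sup>+\<omega>. ennreal (exp (c * (h * (\<Sum>m\<le>N. indicator {0 :: int ^ 'd} (unit_walk \<omega> (a * (real m * h))))))) \<partial>walk_space)"
proof -
  \<comment> \<open>For \<open>i\<close> either \<open>0\<close> or \<open>1\<close> this gives
    \<open>exp (c * h * i) = 1 + \<epsilon> * i\<close>.\<close>
  define \<epsilon> where "\<epsilon> = exp (c * h) - 1"
  have \<epsilon>: "0 \<le> \<epsilon>" using c h by (simp add: \<epsilon>_def)
  have expand: "ennreal (exp (c * (h * (\<Sum>m\<le>N. indicator {q m} (unit_walk \<omega> (a * (real m * h))))))) =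
    (\<Sum>A\<in>Pow {..N}. ennreal (\<epsilon> ^ card A) * (\<Prod>m\<in>A. indicator {q m} (unit_walk \<omega> (a * (real m * h)))))"
    for q :: "nat \<Rightarrow> int ^ 'd" and \<omega>
  proof -
    have "exp (c * (h * (\<Sum>m\<le>N. indicator {q m} (unit_walk \<omega> (a * (real m * h)))))) =
      (\<Prod>m\<le>N. \<epsilon> * indicator {q m} (unit_walk \<omega> (a * (real m * h))) + 1)"
      unfolding sum_distrib_left exp_sum[OF finite_atMost]
      by (intro prod.cong) (auto simp: indicator_def \<epsilon>_def)
    also have "\<dots> = (\<Sum>A\<in>Pow {..N}. \<epsilon> ^ card A * (\<Prod>m\<in>A. indicator {q m} (unit_walk \<omega> (a * (real m * h)))))"
      by (subst prod_add) (auto simp: prod.distrib)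
    finally have "ennreal (exp (c * (h * (\<Sum>m\<le>N. indicator {q m} (unit_walk \<omega> (a * (real m * h))))))) =
      (\<Sum>A\<in>Pow {..N}. ennreal (\<epsilon> ^ card A * (\<Prod>m\<in>A. indicator {q m} (unit_walk \<omega> (a * (real m * h))))))"
      using \<epsilon> by (simp add: sum_ennreal prod_nonneg)
    also have "\<dots> = (\<Sum>A\<in>Pow {..N}. ennreal (\<epsilon> ^ card A) * (\<Prod>m\<in>A. indicator {q m} (unit_walk \<omega> (a * (real m * h)))))"
      using \<epsilon> by (intro sum.cong) (auto simp: ennreal_mult prod_nonneg prod_ennreal[symmetric] ennreal_indicator)
    finally show ?thesis .
  qed
  have term_le: "(\<integral>\<^sup>+\<omega>. (\<Prod>m\<in>A. indicator {q (real m * h)} (unit_walk \<omega> (a * (real m * h)))) \<partial>walk_space) \<le>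
    (\<integral>\<^sup>+\<omega>. (\<Prod>m\<in>A. indicator {0 :: int ^ 'd} (unit_walk \<omega> (a * (real m * h))) :: ennreal) \<partial>walk_space)"
    if "A \<subseteq> {..N}" for A
  proof -
    define T where "T = (\<lambda>m. a * (real m * h)) ` A"
    \<comment> \<open>Distinct indices must give distinct times for the product over
      \<open>A\<close> to become one over the set \<open>T\<close>; hence \<open>0 < a\<close>, and
      the walk at rest is treated separately below.\<close>
    have inj: "inj_on (\<lambda>m. a * (real m * h)) A" using a h by (auto simp: inj_on_def)
    have T: "finite T" "T \<subseteq> {0..}" using finite_subset[OF that] a h by (auto simp: T_def)
    have "(\<Prod>m\<in>A. indicator {q' (real m * h)} (unit_walk \<omega> (a * (real m * h)))) =
      (\<Prod>s\<in>T. indicator {q' (s / a)} (0 + unit_walk \<omega> s) :: ennreal)" for \<omega> and q' :: "real \<Rightarrow> int ^ 'd"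
      unfolding T_def using a by (subst prod.reindex[OF inj]) simp
    from this[of q] this[of "\<lambda>_. 0"] show ?thesis
      using nn_integral_fdd_le[OF T, of "\<lambda>s. q (s / a)" 0] by simp
  qed
  show ?thesis
    unfolding expand[of "\<lambda>m. q (real m * h)"] expand[of "\<lambda>_. 0"]
    by (simp add: nn_integral_sum nn_integral_cmult) (intro sum_mono mult_left_mono term_le, auto)
qed

lemma nn_integral_exp_riemann_tendsto:
  fixes q :: "real \<Rightarrow> int ^ 'd"
  assumes a: "0 \<le> a" and c: "0 \<le> c" and t: "0 < t" and q: "step_path t q" and [measurable]: "q \<in> measurable borel (count_space UNIV)"
  shows "(\<lambda>N. \<integral>\<^sup>+\<omega>. ennreal (exp (c * (t / real N * (\<Sum>m\<le>N. indicator {q (real m * (t / real N))} (unit_walk \<omega> (a * (real m * (t / real N)))))))) \<partial>walk_space)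
    \<longlonglongrightarrow> (\<integral>\<^sup>+\<omega>. ennreal (exp (c * (LINT s:{0..t}|lborel. indicator {q s} (unit_walk \<omega> (a * s))))) \<partial>walk_space)"
\<comment> \<open>There are \<open>N + 1\<close> grid points, so the Riemann sum is at most
  \<open>t * (N + 1) / N \<le> 2 * t\<close>.\<close>
proof (rule nn_integral_dominated_convergence[where w="\<lambda>_. ennreal (exp (c * (2 * t)))"])
  have [measurable]: "(\<lambda>\<omega>. LINT s:{0..t}|lborel. indicator {q s} (unit_walk \<omega> (a * s)) :: real) \<in> borel_measurable walk_space"
    by (rule measurable_coincidence_time) measurable
  show "(\<lambda>\<omega>. ennreal (exp (c * (LINT s:{0..t}|lborel. indicator {q s} (unit_walk \<omega> (a * s)))))) \<in> borel_measurable walk_space"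
    by measurable
  show "AE \<omega> in walk_space. ennreal (exp (c * (t / real N * (\<Sum>m\<le>N. indicator {q (real m * (t / real N))} (unit_walk \<omega> (a * (real m * (t / real N)))))))) \<le> ennreal (exp (c * (2 * t)))" for N
  proof (rule AE_I2)
    fix \<omega>
    have "(\<Sum>m\<le>N. indicator {q (real m * (t / real N))} (unit_walk \<omega> (a * (real m * (t / real N))))) \<le> (\<Sum>m\<le>N. 1 :: real)"
      by (intro sum_mono) (auto simp: indicator_def)
    then have "t / real N * (\<Sum>m\<le>N. indicator {q (real m * (t / real N))} (unit_walk \<omega> (a * (real m * (t / real N))))) \<le> t / real N * (real N + 1)"
      using t by (intro mult_left_mono) auto
    also have "\<dots> \<le> 2 * t" using t by (cases "N = 0") (auto simp: field_simps)
    finally show "ennreal (exp (c * (t / real N * (\<Sum>m\<le>N. indicator {q (real m * (t / real N))} (unit_walk \<omega> (a * (real m * (t / real N)))))))) \<le> ennreal (exp (c * (2 * t)))"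
      using c by (intro ennreal_leI exp_le_cancel_iff[THEN iffD2] mult_left_mono)
  qed
  show "AE \<omega> in walk_space. (\<lambda>N. ennreal (exp (c * (t / real N * (\<Sum>m\<le>N. indicator {q (real m * (t / real N))} (unit_walk \<omega> (a * (real m * (t / real N)))))))))
    \<longlonglongrightarrow> ennreal (exp (c * (LINT s:{0..t}|lborel. indicator {q s} (unit_walk \<omega> (a * s)))))"
    using AE_regular
  proof eventually_elim
    case (elim \<omega>)
    have "step_path t (\<lambda>s. indicator {q s} (unit_walk \<omega> (a * s)) :: real)"
      using step_path_map2[OF q step_path_unit_walk[OF elim, of t 0 a], of "\<lambda>x y. indicator {x} y"] by simp
    then have "(\<lambda>N. t / real N * (\<Sum>m\<le>N. indicator {q (real m * (t / real N))} (unit_walk \<omega> (a * (real m * (t / real N)))))) \<longlonglongrightarrow>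
       (LINT s:{0..t}|lborel. indicator {q s} (unit_walk \<omega> (a * s)))"
      by (rule riemann_sum_tendsto[OF _ _ _ _ t]; (assumption | measurable | simp add: indicator_le_1))
    then show ?case
      by (intro tendsto_ennrealI tendsto_intros)
  qed
qed (auto simp: walk_space.emeasure_space_1[simplified] ennreal_mult_less_top)

text \<open>Limit of the comparison of Riemann sums. A walk with \<open>a = 0\<close> stays at
  \<open>0\<close> and has the maximal local time \<open>t\<close> there, so the comparison is
  pathwise.\<close>

theorem nn_integral_exp_local_time_le:
  fixes q :: "real \<Rightarrow> int ^ 'd"
  assumes a: "0 \<le> a" and c: "0 \<le> c" and t: "0 < t" and q: "step_path t q" and q_m [measurable]: "q \<in> measurable borel (count_space UNIV)"
  shows "(\<integral>\<^sup>+\<omega>. ennreal (exp (c * (LINT s:{0..t}|lborel. indicator {q s} (unit_walk \<omega> (a * s))))) \<partial>walk_space) \<le> return_moment TYPE('d) a c t"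
proof (cases "a = 0")
  case False
  then have a: "0 < a" using assms by simp
  show ?thesis
    unfolding return_moment_def
  proof (rule LIMSEQ_le)
    show "\<exists>K. \<forall>N\<ge>K. (\<integral>\<^sup>+\<omega>. ennreal (exp (c * (t / real N * (\<Sum>m\<le>N. indicator {q (real m * (t / real N))} (unit_walk \<omega> (a * (real m * (t / real N)))))))) \<partial>walk_space)
      \<le> (\<integral>\<^sup>+\<omega>. ennreal (exp (c * (t / real N * (\<Sum>m\<le>N. indicator {0 :: int ^ 'd} (unit_walk \<omega> (a * (real m * (t / real N)))))))) \<partial>walk_space)"
      by (rule exI[of _ 1], intro allI impI riemann_exp_le a c) (use t in auto)
    show "(\<lambda>N. \<integral>\<^sup>+\<omega>. ennreal (exp (c * (t / real N * (\<Sum>m\<le>N. indicator {q (real m * (t / real N))} (unit_walk \<omega> (a * (real m * (t / real N)))))))) \<partial>walk_space)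
      \<longlonglongrightarrow> (\<integral>\<^sup>+\<omega>. ennreal (exp (c * (LINT s:{0..t}|lborel. indicator {q s} (unit_walk \<omega> (a * s))))) \<partial>walk_space)"
      by (rule nn_integral_exp_riemann_tendsto) (use assms in auto)
    show "(\<lambda>N. \<integral>\<^sup>+\<omega>. ennreal (exp (c * (t / real N * (\<Sum>m\<le>N. indicator {0 :: int ^ 'd} (unit_walk \<omega> (a * (real m * (t / real N)))))))) \<partial>walk_space)
      \<longlonglongrightarrow> (\<integral>\<^sup>+\<omega>. ennreal (exp (c * (LINT s:{0..t}|lborel. indicator {0 :: int ^ 'd} (unit_walk \<omega> (a * s))))) \<partial>walk_space)"
      by (rule nn_integral_exp_riemann_tendsto[where q="\<lambda>_. 0"]) (use assms in auto)
  qed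
next
  case True
  show ?thesis
    unfolding return_moment_def
  proof (rule nn_integral_mono_AE)
    show "AE \<omega> in walk_space. ennreal (exp (c * (LINT s:{0..t}|lborel. indicator {q s} (unit_walk \<omega> (a * s))))) \<le>
      ennreal (exp (c * (LINT s:{0..t}|lborel. indicator {0 :: int ^ 'd} (unit_walk \<omega> (a * s)))))"
      using AE_regular
    proof eventually_elim
      case (elim \<omega>)
      have "(LINT s:{0..t}|lborel. indicator {0 :: int ^ 'd} (unit_walk \<omega> (a * s))) = (t :: real)"
        using elim t by (simp add: True unit_walk_0 set_lebesgue_integral_def)
      moreover have "(LINT s:{0..t}|lborel. indicator {q s} (unit_walk \<omega> (a * s))) \<le> t - 0"
        using t by (intro set_integral_bounds(3); (measurable | simp add: indicator_le_1))
      ultimately show ?case using c by (intro ennreal_leI) (auto intro: mult_left_mono)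
    qed
  qed
qed

section \<open>Moments of the solution\<close>

text \<open>Collision time of a walk of jump rate \<open>a\<close> with a catalyst of jump rate
  \<open>b\<close>, where \<open>y\<close> is the displacement of the start of the walk from that of
  the catalyst. The catalyst is read at \<open>t - s\<close>, as in the Feynman--Kac
  formula.\<close>

definition overlap :: "real \<Rightarrow> real \<Rightarrow> int ^ 'd \<Rightarrow> real \<Rightarrow> (nat \<Rightarrow> real \<times> (int ^ 'd)) \<Rightarrow> (nat \<Rightarrow> real \<times> (int ^ 'd)) \<Rightarrow> real" where
  "overlap a b y t \<omega> \<omega>' = (LINT s:{0..t}|lborel. indicator {unit_walk \<omega>' (b * (t - s))} (y + unit_walk \<omega> (a * s)))"

lemma measurable_overlap [measurable (raw)]:
  assumes [measurable]: "f \<in> measurable M (walk_space :: (nat \<Rightarrow> real \<times> (int ^ 'd)) measure)" "g \<in> measurable M walk_space"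
  shows "(\<lambda>x. overlap a b y t (f x) (g x)) \<in> borel_measurable M"
  unfolding overlap_def by (rule measurable_coincidence_time) measurable

lemma overlap_integrand_measurable [measurable]:
  "(\<lambda>s. indicator {unit_walk \<omega>' (b * (t - s))} (y + unit_walk \<omega> (a * s)) :: real) \<in> borel_measurable borel"
  by (rule measurable_indicator_eq) measurable

lemma overlap_nonneg: "0 \<le> overlap a b y t \<omega> \<omega>'"
  and overlap_le: "0 \<le> t \<Longrightarrow> overlap a b y t \<omega> \<omega>' \<le> t"
proof -
  show "0 \<le> overlap a b y t \<omega> \<omega>'"
    unfolding overlap_def set_lebesgue_integral_def by (intro integral_nonneg_AE AE_I2) (auto simp: indicator_def)
  show "overlap a b y t \<omega> \<omega>' \<le> t" if "0 \<le> t"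
    using set_integral_bounds(3)[OF _ _ overlap_integrand_measurable that] by (simp add: overlap_def indicator_le_1)
qed

text \<open>Substituting \<open>t - s\<close> for \<open>s\<close> lets the catalyst run forwards
  and the walk backwards without changing the coincidences. This is the origin of the symmetry
  between \<open>(\<kappa>, p)\<close> and \<open>(\<rho>, n)\<close>.\<close>

lemma overlap_swap: "overlap a b y t \<omega> \<omega>' = overlap b a (- y) t \<omega>' \<omega>"
proof -
  have "indicator {unit_walk \<omega>' (b * (t - (t - s)))} (y + unit_walk \<omega> (a * (t - s))) =
    (indicator {unit_walk \<omega> (a * (t - s))} (- y + unit_walk \<omega>' (b * s)) :: real)" for s
    by (auto simp: indicator_def algebra_simps)
  then show ?thesis
    unfolding overlap_def by (subst set_integral_reflect) simp
qed

abbreviation walks :: "nat \<Rightarrow> (nat \<Rightarrow> nat \<Rightarrow> real \<times> (int ^ 'd)) measure" where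
  "walks n \<equiv> PiM {1..n} (\<lambda>_. walk_space)"

interpretation walks_prod: product_prob_space "\<lambda>_. walk_space :: (nat \<Rightarrow> real \<times> (int ^ 'd)) measure" "UNIV :: nat set"
  by (rule product_prob_spaceI) (rule walk_space.prob_space_axioms)

lemma prob_space_walks: "prob_space (walks n)"
  by (rule prob_space_PiM) (rule walk_space.prob_space_axioms)

lemma measurable_walks_component [measurable]:
  "k \<in> {1..n} \<Longrightarrow> (\<lambda>\<eta>. \<eta> k) \<in> measurable (walks n) walk_space"
  by (rule measurable_component_singleton)

lemma emeasure_walks [simp]: "emeasure (PiM A (\<lambda>_. walk_space)) (space (PiM A (\<lambda>_. walk_space))) = 1"
  by (rule prob_space.emeasure_space_1) (rule prob_space_PiM, rule walk_space.prob_space_axioms)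

lemma AE_walks_regular: "AE \<eta> in walks n. \<forall>k\<in>{1..n}. regular (\<eta> k)"
  by (intro eventually_ball_finite ballI AE_PiM_component walk_space.prob_space_axioms AE_regular) auto

text \<open>For \<open>a = 2 d \<kappa>\<close> and \<open>b = 2 d \<rho>\<close> this is the
  \<open>p\<close>-th moment of the solution: \<open>\<xi>\<close> are the \<open>p\<close> copies
  of \<open>X\<close>, \<open>\<eta>\<close> the \<open>n\<close> catalysts.\<close>

definition moment :: "real \<Rightarrow> real \<Rightarrow> nat \<Rightarrow> nat \<Rightarrow> int ^ 'd \<Rightarrow> real \<Rightarrow> ennreal" where
  "moment a b p n y t = (\<integral>\<^sup>+\<eta>. \<integral>\<^sup>+\<xi>. ennreal (exp (\<Sum>j\<in>{1..p}. \<Sum>k\<in>{1..n}. overlap a b y t (\<xi> j) (\<eta> k))) \<partial>walks p \<partial>walks n)"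

lemma nn_integral_walks_swap:
  assumes "(\<lambda>(\<eta>, \<xi>). f \<eta> \<xi>) \<in> borel_measurable ((walks n :: (nat \<Rightarrow> nat \<Rightarrow> real \<times> (int ^ 'd)) measure) \<Otimes>\<^sub>M (walks p :: (nat \<Rightarrow> nat \<Rightarrow> real \<times> (int ^ 'd)) measure))"
  shows "(\<integral>\<^sup>+\<eta>. \<integral>\<^sup>+\<xi>. f \<eta> \<xi> \<partial>walks p \<partial>walks n) = (\<integral>\<^sup>+\<xi>. \<integral>\<^sup>+\<eta>. f \<eta> \<xi> \<partial>walks n \<partial>(walks p :: (nat \<Rightarrow> nat \<Rightarrow> real \<times> (int ^ 'd)) measure))"
proof -
  interpret n: prob_space "walks n :: (nat \<Rightarrow> nat \<Rightarrow> real \<times> (int ^ 'd)) measure" by (rule prob_space_walks)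
  interpret p: prob_space "walks p :: (nat \<Rightarrow> nat \<Rightarrow> real \<times> (int ^ 'd)) measure" by (rule prob_space_walks)
  interpret pair_prob_space "walks n :: (nat \<Rightarrow> nat \<Rightarrow> real \<times> (int ^ 'd)) measure" "walks p :: (nat \<Rightarrow> nat \<Rightarrow> real \<times> (int ^ 'd)) measure" ..
  show ?thesis using assms by (rule Fubini'[symmetric])
qed

lemma moment_swap: "moment a b p n y t = moment b a n p (- y) t"
proof -
  have "moment a b p n y t = (\<integral>\<^sup>+\<xi>. \<integral>\<^sup>+\<eta>. ennreal (exp (\<Sum>j\<in>{1..p}. \<Sum>k\<in>{1..n}. overlap a b y t (\<xi> j) (\<eta> k))) \<partial>walks n \<partial>walks p)"
    unfolding moment_def by (rule nn_integral_walks_swap) measurable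
  also have "\<dots> = moment b a n p (- y) t"
    unfolding moment_def
    by (intro nn_integral_cong arg_cong[where f=ennreal] arg_cong[where f=exp]) (subst sum.swap, simp add: overlap_swap[of a b])
  finally show ?thesis .
qed

lemma nn_integral_walks_prod:
  assumes "\<And>k. k \<in> {1..n} \<Longrightarrow> f k \<in> borel_measurable walk_space"
  shows "(\<integral>\<^sup>+\<eta>. (\<Prod>k\<in>{1..n}. f k (\<eta> k)) \<partial>walks n) = (\<Prod>k\<in>{1..n}. \<integral>\<^sup>+\<omega>. f k \<omega> \<partial>walk_space)"
  by (rule walks_prod.product_nn_integral_prod) (use assms in auto)

lemma ennreal_exp_sum: "finite A \<Longrightarrow> ennreal (exp (\<Sum>i\<in>A. f i)) = (\<Prod>i\<in>A. ennreal (exp (f i)))"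
  by (simp add: exp_sum prod_ennreal)

text \<open>Jensen's inequality with weights \<open>1 / n\<close>. It charges each catalyst with
  \<open>n\<close> times its own overlap, whence the weight \<open>n\<close> in the return
  moment.\<close>

lemma exp_sum_le_mean:
  assumes "1 \<le> n"
  shows "exp (\<Sum>k\<in>{1..n}. f k) \<le> (\<Sum>k\<in>{1..n}. 1 / real n * exp (real n * f k))"
proof -
  have "exp (\<Sum>k\<in>{1..n}. (1 / real n) *\<^sub>R (real n * f k)) \<le> (\<Sum>k\<in>{1..n}. 1 / real n * exp (real n * f k))"
    by (rule convex_on_sum[OF _ _ exp_convex]) (use assms in auto)
  then show ?thesis using assms by simp
qed

text \<open>With the catalysts frozen, Jensen's inequality leaves collisions with one deterministic
  step path at a time, and each is compared with returns to the origin. The resulting bound does not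
  depend on \<open>\<eta>\<close>.\<close>

lemma nn_integral_exp_overlaps_le:
  fixes y :: "int ^ 'd"
  assumes a: "0 \<le> a" and t: "0 < t" and n: "1 \<le> n" and reg: "\<And>k. k \<in> {1..n} \<Longrightarrow> regular (\<eta> k)"
  shows "(\<integral>\<^sup>+\<omega>. ennreal (exp (\<Sum>k\<in>{1..n}. overlap a b y t \<omega> (\<eta> k))) \<partial>walk_space) \<le> return_moment TYPE('d) a (real n) t"
proof -
  have "(\<integral>\<^sup>+\<omega>. ennreal (exp (\<Sum>k\<in>{1..n}. overlap a b y t \<omega> (\<eta> k))) \<partial>walk_space) \<le>
    (\<integral>\<^sup>+\<omega>. ennreal (\<Sum>k\<in>{1..n}. 1 / real n * exp (real n * overlap a b y t \<omega> (\<eta> k))) \<partial>walk_space)"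
    by (intro nn_integral_mono ennreal_leI exp_sum_le_mean n)
  also have "\<dots> = (\<Sum>k\<in>{1..n}. ennreal (1 / real n) * (\<integral>\<^sup>+\<omega>. ennreal (exp (real n * overlap a b y t \<omega> (\<eta> k))) \<partial>walk_space))"
  proof -
    have "ennreal (\<Sum>k\<in>{1..n}. 1 / real n * exp (real n * overlap a b y t \<omega> (\<eta> k))) =
      (\<Sum>k\<in>{1..n}. ennreal (1 / real n) * ennreal (exp (real n * overlap a b y t \<omega> (\<eta> k))))" for \<omega>
      by (subst sum_ennreal[symmetric]) (auto simp only: ennreal_mult exp_ge_zero zero_le_divide_1_iff of_nat_0_le_iff intro!: mult_nonneg_nonneg sum.cong)
    then show ?thesis
      by (simp only:) (subst nn_integral_sum, measurable, intro sum.cong refl nn_integral_cmult, measurable)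
  qed
  also have "\<dots> \<le> (\<Sum>k\<in>{1..n}. ennreal (1 / real n) * return_moment TYPE('d) a (real n) t)"
  proof (intro sum_mono mult_left_mono)
    fix k assume "k \<in> {1..n}"
    then have r: "regular (\<eta> k)" by (rule reg)
    have "overlap a b y t \<omega> (\<eta> k) = (LINT s:{0..t}|lborel. indicator {unit_walk (\<eta> k) (b * (t - s)) - y} (unit_walk \<omega> (a * s)))" for \<omega>
      unfolding overlap_def by (intro set_lebesgue_integral_cong) (auto simp: indicator_def algebra_simps)
    moreover have "step_path t (\<lambda>s. unit_walk (\<eta> k) (b * (t - s)) - y)"
      using step_path_map[OF step_path_unit_walk[OF r, of t "b * t" "- b"], of "\<lambda>z. z - y"] by (simp add: algebra_simps)
    ultimately show "(\<integral>\<^sup>+\<omega>. ennreal (exp (real n * overlap a b y t \<omega> (\<eta> k))) \<partial>walk_space) \<le> return_moment TYPE('d) a (real n) t"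
      by (simp only:) (rule nn_integral_exp_local_time_le, use a t in \<open>auto intro!: measurable_minus_count_space measurable_unit_walk\<close>)
  qed auto
  also have "\<dots> = return_moment TYPE('d) a (real n) t"
  proof -
    have "of_nat n * ennreal (1 / real n) = 1"
      using n by (simp add: ennreal_of_nat_eq_real_of_nat ennreal_mult[symmetric])
    then show ?thesis by (simp add: mult.assoc[symmetric])
  qed
  finally show ?thesis .
qed

text \<open>Given the catalysts, the \<open>p\<close> walks are independent, so the bound for one
  walk is raised to the power \<open>p\<close>.\<close>

theorem moment_le:
  fixes y :: "int ^ 'd"
  assumes a: "0 \<le> a" and t: "0 < t" and n: "1 \<le> n"
  shows "moment a b p n y t \<le> return_moment TYPE('d) a (real n) t ^ p"
proof -
  have "moment a b p n y t \<le> (\<integral>\<^sup>+\<eta>. return_moment TYPE('d) a (real n) t ^ p \<partial>(walks n :: (nat \<Rightarrow> nat \<Rightarrow> real \<times> (int ^ 'd)) measure))"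
    unfolding moment_def
  proof (rule nn_integral_mono_AE)
    show "AE \<eta> in walks n. (\<integral>\<^sup>+\<xi>. ennreal (exp (\<Sum>j\<in>{1..p}. \<Sum>k\<in>{1..n}. overlap a b y t (\<xi> j) (\<eta> k))) \<partial>walks p) \<le> return_moment TYPE('d) a (real n) t ^ p"
      using AE_walks_regular
    proof eventually_elim
      case (elim \<eta>)
      have "(\<integral>\<^sup>+\<xi>. ennreal (exp (\<Sum>j\<in>{1..p}. \<Sum>k\<in>{1..n}. overlap a b y t (\<xi> j) (\<eta> k))) \<partial>walks p) =
        (\<Prod>j\<in>{1..p}. \<integral>\<^sup>+\<omega>. ennreal (exp (\<Sum>k\<in>{1..n}. overlap a b y t \<omega> (\<eta> k))) \<partial>walk_space)"
        by (subst ennreal_exp_sum, simp, subst nn_integral_walks_prod) auto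
      also have "\<dots> \<le> (\<Prod>j\<in>{1..p}. return_moment TYPE('d) a (real n) t)"
        by (intro prod_mono_ennreal nn_integral_exp_overlaps_le a t n) (use elim in auto)
      finally show ?case by simp
    qed
  qed
  then show ?thesis by simp
qed

corollary moment_le':
  fixes y :: "int ^ 'd"
  assumes "0 \<le> b" "0 < t" "1 \<le> p"
  shows "moment a b p n y t \<le> return_moment TYPE('d) b (real p) t ^ n"
  using moment_le[of b t p a n "- y"] assms by (simp add: moment_swap[of a b])

lemma moment_ge_1:
  fixes y :: "int ^ 'd"
  assumes "0 \<le> t"
  shows "1 \<le> moment a b p n y t"
proof -
  have "(1::ennreal) = (\<integral>\<^sup>+\<eta>. \<integral>\<^sup>+\<xi>. 1 \<partial>(walks p :: (nat \<Rightarrow> nat \<Rightarrow> real \<times> (int ^ 'd)) measure) \<partial>(walks n :: (nat \<Rightarrow> nat \<Rightarrow> real \<times> (int ^ 'd)) measure))"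
    by simp
  also have "\<dots> \<le> moment a b p n y t"
    unfolding moment_def by (intro nn_integral_mono) (auto simp: overlap_nonneg sum_nonneg simp flip: ennreal_1 intro!: ennreal_leI)
  finally show ?thesis .
qed

section \<open>Lower bounds on the moments by explicit strategies\<close>

lemma set_integral_mono_Icc:
  fixes f g :: "real \<Rightarrow> real"
  assumes f: "\<And>s. 0 \<le> f s" "\<And>s. f s \<le> 1" "f \<in> borel_measurable borel"
    and g: "\<And>s. 0 \<le> g s" "\<And>s. g s \<le> 1" "g \<in> borel_measurable borel"
    and le: "\<And>s. s \<in> {a..b} \<Longrightarrow> g s \<le> f s" and sub: "a' \<le> a" "b \<le> b'" "a \<le> b"
  shows "(LINT s:{a..b}|lborel. g s) \<le> (LINT s:{a'..b'}|lborel. f s)"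
  unfolding set_lebesgue_integral_def
proof (rule integral_mono)
  show "integrable lborel (\<lambda>s. indicator {a..b} s *\<^sub>R g s)"
    using set_integral_bounds(1)[of g a b] g sub by (simp add: set_integrable_def)
  show "integrable lborel (\<lambda>s. indicator {a'..b'} s *\<^sub>R f s)"
    using set_integral_bounds(1)[of f a' b'] f sub by (simp add: set_integrable_def)
qed (use f le sub in \<open>auto simp: indicator_def\<close>)

lemma return_integrand_measurable:
  "(\<lambda>s. indicator {z} (y + unit_walk \<omega> (a * s)) :: real) \<in> borel_measurable borel"
  by (rule measurable_indicator_count_space) measurable

text \<open>The catalyst moves to \<open>y\<close> within its first time unit, with probability
  \<open>heat b y\<close>, and rests there for the remaining \<open>t - 1\<close>. On the reversed
  clock it occupies the start of the walks during \<open>{0..t - 1}\<close>, so each overlap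
  dominates a local time at the starting point.\<close>

lemma nn_integral_exp_overlaps_ge_moving:
  fixes y :: "int ^ 'd"
  assumes b: "0 \<le> b" and t: "1 \<le> t"
  shows "ennreal (heat b y * exp (- (b * (t - 1)))) *
      ennreal (exp (\<Sum>j\<in>J. LINT s:{0..t - 1}|lborel. indicator {0} (unit_walk (\<xi> j) (a * s)))) \<le>
    (\<integral>\<^sup>+\<omega>. ennreal (exp (\<Sum>j\<in>J. overlap a b y t (\<xi> j) \<omega>)) \<partial>walk_space)"
proof -
  let ?c = "ennreal (exp (\<Sum>j\<in>J. LINT s:{0..t - 1}|lborel. indicator {0} (unit_walk (\<xi> j) (a * s))))"
  have "ennreal (heat b y * exp (- (b * (t - 1)))) * ?c =
    (\<integral>\<^sup>+\<omega>. indicator {y} (unit_walk \<omega> b) \<partial>walk_space) * (\<integral>\<^sup>+\<omega>'. (if fst (\<omega>' 0) \<le> b * (t - 1) then 0 else 1) * ?c \<partial>(walk_space :: (nat \<Rightarrow> real \<times> (int ^ 'd)) measure))"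
    using b t by (subst nn_integral_multc) (auto simp: nn_integral_no_jump nn_integral_heat ennreal_mult mult.assoc)
  also have "\<dots> = (\<integral>\<^sup>+\<omega>. \<integral>\<^sup>+\<omega>'. indicator {y} (unit_walk \<omega> b) * ((if fst (\<omega>' 0) \<le> b * (t - 1) then 0 else 1) * ?c) \<partial>(walk_space :: (nat \<Rightarrow> real \<times> (int ^ 'd)) measure) \<partial>walk_space)"
    by (simp add: nn_integral_cmult nn_integral_multc)
  also have "\<dots> \<le> (\<integral>\<^sup>+\<omega>. \<integral>\<^sup>+\<omega>'. ennreal (exp (\<Sum>j\<in>J. overlap a b y t (\<xi> j) (splice b \<omega> \<omega>'))) \<partial>walk_space \<partial>walk_space)"
  proof (rule nn_integral_mono_AE, use AE_regular in eventually_elim, rule nn_integral_mono_AE, use AE_regular in eventually_elim)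
    fix \<omega> \<omega>' :: "nat \<Rightarrow> real \<times> (int ^ 'd)"
    assume r: "regular \<omega>" "regular \<omega>'"
    show "indicator {y} (unit_walk \<omega> b) * ((if fst (\<omega>' 0) \<le> b * (t - 1) then 0 else 1) * ?c) \<le>
      ennreal (exp (\<Sum>j\<in>J. overlap a b y t (\<xi> j) (splice b \<omega> \<omega>')))"
    proof (cases "unit_walk \<omega> b = y \<and> b * (t - 1) < fst (\<omega>' 0)")
      case True
      \<comment> \<open>Feynman--Kac time \<open>s\<close> is catalyst time \<open>t - s\<close>,
        which for \<open>s \<le> t - 1\<close> lies past the splice at catalyst time
        \<open>1\<close>.\<close>
      have path: "unit_walk (splice b \<omega> \<omega>') (b * (t - s)) = y" if "s \<in> {0..t - 1}" for s
      proof -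
        have "b * (t - s) = b + b * (t - 1 - s)" by (simp add: algebra_simps)
        moreover have "0 \<le> b * (t - 1 - s)" "b * (t - 1 - s) \<le> b * (t - 1)"
          using that b by (auto intro: mult_left_mono)
        moreover from this(2) have "unit_walk \<omega>' (b * (t - 1 - s)) = 0"
          using True by (intro unit_walk_no_jump[OF r(2), of "b * (t - 1)"]) auto
        ultimately show ?thesis
          using True unit_walk_splice_after[OF r b] by simp
      qed
      have "(LINT s:{0..t - 1}|lborel. indicator {0} (unit_walk (\<xi> j) (a * s))) \<le> overlap a b y t (\<xi> j) (splice b \<omega> \<omega>')" for j
        unfolding overlap_def
        by (rule set_integral_mono_Icc)
          (use t return_integrand_measurable[of 0 0] in \<open>auto simp: path overlap_integrand_measurable indicator_le_1 indicator_def[of "{y}"]\<close>)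
      then have "?c \<le> ennreal (exp (\<Sum>j\<in>J. overlap a b y t (\<xi> j) (splice b \<omega> \<omega>')))"
        by (auto intro!: ennreal_leI sum_mono)
      then show ?thesis using True by simp
    qed auto
  qed
  also have "\<dots> = (\<integral>\<^sup>+\<omega>. ennreal (exp (\<Sum>j\<in>J. overlap a b y t (\<xi> j) \<omega>)) \<partial>walk_space)"
    by (rule nn_integral_splice[symmetric]) (use b in auto)
  finally show ?thesis .
qed

text \<open>A catalyst avoids jumping with probability \<open>exp (- (b * t))\<close>, and the walks
  have to come to it. This strategy replaces the moving one when
  \<open>heat b y = 0\<close>.\<close>

lemma nn_integral_exp_overlaps_ge_staying:
  fixes y :: "int ^ 'd"
  assumes b: "0 \<le> b" and t: "0 \<le> t"
  shows "ennreal (exp (- (b * t))) *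
      ennreal (exp (\<Sum>j\<in>J. LINT s:{0..t}|lborel. indicator {0} (y + unit_walk (\<xi> j) (a * s)))) \<le>
    (\<integral>\<^sup>+\<omega>. ennreal (exp (\<Sum>j\<in>J. overlap a b y t (\<xi> j) \<omega>)) \<partial>walk_space)"
proof -
  let ?c = "ennreal (exp (\<Sum>j\<in>J. LINT s:{0..t}|lborel. indicator {0} (y + unit_walk (\<xi> j) (a * s))))"
  have "ennreal (exp (- (b * t))) * ?c = (\<integral>\<^sup>+\<omega>. (if fst (\<omega> 0) \<le> b * t then 0 else 1) * ?c \<partial>(walk_space :: (nat \<Rightarrow> real \<times> (int ^ 'd)) measure))"
    using b t by (subst nn_integral_multc) (auto simp: nn_integral_no_jump)
  also have "\<dots> \<le> (\<integral>\<^sup>+\<omega>. ennreal (exp (\<Sum>j\<in>J. overlap a b y t (\<xi> j) \<omega>)) \<partial>walk_space)"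
  proof (rule nn_integral_mono_AE, use AE_regular in eventually_elim)
    fix \<omega> :: "nat \<Rightarrow> real \<times> (int ^ 'd)"
    assume r: "regular \<omega>"
    show "(if fst (\<omega> 0) \<le> b * t then 0 else 1) * ?c \<le> ennreal (exp (\<Sum>j\<in>J. overlap a b y t (\<xi> j) \<omega>))"
    proof (cases "b * t < fst (\<omega> 0)")
      case True
      have path: "unit_walk \<omega> (b * (t - s)) = 0" if "s \<in> {0..t}" for s
        using that b by (intro unit_walk_no_jump[OF r True]) (auto intro: mult_left_mono)
      have "(LINT s:{0..t}|lborel. indicator {0} (y + unit_walk (\<xi> j) (a * s))) \<le> overlap a b y t (\<xi> j) \<omega>" for j
        unfolding overlap_def
        by (rule set_integral_mono_Icc)
          (use t return_integrand_measurable in \<open>auto simp: path overlap_integrand_measurable indicator_le_1\<close>)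
      then have "?c \<le> ennreal (exp (\<Sum>j\<in>J. overlap a b y t (\<xi> j) \<omega>))"
        by (auto intro!: ennreal_leI sum_mono)
      then show ?thesis using True by simp
    qed auto
  qed
  finally show ?thesis .
qed

lemma measurable_return_time_shifted:
  "(\<lambda>\<omega>. LINT s:{\<alpha>..\<beta>}|lborel. indicator {0} (y + unit_walk \<omega> (a * s)) :: real) \<in> borel_measurable walk_space"
  by (rule measurable_coincidence_time) measurable

text \<open>The walk uses the first time unit to get from \<open>y\<close> to \<open>0\<close>, with
  probability \<open>heat a y\<close>, and starts afresh there for the remaining
  \<open>t - 1\<close>.\<close>

lemma return_moment_shifted_ge:
  fixes y :: "int ^ 'd"
  assumes a: "0 \<le> a" and t: "1 \<le> t" and c: "0 \<le> c"
  shows "ennreal (heat a y) * return_moment TYPE('d) a c (t - 1) \<le>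
    (\<integral>\<^sup>+\<omega>. ennreal (exp (c * (LINT s:{0..t}|lborel. indicator {0} (y + unit_walk \<omega> (a * s))))) \<partial>walk_space)"
proof -
  note [measurable] = measurable_return_time_shifted
  have "ennreal (heat a y) * return_moment TYPE('d) a c (t - 1) =
    (\<integral>\<^sup>+\<omega>. \<integral>\<^sup>+\<omega>'. indicator {- y} (unit_walk \<omega> a) *
      ennreal (exp (c * (LINT s:{0..t - 1}|lborel. indicator {0 :: int ^ 'd} (unit_walk \<omega>' (a * s))))) \<partial>walk_space \<partial>(walk_space :: (nat \<Rightarrow> real \<times> (int ^ 'd)) measure))"
    by (simp add: nn_integral_cmult nn_integral_multc nn_integral_heat heat_uminus return_moment_def)
  also have "\<dots> \<le> (\<integral>\<^sup>+\<omega>. \<integral>\<^sup>+\<omega>'. ennreal (exp (c * (LINT s:{0..t}|lborel. indicator {0} (y + unit_walk (splice a \<omega> \<omega>') (a * s))))) \<partial>walk_space \<partial>walk_space)"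
  proof (rule nn_integral_mono_AE, use AE_regular in eventually_elim, rule nn_integral_mono_AE, use AE_regular in eventually_elim)
    fix \<omega> \<omega>' :: "nat \<Rightarrow> real \<times> (int ^ 'd)"
    assume r: "regular \<omega>" "regular \<omega>'"
    show "indicator {- y} (unit_walk \<omega> a) * ennreal (exp (c * (LINT s:{0..t - 1}|lborel. indicator {0} (unit_walk \<omega>' (a * s))))) \<le>
      ennreal (exp (c * (LINT s:{0..t}|lborel. indicator {0} (y + unit_walk (splice a \<omega> \<omega>') (a * s)))))"
    proof (cases "unit_walk \<omega> a = - y")
      case True
      have path: "y + unit_walk (splice a \<omega> \<omega>') (a * s) = unit_walk \<omega>' (a * (s - 1))" if "s \<in> {1..t}" for s
      proof -
        have "a * s = a + a * (s - 1)" by (simp add: algebra_simps)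
        then show ?thesis using unit_walk_splice_after[OF r a, of "a * (s - 1)"] that a True by simp
      qed
      have "(LINT s:{0..t - 1}|lborel. indicator {0} (unit_walk \<omega>' (a * s))) = (LINT s:{1..t}|lborel. indicator {0} (unit_walk \<omega>' (a * (s - 1))) :: real)"
        by (subst set_integral_shift[of 1]) simp
      also have "\<dots> \<le> (LINT s:{0..t}|lborel. indicator {0} (y + unit_walk (splice a \<omega> \<omega>') (a * s)))"
      proof (rule set_integral_mono_Icc)
        show "(\<lambda>s. indicator {0} (unit_walk \<omega>' (a * (s - 1))) :: real) \<in> borel_measurable borel"
          by (rule measurable_indicator_count_space) measurable
      qed (use t return_integrand_measurable in \<open>auto simp: path indicator_le_1\<close>)
      finally show ?thesis using True c by (auto intro!: ennreal_leI mult_left_mono)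
    qed auto
  qed
  also have "\<dots> = (\<integral>\<^sup>+\<omega>. ennreal (exp (c * (LINT s:{0..t}|lborel. indicator {0} (y + unit_walk \<omega> (a * s))))) \<partial>walk_space)"
    by (rule nn_integral_splice[symmetric]) (use a in auto)
  finally show ?thesis .
qed

lemma moment_alt:
  "moment a b p n y t = (\<integral>\<^sup>+\<xi>. (\<Prod>k\<in>{1..n}. \<integral>\<^sup>+\<omega>. ennreal (exp (\<Sum>j\<in>{1..p}. overlap a b y t (\<xi> j) \<omega>)) \<partial>walk_space) \<partial>walks p)"
proof -
  have "moment a b p n y t = (\<integral>\<^sup>+\<xi>. \<integral>\<^sup>+\<eta>. ennreal (exp (\<Sum>j\<in>{1..p}. \<Sum>k\<in>{1..n}. overlap a b y t (\<xi> j) (\<eta> k))) \<partial>walks n \<partial>walks p)"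
    unfolding moment_def by (rule nn_integral_walks_swap) measurable
  also have "\<dots> = (\<integral>\<^sup>+\<xi>. (\<Prod>k\<in>{1..n}. \<integral>\<^sup>+\<omega>. ennreal (exp (\<Sum>j\<in>{1..p}. overlap a b y t (\<xi> j) \<omega>)) \<partial>walk_space) \<partial>walks p)"
  proof (intro nn_integral_cong)
    fix \<xi> :: "nat \<Rightarrow> nat \<Rightarrow> real \<times> (int ^ 'a)"
    have "(\<integral>\<^sup>+\<eta>. ennreal (exp (\<Sum>j\<in>{1..p}. \<Sum>k\<in>{1..n}. overlap a b y t (\<xi> j) (\<eta> k))) \<partial>walks n) =
      (\<integral>\<^sup>+\<eta>. (\<Prod>k\<in>{1..n}. ennreal (exp (\<Sum>j\<in>{1..p}. overlap a b y t (\<xi> j) (\<eta> k)))) \<partial>walks n)"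
      by (subst sum.swap, subst ennreal_exp_sum) simp_all
    also have "\<dots> = (\<Prod>k\<in>{1..n}. \<integral>\<^sup>+\<omega>. ennreal (exp (\<Sum>j\<in>{1..p}. overlap a b y t (\<xi> j) \<omega>)) \<partial>walk_space)"
      by (rule nn_integral_walks_prod) measurable
    finally show "(\<integral>\<^sup>+\<eta>. ennreal (exp (\<Sum>j\<in>{1..p}. \<Sum>k\<in>{1..n}. overlap a b y t (\<xi> j) (\<eta> k))) \<partial>walks n) =
      (\<Prod>k\<in>{1..n}. \<integral>\<^sup>+\<omega>. ennreal (exp (\<Sum>j\<in>{1..p}. overlap a b y t (\<xi> j) \<omega>)) \<partial>walk_space)" .
  qed
  finally show ?thesis .
qed

text \<open>Common part of the two strategies: given the walks, the catalysts are independent and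
  each pays \<open>C\<close> for the same exponent. The exponents add up to \<open>n\<close> times a
  local time of each walk, after which the walks factorise.\<close>

lemma moment_ge_aux:
  fixes y :: "int ^ 'd"
  assumes le: "\<And>\<xi>. C * ennreal (exp (\<Sum>j\<in>{1..p}. L (\<xi> j))) \<le>
      (\<integral>\<^sup>+\<omega>. ennreal (exp (\<Sum>j\<in>{1..p}. overlap a b y t (\<xi> j) \<omega>)) \<partial>walk_space)"
    and [measurable]: "L \<in> borel_measurable walk_space"
  shows "C ^ n * (\<integral>\<^sup>+\<omega>. ennreal (exp (real n * L \<omega>)) \<partial>walk_space) ^ p \<le> moment a b p n y t"
proof -
  have "C ^ n * (\<integral>\<^sup>+\<omega>. ennreal (exp (real n * L \<omega>)) \<partial>walk_space) ^ p =
    C ^ n * (\<integral>\<^sup>+\<xi>. (\<Prod>j\<in>{1..p}. ennreal (exp (real n * L (\<xi> j)))) \<partial>walks p)"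
    by (subst nn_integral_walks_prod) auto
  also have "\<dots> = (\<integral>\<^sup>+\<xi>. C ^ n * (\<Prod>j\<in>{1..p}. ennreal (exp (real n * L (\<xi> j)))) \<partial>walks p)"
    by (rule nn_integral_cmult[symmetric]) measurable
  also have "\<dots> = (\<integral>\<^sup>+\<xi>. (\<Prod>k\<in>{1..n}. C * ennreal (exp (\<Sum>j\<in>{1..p}. L (\<xi> j)))) \<partial>walks p)"
    by (intro nn_integral_cong)
      (simp add: power_mult_distrib ennreal_power exp_of_nat_mult[symmetric] ennreal_exp_sum[symmetric] sum_distrib_left del: prod_constant flip: prod_constant, simp add: power_mult_distrib ennreal_power exp_of_nat_mult[symmetric] sum_distrib_left)
  also have "\<dots> \<le> moment a b p n y t"
    unfolding moment_alt by (intro nn_integral_mono prod_mono_ennreal le)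
  finally show ?thesis .
qed

theorem moment_ge_moving:
  fixes y :: "int ^ 'd"
  assumes "0 \<le> b" "1 \<le> t"
  shows "ennreal (heat b y * exp (- (b * (t - 1)))) ^ n * return_moment TYPE('d) a (real n) (t - 1) ^ p \<le> moment a b p n y t"
  unfolding return_moment_def
  by (rule moment_ge_aux) (use nn_integral_exp_overlaps_ge_moving[OF assms] in auto)

theorem moment_ge_staying:
  fixes y :: "int ^ 'd"
  assumes "0 \<le> a" "0 \<le> b" "1 \<le> t"
  shows "ennreal (exp (- (b * t))) ^ n * (ennreal (heat a y) * return_moment TYPE('d) a (real n) (t - 1)) ^ p \<le> moment a b p n y t"
proof -
  have "ennreal (exp (- (b * t))) ^ n * (ennreal (heat a y) * return_moment TYPE('d) a (real n) (t - 1)) ^ p \<le>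
    ennreal (exp (- (b * t))) ^ n * (\<integral>\<^sup>+\<omega>. ennreal (exp (real n * (LINT s:{0..t}|lborel. indicator {0} (y + unit_walk \<omega> (a * s))))) \<partial>walk_space) ^ p"
    using assms by (intro mult_left_mono power_mono return_moment_shifted_ge) auto
  also have "\<dots> \<le> moment a b p n y t"
    using assms by (intro moment_ge_aux nn_integral_exp_overlaps_ge_staying measurable_return_time_shifted) auto
  finally show ?thesis .
qed

section \<open>Growth of the exponential moments of the local time\<close>

text \<open>Measuring time in units of \<open>1 / c\<close> turns the weight into \<open>1\<close>
  and the jump rate into \<open>a / c\<close>. With \<open>c = n\<close> this explains the form
  \<open>n * \<mu>(\<kappa> / n)\<close>.\<close>

lemma return_moment_scale:
  assumes c: "0 < c"
  shows "return_moment TYPE('d::finite) a c t = return_moment TYPE('d) (a / c) 1 (c * t)"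
proof -
  have "c * (LINT s:{0..t}|lborel. indicator {0 :: int ^ 'd} (unit_walk \<omega> (a * s))) =
    (LINT s:{0..c * t}|lborel. indicator {0 :: int ^ 'd} (unit_walk \<omega> (a / c * s)) :: real)" for \<omega>
  proof -
    have "(LINT s:{0..c * t}|lborel. indicator {0 :: int ^ 'd} (unit_walk \<omega> (a / c * s)) :: real) =
      \<bar>c\<bar> *\<^sub>R (\<integral>s. indicator {0..c * t} (0 + c * s) *\<^sub>R indicator {0 :: int ^ 'd} (unit_walk \<omega> (a / c * (0 + c * s))) \<partial>lborel)"
      unfolding set_lebesgue_integral_def using c by (intro lborel_integral_real_affine) auto
    also have "\<dots> = c * (LINT s:{0..t}|lborel. indicator {0 :: int ^ 'd} (unit_walk \<omega> (a * s)))"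
      unfolding set_lebesgue_integral_def using c
      by (auto intro!: Bochner_Integration.integral_cong simp: indicator_def zero_le_mult_iff)
    finally show ?thesis by simp
  qed
  then show ?thesis by (simp add: return_moment_def)
qed

lemma return_moment_le_exp:
  assumes "0 \<le> t" "0 \<le> c"
  shows "return_moment TYPE('d::finite) a c t \<le> ennreal (exp (c * t))"
proof -
  have "(LINT s:{0..t}|lborel. indicator {0 :: int ^ 'd} (unit_walk \<omega> (a * s))) \<le> t - 0" for \<omega>
    using assms return_integrand_measurable[of "0 :: int ^ 'd" 0]
    by (intro set_integral_bounds(3)) (auto simp: indicator_le_1)
  then have "return_moment TYPE('d) a c t \<le> (\<integral>\<^sup>+\<omega>. ennreal (exp (c * t)) \<partial>(walk_space :: (nat \<Rightarrow> real \<times> (int ^ 'd)) measure))"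
    unfolding return_moment_def using assms by (intro nn_integral_mono ennreal_leI) (auto intro: mult_left_mono)
  then show ?thesis by (simp add: walk_space.emeasure_space_1[simplified])
qed

lemma return_moment_ge_1:
  assumes "0 \<le> t" "0 \<le> c"
  shows "1 \<le> return_moment TYPE('d::finite) a c t"
proof -
  have "0 \<le> (LINT s:{0..t}|lborel. indicator {0 :: int ^ 'd} (unit_walk \<omega> (a * s)) :: real)" for \<omega>
    using assms return_integrand_measurable[of "0 :: int ^ 'd" 0]
    by (intro set_integral_bounds(2)) (auto simp: indicator_le_1)
  then have "(\<integral>\<^sup>+\<omega>. 1 \<partial>(walk_space :: (nat \<Rightarrow> real \<times> (int ^ 'd)) measure)) \<le> return_moment TYPE('d) a c t"
    unfolding return_moment_def using assms by (intro nn_integral_mono) (auto simp flip: ennreal_1 intro!: ennreal_leI)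
  then show ?thesis by (simp add: walk_space.emeasure_space_1[simplified])
qed

text \<open>Expectation of \<open>exp_integral_identity\<close> for the indicator of being at
  \<open>0\<close>: at time \<open>s\<close> this indicator contributes
  \<open>heat (a * s) 0\<close>, and by the Markov property the remaining exponent is that of a
  fresh walk over time \<open>t - s\<close>.\<close>

theorem return_moment_renewal:
  assumes a: "0 \<le> a" and t: "0 \<le> t"
  shows "return_moment TYPE('d::finite) a 1 t =
    1 + (\<integral>\<^sup>+s. indicator {0..t} s * (ennreal (heat (a * s) (0 :: int ^ 'd)) * return_moment TYPE('d) a 1 (t - s)) \<partial>lborel)"
proof -
  define g where "g = (\<lambda>(\<omega> :: nat \<Rightarrow> real \<times> (int ^ 'd)) s. indicator {0} (unit_walk \<omega> (a * s)) :: real)"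
  have g_m [measurable]: "(\<lambda>x. g (fst x) (snd x)) \<in> borel_measurable (walk_space \<Otimes>\<^sub>M borel)"
    unfolding g_def by measurable
  have g_m1: "g \<omega> \<in> borel_measurable borel" for \<omega> unfolding g_def by measurable
  have g01: "0 \<le> g \<omega> s" "g \<omega> s \<le> 1" for \<omega> s by (simp_all add: g_def indicator_le_1)
  have E_m [measurable]: "(\<lambda>x. LINT r:{snd x..t}|lborel. g (fst x) r) \<in> borel_measurable (walk_space \<Otimes>\<^sub>M borel)"
  proof -
    have "(\<lambda>y. indicator {snd (fst y)..t} (snd y) *\<^sub>R g (fst (fst y)) (snd y)) \<in> borel_measurable ((walk_space \<Otimes>\<^sub>M borel) \<Otimes>\<^sub>M lborel)"
    proof -
      have "(\<lambda>y. (if snd (fst y) \<le> snd y \<and> snd y \<le> t then 1 else 0) *\<^sub>R g (fst (fst y)) (snd y)) \<in> borel_measurable ((walk_space \<Otimes>\<^sub>M borel) \<Otimes>\<^sub>M lborel)"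
        unfolding g_def by measurable
      then show ?thesis by (simp add: indicator_def of_bool_def)
    qed
    then show ?thesis
      unfolding set_lebesgue_integral_def
      by (intro lborel.borel_measurable_lebesgue_integral) (simp add: split_beta')
  qed
  have slice: "(\<integral>\<^sup>+\<omega>. ennreal (g \<omega> s * exp (LINT r:{s..t}|lborel. g \<omega> r)) \<partial>walk_space) =
    ennreal (heat (a * s) (0 :: int ^ 'd)) * return_moment TYPE('d) a 1 (t - s)" if s: "s \<in> {0..t}" for s
  proof -
    have "(\<integral>\<^sup>+\<omega>. ennreal (g \<omega> s * exp (LINT r:{s..t}|lborel. g \<omega> r)) \<partial>walk_space) =
      (\<integral>\<^sup>+\<omega>. \<integral>\<^sup>+\<omega>'. indicator {0 :: int ^ 'd} (unit_walk \<omega> (a * s)) * ennreal (exp (1 * (LINT r:{0..t - s}|lborel. g \<omega>' r))) \<partial>walk_space \<partial>walk_space)"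
    proof (rule nn_integral_splice_cong[where u="a * s"])
      show "(\<lambda>\<omega>. ennreal (g \<omega> s * exp (LINT r:{s..t}|lborel. g \<omega> r))) \<in> borel_measurable walk_space"
        unfolding g_def by measurable
      show "0 \<le> a * s" using a s by simp
      fix \<omega> \<omega>' :: "nat \<Rightarrow> real \<times> (int ^ 'd)"
      assume r: "regular \<omega>" "regular \<omega>'"
      have at_s: "g (splice (a * s) \<omega> \<omega>') s = g \<omega> s"
        using r a s by (simp add: g_def unit_walk_splice_before)
      show "ennreal (g (splice (a * s) \<omega> \<omega>') s * exp (LINT r:{s..t}|lborel. g (splice (a * s) \<omega> \<omega>') r)) =
        indicator {0} (unit_walk \<omega> (a * s)) * ennreal (exp (1 * (LINT r:{0..t - s}|lborel. g \<omega>' r)))"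
      proof (cases "unit_walk \<omega> (a * s) = 0")
        case True
        have "(LINT r:{s..t}|lborel. g (splice (a * s) \<omega> \<omega>') r) = (LINT r:{0..t - s}|lborel. g (splice (a * s) \<omega> \<omega>') (s + r))"
          by (rule set_integral_shift)
        also have "\<dots> = (LINT r:{0..t - s}|lborel. g \<omega>' r)"
          by (rule set_lebesgue_integral_cong)
            (use True a s r in \<open>auto simp: g_def distrib_left unit_walk_splice_after\<close>)
        finally show ?thesis using True by (simp add: at_s) (simp add: g_def)
      next
        case False
        then show ?thesis by (simp add: at_s) (simp add: g_def)
      qed
    qed
    also have "\<dots> = ennreal (heat (a * s) (0 :: int ^ 'd)) * return_moment TYPE('d) a 1 (t - s)"
      unfolding return_moment_def g_def by (simp add: nn_integral_cmult nn_integral_multc nn_integral_heat)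
    finally show ?thesis .
  qed
  interpret L: pair_sigma_finite "walk_space :: (nat \<Rightarrow> real \<times> (int ^ 'd)) measure" "lborel :: real measure" ..
  have "return_moment TYPE('d) a 1 t = (\<integral>\<^sup>+\<omega>. 1 + (\<integral>\<^sup>+s. indicator {0..t} s * ennreal (g \<omega> s * exp (LINT r:{s..t}|lborel. g \<omega> r)) \<partial>lborel) \<partial>walk_space)"
    unfolding return_moment_def
  proof (rule nn_integral_cong_AE, use AE_regular in eventually_elim)
    fix \<omega> :: "nat \<Rightarrow> real \<times> (int ^ 'd)" assume r: "regular \<omega>"
    have "step_path t (g \<omega>)"
      using step_path_map[OF step_path_unit_walk[OF r, of t 0 a], of "indicator {0}"] by (simp add: g_def[abs_def])
    from exp_integral_identity[OF this g01 g_m1 t]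
    show "ennreal (exp (1 * (LINT s:{0..t}|lborel. indicator {0} (unit_walk \<omega> (a * s))))) =
      1 + (\<integral>\<^sup>+s. indicator {0..t} s * ennreal (g \<omega> s * exp (LINT r:{s..t}|lborel. g \<omega> r)) \<partial>lborel)"
      by (simp add: g_def)
  qed
  also have "\<dots> = 1 + (\<integral>\<^sup>+\<omega>. \<integral>\<^sup>+s. indicator {0..t} s * ennreal (g \<omega> s * exp (LINT r:{s..t}|lborel. g \<omega> r)) \<partial>lborel \<partial>walk_space)"
    by (subst nn_integral_add) (auto simp: walk_space.emeasure_space_1[simplified] intro!: lborel.borel_measurable_nn_integral)
  also have "(\<integral>\<^sup>+\<omega>. \<integral>\<^sup>+s. indicator {0..t} s * ennreal (g \<omega> s * exp (LINT r:{s..t}|lborel. g \<omega> r)) \<partial>lborel \<partial>walk_space) =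
    (\<integral>\<^sup>+s. \<integral>\<^sup>+\<omega>. indicator {0..t} s * ennreal (g \<omega> s * exp (LINT r:{s..t}|lborel. g \<omega> r)) \<partial>walk_space \<partial>lborel)"
    by (rule L.Fubini'[symmetric]) (simp add: split_beta')
  also have "\<dots> = (\<integral>\<^sup>+s. indicator {0..t} s * (ennreal (heat (a * s) (0 :: int ^ 'd)) * return_moment TYPE('d) a 1 (t - s)) \<partial>lborel)"
    by (intro nn_integral_cong) (auto simp: indicator_def slice)
  finally show ?thesis .
qed

section \<open>The resolvent kernel as a function of its parameter\<close>

text \<open>Laplace transform in time of the transition probability. For
  \<open>a = 2 d \<kappa>\<close> it is the kernel at \<open>(0, x)\<close> of the inverse of
  \<open>\<theta> - \<kappa> \<Delta>\<close>.\<close>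

definition green_kernel :: "real \<Rightarrow> real \<Rightarrow> int ^ 'd \<Rightarrow> real" where
  "green_kernel a \<theta> x = (LINT s|lborel. indicator {0..} s * (exp (- \<theta> * s) * heat (a * s) x))"

lemma nn_integral_exp_Ici:
  assumes "0 < \<theta>"
  shows "(\<integral>\<^sup>+s. ennreal (indicator {0..} s * exp (- \<theta> * s)) \<partial>lborel) = ennreal (1 / \<theta>)"
proof -
  have "prob_space (density lborel (\<lambda>s. ennreal (exponential_density \<theta> s)))"
    by (rule prob_space_exponential_density) (use assms in simp)
  then have 1: "(\<integral>\<^sup>+s. ennreal (exponential_density \<theta> s) \<partial>lborel) = 1"
    using prob_space.emeasure_space_1 by (fastforce simp: emeasure_density)
  have "(\<integral>\<^sup>+s. ennreal (indicator {0..} s * exp (- \<theta> * s)) \<partial>lborel) = (\<integral>\<^sup>+s. ennreal (1 / \<theta>) * ennreal (exponential_density \<theta> s) \<partial>lborel)"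
    using assms by (intro nn_integral_cong) (auto simp: exponential_density_def ennreal_mult[symmetric] indicator_def mult.commute)
  also have "\<dots> = ennreal (1 / \<theta>)"
    by (subst nn_integral_cmult) (simp_all add: 1)
  finally show ?thesis .
qed

lemma exp_Ici_integral:
  fixes \<theta> :: real
  assumes "0 < \<theta>"
  shows "integrable lborel (\<lambda>s. indicator {0..} s * exp (- \<theta> * s))" "(LINT s|lborel. indicator {0..} s * exp (- \<theta> * s)) = 1 / \<theta>"
proof -
  have "has_bochner_integral lborel (\<lambda>s. indicator {0..} s * exp (- \<theta> * s)) (1 / \<theta>)"
    by (rule has_bochner_integral_nn_integral) (use assms nn_integral_exp_Ici[OF assms] in auto)
  then show "integrable lborel (\<lambda>s. indicator {0..} s * exp (- \<theta> * s))" "(LINT s|lborel. indicator {0..} s * exp (- \<theta> * s)) = 1 / \<theta>"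
    by (auto simp: has_bochner_integral_iff)
qed

lemma green_kernel_integrable:
  assumes "0 < \<theta>"
  shows "integrable lborel (\<lambda>s. indicator {0..} s * (exp (- \<theta> * s) * heat (a * s) x))"
proof (rule Bochner_Integration.integrable_bound[OF exp_Ici_integral(1)[OF assms]])
  show "AE s in lborel. norm (indicator {0..} s * (exp (- \<theta> * s) * heat (a * s) x)) \<le> norm (indicator {0..} s * exp (- \<theta> * s))"
    by (rule AE_I2) (auto simp: indicator_def heat_le_1 abs_mult)
qed measurable

lemma nn_integral_green_kernel:
  assumes "0 < \<theta>"
  shows "(\<integral>\<^sup>+s. indicator {0..} s * ennreal (exp (- \<theta> * s) * heat (a * s) x) \<partial>lborel) = ennreal (green_kernel a \<theta> x)"
proof -
  have "(\<integral>\<^sup>+s. indicator {0..} s * ennreal (exp (- \<theta> * s) * heat (a * s) x) \<partial>lborel) = (\<integral>\<^sup>+s. ennreal (indicator {0..} s * (exp (- \<theta> * s) * heat (a * s) x)) \<partial>lborel)"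
    by (intro nn_integral_cong) (auto simp: indicator_def)
  also have "\<dots> = ennreal (green_kernel a \<theta> x)"
    unfolding green_kernel_def by (rule nn_integral_eq_integral[OF green_kernel_integrable[OF assms]]) (auto simp: indicator_def)
  finally show ?thesis .
qed

lemma green_kernel_nonneg [simp]: "0 \<le> green_kernel a \<theta> x"
  unfolding green_kernel_def by (intro integral_nonneg_AE AE_I2) (auto simp: indicator_def)

lemma green_kernel_le:
  assumes "0 < \<theta>"
  shows "green_kernel a \<theta> x \<le> 1 / \<theta>"
  unfolding green_kernel_def exp_Ici_integral(2)[OF assms, symmetric]
  by (rule integral_mono[OF green_kernel_integrable[OF assms] exp_Ici_integral(1)[OF assms]])
    (auto simp: indicator_def heat_le_1)

text \<open>As \<open>heat\<close> is at most \<open>1\<close>, the difference is dominated by that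
  of the transforms of the constant \<open>1\<close>. This supplies the continuity for the
  intermediate value argument.\<close>

lemma green_kernel_diff_le:
  assumes "0 < \<theta>" "\<theta> \<le> \<mu>"
  shows "\<bar>green_kernel a \<theta> x - green_kernel a \<mu> x\<bar> \<le> 1 / \<theta> - 1 / \<mu>"
proof -
  have \<mu>: "0 < \<mu>" using assms by simp
  note i = green_kernel_integrable[OF assms(1), of a x] green_kernel_integrable[OF \<mu>, of a x]
  have e: "exp (- \<mu> * s) \<le> exp (- \<theta> * s)" if "0 \<le> s" for s using assms that by (auto intro: mult_right_mono)
  have d: "green_kernel a \<theta> x - green_kernel a \<mu> x = (LINT s|lborel. indicator {0..} s * ((exp (- \<theta> * s) - exp (- \<mu> * s)) * heat (a * s) x))"
    unfolding green_kernel_def by (subst Bochner_Integration.integral_diff[symmetric, OF i]) (auto intro!: Bochner_Integration.integral_cong simp: algebra_simps)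
  have "0 \<le> green_kernel a \<theta> x - green_kernel a \<mu> x"
    unfolding d by (intro integral_nonneg_AE AE_I2) (use e in \<open>auto simp: indicator_def\<close>)
  moreover have "green_kernel a \<theta> x - green_kernel a \<mu> x \<le> (LINT s|lborel. indicator {0..} s * exp (- \<theta> * s) - indicator {0..} s * exp (- \<mu> * s))"
    unfolding d
  proof (rule integral_mono)
    show "integrable lborel (\<lambda>s. indicator {0..} s * ((exp (- \<theta> * s) - exp (- \<mu> * s)) * heat (a * s) x))"
      using Bochner_Integration.integrable_diff[OF i] by (simp add: algebra_simps)
    show "integrable lborel (\<lambda>s. indicator {0..} s * exp (- \<theta> * s) - indicator {0..} s * exp (- \<mu> * s))"
      by (intro Bochner_Integration.integrable_diff exp_Ici_integral assms \<mu>)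
    show "indicator {0..} s * ((exp (- \<theta> * s) - exp (- \<mu> * s)) * heat (a * s) x) \<le> indicator {0..} s * exp (- \<theta> * s) - indicator {0..} s * exp (- \<mu> * s)" for s
      using e[of s] heat_le_1[of "a * s" x] by (auto simp: indicator_def mult_left_le)
  qed
  moreover have "\<dots> = 1 / \<theta> - 1 / \<mu>"
    using exp_Ici_integral[OF assms(1)] exp_Ici_integral[OF \<mu>] by (subst Bochner_Integration.integral_diff) auto
  ultimately show ?thesis by simp
qed

text \<open>The difference integrates a function that is positive at every \<open>s > 0\<close>.
  Strictness separates the parameters on the two sides of the critical one.\<close>

lemma green_kernel_strict_decreasing:
  assumes a: "0 \<le> a" and "0 < \<theta>" "\<theta> < \<mu>"
  shows "green_kernel a \<mu> (0 :: int ^ 'd) < green_kernel a \<theta> (0 :: int ^ 'd)"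
proof -
  have \<mu>: "0 < \<mu>" using assms by simp
  let ?f = "\<lambda>s. indicator {0..} s * ((exp (- \<theta> * s) - exp (- \<mu> * s)) * heat (a * s) (0 :: int ^ 'd))"
  note i = green_kernel_integrable[OF assms(2), of a "0 :: int ^ 'd"] green_kernel_integrable[OF \<mu>, of a "0 :: int ^ 'd"]
  have d: "green_kernel a \<theta> (0 :: int ^ 'd) - green_kernel a \<mu> (0 :: int ^ 'd) = (LINT s|lborel. ?f s)"
    unfolding green_kernel_def by (subst Bochner_Integration.integral_diff[symmetric, OF i]) (auto intro!: Bochner_Integration.integral_cong simp: algebra_simps)
  have fi: "integrable lborel ?f"
    using Bochner_Integration.integrable_diff[OF i] by (simp add: algebra_simps)
  have pos: "0 < ?f s" if "0 < s" for s
  proof -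
    have "0 < heat (a * s) (0 :: int ^ 'd)"
      using heat_0_ge[of "a * s", where 'd='d] a that by (smt (verit) exp_gt_zero mult_nonneg_nonneg)
    moreover have "exp (- \<mu> * s) < exp (- \<theta> * s)" using assms that by simp
    ultimately show ?thesis using that by simp
  qed
  have nn: "0 \<le> ?f s" for s using pos[of s] by (cases "0 < s"; cases "s = 0") (auto simp: indicator_def)
  have "(LINT s|lborel. ?f s) \<noteq> 0"
  proof
    assume "(LINT s|lborel. ?f s) = 0"
    then have "AE s in lborel. ?f s = 0"
      using integral_nonneg_eq_0_iff_AE[OF fi] nn by auto
    then have "AE s in lborel. s \<notin> {0<..<1::real}"
      by eventually_elim (use pos in fastforce)
    moreover have "{x::real. 0 < x \<and> x < 1} = {0<..<1}" by auto
    ultimately have "emeasure lborel {0<..<1::real} = 0"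
      using AE_iff_measurable[of "{0<..<1::real}" lborel "\<lambda>s. s \<notin> {0<..<1}"] by auto
    then show False by simp
  qed
  moreover have "0 \<le> (LINT s|lborel. ?f s)" using nn by (intro integral_nonneg_AE AE_I2)
  ultimately show ?thesis using d by linarith
qed

text \<open>The crude bound \<open>1 / (\<theta> + 1)\<close> puts the value at
  \<open>\<theta> + 1\<close> below \<open>1\<close>, so the level \<open>1\<close> is met within
  \<open>{\<theta>..\<theta> + 1}\<close>.\<close>

lemma critical_green_kernel:
  assumes "0 < \<theta>" "1 \<le> green_kernel a \<theta> (x :: int ^ 'd)"
  obtains \<mu> where "\<theta> \<le> \<mu>" "green_kernel a \<mu> x = 1"
proof -
  have "green_kernel a (\<theta> + 1) x \<le> 1 / (\<theta> + 1)" using assms by (intro green_kernel_le) simp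
  also have "\<dots> \<le> 1" using assms by simp
  finally have le: "green_kernel a (\<theta> + 1) x \<le> 1" .
  have cont: "continuous_on {\<theta>..\<theta> + 1} (\<lambda>\<mu>. green_kernel a \<mu> x)"
  proof (rule continuous_on_eq_continuous_within[THEN iffD2], rule ballI)
    fix \<mu> assume \<mu>: "\<mu> \<in> {\<theta>..\<theta> + 1}"
    then have p: "0 < \<mu>" using assms by simp
    have "((\<lambda>\<nu>. 1 / \<nu> - 1 / \<mu>) \<longlongrightarrow> 1 / \<mu> - 1 / \<mu>) (at \<mu>)"
      using p by (intro tendsto_intros) auto
    then have lim: "((\<lambda>\<nu>. \<bar>1 / \<nu> - 1 / \<mu>\<bar>) \<longlongrightarrow> 0) (at \<mu>)" by (simp add: tendsto_rabs_zero)
    have "((\<lambda>\<nu>. green_kernel a \<nu> x - green_kernel a \<mu> x) \<longlongrightarrow> 0) (at \<mu>)"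
    proof (rule Lim_null_comparison[OF _ lim])
      have "\<forall>\<^sub>F \<nu> in at \<mu>. 0 < \<nu>" using order_tendstoD(1)[OF tendsto_ident_at p] by simp
      then show "\<forall>\<^sub>F \<nu> in at \<mu>. norm (green_kernel a \<nu> x - green_kernel a \<mu> x) \<le> \<bar>1 / \<nu> - 1 / \<mu>\<bar>"
      proof eventually_elim
        case (elim \<nu>)
        show ?case
          using green_kernel_diff_le[of \<nu> \<mu> a x] green_kernel_diff_le[of \<mu> \<nu> a x] elim p by (cases "\<nu> \<le> \<mu>") auto
      qed
    qed
    then have "isCont (\<lambda>\<nu>. green_kernel a \<nu> x) \<mu>" by (simp add: isCont_def LIM_zero_iff)
    then show "continuous (at \<mu> within {\<theta>..\<theta> + 1}) (\<lambda>\<mu>. green_kernel a \<mu> x)"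
      by (rule continuous_at_imp_continuous_at_within)
  qed
  from IVT2'[OF le assms(2) _ cont] that show ?thesis by auto
qed

section \<open>Growth rate from the renewal equation\<close>

text \<open>Let \<open>U\<close> be the moment tilted by \<open>exp (- \<theta> * s)\<close> and
  \<open>M\<close> its supremum on \<open>{0..t}\<close>. With \<open>g\<close> the kernel value,
  the renewal equation gives \<open>M \<le> 1 + g * M\<close>, and \<open>g < 1\<close> bounds
  \<open>M\<close> by \<open>1 / (1 - g)\<close>.\<close>

lemma return_moment_upper:
  assumes a: "0 \<le> a" and \<theta>: "0 < \<theta>" and g: "green_kernel a \<theta> (0 :: int ^ 'd) < 1" and t: "0 \<le> t"
  shows "return_moment TYPE('d) a 1 t \<le> ennreal (exp (\<theta> * t) / (1 - green_kernel a \<theta> (0 :: int ^ 'd)))"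
proof -
  let ?V = "return_moment TYPE('d) a 1" and ?g = "green_kernel a \<theta> (0 :: int ^ 'd)"
  define U where "U = (\<lambda>s. ennreal (exp (- \<theta> * s)) * ?V s)"
  define M where "M = (SUP s\<in>{0..t}. U s)"
  have V_U: "?V s = ennreal (exp (\<theta> * s)) * U s" for s
    by (simp add: U_def mult.assoc[symmetric] ennreal_mult[symmetric] exp_add[symmetric])
  \<comment> \<open>Finiteness of \<open>M\<close> comes from the trivial bound; the inequality
    below would also admit an infinite \<open>M\<close>.\<close>
  have "M \<le> ennreal (exp t)"
    unfolding M_def
  proof (rule SUP_least)
    fix s assume s: "s \<in> {0..t}"
    have "U s \<le> 1 * ennreal (exp (1 * s))"
      unfolding U_def using s \<theta> by (intro mult_mono return_moment_le_exp) auto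
    also have "\<dots> \<le> ennreal (exp t)" using s by (auto intro: ennreal_leI)
    finally show "U s \<le> ennreal (exp t)" .
  qed
  then have M_fin: "M < \<top>" using ennreal_less_top le_less_trans by blast
  have "M \<le> 1 + ennreal ?g * M"
    unfolding M_def
  proof (rule SUP_least, fold M_def)
    fix s assume s: "s \<in> {0..t}"
    have "(\<integral>\<^sup>+r. indicator {0..s} r * (ennreal (heat (a * r) (0 :: int ^ 'd)) * ?V (s - r)) \<partial>lborel) \<le>
      (\<integral>\<^sup>+r. ennreal (exp (\<theta> * s)) * (indicator {0..} r * ennreal (exp (- \<theta> * r) * heat (a * r) (0 :: int ^ 'd))) * M \<partial>lborel)"
    proof (rule nn_integral_mono)
      fix r
      show "indicator {0..s} r * (ennreal (heat (a * r) (0 :: int ^ 'd)) * ?V (s - r)) \<le>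
        ennreal (exp (\<theta> * s)) * (indicator {0..} r * ennreal (exp (- \<theta> * r) * heat (a * r) (0 :: int ^ 'd))) * M"
      proof (cases "r \<in> {0..s}")
        case True
        have "U (s - r) \<le> M" unfolding M_def using True s by (intro SUP_upper) auto
        then have "ennreal (heat (a * r) (0 :: int ^ 'd)) * ?V (s - r) \<le> ennreal (heat (a * r) (0 :: int ^ 'd)) * (ennreal (exp (\<theta> * (s - r))) * M)"
          unfolding V_U by (intro mult_left_mono) auto
        also have "\<dots> = ennreal (exp (\<theta> * s)) * ennreal (exp (- \<theta> * r) * heat (a * r) (0 :: int ^ 'd)) * M"
          by (simp add: mult.assoc[symmetric] ennreal_mult[symmetric]) (simp add: algebra_simps exp_diff exp_minus field_simps)
        finally show ?thesis using True by simp
      qed simp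
    qed
    also have "\<dots> = ennreal (exp (\<theta> * s)) * ennreal ?g * M"
      using nn_integral_green_kernel[OF \<theta>, of a "0 :: int ^ 'd"]
      by (simp add: nn_integral_multc nn_integral_cmult)
    finally have "?V s \<le> 1 + ennreal (exp (\<theta> * s)) * ennreal ?g * M"
      using s by (subst return_moment_renewal[OF a]) (auto intro: add_left_mono)
    then have "U s \<le> ennreal (exp (- \<theta> * s)) * (1 + ennreal (exp (\<theta> * s)) * ennreal ?g * M)"
      unfolding U_def by (rule mult_left_mono) simp
    also have "\<dots> = ennreal (exp (- \<theta> * s)) + ennreal ?g * M"
      by (simp add: distrib_left mult.assoc[symmetric] ennreal_mult[symmetric] exp_add[symmetric])
    also have "\<dots> \<le> 1 + ennreal ?g * M"
      using s \<theta> by (intro add_right_mono) (auto simp flip: ennreal_1 intro!: ennreal_leI)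
    finally show "U s \<le> 1 + ennreal ?g * M" .
  qed
  moreover obtain m where m: "M = ennreal m" "0 \<le> m" using M_fin by (cases M) auto
  ultimately have "m \<le> 1 + ?g * m"
    by (simp add: ennreal_mult[symmetric] ennreal_plus[symmetric] ennreal_1[symmetric] del: ennreal_plus ennreal_1)
  then have "m \<le> 1 / (1 - ?g)" using g by (simp add: field_simps)
  have "?V t = ennreal (exp (\<theta> * t)) * U t" by (rule V_U)
  also have "\<dots> \<le> ennreal (exp (\<theta> * t)) * M"
    unfolding M_def using t by (intro mult_left_mono SUP_upper) auto
  also have "\<dots> = ennreal (exp (\<theta> * t) * m)" using m by (simp add: ennreal_mult)
  also have "\<dots> \<le> ennreal (exp (\<theta> * t) * (1 / (1 - ?g)))"
    using \<open>m \<le> 1 / (1 - ?g)\<close> by (intro ennreal_leI mult_left_mono) auto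
  finally show ?thesis by simp
qed

text \<open>Counterpart of the upper bound with the infimum \<open>m\<close> of the tilted moment.
  Up to time \<open>T\<close> the moment is bounded below by \<open>1\<close>; beyond
  \<open>T\<close> the renewal equation cut off at \<open>r \<le> T\<close> refers only to arguments
  \<open>s - r\<close> in \<open>{0..t}\<close>, where the tilted moment is at least
  \<open>m\<close>.\<close>

lemma return_moment_lower:
  assumes a: "0 \<le> a" and \<theta>: "0 \<le> \<theta>" and T: "0 \<le> T" and t: "0 \<le> t"
    and g: "1 \<le> (\<integral>\<^sup>+s. indicator {0..T} s * ennreal (exp (- \<theta> * s) * heat (a * s) (0 :: int ^ 'd)) \<partial>lborel)"
  shows "ennreal (exp (- \<theta> * T)) * ennreal (exp (\<theta> * t)) \<le> return_moment TYPE('d) a 1 t"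
proof -
  let ?V = "return_moment TYPE('d) a 1"
  define U where "U = (\<lambda>s. ennreal (exp (- \<theta> * s)) * ?V s)"
  define m where "m = (INF s\<in>{0..t}. U s)"
  have V_U: "?V s = ennreal (exp (\<theta> * s)) * U s" for s
    by (simp add: U_def mult.assoc[symmetric] ennreal_mult[symmetric] exp_add[symmetric])
  have "ennreal (exp (- \<theta> * T)) \<le> m"
  proof (rule ccontr)
    assume "\<not> ennreal (exp (- \<theta> * T)) \<le> m"
    then have less: "m < ennreal (exp (- \<theta> * T))" by simp
    then have m_fin: "m < \<top>" using ennreal_less_top less_trans by blast
    \<comment> \<open>Each \<open>U s\<close> is at least one of two quantities. Both exceed
      \<open>m\<close>, the first by assumption and the second because \<open>m\<close> is finite,
      which contradicts the choice of \<open>m\<close> as infimum.\<close>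
    have "min (ennreal (exp (- \<theta> * T))) (ennreal (exp (- \<theta> * t)) + m) \<le> m"
      unfolding m_def
    proof (rule INF_greatest, fold m_def)
      fix s assume s: "s \<in> {0..t}"
      show "min (ennreal (exp (- \<theta> * T))) (ennreal (exp (- \<theta> * t)) + m) \<le> U s"
      proof (cases "s \<le> T")
        case True
        have "ennreal (exp (- \<theta> * T)) * 1 \<le> U s"
          unfolding U_def using True s \<theta> by (intro mult_mono return_moment_ge_1) (auto intro: mult_left_mono)
        then show ?thesis by (simp add: min.coboundedI1)
      next
        case False
        have "ennreal (exp (\<theta> * s)) * 1 * m \<le> ennreal (exp (\<theta> * s)) * (\<integral>\<^sup>+r. indicator {0..T} r * ennreal (exp (- \<theta> * r) * heat (a * r) (0 :: int ^ 'd)) \<partial>lborel) * m"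
          using g by (intro mult_right_mono mult_left_mono) auto
        also have "\<dots> = (\<integral>\<^sup>+r. ennreal (exp (\<theta> * s)) * (indicator {0..T} r * ennreal (exp (- \<theta> * r) * heat (a * r) (0 :: int ^ 'd))) * m \<partial>lborel)"
          by (simp add: nn_integral_multc nn_integral_cmult)
        also have "\<dots> \<le> (\<integral>\<^sup>+r. indicator {0..s} r * (ennreal (heat (a * r) (0 :: int ^ 'd)) * ?V (s - r)) \<partial>lborel)"
        proof (rule nn_integral_mono)
          fix r
          show "ennreal (exp (\<theta> * s)) * (indicator {0..T} r * ennreal (exp (- \<theta> * r) * heat (a * r) (0 :: int ^ 'd))) * m \<le>
            indicator {0..s} r * (ennreal (heat (a * r) (0 :: int ^ 'd)) * ?V (s - r))"
          proof (cases "r \<in> {0..T}")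
            case True
            have "m \<le> U (s - r)" unfolding m_def using True s False by (intro INF_lower) auto
            have "ennreal (exp (\<theta> * s)) * ennreal (exp (- \<theta> * r) * heat (a * r) (0 :: int ^ 'd)) * m =
              ennreal (heat (a * r) (0 :: int ^ 'd)) * (ennreal (exp (\<theta> * (s - r))) * m)"
              by (simp add: mult.assoc[symmetric] ennreal_mult[symmetric]) (simp add: algebra_simps exp_diff exp_minus field_simps)
            also have "\<dots> \<le> ennreal (heat (a * r) (0 :: int ^ 'd)) * ?V (s - r)"
              unfolding V_U using \<open>m \<le> U (s - r)\<close> by (intro mult_left_mono) auto
            finally show ?thesis using True False by simp
          qed simp
        qed
        finally have "1 + ennreal (exp (\<theta> * s)) * m \<le> ?V s"
          using s by (subst return_moment_renewal[OF a]) (auto intro: add_left_mono)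
        then have "ennreal (exp (- \<theta> * s)) * (1 + ennreal (exp (\<theta> * s)) * m) \<le> U s"
          unfolding U_def by (rule mult_left_mono) simp
        also have "ennreal (exp (- \<theta> * s)) * (1 + ennreal (exp (\<theta> * s)) * m) = ennreal (exp (- \<theta> * s)) + m"
          by (simp add: distrib_left mult.assoc[symmetric] ennreal_mult[symmetric] exp_add[symmetric])
        finally have "ennreal (exp (- \<theta> * s)) + m \<le> U s" .
        moreover have "ennreal (exp (- \<theta> * t)) \<le> ennreal (exp (- \<theta> * s))"
          using s \<theta> by (intro ennreal_leI) (auto intro: mult_left_mono)
        ultimately show ?thesis by (meson add_right_mono min.coboundedI2 order_trans)
      qed
    qed
    moreover have "m < ennreal (exp (- \<theta> * t)) + m"
      using m_fin by (cases m) (auto simp: ennreal_plus[symmetric] ennreal_less_iff simp del: ennreal_plus)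
    ultimately show False using less by (simp add: min_le_iff_disj not_le[symmetric])
  qed
  also have "m \<le> U t" unfolding m_def using t by (intro INF_lower) auto
  finally show ?thesis
    unfolding V_U by (subst mult.commute) (rule mult_left_mono, auto)
qed

lemma return_moment_real:
  assumes "0 \<le> t"
  shows "ennreal (enn2real (return_moment TYPE('d::finite) a 1 t)) = return_moment TYPE('d) a 1 t"
    and "1 \<le> enn2real (return_moment TYPE('d::finite) a 1 t)"
proof -
  have fin: "return_moment TYPE('d) a 1 t < \<top>"
    using return_moment_le_exp[OF assms, of 1 a, where 'd='d] ennreal_less_top le_less_trans by force
  then show e: "ennreal (enn2real (return_moment TYPE('d::finite) a 1 t)) = return_moment TYPE('d) a 1 t" by simp
  show "1 \<le> enn2real (return_moment TYPE('d::finite) a 1 t)"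
  proof -
    have "ennreal 1 \<le> ennreal (enn2real (return_moment TYPE('d::finite) a 1 t))"
      using return_moment_ge_1[OF assms, of 1 a, where 'd='d] by (simp add: e)
    then show ?thesis by simp
  qed
qed

text \<open>The truncated integrals increase to the kernel; the strict inequality leaves room to
  stop at a finite \<open>T\<close>.\<close>

lemma truncated_green_kernel:
  assumes \<theta>: "0 < \<theta>" and g: "1 < green_kernel a \<theta> (x :: int ^ 'd)"
  obtains T where "0 \<le> T" "1 \<le> (\<integral>\<^sup>+s. indicator {0..T} s * ennreal (exp (- \<theta> * s) * heat (a * s) x) \<partial>lborel)"
proof -
  have "(\<lambda>N. \<integral>\<^sup>+s. indicator {0..real N} s * ennreal (exp (- \<theta> * s) * heat (a * s) x) \<partial>lborel)
    \<longlonglongrightarrow> (\<integral>\<^sup>+s. indicator {0..} s * ennreal (exp (- \<theta> * s) * heat (a * s) x) \<partial>lborel)"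
  proof (rule nn_integral_LIMSEQ)
    show "incseq (\<lambda>N s. indicator {0..real N} s * ennreal (exp (- \<theta> * s) * heat (a * s) x))"
      by (auto simp: incseq_def le_fun_def indicator_def)
    show "(\<lambda>N. indicator {0..real N} s * ennreal (exp (- \<theta> * s) * heat (a * s) x)) \<longlonglongrightarrow>
      indicator {0..} s * ennreal (exp (- \<theta> * s) * heat (a * s) x)" for s
    proof (rule tendsto_eventually)
      obtain N :: nat where "s \<le> real N" using real_arch_simple by blast
      then show "\<forall>\<^sub>F N in sequentially. indicator {0..real N} s * ennreal (exp (- \<theta> * s) * heat (a * s) x) =
        indicator {0..} s * ennreal (exp (- \<theta> * s) * heat (a * s) x)"
        unfolding eventually_sequentially by (intro exI[of _ N]) (auto simp: indicator_def)
    qed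
  qed auto
  moreover have "1 < (\<integral>\<^sup>+s. indicator {0..} s * ennreal (exp (- \<theta> * s) * heat (a * s) x) \<partial>lborel)"
    unfolding nn_integral_green_kernel[OF \<theta>] using g by simp
  ultimately have "\<forall>\<^sub>F N in sequentially. 1 < (\<integral>\<^sup>+s. indicator {0..real N} s * ennreal (exp (- \<theta> * s) * heat (a * s) x) \<partial>lborel)"
    by (rule order_tendstoD)
  then obtain N where "1 < (\<integral>\<^sup>+s. indicator {0..real N} s * ennreal (exp (- \<theta> * s) * heat (a * s) x) \<partial>lborel)"
    by (auto simp: eventually_sequentially)
  then show thesis by (intro that[of "real N"]) auto
qed

lemma return_moment_growth_upper:
  assumes a: "0 \<le> a" and \<theta>: "0 < \<theta>" and g: "green_kernel a \<theta> (0 :: int ^ 'd) < 1" and u: "\<theta> < u"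
  shows "\<forall>\<^sub>F t in at_top. ln (enn2real (return_moment TYPE('d) a 1 t)) / t < u"
proof -
  define C where "C = - ln (1 - green_kernel a \<theta> (0 :: int ^ 'd))"
  have "((\<lambda>t. \<theta> + C / t) \<longlongrightarrow> \<theta> + 0) at_top"
    by (intro tendsto_add tendsto_diff tendsto_const real_tendsto_divide_at_top[OF tendsto_const] filterlim_ident)
  then have "\<forall>\<^sub>F t in at_top. \<theta> + C / t < u" using u by (intro order_tendstoD) auto
  then show ?thesis
    using eventually_gt_at_top[of 0]
  proof eventually_elim
    case (elim t)
    let ?v = "enn2real (return_moment TYPE('d) a 1 t)"
    have "?v \<le> exp (\<theta> * t) / (1 - green_kernel a \<theta> (0 :: int ^ 'd))"
      using return_moment_upper[OF a \<theta> g, of t] elim g return_moment_real(1)[of t a, where 'd='d]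
      by (intro enn2real_leI) auto
    then have "ln ?v \<le> ln (exp (\<theta> * t) / (1 - green_kernel a \<theta> (0 :: int ^ 'd)))"
      using return_moment_real(2)[of t a, where 'd='d] elim by (intro ln_mono) auto
    also have "\<dots> = \<theta> * t + C" using g by (simp add: ln_div C_def)
    finally have "ln ?v / t \<le> (\<theta> * t + C) / t" using elim by (intro divide_right_mono) auto
    also have "\<dots> = \<theta> + C / t" using elim by (simp add: field_simps)
    finally show ?case using elim by simp
  qed
qed

lemma return_moment_growth_lower:
  assumes a: "0 \<le> a" and \<theta>: "0 < \<theta>" and g: "1 < green_kernel a \<theta> (0 :: int ^ 'd)" and l: "l < \<theta>"
  shows "\<forall>\<^sub>F t in at_top. l < ln (enn2real (return_moment TYPE('d) a 1 t)) / t"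
proof -
  obtain T where T: "0 \<le> T" "1 \<le> (\<integral>\<^sup>+s. indicator {0..T} s * ennreal (exp (- \<theta> * s) * heat (a * s) (0 :: int ^ 'd)) \<partial>lborel)"
    using truncated_green_kernel[OF \<theta> g] .
  have "((\<lambda>t. \<theta> - \<theta> * T / t) \<longlongrightarrow> \<theta> - 0) at_top"
    by (intro tendsto_add tendsto_diff tendsto_const real_tendsto_divide_at_top[OF tendsto_const] filterlim_ident)
  then have "\<forall>\<^sub>F t in at_top. l < \<theta> - \<theta> * T / t" using l by (intro order_tendstoD) auto
  then show ?thesis
    using eventually_gt_at_top[of 0]
  proof eventually_elim
    case (elim t)
    let ?v = "enn2real (return_moment TYPE('d) a 1 t)"
    have "ennreal (exp (\<theta> * t - \<theta> * T)) \<le> ennreal ?v"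
      using return_moment_lower[OF a _ T(1) _ T(2), of t] \<theta> elim return_moment_real(1)[of t a, where 'd='d]
      by (simp add: ennreal_mult[symmetric] exp_add[symmetric])
    then have "exp (\<theta> * t - \<theta> * T) \<le> ?v" by simp
    then have "\<theta> * t - \<theta> * T \<le> ln ?v"
      using return_moment_real(2)[of t a, where 'd='d] elim by (subst ln_ge_iff) auto
    then have "(\<theta> * t - \<theta> * T) / t \<le> ln ?v / t" using elim by (intro divide_right_mono) auto
    then show ?case using elim by (simp add: diff_divide_distrib)
  qed
qed

text \<open>By strict monotonicity the kernel lies above \<open>1\<close> just below
  \<open>\<theta>\<close> and below \<open>1\<close> just above it, so the two renewal bounds
  enclose \<open>\<theta>\<close>.\<close>

theorem return_moment_growth_critical:
  assumes a: "0 \<le> a" and \<theta>: "0 < \<theta>" and g: "green_kernel a \<theta> (0 :: int ^ 'd) = 1"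
  shows "((\<lambda>t. ln (enn2real (return_moment TYPE('d) a 1 t)) / t) \<longlongrightarrow> \<theta>) at_top"
proof (rule order_tendstoI)
  fix l assume l: "l < \<theta>"
  \<comment> \<open>\<open>max l 0\<close> keeps \<open>\<theta>'\<close> positive when
    \<open>l\<close> is negative.\<close>
  define \<theta>' where "\<theta>' = (max l 0 + \<theta>) / 2"
  have "0 < \<theta>'" "l < \<theta>'" "\<theta>' < \<theta>" using l \<theta> by (auto simp: \<theta>'_def)
  then show "\<forall>\<^sub>F t in at_top. l < ln (enn2real (return_moment TYPE('d) a 1 t)) / t"
    using green_kernel_strict_decreasing[OF a, of \<theta>' \<theta>, where 'd='d] g by (intro return_moment_growth_lower[OF a, of \<theta>']) auto
next
  fix u assume u: "\<theta> < u"
  define \<theta>' where "\<theta>' = (\<theta> + u) / 2"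
  have "\<theta> < \<theta>'" "\<theta>' < u" using u by (auto simp: \<theta>'_def)
  then show "\<forall>\<^sub>F t in at_top. ln (enn2real (return_moment TYPE('d) a 1 t)) / t < u"
    using green_kernel_strict_decreasing[OF a \<theta>, of \<theta>', where 'd='d] g \<theta> by (intro return_moment_growth_upper[OF a, of \<theta>']) auto
qed

text \<open>Every positive \<open>\<theta>\<close> is an upper bound for the rate, and the moment is
  at least \<open>1\<close>.\<close>

theorem return_moment_growth_subcritical:
  assumes a: "0 \<le> a" and g: "\<And>\<theta>. 0 < \<theta> \<Longrightarrow> green_kernel a \<theta> (0 :: int ^ 'd) < 1"
  shows "((\<lambda>t. ln (enn2real (return_moment TYPE('d) a 1 t)) / t) \<longlongrightarrow> 0) at_top"
proof (rule order_tendstoI)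
  fix l :: real assume l: "l < 0"
  show "\<forall>\<^sub>F t in at_top. l < ln (enn2real (return_moment TYPE('d) a 1 t)) / t"
    using eventually_gt_at_top[of 0]
  proof eventually_elim
    case (elim t)
    have "0 \<le> ln (enn2real (return_moment TYPE('d) a 1 t)) / t"
      using return_moment_real(2)[of t a, where 'd='d] elim by simp
    with l show ?case by simp
  qed
next
  fix u :: real assume u: "0 < u"
  then show "\<forall>\<^sub>F t in at_top. ln (enn2real (return_moment TYPE('d) a 1 t)) / t < u"
    by (intro return_moment_growth_upper[OF a, of "u / 2"] g) auto
qed

section \<open>The spectrum of the Anderson operator\<close>

lemma L2_set_le_l2_norm:
  assumes "f \<in> l2" "finite F"
  shows "L2_set (\<lambda>x. cmod (f x)) F \<le> l2_norm f"
  unfolding L2_set_def l2_norm_def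
  by (rule real_sqrt_le_mono, rule finite_sum_le_infsum) (use assms in \<open>auto simp: l2_def\<close>)

text \<open>Finite sections determine both membership and norm; the \<open>l2\<close> inequalities
  below are proved for \<open>L2_set\<close> and passed on through this rule.\<close>

lemma l2I:
  assumes "\<And>F. finite F \<Longrightarrow> L2_set (\<lambda>x. cmod (f x)) F \<le> B"
  shows "f \<in> l2" "l2_norm f \<le> B"
proof -
  have B: "0 \<le> B" using assms[of "{}"] by simp
  have le: "(\<Sum>x\<in>F. (cmod (f x))\<^sup>2) \<le> B\<^sup>2" if "finite F" for F
    using assms[OF that] unfolding L2_set_def by (rule sqrt_le_D)
  have s: "(\<lambda>x. (cmod (f x))\<^sup>2) summable_on UNIV"
    by (rule nonneg_bdd_above_summable_on) (use le in \<open>auto simp: bdd_above_def\<close>)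
  then show "f \<in> l2" by (simp add: l2_def)
  have "(\<Sum>\<^sub>\<infinity>x. (cmod (f x))\<^sup>2) \<le> B\<^sup>2"
    by (rule infsum_le_finite_sums[OF s]) (use le in auto)
  then show "l2_norm f \<le> B" unfolding l2_norm_def using B by (intro real_le_lsqrt) (auto intro!: infsum_nonneg)
qed

lemma l2_norm_nonneg: "0 \<le> l2_norm f"
  unfolding l2_norm_def by (auto intro!: infsum_nonneg)

lemma cmod_le_l2_norm: "f \<in> l2 \<Longrightarrow> cmod (f x) \<le> l2_norm f"
  using L2_set_le_l2_norm[of f "{x}"] by simp

lemma zero_in_l2 [simp]: "(\<lambda>_. 0) \<in> l2" by (simp add: l2_def)

lemma l2_norm_zero [simp]: "l2_norm (\<lambda>_. 0) = 0" by (simp add: l2_norm_def)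

lemma l2_add:
  assumes "f \<in> l2" "g \<in> l2"
  shows "(\<lambda>x. f x + g x) \<in> l2" "l2_norm (\<lambda>x. f x + g x) \<le> l2_norm f + l2_norm g"
proof -
  have "L2_set (\<lambda>x. cmod (f x + g x)) F \<le> l2_norm f + l2_norm g" if F: "finite F" for F
  proof -
    have "L2_set (\<lambda>x. cmod (f x + g x)) F \<le> L2_set (\<lambda>x. cmod (f x) + cmod (g x)) F"
      by (rule L2_set_mono) (auto intro: norm_triangle_ineq)
    also have "\<dots> \<le> L2_set (\<lambda>x. cmod (f x)) F + L2_set (\<lambda>x. cmod (g x)) F" by (rule L2_set_triangle_ineq)
    also have "\<dots> \<le> l2_norm f + l2_norm g" by (intro add_mono L2_set_le_l2_norm assms F)
    finally show ?thesis .
  qed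
  from l2I[OF this] show "(\<lambda>x. f x + g x) \<in> l2" "l2_norm (\<lambda>x. f x + g x) \<le> l2_norm f + l2_norm g" by auto
qed

lemma l2_dominated:
  assumes "f \<in> l2" "\<And>x. cmod (g x) \<le> C * cmod (f x)" "0 \<le> C"
  shows "g \<in> l2" "l2_norm g \<le> C * l2_norm f"
proof -
  have "L2_set (\<lambda>x. cmod (g x)) F \<le> C * l2_norm f" if F: "finite F" for F
  proof -
    have "L2_set (\<lambda>x. cmod (g x)) F \<le> L2_set (\<lambda>x. C * cmod (f x)) F"
      by (rule L2_set_mono) (use assms in auto)
    also have "\<dots> = C * L2_set (\<lambda>x. cmod (f x)) F" using assms by (intro L2_set_right_distrib[symmetric])
    also have "\<dots> \<le> C * l2_norm f" by (intro mult_left_mono L2_set_le_l2_norm assms F)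
    finally show ?thesis .
  qed
  from l2I[OF this] show "g \<in> l2" "l2_norm g \<le> C * l2_norm f" by auto
qed

lemma l2_scale: "f \<in> l2 \<Longrightarrow> (\<lambda>x. c * f x) \<in> l2" "f \<in> l2 \<Longrightarrow> l2_norm (\<lambda>x. c * f x) \<le> cmod c * l2_norm f"
  using l2_dominated[of f "\<lambda>x. c * f x" "cmod c"] by (auto simp: norm_mult)

lemma l2_diff:
  assumes "f \<in> l2" "g \<in> l2"
  shows "(\<lambda>x. f x - g x) \<in> l2" "l2_norm (\<lambda>x. f x - g x) \<le> l2_norm f + l2_norm g"
  using l2_add[OF assms(1) l2_scale(1)[OF assms(2), of "-1"]] l2_scale(2)[OF assms(2), of "-1"] by auto

lemma l2_norm_le_0: "f \<in> l2 \<Longrightarrow> l2_norm f \<le> 0 \<Longrightarrow> f x = 0"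
  using cmod_le_l2_norm[of f x] by (metis norm_le_zero_iff order_trans)

section \<open>The shifted operator and its resolvent set\<close>

text \<open>The Anderson operator plus the constant \<open>2 d \<kappa>\<close>: for
  \<open>\<kappa> \<ge> 0\<close> its matrix entries are nonnegative, as the Schur test demands. The
  codomain is generic because it acts on real weights as well as on complex vectors.\<close>

definition hop :: "real \<Rightarrow> (int ^ 'd \<Rightarrow> 'b::real_normed_algebra_1) \<Rightarrow> int ^ 'd \<Rightarrow> 'b" where
  "hop \<kappa> f x = of_real \<kappa> * (\<Sum>e\<in>unit_steps. f (x + e)) + (if x = 0 then 1 else 0) * f x"

lemma laplacian_eq:
  "laplacian f x = (\<Sum>e\<in>unit_steps. f (x + e)) - of_nat (2 * CARD('d)) * (f (x :: int ^ 'd) :: 'b::ring_1)"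
proof -
  have "{y. y - x \<in> unit_steps} = (+) x ` unit_steps" by (force simp: image_iff)
  then have "laplacian f x = (\<Sum>e\<in>unit_steps. f (x + e) - f x)"
    unfolding laplacian_def by (simp add: sum.reindex)
  then show ?thesis by (simp add: sum_subtractf card_unit_steps)
qed

lemma anderson_operator_eq:
  "anderson_operator \<kappa> f x = hop \<kappa> f x - of_real (2 * real CARD('d) * \<kappa>) * f (x :: int ^ 'd)"
  by (simp add: anderson_operator_def hop_def laplacian_eq algebra_simps)

lemma hop_linear:
  fixes f g :: "int ^ 'd \<Rightarrow> 'b::real_normed_field"
  shows "hop \<kappa> (\<lambda>x. c * f x) x = c * hop \<kappa> f x"
  "hop \<kappa> (\<lambda>x. f x + g x) x = hop \<kappa> f x + hop \<kappa> g x"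
  "hop \<kappa> (\<lambda>x. f x - g x) x = hop \<kappa> f x - hop \<kappa> g x"
  by (simp_all add: hop_def sum.distrib sum_subtractf sum_distrib_left algebra_simps)

text \<open>The Schur test for the symmetric kernel of \<open>hop \<kappa>\<close> with weight \<open>h\<close>.\<close>

lemma hop_bound:
  fixes h :: "int ^ 'd \<Rightarrow> real" and f :: "int ^ 'd \<Rightarrow> complex"
  assumes \<kappa>: "0 \<le> \<kappa>" and h: "\<And>x. 0 < h x" "\<And>x. hop \<kappa> h x \<le> M * h x" and f: "f \<in> l2"
  shows "hop \<kappa> f \<in> l2" "l2_norm (hop \<kappa> f) \<le> M * l2_norm f"
proof -
  define s where "s = (\<lambda>x y :: int ^ 'd. \<kappa> * indicator unit_steps (y - x) + (if x = 0 \<and> y = 0 then 1 else 0))"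
  define N where "N = (\<lambda>x :: int ^ 'd. insert x ((+) x ` unit_steps))"
  have finN: "finite (N x)" for x by (simp add: N_def)
  have s_nonneg: "0 \<le> s x y" for x y using \<kappa> by (simp add: s_def)
  have s_sym: "s x y = s y x" for x y
    using uminus_unit_steps[of "y - x"] by (auto simp: s_def indicator_def)
  have s_out: "s x y = 0" if "y \<notin> N x" for x y
  proof -
    have "y - x \<notin> unit_steps" using that by (auto simp: N_def image_iff algebra_simps)
    then show ?thesis using that by (auto simp: s_def N_def)
  qed
  have hop_s: "hop \<kappa> g x = (\<Sum>y\<in>N x. of_real (s x y) * g y)" for g :: "int ^ 'd \<Rightarrow> 'b::{real_normed_field}" and x
  proof -
    have 0: "x \<notin> (+) x ` unit_steps" by (auto simp: unit_steps_def)
    have sx: "s x x = (if x = 0 then 1 else 0)" by (simp add: s_def unit_steps_def)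
    have "(\<Sum>y\<in>(+) x ` unit_steps. of_real (s x y) * g y) = (\<Sum>e\<in>unit_steps. of_real (s x (x + e)) * g (x + e))"
      by (subst sum.reindex) auto
    also have "\<dots> = (\<Sum>e\<in>unit_steps. of_real \<kappa> * g (x + e))"
      by (intro sum.cong) (auto simp: s_def unit_steps_def)
    finally show ?thesis
      unfolding N_def using 0 by (simp add: sx hop_def sum_distrib_left)
  qed
  have M: "0 \<le> M"
  proof -
    have "0 \<le> hop \<kappa> h 0" using h(1) by (simp add: hop_s sum_nonneg s_nonneg less_imp_le)
    also have "\<dots> \<le> M * h 0" by (rule h)
    finally show ?thesis using h(1)[of 0] by (simp add: zero_le_mult_iff)
  qed
  have sq: "(cmod (hop \<kappa> f x))\<^sup>2 \<le> M * h x * (\<Sum>y\<in>N x. s x y * ((cmod (f y))\<^sup>2 / h y))" for x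
  proof -
    have "cmod (hop \<kappa> f x) \<le> (\<Sum>y\<in>N x. s x y * cmod (f y))"
      unfolding hop_s by (rule order_trans[OF norm_sum]) (auto simp: norm_mult s_nonneg)
    \<comment> \<open>Cauchy--Schwarz with the weight inserted: the squares of the first factors sum
      to \<open>hop \<kappa> h x\<close>, which the hypothesis bounds by
      \<open>M * h x\<close>.\<close>
    also have "\<dots> = (\<Sum>y\<in>N x. sqrt (s x y * h y) * sqrt (s x y * ((cmod (f y))\<^sup>2 / h y)))"
    proof (intro sum.cong refl)
      fix y
      have "sqrt (s x y * h y) * sqrt (s x y * ((cmod (f y))\<^sup>2 / h y)) = sqrt ((s x y * cmod (f y))\<^sup>2)"
        using h(1)[of y] by (simp add: real_sqrt_mult[symmetric] power2_eq_square field_simps)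
      then show "s x y * cmod (f y) = sqrt (s x y * h y) * sqrt (s x y * ((cmod (f y))\<^sup>2 / h y))"
        using s_nonneg[of x y] by simp
    qed
    finally have "(cmod (hop \<kappa> f x))\<^sup>2 \<le> (\<Sum>y\<in>N x. sqrt (s x y * h y) * sqrt (s x y * ((cmod (f y))\<^sup>2 / h y)))\<^sup>2"
      by (intro power_mono) auto
    also have "\<dots> \<le> (\<Sum>y\<in>N x. (sqrt (s x y * h y))\<^sup>2) * (\<Sum>y\<in>N x. (sqrt (s x y * ((cmod (f y))\<^sup>2 / h y)))\<^sup>2)"
      by (rule Cauchy_Schwarz_ineq_sum)
    also have "\<dots> = hop \<kappa> h x * (\<Sum>y\<in>N x. s x y * ((cmod (f y))\<^sup>2 / h y))"
      using s_nonneg h(1) by (auto simp: hop_s less_imp_le intro!: arg_cong2[where f="(*)"] sum.cong)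
    also have "\<dots> \<le> M * h x * (\<Sum>y\<in>N x. s x y * ((cmod (f y))\<^sup>2 / h y))"
      using s_nonneg h by (intro mult_right_mono sum_nonneg mult_nonneg_nonneg divide_nonneg_pos) auto
    finally show ?thesis .
  qed
  have "L2_set (\<lambda>x. cmod (hop \<kappa> f x)) F \<le> M * l2_norm f" if F: "finite F" for F
  proof -
    define F' where "F' = (\<Union>x\<in>F. N x)"
    have F': "finite F'" using F finN by (simp add: F'_def)
    \<comment> \<open>Column sums are row sums by symmetry of the kernel, so the hypothesis on
      \<open>h\<close> enters a second time.\<close>
    have row: "(\<Sum>x\<in>F. s x y * h x) \<le> M * h y" for y
    proof -
      have "(\<Sum>x\<in>F. s x y * h x) = (\<Sum>x\<in>F \<inter> N y. s y x * h x)"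
        by (rule sum.mono_neutral_cong_right) (use F s_out s_sym in auto)
      also have "\<dots> \<le> (\<Sum>x\<in>N y. s y x * h x)"
        by (rule sum_mono2[OF finN]) (auto intro: mult_nonneg_nonneg[OF s_nonneg less_imp_le[OF h(1)]])
      also have "\<dots> = hop \<kappa> h y" by (simp add: hop_s)
      finally show ?thesis using h(2) order_trans by blast
    qed
    have "(\<Sum>x\<in>F. (cmod (hop \<kappa> f x))\<^sup>2) \<le> (\<Sum>x\<in>F. M * h x * (\<Sum>y\<in>N x. s x y * ((cmod (f y))\<^sup>2 / h y)))"
      by (intro sum_mono sq)
    also have "\<dots> = (\<Sum>x\<in>F. M * h x * (\<Sum>y\<in>F'. s x y * ((cmod (f y))\<^sup>2 / h y)))"
      by (intro sum.cong refl arg_cong2[where f="(*)"] sum.mono_neutral_left) (use F' s_out in \<open>auto simp: F'_def\<close>)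
    also have "\<dots> = M * (\<Sum>y\<in>F'. (cmod (f y))\<^sup>2 / h y * (\<Sum>x\<in>F. s x y * h x))"
      unfolding sum_distrib_left by (subst sum.swap) (auto intro!: sum.cong simp: algebra_simps)
    also have "\<dots> \<le> M * (\<Sum>y\<in>F'. (cmod (f y))\<^sup>2 / h y * (M * h y))"
      using M h(1) by (intro mult_left_mono sum_mono row) (auto intro!: divide_nonneg_pos)
    also have "\<dots> = M * (\<Sum>y\<in>F'. M * (cmod (f y))\<^sup>2)"
      using h(1) by (auto intro!: sum.cong arg_cong2[where f="(*)"] simp: less_imp_neq[symmetric] field_simps)
    also have "\<dots> = M\<^sup>2 * (\<Sum>y\<in>F'. (cmod (f y))\<^sup>2)"
      by (simp add: sum_distrib_left[symmetric] power2_eq_square)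
    also have "\<dots> = (M * L2_set (\<lambda>x. cmod (f x)) F')\<^sup>2"
      by (simp add: L2_set_def power_mult_distrib sum_nonneg)
    finally have "L2_set (\<lambda>x. cmod (hop \<kappa> f x)) F \<le> M * L2_set (\<lambda>x. cmod (f x)) F'"
      unfolding L2_set_def using M by (intro real_le_lsqrt) (auto intro!: mult_nonneg_nonneg sum_nonneg)
    also have "\<dots> \<le> M * l2_norm f" by (intro mult_left_mono L2_set_le_l2_norm f F' M)
    finally show ?thesis .
  qed
  from l2I[OF this] show "hop \<kappa> f \<in> l2" "l2_norm (hop \<kappa> f) \<le> M * l2_norm f" by auto
qed

text \<open>The Schur test with weight \<open>h\<close> bounds the norm of
  \<open>hop \<kappa>\<close> by \<open>M = \<theta> + c\<close>. For \<open>r > \<theta>\<close>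
  the operator minus \<open>r\<close> is \<open>hop \<kappa> - R\<close> with
  \<open>R = r + c > M\<close>: it is bounded below by \<open>R - M\<close>, and a Neumann series
  inverts it.\<close>

theorem resolvent_if_supersolution:
  fixes h :: "int ^ 'd \<Rightarrow> real"
  assumes \<kappa>: "0 \<le> \<kappa>" and h: "\<And>x. 0 < h x" "\<And>x. hop \<kappa> h x \<le> (\<theta> + 2 * real CARD('d) * \<kappa>) * h x"
    and r: "\<theta> < r"
  shows "complex_of_real r \<notin> l2_spectrum (anderson_operator \<kappa> :: (int ^ 'd \<Rightarrow> complex) \<Rightarrow> _)"
proof -
  define c where "c = 2 * real CARD('d) * \<kappa>"
  define M where "M = \<theta> + c"
  define R where "R = r + c"
  note hb = hop_bound[OF \<kappa> h, folded c_def, folded M_def]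
  have MR: "M < R" using r by (simp add: M_def R_def)
  have M: "0 \<le> M"
  proof -
    have "0 \<le> hop \<kappa> h 0" using \<kappa> h(1) by (simp add: hop_def sum_nonneg less_imp_le)
    also have "\<dots> \<le> M * h 0" using h(2)[of 0] by (simp add: M_def c_def)
    finally show ?thesis using h(1)[of 0] by (simp add: zero_le_mult_iff)
  qed
  have R: "0 < R" using M MR by simp
  define T where "T = (\<lambda>f :: int ^ 'd \<Rightarrow> complex. \<lambda>x. hop \<kappa> f x - of_real R * f x)"
  have op: "anderson_operator \<kappa> f x - complex_of_real r * f x = T f x" for f and x :: "int ^ 'd"
    by (simp add: anderson_operator_eq T_def R_def c_def algebra_simps)
  have T_l2: "T f \<in> l2" if "f \<in> l2" for f
    unfolding T_def using that by (intro l2_diff l2_scale hb)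
  have lower: "(R - M) * l2_norm f \<le> l2_norm (T f)" if f: "f \<in> l2" for f
  proof -
    have "(\<lambda>x. of_real R * f x) = (\<lambda>x. hop \<kappa> f x - T f x)" by (simp add: T_def)
    then have "l2_norm (\<lambda>x. of_real R * f x) \<le> M * l2_norm f + l2_norm (T f)"
      using l2_diff(2)[OF hb(1)[OF f] T_l2[OF f]] hb(2)[OF f] by simp
    moreover have "R * l2_norm f \<le> l2_norm (\<lambda>x. of_real R * f x)"
      using l2_scale(2)[OF l2_scale(1)[OF f, of "of_real R"], of "of_real (1 / R)"] R by (simp add: norm_divide field_simps)
    ultimately show ?thesis by (simp add: algebra_simps)
  qed
  have inj: "inj_on T l2"
  proof (rule inj_onI)
    fix f g assume f: "f \<in> l2" and g: "g \<in> l2" and eq: "T f = T g"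
    have "T (\<lambda>x. f x - g x) x = T f x - T g x" for x by (simp add: T_def hop_linear algebra_simps)
    then have "T (\<lambda>x. f x - g x) = (\<lambda>_. 0)" using eq by auto
    then have "(R - M) * l2_norm (\<lambda>x. f x - g x) \<le> 0" using lower[OF l2_diff(1)[OF f g]] by simp
    then have "l2_norm (\<lambda>x. f x - g x) \<le> 0" using MR by (simp add: mult_le_0_iff)
    from l2_norm_le_0[OF l2_diff(1)[OF f g] this] show "f = g" by (auto simp: fun_eq_iff)
  qed
  have surj: "\<exists>f\<in>l2. T f = g" if g: "g \<in> l2" for g
  proof -
    \<comment> \<open>Iterates for the Neumann series with terms
      \<open>u k = S k / R ^ Suc k\<close>. It converges pointwise, and the uniform norm bound on
      its partial sums puts the limit into \<open>l2\<close>.\<close>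
    define S where "S = (\<lambda>k. (hop \<kappa> ^^ k) g)"
    have S: "S k \<in> l2 \<and> l2_norm (S k) \<le> M ^ k * l2_norm g" for k
    proof (induction k)
      case (Suc k)
      have "l2_norm (hop \<kappa> (S k)) \<le> M * l2_norm (S k)" using hb(2) Suc by blast
      also have "\<dots> \<le> M * (M ^ k * l2_norm g)" using Suc M by (intro mult_left_mono) auto
      finally show ?case using hb(1) Suc by (simp add: S_def)
    qed (simp add: S_def g)
    define u where "u = (\<lambda>k x. of_real (1 / R ^ Suc k) * S k x)"
    have u_l2: "u k \<in> l2" "l2_norm (u k) \<le> (M / R) ^ k * (l2_norm g / R)" for k
    proof -
      show "u k \<in> l2" unfolding u_def using S by (intro l2_scale) auto
      have "l2_norm (u k) \<le> 1 / R ^ Suc k * l2_norm (S k)"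
        unfolding u_def using l2_scale(2)[of "S k" "of_real (1 / R ^ Suc k)"] S R by (simp add: norm_divide norm_mult norm_power)
      also have "\<dots> \<le> 1 / R ^ Suc k * (M ^ k * l2_norm g)" using S R by (intro mult_left_mono) auto
      finally show "l2_norm (u k) \<le> (M / R) ^ k * (l2_norm g / R)" by (simp add: power_divide field_simps)
    qed
    have MR1: "\<bar>M / R\<bar> < 1" using M MR R by simp
    have geo: "summable (\<lambda>k. (M / R) ^ k * (l2_norm g / R))"
      using MR1 by (intro summable_mult2 summable_geometric) auto
    define B where "B = (\<Sum>k. (M / R) ^ k * (l2_norm g / R))"
    have u_sum: "summable (\<lambda>k. u k x)" for x
      by (rule summable_comparison_test'[OF geo, of 0]) (meson cmod_le_l2_norm u_l2 order_trans)
    define f where "f = (\<lambda>x. - (\<Sum>k. u k x))"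
    have part: "(\<lambda>x. \<Sum>k<n. u k x) \<in> l2 \<and> l2_norm (\<lambda>x. \<Sum>k<n. u k x) \<le> (\<Sum>k<n. (M / R) ^ k * (l2_norm g / R))" for n
    proof (induction n)
      case (Suc n)
      then show ?case using l2_add[of "\<lambda>x. \<Sum>k<n. u k x" "u n"] u_l2[of n] by auto
    qed auto
    have "L2_set (\<lambda>x. cmod (f x)) F \<le> B" if F: "finite F" for F
    proof (rule LIMSEQ_le_const2)
      show "(\<lambda>n. L2_set (\<lambda>x. cmod (\<Sum>k<n. u k x)) F) \<longlonglongrightarrow> L2_set (\<lambda>x. cmod (f x)) F"
        unfolding L2_set_def f_def norm_minus_cancel
        by (intro tendsto_real_sqrt tendsto_sum tendsto_power tendsto_norm summable_LIMSEQ u_sum)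
      have "L2_set (\<lambda>x. cmod (\<Sum>k<n. u k x)) F \<le> B" for n
      proof -
        have "L2_set (\<lambda>x. cmod (\<Sum>k<n. u k x)) F \<le> l2_norm (\<lambda>x. \<Sum>k<n. u k x)"
          using part F by (intro L2_set_le_l2_norm) auto
        also have "\<dots> \<le> (\<Sum>k<n. (M / R) ^ k * (l2_norm g / R))" using part by auto
        also have "\<dots> \<le> B" unfolding B_def using M R l2_norm_nonneg[of g] by (intro sum_le_suminf geo) auto
        finally show ?thesis .
      qed
      then show "\<exists>N. \<forall>n\<ge>N. L2_set (\<lambda>x. cmod (\<Sum>k<n. u k x)) F \<le> B" by auto
    qed
    then have f: "f \<in> l2" by (rule l2I)
    have "T f x = g x" for x
    proof -
      have hop_f: "hop \<kappa> f x = - (\<Sum>k. hop \<kappa> (u k) x)"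
      proof -
        have "(\<lambda>k. hop \<kappa> (u k) x) sums hop \<kappa> (\<lambda>y. \<Sum>k. u k y) x"
          unfolding hop_def by (intro sums_add sums_mult sums_sum summable_sums u_sum)
        moreover have "hop \<kappa> f x = - hop \<kappa> (\<lambda>y. \<Sum>k. u k y) x"
          using hop_linear(1)[of \<kappa> "-1" "\<lambda>y. \<Sum>k. u k y" x] by (simp add: f_def)
        ultimately show ?thesis by (simp add: sums_unique[symmetric])
      qed
      have hop_u: "hop \<kappa> (u k) x = of_real R * u (Suc k) x" for k
      proof -
        have "hop \<kappa> (u k) x = of_real (1 / R ^ Suc k) * S (Suc k) x"
          unfolding u_def by (subst hop_linear(1)) (simp add: S_def)
        then show ?thesis using R by (simp add: u_def)
      qed
      have "hop \<kappa> f x = - (\<Sum>k. of_real R * u (Suc k) x)"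
        unfolding hop_f hop_u ..
      also have "\<dots> = - of_real R * (\<Sum>k. u (Suc k) x)"
        using u_sum[of x] by (subst suminf_mult) (simp_all add: summable_Suc_iff[of "\<lambda>k. u k x"])
      also have "(\<Sum>k. u (Suc k) x) = (\<Sum>k. u k x) - u 0 x" by (rule suminf_split_head[OF u_sum])
      finally show ?thesis using R by (simp add: T_def f_def u_def S_def algebra_simps)
    qed
    then show ?thesis using f by (intro bexI[of _ f]) auto
  qed
  have "bij_betw T l2 l2"
    unfolding bij_betw_def using inj T_l2 surj by (auto simp: image_iff)
  moreover have "\<forall>f\<in>l2. l2_norm f \<le> 1 / (R - M) * l2_norm (T f)"
    using lower MR by (auto simp: field_simps)
  ultimately have "bij_betw (\<lambda>f (x :: int ^ 'd). anderson_operator \<kappa> f x - complex_of_real r * f x) l2 l2 \<and>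
    (\<exists>C. \<forall>f\<in>l2. l2_norm f \<le> C * l2_norm (\<lambda>x :: int ^ 'd. anderson_operator \<kappa> f x - complex_of_real r * f x))"
    unfolding op by blast
  then show ?thesis by (simp add: l2_spectrum_def)
qed

section \<open>Approximate eigenfunctions for the value zero\<close>

text \<open>The set lies in a box with side \<open>S\<close>, over which a sum of product weights
  factorises. Two weights occur below: a geometric one for an \<open>l2\<close> norm, and
  \<open>1\<close> for counting lattice points.\<close>

lemma sum_prod_vec_le:
  fixes w :: "int \<Rightarrow> real" and F :: "(int ^ 'd) set"
  assumes S: "finite S" and F: "\<And>x i. x \<in> F \<Longrightarrow> x $ i \<in> S" and w: "\<And>k. 0 \<le> w k"
  shows "finite F" "(\<Sum>x\<in>F. \<Prod>i\<in>UNIV. w (x $ i)) \<le> (\<Sum>k\<in>S. w k) ^ CARD('d)"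
proof -
  have inj: "inj_on vec_nth F" by (auto simp: inj_on_def vec_nth_inject)
  have sub: "vec_nth ` F \<subseteq> (UNIV :: 'd set) \<rightarrow>\<^sub>E S" using F by (auto simp: PiE_UNIV_domain)
  have fin: "finite ((UNIV :: 'd set) \<rightarrow>\<^sub>E S)" using S by (intro finite_PiE) auto
  show "finite F" using finite_subset[OF sub fin] inj finite_imageD by blast
  have "(\<Sum>x\<in>F. \<Prod>i\<in>UNIV. w (x $ i)) = (\<Sum>g\<in>vec_nth ` F. \<Prod>i\<in>UNIV. w (g i))"
    by (subst sum.reindex[OF inj]) simp
  also have "\<dots> \<le> (\<Sum>g\<in>(UNIV :: 'd set) \<rightarrow>\<^sub>E S. \<Prod>i\<in>UNIV. w (g i))"
    by (rule sum_mono2[OF fin sub]) (auto intro!: prod_nonneg w)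
  also have "\<dots> = (\<Prod>i\<in>(UNIV :: 'd set). \<Sum>k\<in>S. w k)"
    by (rule prod_sum_PiE[symmetric]) (use S in auto)
  finally show "(\<Sum>x\<in>F. \<Prod>i\<in>UNIV. w (x $ i)) \<le> (\<Sum>k\<in>S. w k) ^ CARD('d)" by simp
qed

lemma sum_power_abs_le:
  fixes q :: real
  assumes q: "0 < q" "q < 1" and S: "finite (S :: int set)"
  shows "(\<Sum>k\<in>S. q ^ nat \<bar>k\<bar>) \<le> 2 / (1 - q)"
proof -
  have geo: "(\<Sum>n\<in>A. q ^ n) \<le> 1 / (1 - q)" if "finite A" for A :: "nat set"
    using sum_le_suminf[OF summable_geometric that, of q] q suminf_geometric[of q] by (simp add: that)
  have part: "(\<Sum>k\<in>T. q ^ nat \<bar>k\<bar>) \<le> 1 / (1 - q)" if "finite T" "inj_on (\<lambda>k. nat \<bar>k\<bar>) T" for T :: "int set"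
    using geo[of "(\<lambda>k. nat \<bar>k\<bar>) ` T"] that by (simp add: sum.reindex)
  have "(\<Sum>k\<in>S. q ^ nat \<bar>k\<bar>) = (\<Sum>k\<in>S \<inter> {0..}. q ^ nat \<bar>k\<bar>) + (\<Sum>k\<in>S - {0..}. q ^ nat \<bar>k\<bar>)"
    using S by (subst sum.Int_Diff[of _ _ "{0..}"]) auto
  also have "\<dots> \<le> 1 / (1 - q) + 1 / (1 - q)"
    by (intro add_mono part) (use S in \<open>auto simp: inj_on_def\<close>)
  finally show ?thesis by simp
qed

text \<open>After translation by \<open>z\<close> the squared function is a product over coordinates
  of powers of \<open>q = exp (- 2 * \<epsilon>)\<close>, so its sum is bounded by a power of a
  two-sided geometric series.\<close>

lemma exp_neg_l1_in_l2:
  fixes \<epsilon> :: real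
  assumes \<epsilon>: "0 < \<epsilon>"
  shows "(\<lambda>x :: int ^ 'd. complex_of_real (exp (- \<epsilon> * l1 (x - z)))) \<in> l2"
proof -
  define q where "q = exp (- 2 * \<epsilon>)"
  have q: "0 < q" "q < 1" using \<epsilon> by (auto simp: q_def)
  have le: "(\<Sum>x\<in>F. (cmod (complex_of_real (exp (- \<epsilon> * l1 (x - z)))))\<^sup>2) \<le> (2 / (1 - q)) ^ CARD('d)" if F: "finite F" for F :: "(int ^ 'd) set"
  proof -
    have "(cmod (complex_of_real (exp (- \<epsilon> * l1 y))))\<^sup>2 = (\<Prod>i\<in>UNIV. q ^ nat \<bar>y $ i\<bar>)" for y :: "int ^ 'd"
    proof -
      have "(cmod (complex_of_real (exp (- \<epsilon> * l1 y))))\<^sup>2 = exp (\<Sum>i\<in>UNIV. real (nat \<bar>y $ i\<bar>) * (- 2 * \<epsilon>))"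
        by (simp add: exp_of_nat_mult[symmetric] power2_eq_square exp_add[symmetric] l1_def sum_distrib_right[symmetric] sum_negf)
      moreover have "q ^ n = exp (real n * (- 2 * \<epsilon>))" for n
        unfolding q_def by (rule exp_of_nat_mult[symmetric])
      ultimately show ?thesis by (simp only: exp_sum[OF finite])
    qed
    then have "(\<Sum>x\<in>F. (cmod (complex_of_real (exp (- \<epsilon> * l1 (x - z)))))\<^sup>2) = (\<Sum>y\<in>(\<lambda>x. x - z) ` F. \<Prod>i\<in>UNIV. q ^ nat \<bar>y $ i\<bar>)"
      by (subst sum.reindex) (auto simp: inj_on_def)
    also have "\<dots> \<le> (\<Sum>k\<in>(\<Union>i. (\<lambda>x. (x - z) $ i) ` F). q ^ nat \<bar>k\<bar>) ^ CARD('d)"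
    proof (rule sum_prod_vec_le)
      show "finite (\<Union>i. (\<lambda>x. (x - z) $ i) ` F)" using F by simp
      show "y $ i \<in> (\<Union>i. (\<lambda>x. (x - z) $ i) ` F)" if "y \<in> (\<lambda>x. x - z) ` F" for y i
        using that by blast
      show "0 \<le> q ^ nat \<bar>k\<bar>" for k using q by simp
    qed
    also have "\<dots> \<le> (2 / (1 - q)) ^ CARD('d)"
      using F q by (intro power_mono sum_power_abs_le sum_nonneg) auto
    finally show ?thesis .
  qed
  show ?thesis
    unfolding l2_def mem_Collect_eq by (rule nonneg_bdd_above_summable_on) (use le in \<open>auto simp: bdd_above_def\<close>)
qed

text \<open>The function \<open>exp (- \<epsilon> * l1 (x - z))\<close> changes by a relative amount
  of at most \<open>exp \<epsilon> - 1\<close> per step, so its Laplacian is small compared with it,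
  and for \<open>z\<close> far away the potential sees almost nothing of it. This rules out a
  bounded inverse.\<close>

theorem zero_in_spectrum:
  assumes \<kappa>: "0 < \<kappa>"
  shows "0 \<in> l2_spectrum (anderson_operator \<kappa> :: (int ^ 'd \<Rightarrow> complex) \<Rightarrow> _)"
proof (rule ccontr)
  assume "0 \<notin> l2_spectrum (anderson_operator \<kappa> :: (int ^ 'd \<Rightarrow> complex) \<Rightarrow> _)"
  then obtain C where C: "\<And>f :: int ^ 'd \<Rightarrow> complex. f \<in> l2 \<Longrightarrow> l2_norm f \<le> C * l2_norm (anderson_operator \<kappa> f)"
    by (auto simp: l2_spectrum_def)
  define c where "c = \<kappa> * (2 * real CARD('d))"
  have c: "0 < c" using \<kappa> by (simp add: c_def)
  define C' where "C' = max C 1"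
  have C': "C \<le> C'" "0 < C'" by (auto simp: C'_def)
  \<comment> \<open>The choice makes the Laplacian part at most \<open>1 / (4 * C')\<close> times
    \<open>l2_norm F\<close>, and \<open>R\<close> makes the value at the origin at most
    \<open>1 / (4 * C')\<close>. The bound \<open>l2_norm F / 4 + 1 / 4\<close> is then too small,
    because \<open>l2_norm F \<ge> 1\<close>.\<close>
  define \<epsilon> where "\<epsilon> = ln (1 + 1 / (4 * c * C'))"
  have "0 < 1 / (4 * c * C')" using c C' by simp
  then have "exp \<epsilon> = 1 + 1 / (4 * c * C')" "0 < \<epsilon>"
    unfolding \<epsilon>_def by (intro exp_ln ln_gt_zero; linarith)+
  then have \<epsilon>: "0 < \<epsilon>" "c * (exp \<epsilon> - 1) = 1 / (4 * C')" using c C' by auto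
  obtain R :: nat where R: "exp (- \<epsilon> * R) < 1 / (4 * C')"
  proof -
    have "((\<lambda>n. exp (- \<epsilon>) ^ n) \<longlonglongrightarrow> 0)" using \<epsilon> by (intro LIMSEQ_realpow_zero) auto
    then have "\<forall>\<^sub>F n in sequentially. exp (- \<epsilon>) ^ n < 1 / (4 * C')" using C' by (intro order_tendstoD) auto
    then obtain n where "exp (- \<epsilon>) ^ n < 1 / (4 * C')" by (auto simp: eventually_sequentially)
    then show thesis by (intro that[of n]) (simp add: exp_of_nat_mult[symmetric] mult.commute)
  qed
  obtain i :: 'd where True by simp
  define z :: "int ^ 'd" where "z = axis i (int R)"
  have z: "l1 (- z) = int R" by (simp add: l1_def z_def axis_def if_distrib[of abs] if_distrib[of uminus] cong: if_cong)
  define f where "f = (\<lambda>x :: int ^ 'd. exp (- \<epsilon> * l1 (x - z)))"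
  define F where "F = (\<lambda>x. complex_of_real (f x))"
  have F: "F \<in> l2" unfolding F_def f_def by (rule exp_neg_l1_in_l2[OF \<epsilon>(1)])
  have F1: "1 \<le> l2_norm F" using cmod_le_l2_norm[OF F, of z] by (simp add: F_def f_def)
  have ratio: "\<bar>f (x + e) - f x\<bar> \<le> (exp \<epsilon> - 1) * f x" if "e \<in> unit_steps" for x e
  proof -
    have e: "l1 e = 1" "l1 (- e) = 1" using that by (simp_all add: l1_unit_step)
    have eq: "x - z + e = x + e - z" "x + e - z + - e = x - z" by simp_all
    have t: "l1 (x + e - z) \<le> l1 (x - z) + 1" "l1 (x - z) \<le> l1 (x + e - z) + 1"
      using l1_triangle[of "x - z" e] l1_triangle[of "x + e - z" "- e"] by (simp_all only: e eq)
    have up: "f (x + e) \<le> exp \<epsilon> * f x"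
    proof -
      have "real_of_int (l1 (x - z)) \<le> real_of_int (l1 (x + e - z)) + 1" using t(2) by linarith
      then have "\<epsilon> * l1 (x - z) \<le> \<epsilon> * (real_of_int (l1 (x + e - z)) + 1)" using \<epsilon>(1) by (intro mult_left_mono) auto
      then have "- \<epsilon> * l1 (x + e - z) \<le> \<epsilon> + - \<epsilon> * l1 (x - z)" by (simp add: distrib_left)
      then show ?thesis unfolding f_def exp_add[symmetric] by simp
    qed
    have lo: "f x \<le> exp \<epsilon> * f (x + e)"
    proof -
      have "real_of_int (l1 (x + e - z)) \<le> real_of_int (l1 (x - z)) + 1" using t(1) by linarith
      then have "\<epsilon> * l1 (x + e - z) \<le> \<epsilon> * (real_of_int (l1 (x - z)) + 1)" using \<epsilon>(1) by (intro mult_left_mono) auto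
      then have "- \<epsilon> * l1 (x - z) \<le> \<epsilon> + - \<epsilon> * l1 (x + e - z)" by (simp add: distrib_left)
      then show ?thesis unfolding f_def exp_add[symmetric] by simp
    qed
    have fp: "0 < f x" "0 < f (x + e)" by (simp_all add: f_def)
    have E: "1 < exp \<epsilon>" using \<epsilon> by simp
    have "f x - f (x + e) \<le> (exp \<epsilon> - 1) * f x"
    proof (cases "f (x + e) \<le> f x")
      case True
      have "f x - f (x + e) \<le> (exp \<epsilon> - 1) * f (x + e)" using lo by (simp add: algebra_simps)
      also have "\<dots> \<le> (exp \<epsilon> - 1) * f x" using True E by (intro mult_left_mono) auto
      finally show ?thesis .
    next
      case False
      then show ?thesis using E fp by (smt (verit) mult_pos_pos)
    qed
    moreover have "f (x + e) - f x \<le> (exp \<epsilon> - 1) * f x" using up by (simp add: algebra_simps)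
    ultimately show ?thesis by linarith
  qed
  define P where "P = (\<lambda>x. complex_of_real \<kappa> * laplacian F x)"
  define Q where "Q = (\<lambda>x :: int ^ 'd. (if x = 0 then 1 else 0) * F x)"
  have op: "anderson_operator \<kappa> F = (\<lambda>x. P x + Q x)" by (auto simp: anderson_operator_def P_def Q_def)
  have P_le: "cmod (P x) \<le> 1 / (4 * C') * cmod (F x)" for x
  proof -
    have "{y. y - x \<in> unit_steps} = (+) x ` unit_steps" by (force simp: image_iff)
    then have "laplacian F x = (\<Sum>e\<in>unit_steps. F (x + e) - F x)"
      unfolding laplacian_def by (simp add: sum.reindex)
    also have "cmod \<dots> \<le> (\<Sum>e\<in>(unit_steps :: (int ^ 'd) set). (exp \<epsilon> - 1) * f x)"
      using ratio by (intro sum_norm_le) (simp add: F_def flip: of_real_diff)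
    also have "\<dots> = 2 * real CARD('d) * (exp \<epsilon> - 1) * f x" by (simp add: card_unit_steps)
    finally have "\<kappa> * cmod (laplacian F x) \<le> \<kappa> * (2 * real CARD('d) * (exp \<epsilon> - 1) * f x)"
      using \<kappa> by (intro mult_left_mono) auto
    also have "\<dots> = 1 / (4 * C') * f x" unfolding \<epsilon>(2)[symmetric] by (simp add: c_def)
    also have "f x = cmod (F x)" by (simp add: F_def f_def)
    finally show ?thesis using \<kappa> by (simp add: P_def norm_mult)
  qed
  have P: "P \<in> l2" "l2_norm P \<le> 1 / (4 * C') * l2_norm F"
    using l2_dominated[OF F P_le] C' by auto
  have "L2_set (\<lambda>x. cmod (Q x)) A \<le> 1 / (4 * C')" if "finite A" for A
  proof -
    have "(\<Sum>x\<in>A. (cmod (Q x))\<^sup>2) = (\<Sum>x\<in>A \<inter> {0}. (cmod (Q x))\<^sup>2)"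
      by (rule sum.mono_neutral_right) (use that in \<open>auto simp: Q_def\<close>)
    also have "\<dots> \<le> (\<Sum>x\<in>{0}. (cmod (Q x))\<^sup>2)" by (intro sum_mono2) auto
    also have "\<dots> = (f 0)\<^sup>2" by (simp add: Q_def F_def f_def)
    finally have "L2_set (\<lambda>x. cmod (Q x)) A \<le> f 0" unfolding L2_set_def by (intro real_le_lsqrt) (auto simp: f_def intro: sum_nonneg)
    also have "f 0 \<le> 1 / (4 * C')" using R z by (simp add: f_def)
    finally show ?thesis .
  qed
  from l2I[OF this] have Q: "Q \<in> l2" "l2_norm Q \<le> 1 / (4 * C')" by auto
  have "l2_norm F \<le> C * l2_norm (anderson_operator \<kappa> F)" by (rule C[OF F])
  also have "\<dots> \<le> C' * (1 / (4 * C') * l2_norm F + 1 / (4 * C'))"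
    using C' l2_add(2)[OF P(1) Q(1)] P(2) Q(2) unfolding op by (intro mult_mono) (auto simp: l2_norm_nonneg intro: add_nonneg_nonneg)
  also have "\<dots> = l2_norm F / 4 + 1 / 4" using C' by (simp add: field_simps)
  finally show False using F1 by simp
qed

section \<open>The resolvent kernel as eigenfunction and as supersolution\<close>

lemma nn_integral_heat_count_space: "(\<integral>\<^sup>+x. ennreal (heat u x) \<partial>count_space (UNIV :: (int ^ 'd) set)) = 1"
  using nn_integral_unit_walk[of "\<lambda>_ :: int ^ 'd. 1" u] by (simp add: walk_space.emeasure_space_1[simplified])

lemma sum_heat_le_1: "finite F \<Longrightarrow> (\<Sum>x\<in>F. heat u (x :: int ^ 'd)) \<le> 1"
proof -
  assume F: "finite F"
  have "ennreal (\<Sum>x\<in>F. heat u x) = (\<integral>\<^sup>+x. ennreal (heat u x) \<partial>count_space F)"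
    using F by (simp add: nn_integral_count_space_finite sum_ennreal)
  also have "\<dots> = (\<integral>\<^sup>+x. ennreal (heat u x) * indicator F x \<partial>count_space UNIV)"
    by (subst nn_integral_count_space_indicator) auto
  also have "\<dots> \<le> (\<integral>\<^sup>+x. ennreal (heat u x) \<partial>count_space (UNIV :: (int ^ 'd) set))"
    by (intro nn_integral_mono) (auto simp: indicator_def)
  finally show ?thesis by (simp add: nn_integral_heat_count_space)
qed

lemma sum_green_kernel_le:
  assumes \<theta>: "0 < \<theta>" and F: "finite F"
  shows "(\<Sum>x\<in>F. green_kernel a \<theta> (x :: int ^ 'd)) \<le> 1 / \<theta>"
proof -
  have "(\<Sum>x\<in>F. green_kernel a \<theta> x) = (LINT s|lborel. (\<Sum>x\<in>F. indicator {0..} s * (exp (- \<theta> * s) * heat (a * s) x)))"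
    unfolding green_kernel_def by (rule Bochner_Integration.integral_sum[symmetric]) (rule green_kernel_integrable[OF \<theta>])
  also have "\<dots> \<le> (LINT s|lborel. indicator {0..} s * exp (- \<theta> * s))"
  proof (rule integral_mono)
    show "integrable lborel (\<lambda>s. \<Sum>x\<in>F. indicator {0..} s * (exp (- \<theta> * s) * heat (a * s) x))"
      by (rule Bochner_Integration.integrable_sum) (rule green_kernel_integrable[OF \<theta>])
    show "(\<Sum>x\<in>F. indicator {0..} s * (exp (- \<theta> * s) * heat (a * s) x)) \<le> indicator {0..} s * exp (- \<theta> * s)" for s
      unfolding sum_distrib_left[symmetric] using sum_heat_le_1[OF F, of "a * s"] by (auto simp: indicator_def mult_left_le)
  qed (rule exp_Ici_integral(1)[OF \<theta>])
  also have "\<dots> = 1 / \<theta>" by (rule exp_Ici_integral(2)[OF \<theta>])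
  finally show ?thesis .
qed

text \<open>The kernel is bounded by \<open>1 / \<theta>\<close> and has total mass at most
  \<open>1 / \<theta>\<close>, hence it is square summable.\<close>

lemma green_kernel_in_l2:
  assumes \<theta>: "0 < \<theta>"
  shows "(\<lambda>x :: int ^ 'd. complex_of_real (green_kernel a \<theta> x)) \<in> l2"
proof -
  have le: "(\<Sum>x\<in>F. (cmod (complex_of_real (green_kernel a \<theta> x)))\<^sup>2) \<le> 1 / \<theta> * (1 / \<theta>)" if F: "finite F" for F :: "(int ^ 'd) set"
  proof -
    have "(\<Sum>x\<in>F. (cmod (complex_of_real (green_kernel a \<theta> x)))\<^sup>2) \<le> (\<Sum>x\<in>F. 1 / \<theta> * green_kernel a \<theta> x)"
    proof (rule sum_mono)
      fix x
      have "green_kernel a \<theta> x * green_kernel a \<theta> x \<le> 1 / \<theta> * green_kernel a \<theta> x"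
        by (intro mult_right_mono green_kernel_le \<theta>) simp
      then show "(cmod (complex_of_real (green_kernel a \<theta> x)))\<^sup>2 \<le> 1 / \<theta> * green_kernel a \<theta> x"
        by (simp add: power2_eq_square)
    qed
    also have "\<dots> \<le> 1 / \<theta> * (1 / \<theta>)"
      unfolding sum_distrib_left[symmetric] using \<theta> by (intro mult_left_mono sum_green_kernel_le F) auto
    finally show ?thesis .
  qed
  show ?thesis
    unfolding l2_def mem_Collect_eq by (rule nonneg_bdd_above_summable_on) (use le in \<open>auto simp: bdd_above_def\<close>)
qed

lemma nn_integral_linear_combination:
  assumes "f \<in> borel_measurable M" "g \<in> borel_measurable M"
  shows "(\<integral>\<^sup>+x. b * f x + c * g x \<partial>M) = b * (\<integral>\<^sup>+x. f x \<partial>M) + c * (\<integral>\<^sup>+x. g x \<partial>M)"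
  using assms by (simp add: nn_integral_add nn_integral_cmult)

text \<open>Laplace transforms turn convolutions into products. In the factor
  \<open>1 / (\<theta> + a)\<close>, \<open>\<theta>\<close> comes from the transform and
  \<open>a\<close> from the exponential kernel.\<close>

lemma nn_integral_exp_convolution:
  assumes [measurable]: "f \<in> borel_measurable borel" and f: "\<And>s. 0 \<le> f s" and \<theta>: "0 < \<theta>" and a: "0 \<le> a"
  shows "(\<integral>\<^sup>+s. indicator {0..} s * ennreal (exp (- \<theta> * s)) *
      (\<integral>\<^sup>+r. indicator {0..s} r * (ennreal (exp (- a * r)) * ennreal (f (s - r))) \<partial>lborel) \<partial>lborel) =
    ennreal (1 / (\<theta> + a)) * (\<integral>\<^sup>+s. indicator {0..} s * ennreal (exp (- \<theta> * s) * f s) \<partial>lborel)"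
proof -
  define I where "I = (\<integral>\<^sup>+s. indicator {0..} s * ennreal (exp (- \<theta> * s) * f s) \<partial>lborel)"
  have "(\<integral>\<^sup>+s. indicator {0..} s * ennreal (exp (- \<theta> * s)) *
      (\<integral>\<^sup>+r. indicator {0..s} r * (ennreal (exp (- a * r)) * ennreal (f (s - r))) \<partial>lborel) \<partial>lborel) =
    (\<integral>\<^sup>+s. \<integral>\<^sup>+r. (indicator {0..} r * ennreal (exp (- (\<theta> + a) * r))) * (indicator {0..} (s - r) * ennreal (exp (- \<theta> * (s - r)) * f (s - r))) \<partial>lborel \<partial>lborel)"
  proof (rule nn_integral_cong)
    fix s :: real
    have "(\<lambda>r. indicator {0..s} r * (ennreal (exp (- a * r)) * ennreal (f (s - r)))) \<in> borel_measurable lborel"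
      by measurable
    then have "indicator {0..} s * ennreal (exp (- \<theta> * s)) * (\<integral>\<^sup>+r. indicator {0..s} r * (ennreal (exp (- a * r)) * ennreal (f (s - r))) \<partial>lborel) =
      (\<integral>\<^sup>+r. indicator {0..} s * ennreal (exp (- \<theta> * s)) * (indicator {0..s} r * (ennreal (exp (- a * r)) * ennreal (f (s - r)))) \<partial>lborel)"
      by (rule nn_integral_cmult[symmetric])
    also have "\<dots> = (\<integral>\<^sup>+r. (indicator {0..} r * ennreal (exp (- (\<theta> + a) * r))) * (indicator {0..} (s - r) * ennreal (exp (- \<theta> * (s - r)) * f (s - r))) \<partial>lborel)"
    proof (rule nn_integral_cong)
      fix r
      have "exp (- \<theta> * s) * exp (- a * r) = exp (- (\<theta> + a) * r) * exp (- \<theta> * (s - r))"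
        unfolding exp_add[symmetric] by (simp add: algebra_simps)
      then have "ennreal (exp (- \<theta> * s)) * (ennreal (exp (- a * r)) * ennreal (f (s - r))) =
        ennreal (exp (- (\<theta> + a) * r)) * ennreal (exp (- \<theta> * (s - r)) * f (s - r))"
        by (simp add: ennreal_mult[symmetric] f mult.assoc[symmetric])
      then show "indicator {0..} s * ennreal (exp (- \<theta> * s)) * (indicator {0..s} r * (ennreal (exp (- a * r)) * ennreal (f (s - r)))) =
        (indicator {0..} r * ennreal (exp (- (\<theta> + a) * r))) * (indicator {0..} (s - r) * ennreal (exp (- \<theta> * (s - r)) * f (s - r)))"
        by (cases "r \<in> {0..s}") auto
    qed
    finally show "indicator {0..} s * ennreal (exp (- \<theta> * s)) * (\<integral>\<^sup>+r. indicator {0..s} r * (ennreal (exp (- a * r)) * ennreal (f (s - r))) \<partial>lborel) =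
      (\<integral>\<^sup>+r. (indicator {0..} r * ennreal (exp (- (\<theta> + a) * r))) * (indicator {0..} (s - r) * ennreal (exp (- \<theta> * (s - r)) * f (s - r))) \<partial>lborel)" .
  qed
  also have "\<dots> = (\<integral>\<^sup>+r. \<integral>\<^sup>+s. (indicator {0..} r * ennreal (exp (- (\<theta> + a) * r))) * (indicator {0..} (s - r) * ennreal (exp (- \<theta> * (s - r)) * f (s - r))) \<partial>lborel \<partial>lborel)"
  proof (rule lborel_pair.Fubini'[symmetric])
    have "(\<lambda>x. (if 0 \<le> snd x then 1 else 0) * ennreal (exp (- (\<theta> + a) * snd x)) * ((if 0 \<le> fst x - snd x then 1 else 0) * ennreal (exp (- \<theta> * (fst x - snd x)) * f (fst x - snd x))))
      \<in> borel_measurable (lborel \<Otimes>\<^sub>M lborel)" by measurable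
    then show "(\<lambda>(s, r). (indicator {0..} r * ennreal (exp (- (\<theta> + a) * r))) * (indicator {0..} (s - r) * ennreal (exp (- \<theta> * (s - r)) * f (s - r)))) \<in> borel_measurable (lborel \<Otimes>\<^sub>M lborel)"
      by (simp add: split_beta' indicator_def of_bool_def)
  qed
  also have "\<dots> = (\<integral>\<^sup>+r. (indicator {0..} r * ennreal (exp (- (\<theta> + a) * r))) * I \<partial>lborel)"
  proof (rule nn_integral_cong)
    fix r :: real
    have "(\<integral>\<^sup>+s. (indicator {0..} (s - r) * ennreal (exp (- \<theta> * (s - r)) * f (s - r))) \<partial>lborel) = I"
      unfolding I_def by (subst nn_integral_real_affine[of _ 1 r]) (auto intro!: nn_integral_cong)
    then show "(\<integral>\<^sup>+s. (indicator {0..} r * ennreal (exp (- (\<theta> + a) * r))) * (indicator {0..} (s - r) * ennreal (exp (- \<theta> * (s - r)) * f (s - r))) \<partial>lborel) =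
      (indicator {0..} r * ennreal (exp (- (\<theta> + a) * r))) * I"
      by (subst nn_integral_cmult) auto
  qed
  also have "\<dots> = (\<integral>\<^sup>+r. ennreal (indicator {0..} r * exp (- (\<theta> + a) * r)) \<partial>lborel) * I"
    by (subst nn_integral_multc[symmetric]) (auto intro!: nn_integral_cong simp: indicator_def)
  also have "\<dots> = ennreal (1 / (\<theta> + a)) * I"
    using \<theta> a by (subst nn_integral_exp_Ici) auto
  finally show ?thesis unfolding I_def .
qed

text \<open>Laplace transform of the first-jump equation. With \<open>a = 2 d \<kappa>\<close> it
  says that \<open>\<theta> - \<kappa> \<Delta>\<close> maps the kernel to the unit mass at
  \<open>0\<close>.\<close>

theorem green_kernel_resolvent:
  fixes x :: "int ^ 'd"
  assumes a: "0 \<le> a" and \<theta>: "0 < \<theta>"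
  shows "(\<theta> + a) * green_kernel a \<theta> x = indicator {0} x + a / (2 * real CARD('d)) * (\<Sum>e\<in>unit_steps. green_kernel a \<theta> (x - e))"
proof -
  define h where "h = (\<lambda>s. (\<Sum>e\<in>unit_steps. heat (a * s) (x - e)) / (2 * real CARD('d)))"
  have h: "0 \<le> h s" for s by (simp add: h_def sum_nonneg)
  have [measurable]: "h \<in> borel_measurable borel" unfolding h_def by measurable
  \<comment> \<open>The first-jump equation on the clock \<open>a * s\<close>; the substitution
    \<open>r \<mapsto> a * r\<close> produces the factor \<open>a\<close>. For \<open>a = 0\<close>
    the walk stays at \<open>0\<close>.\<close>
  have step: "ennreal (heat (a * s) x) = ennreal (exp (- a * s)) * indicator {0} x +
    ennreal a * (\<integral>\<^sup>+r. indicator {0..s} r * (ennreal (exp (- a * r)) * ennreal (h (s - r))) \<partial>lborel)" if s: "0 \<le> s" for s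
  proof (cases "a = 0")
    case True
    then show ?thesis by (simp add: heat_0 ennreal_indicator indicator_def)
  next
    case False
    then have a0: "0 < a" using a by simp
    have "(\<integral>\<^sup>+r. ennreal (exponential_density 1 r) * (indicator {..a * s} r *
      (\<Sum>e\<in>unit_steps. ennreal (heat (a * s - r) (x - e)) / of_nat (2 * CARD('d)))) \<partial>lborel) =
      (\<integral>\<^sup>+r. indicator {0..a * s} r * (ennreal (exp (- r)) * ennreal (h (s - r / a))) \<partial>lborel)"
    proof (intro nn_integral_cong)
      fix r
      have "(\<Sum>e\<in>unit_steps. ennreal (heat (a * s - r) (x - e)) / of_nat (2 * CARD('d))) = ennreal (h (s - r / a))"
      proof -
        have "a * (s - r / a) = a * s - r" using a0 by (simp add: field_simps)
        then have "h (s - r / a) = (\<Sum>e\<in>unit_steps. heat (a * s - r) (x - e) / real (2 * CARD('d)))"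
          by (simp add: h_def sum_divide_distrib)
        moreover have "ennreal (heat (a * s - r) (x - e)) / of_nat (2 * CARD('d)) = ennreal (heat (a * s - r) (x - e) / real (2 * CARD('d)))" for e
          by (simp add: ennreal_of_nat_eq_real_of_nat divide_ennreal del: of_nat_mult)
        ultimately show ?thesis by (simp add: sum_ennreal del: of_nat_mult)
      qed
      then show "ennreal (exponential_density 1 r) * (indicator {..a * s} r *
        (\<Sum>e\<in>unit_steps. ennreal (heat (a * s - r) (x - e)) / of_nat (2 * CARD('d)))) =
        indicator {0..a * s} r * (ennreal (exp (- r)) * ennreal (h (s - r / a)))"
        by (auto simp: indicator_def exponential_density_def)
    qed
    also have "\<dots> = ennreal a * (\<integral>\<^sup>+r. indicator {0..s} r * (ennreal (exp (- a * r)) * ennreal (h (s - r))) \<partial>lborel)"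
    proof -
      have "(\<integral>\<^sup>+r. indicator {0..a * s} r * (ennreal (exp (- r)) * ennreal (h (s - r / a))) \<partial>lborel) =
        ennreal \<bar>a\<bar> * (\<integral>\<^sup>+r. indicator {0..a * s} (0 + a * r) * (ennreal (exp (- (0 + a * r))) * ennreal (h (s - (0 + a * r) / a))) \<partial>lborel)"
        using a0 by (intro nn_integral_real_affine) auto
      also have "(\<integral>\<^sup>+r. indicator {0..a * s} (0 + a * r) * (ennreal (exp (- (0 + a * r))) * ennreal (h (s - (0 + a * r) / a))) \<partial>lborel) =
        (\<integral>\<^sup>+r. indicator {0..s} r * (ennreal (exp (- a * r)) * ennreal (h (s - r))) \<partial>lborel)"
        using a0 by (intro nn_integral_cong) (auto simp: indicator_def zero_le_mult_iff)
      finally show ?thesis using a0 by simp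
    qed
    finally show ?thesis using heat_first_step[of "a * s" x] a s by simp
  qed
  have "ennreal (green_kernel a \<theta> x) = (\<integral>\<^sup>+s. indicator {0..} s * ennreal (exp (- \<theta> * s)) * ennreal (heat (a * s) x) \<partial>lborel)"
    unfolding nn_integral_green_kernel[OF \<theta>, symmetric] by (intro nn_integral_cong) (simp add: ennreal_mult mult.assoc)
  also have "\<dots> = (\<integral>\<^sup>+s. indicator {0} x * ennreal (indicator {0..} s * exp (- (\<theta> + a) * s)) + ennreal a * (indicator {0..} s * ennreal (exp (- \<theta> * s)) *
      (\<integral>\<^sup>+r. indicator {0..s} r * (ennreal (exp (- a * r)) * ennreal (h (s - r))) \<partial>lborel)) \<partial>lborel)"
  proof (intro nn_integral_cong)
    fix s :: real
    show "indicator {0..} s * ennreal (exp (- \<theta> * s)) * ennreal (heat (a * s) x) =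
      indicator {0} x * ennreal (indicator {0..} s * exp (- (\<theta> + a) * s)) + ennreal a * (indicator {0..} s * ennreal (exp (- \<theta> * s)) *
      (\<integral>\<^sup>+r. indicator {0..s} r * (ennreal (exp (- a * r)) * ennreal (h (s - r))) \<partial>lborel))"
    proof (cases "0 \<le> s")
      case True
      have "ennreal (exp (- \<theta> * s)) * ennreal (exp (- a * s)) = ennreal (exp (- (\<theta> + a) * s))"
        by (simp add: ennreal_mult[symmetric] exp_add[symmetric] algebra_simps)
      then show ?thesis using True by (simp add: step distrib_left mult_ac)
    qed simp
  qed
  also have "\<dots> = indicator {0} x * ennreal (1 / (\<theta> + a)) + ennreal a * (ennreal (1 / (\<theta> + a)) * (\<integral>\<^sup>+s. indicator {0..} s * ennreal (exp (- \<theta> * s) * h s) \<partial>lborel))"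
  proof -
    have m: "(\<lambda>s. indicator {0..} s * ennreal (exp (- \<theta> * s)) *
      (\<integral>\<^sup>+r. indicator {0..s} r * (ennreal (exp (- a * r)) * ennreal (h (s - r))) \<partial>lborel)) \<in> borel_measurable lborel"
    proof -
      have "(\<lambda>x. (if 0 \<le> snd x \<and> snd x \<le> fst x then 1 else 0) * (ennreal (exp (- a * snd x)) * ennreal (h (fst x - snd x)))) \<in> borel_measurable (lborel \<Otimes>\<^sub>M lborel)"
        by measurable
      then have "(\<lambda>(s, r). indicator {0..s} r * (ennreal (exp (- a * r)) * ennreal (h (s - r)))) \<in> borel_measurable (lborel \<Otimes>\<^sub>M lborel)"
        by (simp add: split_beta' indicator_def of_bool_def)
      then have [measurable]: "(\<lambda>s. \<integral>\<^sup>+r. indicator {0..s} r * (ennreal (exp (- a * r)) * ennreal (h (s - r))) \<partial>lborel) \<in> borel_measurable lborel"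
        by (rule lborel.borel_measurable_nn_integral)
      show ?thesis by measurable
    qed
    show ?thesis
      by (subst nn_integral_linear_combination[OF _ m], measurable)
        (simp only: nn_integral_exp_convolution[OF \<open>h \<in> borel_measurable borel\<close> h \<theta> a] nn_integral_exp_Ici[OF add_pos_nonneg[OF \<theta> a]])
  qed
  also have "(\<integral>\<^sup>+s. indicator {0..} s * ennreal (exp (- \<theta> * s) * h s) \<partial>lborel) = ennreal ((\<Sum>e\<in>unit_steps. green_kernel a \<theta> (x - e)) / (2 * real CARD('d)))"
  proof -
    have "(\<integral>\<^sup>+s. indicator {0..} s * ennreal (exp (- \<theta> * s) * h s) \<partial>lborel) =
      (\<integral>\<^sup>+s. (\<Sum>e\<in>unit_steps. ennreal (1 / (2 * real CARD('d))) * (indicator {0..} s * ennreal (exp (- \<theta> * s) * heat (a * s) (x - e)))) \<partial>lborel)"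
    proof (intro nn_integral_cong)
      fix s
      have "ennreal (exp (- \<theta> * s) * h s) = (\<Sum>e\<in>unit_steps. ennreal (1 / (2 * real CARD('d)) * (exp (- \<theta> * s) * heat (a * s) (x - e))))"
        by (subst sum_ennreal) (auto simp: h_def sum_distrib_left sum_divide_distrib)
      then show "indicator {0..} s * ennreal (exp (- \<theta> * s) * h s) =
        (\<Sum>e\<in>unit_steps. ennreal (1 / (2 * real CARD('d))) * (indicator {0..} s * ennreal (exp (- \<theta> * s) * heat (a * s) (x - e))))"
        by (cases "0 \<le> s") (simp_all only: ennreal_mult indicator_simps atLeast_iff mult_1_left mult_zero_left mult_zero_right sum.neutral_const
            heat_nonneg exp_ge_zero mult_nonneg_nonneg zero_le_divide_1_iff zero_le_mult_iff zero_le_numeral of_nat_0_le_iff simp_thms)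
    qed
    also have "\<dots> = (\<Sum>e\<in>unit_steps. ennreal (1 / (2 * real CARD('d))) * ennreal (green_kernel a \<theta> (x - e)))"
      by (subst nn_integral_sum, measurable, intro sum.cong refl, subst nn_integral_cmult, measurable)
        (simp only: nn_integral_green_kernel[OF \<theta>])
    also have "\<dots> = ennreal ((\<Sum>e\<in>unit_steps. green_kernel a \<theta> (x - e)) / (2 * real CARD('d)))"
    proof -
      have "(\<Sum>e\<in>unit_steps. ennreal (1 / (2 * real CARD('d))) * ennreal (green_kernel a \<theta> (x - e))) =
        (\<Sum>e\<in>unit_steps. ennreal (1 / (2 * real CARD('d)) * green_kernel a \<theta> (x - e)))"
        by (intro sum.cong refl ennreal_mult[symmetric]) auto
      also have "\<dots> = ennreal (\<Sum>e\<in>unit_steps. 1 / (2 * real CARD('d)) * green_kernel a \<theta> (x - e))"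
        by (rule sum_ennreal) simp
      finally show ?thesis by (simp add: sum_divide_distrib)
    qed
    finally show ?thesis .
  qed
  also have "indicator {0} x * ennreal (1 / (\<theta> + a)) + ennreal a * (ennreal (1 / (\<theta> + a)) * ennreal ((\<Sum>e\<in>unit_steps. green_kernel a \<theta> (x - e)) / (2 * real CARD('d)))) =
    ennreal ((indicator {0} x + a * ((\<Sum>e\<in>unit_steps. green_kernel a \<theta> (x - e)) / (2 * real CARD('d)))) / (\<theta> + a))"
  proof -
    define S where "S = (\<Sum>e\<in>unit_steps. green_kernel a \<theta> (x - e)) / (2 * real CARD('d))"
    define i where "i = (indicator {0} x :: real)"
    have i: "indicator {0} x = ennreal i" "0 \<le> i" by (auto simp: i_def indicator_def)
    have S: "0 \<le> S" by (simp add: S_def sum_nonneg)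
    define u where "u = 1 / (\<theta> + a)"
    have u: "0 \<le> u" using \<theta> a by (simp add: u_def)
    have "(i + a * S) / (\<theta> + a) = i * u + a * (u * S)" by (simp add: u_def add_divide_distrib)
    moreover have "ennreal (i * u + a * (u * S)) = ennreal i * ennreal u + ennreal a * (ennreal u * ennreal S)"
      using i(2) S u a by (subst ennreal_plus) (simp_all add: ennreal_mult)
    ultimately show ?thesis
      unfolding S_def[symmetric] u_def[symmetric] i(1) i_def[symmetric] by simp
  qed
  finally have "green_kernel a \<theta> x = (indicator {0} x + a * ((\<Sum>e\<in>unit_steps. green_kernel a \<theta> (x - e)) / (2 * real CARD('d)))) / (\<theta> + a)"
    using \<theta> a by (subst (asm) ennreal_inj) (auto intro!: divide_nonneg_nonneg add_nonneg_nonneg mult_nonneg_nonneg sum_nonneg)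
  from nonzero_eq_divide_eq[THEN iffD1, OF _ this] have "green_kernel a \<theta> x * (\<theta> + a) =
    indicator {0} x + a * ((\<Sum>e\<in>unit_steps. green_kernel a \<theta> (x - e)) / (2 * real CARD('d)))"
    using \<theta> a by simp
  then show ?thesis by (simp add: mult.commute)
qed

text \<open>Write \<open>G\<close> for the kernel. The potential adds \<open>G 0\<close> at the
  origin, where the resolvent equation has the source \<open>1\<close>. The defect
  \<open>1 - G 0\<close> vanishes in the critical case, and for \<open>G 0 \<le> 1\<close> it has
  the sign of a supersolution.\<close>

lemma hop_green_kernel:
  fixes x :: "int ^ 'd"
  assumes \<kappa>: "0 \<le> \<kappa>" and \<theta>: "0 < \<theta>"
  shows "hop \<kappa> (green_kernel (2 * real CARD('d) * \<kappa>) \<theta>) x =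
    (\<theta> + 2 * real CARD('d) * \<kappa>) * green_kernel (2 * real CARD('d) * \<kappa>) \<theta> x - indicator {0} x * (1 - green_kernel (2 * real CARD('d) * \<kappa>) \<theta> (0 :: int ^ 'd))"
proof -
  let ?a = "2 * real CARD('d) * \<kappa>"
  have "(\<Sum>e\<in>unit_steps. green_kernel ?a \<theta> (x - e)) = (\<Sum>e\<in>unit_steps. green_kernel ?a \<theta> (x + e))"
    by (rule sum.reindex_bij_witness[of _ uminus uminus]) auto
  moreover have "0 \<le> ?a" using \<kappa> by simp
  ultimately show ?thesis
    using green_kernel_resolvent[of ?a \<theta> x] \<theta> by (auto simp: hop_def indicator_def)
qed

lemma not_AE_lborel_eq_0:
  assumes "\<And>s::real. 0 < s \<Longrightarrow> f s \<noteq> 0"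
  shows "\<not> (AE s in lborel. f s = 0)"
proof
  assume "AE s in lborel. f s = 0"
  then have "AE s in lborel. s \<notin> {0<..<1::real}"
    by eventually_elim (use assms in fastforce)
  moreover have "{x::real. 0 < x \<and> x < 1} = {0<..<1}" by auto
  ultimately have "emeasure lborel {0<..<1::real} = 0"
    using AE_iff_measurable[of "{0<..<1::real}" lborel "\<lambda>s. s \<notin> {0<..<1}"] by auto
  then show False by simp
qed

lemma green_kernel_pos:
  fixes x :: "int ^ 'd"
  assumes a: "0 < a" and \<theta>: "0 < \<theta>"
  shows "0 < green_kernel a \<theta> x"
proof (rule ccontr)
  let ?f = "\<lambda>s. indicator {0..} s * (exp (- \<theta> * s) * heat (a * s) x)"
  assume "\<not> 0 < green_kernel a \<theta> x"
  then have "green_kernel a \<theta> x = 0" using green_kernel_nonneg[of a \<theta> x] by linarith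
  then have "AE s in lborel. ?f s = 0"
    unfolding green_kernel_def by (subst (asm) integral_nonneg_eq_0_iff_AE[OF green_kernel_integrable[OF \<theta>]]) (auto simp: indicator_def)
  moreover have "0 < ?f s" if "0 < s" for s using that a heat_pos[of "a * s" x] by simp
  ultimately show False using not_AE_lborel_eq_0[of ?f] by force
qed

text \<open>At the critical parameter the kernel is an eigenfunction in \<open>l2\<close>, so
  injectivity fails.\<close>

theorem critical_in_spectrum:
  assumes \<kappa>: "0 \<le> \<kappa>" and \<theta>: "0 < \<theta>" and g: "green_kernel (2 * real CARD('d) * \<kappa>) \<theta> (0 :: int ^ 'd) = 1"
  shows "complex_of_real \<theta> \<in> l2_spectrum (anderson_operator \<kappa> :: (int ^ 'd \<Rightarrow> complex) \<Rightarrow> _)"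
proof -
  let ?T = "\<lambda>f x. anderson_operator \<kappa> f x - complex_of_real \<theta> * f (x :: int ^ 'd)"
  let ?G = "\<lambda>x :: int ^ 'd. complex_of_real (green_kernel (2 * real CARD('d) * \<kappa>) \<theta> x)"
  have "?T ?G x = 0" for x
  proof -
    have e: "hop \<kappa> ?G x = complex_of_real (hop \<kappa> (green_kernel (2 * real CARD('d) * \<kappa>) \<theta>) x)"
      by (simp add: hop_def)
    show ?thesis
      unfolding anderson_operator_eq e hop_green_kernel[OF \<kappa> \<theta>] g by (simp add: algebra_simps)
  qed
  moreover have "?T (\<lambda>_. 0) x = 0" for x by (simp add: anderson_operator_def laplacian_def)
  ultimately have "?T ?G = ?T (\<lambda>_. 0)" by (simp add: fun_eq_iff)
  moreover have "?G \<noteq> (\<lambda>_. 0)"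
  proof
    assume "?G = (\<lambda>_. 0)"
    from fun_cong[OF this, of 0] g show False by simp
  qed
  ultimately have "\<not> inj_on ?T l2"
    using inj_onD[of ?T l2 ?G "\<lambda>_. 0"] green_kernel_in_l2[OF \<theta>] zero_in_l2 by blast
  then show ?thesis by (auto simp: l2_spectrum_def bij_betw_def)
qed

text \<open>The kernel is the weight for the Schur test. At \<open>\<kappa> = 0\<close> it vanishes
  off the origin; there its value \<open>1 / \<theta>\<close> at \<open>0\<close> forces
  \<open>\<theta> \<ge> 1\<close>, and the constant weight works.\<close>

lemma not_in_spectrum:
  assumes \<kappa>: "0 \<le> \<kappa>" and \<theta>: "0 < \<theta>" and g: "green_kernel (2 * real CARD('d) * \<kappa>) \<theta> (0 :: int ^ 'd) \<le> 1" and r: "\<theta> < r"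
  shows "complex_of_real r \<notin> l2_spectrum (anderson_operator \<kappa> :: (int ^ 'd \<Rightarrow> complex) \<Rightarrow> _)"
proof (cases "\<kappa> = 0")
  case True
  have "green_kernel 0 \<theta> (0 :: int ^ 'd) = 1 / \<theta>"
    using green_kernel_resolvent[of 0 \<theta> "0 :: int ^ 'd"] \<theta> by (simp add: field_simps)
  then have "1 / \<theta> \<le> 1" using g True by simp
  then have "1 \<le> \<theta>" using \<theta> by (simp add: divide_le_eq)
  then show ?thesis
    using True r by (intro resolvent_if_supersolution[where h="\<lambda>_. 1" and \<theta>=\<theta>]) (auto simp: hop_def)
next
  case False
  show ?thesis
  proof (rule resolvent_if_supersolution[where h="green_kernel (2 * real CARD('d) * \<kappa>) \<theta>" and \<theta>=\<theta>])
    show "0 < green_kernel (2 * real CARD('d) * \<kappa>) \<theta> x" for x :: "int ^ 'd"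
      using False \<kappa> \<theta> by (intro green_kernel_pos) auto
    show "hop \<kappa> (green_kernel (2 * real CARD('d) * \<kappa>) \<theta>) x \<le> (\<theta> + 2 * real CARD('d) * \<kappa>) * green_kernel (2 * real CARD('d) * \<kappa>) \<theta> x" for x :: "int ^ 'd"
      unfolding hop_green_kernel[OF \<kappa> \<theta>] using g by (auto simp: indicator_def)
  qed (use \<kappa> r in auto)
qed

theorem spectral_sup_critical:
  assumes \<kappa>: "0 \<le> \<kappa>" and \<theta>: "0 < \<theta>" and g: "green_kernel (2 * real CARD('d) * \<kappa>) \<theta> (0 :: int ^ 'd) = 1"
  shows "spectral_sup TYPE('d) \<kappa> = \<theta>"
  unfolding spectral_sup_def
proof (rule cSup_eq_maximum)
  show "\<theta> \<in> {r. complex_of_real r \<in> l2_spectrum (anderson_operator \<kappa> :: (int ^ 'd \<Rightarrow> complex) \<Rightarrow> _)}"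
    using critical_in_spectrum[OF assms] by simp
  show "r \<le> \<theta>" if "r \<in> {r. complex_of_real r \<in> l2_spectrum (anderson_operator \<kappa> :: (int ^ 'd \<Rightarrow> complex) \<Rightarrow> _)}" for r
    using not_in_spectrum[OF \<kappa> \<theta>, where 'd='d and r=r] g that by (force simp: not_le[symmetric])
qed

text \<open>The parameter \<open>r / 2\<close> excludes every \<open>r > 0\<close>, and
  \<open>0\<close> itself is in the spectrum. The case \<open>\<kappa> = 0\<close> does not arise,
  since there the kernel has the value \<open>1\<close> at \<open>\<theta> = 1\<close>.\<close>

theorem spectral_sup_subcritical:
  assumes \<kappa>: "0 \<le> \<kappa>" and g: "\<And>\<theta>. 0 < \<theta> \<Longrightarrow> green_kernel (2 * real CARD('d) * \<kappa>) \<theta> (0 :: int ^ 'd) < 1"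
  shows "spectral_sup TYPE('d) \<kappa> = 0"
  unfolding spectral_sup_def
proof (rule cSup_eq_maximum)
  have "\<kappa> \<noteq> 0"
  proof
    assume "\<kappa> = 0"
    then show False using g[of 1] green_kernel_resolvent[of 0 1 "0 :: int ^ 'd"] by simp
  qed
  then show "0 \<in> {r. complex_of_real r \<in> l2_spectrum (anderson_operator \<kappa> :: (int ^ 'd \<Rightarrow> complex) \<Rightarrow> _)}"
    using zero_in_spectrum[of \<kappa>, where 'd='d] \<kappa> by simp
  show "r \<le> 0" if "r \<in> {r. complex_of_real r \<in> l2_spectrum (anderson_operator \<kappa> :: (int ^ 'd \<Rightarrow> complex) \<Rightarrow> _)}" for r
    using not_in_spectrum[OF \<kappa>, where 'd='d and r=r and \<theta>="r / 2"] g[of "r / 2"] that by (force simp: not_le[symmetric])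
qed

text \<open>If the diagonal value is at least \<open>1\<close> anywhere, the intermediate value
  argument finds a parameter at which it equals \<open>1\<close>.\<close>

lemma criticality_cases:
  assumes \<kappa>: "0 \<le> \<kappa>"
  obtains (supercritical) \<theta> where "0 < \<theta>" "green_kernel (2 * real CARD('d) * \<kappa>) \<theta> (0 :: int ^ 'd) = 1"
    | (subcritical) "\<And>\<theta>. 0 < \<theta> \<Longrightarrow> green_kernel (2 * real CARD('d) * \<kappa>) \<theta> (0 :: int ^ 'd) < 1"
proof (cases "\<exists>\<theta>>0. 1 \<le> green_kernel (2 * real CARD('d) * \<kappa>) \<theta> (0 :: int ^ 'd)")
  case True
  then obtain \<theta> where \<theta>: "0 < \<theta>" "1 \<le> green_kernel (2 * real CARD('d) * \<kappa>) \<theta> (0 :: int ^ 'd)" by auto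
  from critical_green_kernel[OF this] obtain \<mu> where "\<theta> \<le> \<mu>" "green_kernel (2 * real CARD('d) * \<kappa>) \<mu> (0 :: int ^ 'd) = 1" .
  then show ?thesis using \<theta> supercritical[of \<mu>] by simp
next
  case False
  then show ?thesis using subcritical by (meson not_le)
qed

theorem return_moment_growth:
  assumes \<kappa>: "0 \<le> \<kappa>"
  shows "((\<lambda>t. ln (enn2real (return_moment TYPE('d::finite) (2 * real CARD('d) * \<kappa>) 1 t)) / t) \<longlongrightarrow> spectral_sup TYPE('d) \<kappa>) at_top"
  using \<kappa>
proof (cases rule: criticality_cases[where 'd='d])
  case (supercritical \<theta>)
  then show ?thesis
    using return_moment_growth_critical[where 'd='d, of "2 * real CARD('d) * \<kappa>" \<theta>] spectral_sup_critical[OF \<kappa>, of \<theta>, where 'd='d] \<kappa> by simp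
next
  case subcritical
  then show ?thesis
    using return_moment_growth_subcritical[where 'd='d, of "2 * real CARD('d) * \<kappa>"] spectral_sup_subcritical[OF \<kappa>, where 'd='d] \<kappa> by simp
qed

section \<open>Positivity of the spectral supremum and the Green function\<close>

text \<open>As \<open>\<theta>\<close> decreases to \<open>0\<close> the kernel increases to the
  untilted integral, so a bound on all kernel values passes to the limit. In the other direction, a
  value of at most \<open>1\<close> at \<open>\<theta> / 2\<close> is strictly smaller than
  \<open>1\<close> at \<open>\<theta>\<close>.\<close>

lemma nn_integral_heat_le_1_iff:
  fixes a :: real
  assumes a: "0 \<le> a"
  shows "(\<integral>\<^sup>+s. indicator {0..} s * ennreal (heat (a * s) (0 :: int ^ 'd)) \<partial>lborel) \<le> 1 \<longleftrightarrow>
    (\<forall>\<theta>>0. green_kernel a \<theta> (0 :: int ^ 'd) < 1)"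
proof
  assume le: "(\<integral>\<^sup>+s. indicator {0..} s * ennreal (heat (a * s) (0 :: int ^ 'd)) \<partial>lborel) \<le> 1"
  have le1: "green_kernel a \<theta> (0 :: int ^ 'd) \<le> 1" if \<theta>: "0 < \<theta>" for \<theta>
  proof -
    have "ennreal (green_kernel a \<theta> (0 :: int ^ 'd)) \<le> (\<integral>\<^sup>+s. indicator {0..} s * ennreal (heat (a * s) (0 :: int ^ 'd)) \<partial>lborel)"
      unfolding nn_integral_green_kernel[OF \<theta>, symmetric]
      using \<theta> by (intro nn_integral_mono) (auto simp: indicator_def intro!: ennreal_leI mult_left_le_one_le)
    also note le
    finally show ?thesis by simp
  qed
  show "\<forall>\<theta>>0. green_kernel a \<theta> (0 :: int ^ 'd) < 1"
  proof (intro allI impI)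
    fix \<theta> :: real assume "0 < \<theta>"
    then show "green_kernel a \<theta> (0 :: int ^ 'd) < 1"
      using green_kernel_strict_decreasing[OF a, of "\<theta> / 2" \<theta>, where 'd='d] le1[of "\<theta> / 2"] by simp
  qed
next
  assume g: "\<forall>\<theta>>0. green_kernel a \<theta> (0 :: int ^ 'd) < 1"
  have "(\<lambda>n. \<integral>\<^sup>+s. indicator {0..} s * ennreal (exp (- (1 / real (Suc n)) * s) * heat (a * s) (0 :: int ^ 'd)) \<partial>lborel) \<longlonglongrightarrow>
    (\<integral>\<^sup>+s. indicator {0..} s * ennreal (heat (a * s) (0 :: int ^ 'd)) \<partial>lborel)"
  proof (rule nn_integral_LIMSEQ)
    show "incseq (\<lambda>n s. indicator {0..} s * ennreal (exp (- (1 / real (Suc n)) * s) * heat (a * s) (0 :: int ^ 'd)))"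
    proof (intro incseq_SucI le_funI)
      fix n and s :: real
      have "1 / real (Suc (Suc n)) * s \<le> 1 / real (Suc n) * s" if "0 \<le> s"
        using that by (intro mult_right_mono) (auto simp: frac_le)
      then show "indicator {0..} s * ennreal (exp (- (1 / real (Suc n)) * s) * heat (a * s) (0 :: int ^ 'd)) \<le>
        indicator {0..} s * ennreal (exp (- (1 / real (Suc (Suc n))) * s) * heat (a * s) (0 :: int ^ 'd))"
        by (cases "0 \<le> s") (auto intro!: ennreal_leI mult_right_mono)
    qed
    show "(\<lambda>n. indicator {0..} s * ennreal (exp (- (1 / real (Suc n)) * s) * heat (a * s) (0 :: int ^ 'd))) \<longlonglongrightarrow>
      indicator {0..} s * ennreal (heat (a * s) (0 :: int ^ 'd))" for s
    proof -
      have "(\<lambda>n. 1 / real (Suc n)) \<longlonglongrightarrow> 0" by (rule LIMSEQ_Suc) (rule lim_const_over_n)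
      then have "(\<lambda>n. exp (- (1 / real (Suc n)) * s) * heat (a * s) (0 :: int ^ 'd)) \<longlonglongrightarrow> exp (- 0 * s) * heat (a * s) (0 :: int ^ 'd)"
        by (intro tendsto_intros)
      then show ?thesis by (cases "0 \<le> s") (auto intro: tendsto_ennrealI)
    qed
  qed auto
  then show "(\<integral>\<^sup>+s. indicator {0..} s * ennreal (heat (a * s) (0 :: int ^ 'd)) \<partial>lborel) \<le> 1"
  proof (rule LIMSEQ_le_const2)
    show "\<exists>N. \<forall>n\<ge>N. (\<integral>\<^sup>+s. indicator {0..} s * ennreal (exp (- (1 / real (Suc n)) * s) * heat (a * s) (0 :: int ^ 'd)) \<partial>lborel) \<le> 1"
      using g by (intro exI[of _ 0] allI impI, subst nn_integral_green_kernel) (auto intro: less_imp_le simp flip: ennreal_1 intro!: ennreal_leI)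
  qed
qed

lemma nn_integral_Ici_scale:
  fixes f :: "real \<Rightarrow> ennreal"
  assumes [measurable]: "f \<in> borel_measurable borel" and c: "0 < c"
  shows "(\<integral>\<^sup>+s. indicator {0..} s * f s \<partial>lborel) = ennreal c * (\<integral>\<^sup>+s. indicator {0..} s * f (c * s) \<partial>lborel)"
proof -
  have "(\<integral>\<^sup>+s. indicator {0..} s * f s \<partial>lborel) = ennreal \<bar>c\<bar> * (\<integral>\<^sup>+s. indicator {0..} (0 + c * s) * f (0 + c * s) \<partial>lborel)"
    by (rule nn_integral_real_affine) (use c in auto)
  also have "(\<integral>\<^sup>+s. indicator {0..} (0 + c * s) * f (0 + c * s) \<partial>lborel) = (\<integral>\<^sup>+s. indicator {0..} s * f (c * s) \<partial>lborel)"
    using c by (intro nn_integral_cong) (auto simp: indicator_def zero_le_mult_iff)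
  finally show ?thesis using c by simp
qed

lemma green_eq:
  "green (0 :: int ^ 'd) = (\<integral>\<^sup>+s. indicator {0..} s * ennreal (heat (2 * real CARD('d) * s) (0 :: int ^ 'd)) \<partial>lborel)"
proof -
  interpret L: pair_sigma_finite "walk_space :: (nat \<Rightarrow> real \<times> (int ^ 'd)) measure" "lborel :: real measure" ..
  have "green (0 :: int ^ 'd) = (\<integral>\<^sup>+\<omega>. \<integral>\<^sup>+s. indicator {0..} s * indicator {0 :: int ^ 'd} (unit_walk \<omega> (2 * real CARD('d) * s)) \<partial>lborel \<partial>walk_space)"
    unfolding green_def
  proof (intro nn_integral_cong)
    fix \<omega> :: "nat \<Rightarrow> real \<times> (int ^ 'd)"
    have "{t \<in> space lborel. 0 \<le> t \<and> walk 1 0 t \<omega> = 0} \<in> sets lborel"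
      unfolding walk_eq by measurable
    then have m: "{t. 0 \<le> t \<and> walk 1 0 t \<omega> = 0} \<in> sets lborel" by simp
    have "emeasure lborel {t. 0 \<le> t \<and> walk 1 0 t \<omega> = 0} = (\<integral>\<^sup>+s. indicator {t. 0 \<le> t \<and> walk 1 0 t \<omega> = 0} s \<partial>lborel)"
      using m by simp
    also have "\<dots> = (\<integral>\<^sup>+s. indicator {0..} s * indicator {0 :: int ^ 'd} (unit_walk \<omega> (2 * real CARD('d) * s)) \<partial>lborel)"
      by (intro nn_integral_cong) (auto simp: indicator_def walk_eq)
    finally show "emeasure lborel {t. 0 \<le> t \<and> walk 1 0 t \<omega> = 0} = \<dots>" .
  qed
  also have "\<dots> = (\<integral>\<^sup>+s. \<integral>\<^sup>+\<omega>. indicator {0..} s * indicator {0 :: int ^ 'd} (unit_walk \<omega> (2 * real CARD('d) * s)) \<partial>walk_space \<partial>lborel)"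
    by (rule L.Fubini'[symmetric]) measurable
  also have "\<dots> = (\<integral>\<^sup>+s. indicator {0..} s * ennreal (heat (2 * real CARD('d) * s) (0 :: int ^ 'd)) \<partial>lborel)"
    by (simp add: nn_integral_cmult nn_integral_heat)
  finally show ?thesis .
qed

lemma green_neq_0: "green (0 :: int ^ 'd) \<noteq> 0"
proof
  assume "green (0 :: int ^ 'd) = 0"
  then have "AE s in lborel. indicator {0..} s * ennreal (heat (2 * real CARD('d) * s) (0 :: int ^ 'd)) = 0"
    unfolding green_eq by (subst (asm) nn_integral_0_iff_AE) auto
  moreover have "indicator {0..} s * ennreal (heat (2 * real CARD('d) * s) (0 :: int ^ 'd)) \<noteq> 0" if "0 < s" for s
    using that heat_pos[of "2 * real CARD('d) * s" "0 :: int ^ 'd"] by simp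
  ultimately show False
    using not_AE_lborel_eq_0[of "\<lambda>s. indicator {0..} s * ennreal (heat (2 * real CARD('d) * s) (0 :: int ^ 'd))"] by blast
qed
text \<open>Rescaling time writes \<open>green 0\<close> as \<open>\<kappa>\<close> times the
  untilted integral at jump rate \<open>2 d \<kappa>\<close>, so
  \<open>green 0 \<le> \<kappa>\<close> is the subcritical case. At \<open>\<kappa> = 0\<close>,
  where rescaling is impossible, positivity of \<open>green 0\<close> is used instead.\<close>

theorem spectral_sup_pos_iff:
  assumes \<kappa>: "0 \<le> \<kappa>"
  shows "0 < spectral_sup TYPE('d::finite) \<kappa> \<longleftrightarrow> ennreal \<kappa> < green (0 :: int ^ 'd)"
    and "0 \<le> spectral_sup TYPE('d::finite) \<kappa>"
proof -
  have green_le: "green (0 :: int ^ 'd) \<le> ennreal \<kappa> \<longleftrightarrow> (\<forall>\<theta>>0. green_kernel (2 * real CARD('d) * \<kappa>) \<theta> (0 :: int ^ 'd) < 1)"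
  proof (cases "\<kappa> = 0")
    case True
    have "\<not> green_kernel 0 1 (0 :: int ^ 'd) < 1" using green_kernel_resolvent[of 0 1 "0 :: int ^ 'd"] by simp
    moreover have "green (0 :: int ^ 'd) \<noteq> 0" by (rule green_neq_0)
    ultimately show ?thesis using True by (auto intro!: exI[of _ 1])
  next
    case False
    then have \<kappa>0: "0 < \<kappa>" using \<kappa> by simp
    have "green (0 :: int ^ 'd) = ennreal \<kappa> * (\<integral>\<^sup>+s. indicator {0..} s * ennreal (heat (2 * real CARD('d) * \<kappa> * s) (0 :: int ^ 'd)) \<partial>lborel)"
      unfolding green_eq by (subst nn_integral_Ici_scale[OF _ \<kappa>0]) (auto simp: mult.assoc)
    then have "green (0 :: int ^ 'd) \<le> ennreal \<kappa> \<longleftrightarrow> (\<integral>\<^sup>+s. indicator {0..} s * ennreal (heat (2 * real CARD('d) * \<kappa> * s) (0 :: int ^ 'd)) \<partial>lborel) \<le> 1"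
      using \<kappa>0 ennreal_mult_le_mult_iff[of "ennreal \<kappa>" _ 1] by simp
    also have "\<dots> \<longleftrightarrow> (\<forall>\<theta>>0. green_kernel (2 * real CARD('d) * \<kappa>) \<theta> (0 :: int ^ 'd) < 1)"
      by (rule nn_integral_heat_le_1_iff) (use \<kappa> in simp)
    finally show ?thesis .
  qed
  have green_less: "ennreal \<kappa> < green (0 :: int ^ 'd) \<longleftrightarrow> \<not> (\<forall>\<theta>>0. green_kernel (2 * real CARD('d) * \<kappa>) \<theta> (0 :: int ^ 'd) < 1)"
    unfolding green_le[symmetric] by (simp add: not_le)
  from \<kappa> show "0 < spectral_sup TYPE('d::finite) \<kappa> \<longleftrightarrow> ennreal \<kappa> < green (0 :: int ^ 'd)"
    unfolding green_less
  proof (cases rule: criticality_cases[where 'd='d])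
    case (supercritical \<theta>)
    then show "0 < spectral_sup TYPE('d) \<kappa> \<longleftrightarrow> \<not> (\<forall>\<theta>>0. green_kernel (2 * real CARD('d) * \<kappa>) \<theta> (0 :: int ^ 'd) < 1)"
      using spectral_sup_critical[OF \<kappa>, of \<theta>, where 'd='d] by (auto intro!: exI[of _ \<theta>])
  next
    case subcritical
    then show "0 < spectral_sup TYPE('d) \<kappa> \<longleftrightarrow> \<not> (\<forall>\<theta>>0. green_kernel (2 * real CARD('d) * \<kappa>) \<theta> (0 :: int ^ 'd) < 1)"
      using spectral_sup_subcritical[OF \<kappa>, where 'd='d] by auto
  qed
  from \<kappa> show "0 \<le> spectral_sup TYPE('d::finite) \<kappa>"
  proof (cases rule: criticality_cases[where 'd='d])
    case (supercritical \<theta>)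
    then show ?thesis using spectral_sup_critical[OF \<kappa>, of \<theta>, where 'd='d] by auto
  next
    case subcritical
    then show ?thesis using spectral_sup_subcritical[OF \<kappa>, where 'd='d] by auto
  qed
qed

section \<open>Existence of the growth rate of the moments\<close>

text \<open>\<open>ln (K t x x)\<close> is superadditive in \<open>t\<close>, so its rate is a
  supremum \<open>L x\<close>. Travelling from \<open>x\<close> to \<open>y\<close> and back costs a
  constant factor, which makes \<open>L\<close> constant, and symmetry gives
  \<open>K t x y ^ 2 \<le> K (2 * t) x x\<close>, which controls the other entries. The hypothesis
  \<open>lb\<close> takes care of the leftover time when a real \<open>t\<close> is filled with
  periods of length \<open>s\<close>.\<close>

theorem symmetric_kernel_growth:
  fixes K :: "real \<Rightarrow> 's \<Rightarrow> 's \<Rightarrow> real"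
  assumes ck: "\<And>s t x y z. 0 < s \<Longrightarrow> 0 < t \<Longrightarrow> K s x y * K t y z \<le> K (s + t) x z"
    and sym: "\<And>t x y. 0 < t \<Longrightarrow> K t x y = K t y x"
    and pos: "\<And>t x y. 0 < t \<Longrightarrow> 0 < K t x y"
    and ub: "\<And>t x. 0 < t \<Longrightarrow> K t x x \<le> exp (B * t)"
    and lb: "\<And>t x. 0 < t \<Longrightarrow> exp (- C * t) \<le> K t x x"
  obtains \<Lambda> where "\<And>t x y. 0 < t \<Longrightarrow> K t x y \<le> exp (\<Lambda> * t)"
    "\<And>x. ((\<lambda>t. ln (K t x x) / t) \<longlongrightarrow> \<Lambda>) at_top"
proof -
  define L where "L = (\<lambda>x. SUP t\<in>{0<..}. ln (K t x x) / t)"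
  have bdd: "bdd_above ((\<lambda>t. ln (K t x x) / t) ` {0<..})" for x
  proof (rule bdd_aboveI2)
    fix t :: real assume "t \<in> {0<..}"
    then have "ln (K t x x) \<le> ln (exp (B * t))" using ub[of t x] pos[of t x x] by (intro ln_mono) auto
    then have "ln (K t x x) \<le> B * t" by simp
    then show "ln (K t x x) / t \<le> B" using \<open>t \<in> {0<..}\<close> by (simp add: field_simps)
  qed
  have K_L: "ln (K t x x) \<le> L x * t" if "0 < t" for t x
  proof -
    have "ln (K t x x) / t \<le> L x" unfolding L_def using that by (intro cSUP_upper bdd) auto
    then show ?thesis using that by (simp add: field_simps)
  qed
  have powers: "K t x x ^ Suc m \<le> K (real (Suc m) * t) x x" if "0 < t" for t x m
  proof (induction m)
    case (Suc m)
    have "K t x x ^ Suc (Suc m) \<le> K t x x * K (real (Suc m) * t) x x"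
      using Suc pos[OF that, of x x] by (simp add: mult_left_mono)
    also have "\<dots> \<le> K (t + real (Suc m) * t) x x" using that by (intro ck) auto
    also have "t + real (Suc m) * t = real (Suc (Suc m)) * t" by (simp add: algebra_simps)
    finally show ?case .
  qed simp
  have L_le: "L y \<le> L x" for x y
  proof (subst (1) L_def, rule cSUP_least)
    fix t :: real assume "t \<in> {0<..}"
    then have t: "0 < t" by simp
    \<comment> \<open>One time unit from \<open>x\<close> to \<open>y\<close> and one back; divided
      by the number of periods this cost tends to zero.\<close>
    define c where "c = ln (K 1 x y) + ln (K 1 y x)"
    have *: "c + real (Suc m) * ln (K t y y) \<le> L x * (2 + real (Suc m) * t)" for m
    proof -
      have "K 1 x y * K t y y ^ Suc m * K 1 y x \<le> K 1 x y * K (real (Suc m) * t) y y * K 1 y x"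
        using powers[OF t, of y m] pos[of 1 x y] pos[of 1 y x] by (intro mult_right_mono mult_left_mono) auto
      also have "\<dots> \<le> K (1 + real (Suc m) * t) x y * K 1 y x"
        using t pos[of 1 y x] by (intro mult_right_mono ck) auto
      also have "\<dots> \<le> K (1 + real (Suc m) * t + 1) x x" using t by (intro ck) (auto intro: add_pos_pos)
      finally have "ln (K 1 x y * K t y y ^ Suc m * K 1 y x) \<le> ln (K (1 + real (Suc m) * t + 1) x x)"
        using pos[of 1 x y] pos[of 1 y x] pos[OF t, of y y] by (intro ln_mono) auto
      also have "\<dots> \<le> L x * (1 + real (Suc m) * t + 1)" using t by (intro K_L) (auto intro: add_pos_pos)
      also have "ln (K 1 x y * K t y y ^ Suc m * K 1 y x) = c + real (Suc m) * ln (K t y y)"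
        using pos[of 1 x y] pos[of 1 y x] pos[OF t, of y y] by (simp add: c_def ln_mult ln_realpow del: power_Suc of_nat_Suc)
      finally show ?thesis by (simp add: algebra_simps)
    qed
    have "(\<lambda>m. c / real (Suc m) + ln (K t y y)) \<longlonglongrightarrow> 0 + ln (K t y y)"
      by (intro tendsto_intros LIMSEQ_Suc lim_const_over_n)
    moreover have "(\<lambda>m. L x * (2 / real (Suc m) + t)) \<longlonglongrightarrow> L x * (0 + t)"
      by (intro tendsto_intros LIMSEQ_Suc lim_const_over_n)
    ultimately have "0 + ln (K t y y) \<le> L x * (0 + t)"
    proof (rule LIMSEQ_le)
      have "c / real (Suc m) + ln (K t y y) \<le> L x * (2 / real (Suc m) + t)" for m
      proof -
        have "(c + real (Suc m) * ln (K t y y)) / real (Suc m) \<le> L x * (2 + real (Suc m) * t) / real (Suc m)"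
          by (intro divide_right_mono *) simp
        then show ?thesis by (simp add: add_divide_distrib distrib_left del: of_nat_Suc)
      qed
      then show "\<exists>N. \<forall>m\<ge>N. c / real (Suc m) + ln (K t y y) \<le> L x * (2 / real (Suc m) + t)" by blast
    qed
    then show "ln (K t y y) / t \<le> L x" using t by (simp add: field_simps)
  qed simp_all
  define \<Lambda> where "\<Lambda> = L undefined"
  have L_eq: "L x = \<Lambda>" for x unfolding \<Lambda>_def by (rule antisym[OF L_le L_le])
  show thesis
  proof (rule that)
    show "K t x y \<le> exp (\<Lambda> * t)" if t: "0 < t" for t x y
    proof -
      have "K t x y * K t x y \<le> K (t + t) x x" using ck[OF t t, of x y x] sym[OF t, of x y] by simp
      also have "\<dots> \<le> exp (\<Lambda> * (t + t))"
      proof -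
        have "exp (ln (K (t + t) x x)) \<le> exp (\<Lambda> * (t + t))"
          using K_L[of "t + t" x] t unfolding L_eq by simp
        moreover have "exp (ln (K (t + t) x x)) = K (t + t) x x" using pos[of "t + t" x x] t by simp
        ultimately show ?thesis by (simp only:)
      qed
      also have "\<dots> = exp (\<Lambda> * t) * exp (\<Lambda> * t)" by (simp add: exp_add[symmetric] algebra_simps)
      finally have "(K t x y)\<^sup>2 \<le> (exp (\<Lambda> * t))\<^sup>2" by (simp add: power2_eq_square)
      then show ?thesis by (rule power2_le_imp_le) simp
    qed
    show "((\<lambda>t. ln (K t x x) / t) \<longlongrightarrow> \<Lambda>) at_top" for x
    proof (rule order_tendstoI)
      fix u assume u: "\<Lambda> < u"
      show "\<forall>\<^sub>F t in at_top. ln (K t x x) / t < u"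
        using eventually_gt_at_top[of 0]
      proof eventually_elim
        case (elim t)
        then have "ln (K t x x) / t \<le> \<Lambda>" using K_L[of t x] L_eq by (simp add: field_simps)
        then show ?case using u by simp
      qed
    next
      fix l assume l: "l < \<Lambda>"
      then have "l < L x" by (simp add: L_eq)
      then obtain s where s: "0 < s" "l < ln (K s x x) / s"
        unfolding L_def using less_cSUP_iff[OF _ bdd[of x], of l] by auto
      define v where "v = ln (K s x x)"
      have bound: "v / s - (\<bar>v\<bar> + \<bar>C\<bar> * s) / t \<le> ln (K t x x) / t" if t: "s < t" for t
      proof -
        \<comment> \<open>\<open>Suc m\<close> periods of length \<open>s\<close> leave a remainder
          \<open>r\<close> with \<open>0 < r \<le> s\<close>. It has to be positive, as the
          hypotheses speak of positive times only.\<close>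
        define m where "m = nat (\<lceil>t / s\<rceil> - 2)"
        have ts: "1 < t / s" using t s by simp
        then have "2 \<le> \<lceil>t / s\<rceil>" by linarith
        then have m: "real (Suc m) = of_int \<lceil>t / s\<rceil> - 1" by (simp add: m_def)
        have m1: "real (Suc m) < t / s" "t / s \<le> real (Suc m) + 1" unfolding m by linarith+
        define r where "r = t - real (Suc m) * s"
        have r: "0 < r" "r \<le> s" using m1 s by (auto simp: r_def field_simps)
        have "K s x x ^ Suc m * exp (- \<bar>C\<bar> * s) \<le> K (real (Suc m) * s) x x * K r x x"
        proof (intro mult_mono powers s)
          have "exp (- \<bar>C\<bar> * s) \<le> exp (- C * r)"
            using r by (auto intro: order_trans[OF mult_right_mono mult_left_mono])
          also have "\<dots> \<le> K r x x" by (rule lb[OF r(1)])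
          finally show "exp (- \<bar>C\<bar> * s) \<le> K r x x" .
        qed (use pos s in \<open>auto intro!: less_imp_le simp del: of_nat_Suc\<close>)
        also have "\<dots> \<le> K (real (Suc m) * s + r) x x" using r s by (intro ck) auto
        also have "real (Suc m) * s + r = t" by (simp add: r_def)
        finally have "ln (K s x x ^ Suc m * exp (- \<bar>C\<bar> * s)) \<le> ln (K t x x)"
          using pos[OF s(1), of x x] by (intro ln_mono) auto
        moreover have "ln (K s x x ^ Suc m * exp (- \<bar>C\<bar> * s)) = real (Suc m) * v - \<bar>C\<bar> * s"
          using pos[OF s(1), of x x] by (simp add: ln_mult ln_realpow v_def del: power_Suc of_nat_Suc)
        moreover have "(t / s) * v - \<bar>v\<bar> \<le> real (Suc m) * v"
        proof (cases "0 \<le> v")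
          case True
          then have "(t / s - 1) * v \<le> real (Suc m) * v" using m1 by (intro mult_right_mono) auto
          then show ?thesis using True by (simp add: algebra_simps)
        next
          case False
          then have "(t / s) * v \<le> real (Suc m) * v" using m1 by (intro mult_right_mono_neg) auto
          then show ?thesis by simp
        qed
        ultimately have "(t / s) * v - \<bar>v\<bar> - \<bar>C\<bar> * s \<le> ln (K t x x)" by linarith
        then have "((t / s) * v - \<bar>v\<bar> - \<bar>C\<bar> * s) / t \<le> ln (K t x x) / t" using t s by (intro divide_right_mono) auto
        then show ?thesis using t s by (simp add: diff_divide_distrib add_divide_distrib)
      qed
      have "((\<lambda>t. v / s - (\<bar>v\<bar> + \<bar>C\<bar> * s) / t) \<longlongrightarrow> v / s - 0) at_top"
        by (intro tendsto_diff tendsto_const real_tendsto_divide_at_top[OF tendsto_const] filterlim_ident)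
      then have "\<forall>\<^sub>F t in at_top. l < v / s - (\<bar>v\<bar> + \<bar>C\<bar> * s) / t"
        using s(2) by (intro order_tendstoD) (auto simp: v_def)
      then show "\<forall>\<^sub>F t in at_top. l < ln (K t x x) / t"
        using eventually_gt_at_top[of s]
        by eventually_elim (use bound in force)
    qed
  qed
qed

text \<open>Keeps the index sets \<open>{1..n}\<close> from being rewritten to \<open>{Suc 0..n}\<close>.\<close>

declare One_nat_def [simp del]

section \<open>Splicing and reversing families of walks\<close>

lemma measurable_splice_walks [measurable]:
  "(\<lambda>x. \<lambda>j\<in>{1..p}. splice u (fst x j) (snd x j)) \<in> measurable (walks p \<Otimes>\<^sub>M walks p) (walks p :: (nat \<Rightarrow> nat \<Rightarrow> real \<times> (int ^ 'd)) measure)"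
  by (rule measurable_restrict) measurable

text \<open>The walks of a family are independent, so the Markov property holds for all of them with
  a common splice time. The restriction to \<open>{1..p}\<close> keeps the result in the space of
  extensional functions.\<close>

lemma nn_integral_walks_splice:
  fixes F :: "(nat \<Rightarrow> nat \<Rightarrow> real \<times> (int ^ 'd)) \<Rightarrow> ennreal"
  assumes F [measurable]: "F \<in> borel_measurable (walks p)" and u: "0 \<le> u"
  shows "(\<integral>\<^sup>+\<xi>. F \<xi> \<partial>walks p) = (\<integral>\<^sup>+\<xi>. \<integral>\<^sup>+\<xi>'. F (\<lambda>j\<in>{1..p}. splice u (\<xi> j) (\<xi>' j)) \<partial>walks p \<partial>walks p)"
proof -
  interpret P: prob_space "walks p :: (nat \<Rightarrow> nat \<Rightarrow> real \<times> (int ^ 'd)) measure" by (rule prob_space_walks)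
  let ?f = "\<lambda>x. \<lambda>j\<in>{1..p}. splice u (fst x j) (snd x j)"
  have "distr (walks p \<Otimes>\<^sub>M walks p) (walks p) ?f = (walks p :: (nat \<Rightarrow> nat \<Rightarrow> real \<times> (int ^ 'd)) measure)"
  proof (rule walks_prod.PiM_eqI)
    fix A :: "nat \<Rightarrow> (nat \<Rightarrow> real \<times> (int ^ 'd)) set"
    assume A: "\<And>i. i \<in> {1..p} \<Longrightarrow> A i \<in> sets walk_space"
    have X: "Pi\<^sub>E {1..p} A \<in> sets (walks p)" using A by (intro sets_PiM_I_finite) auto
    have ind: "indicator (Pi\<^sub>E {1..p} A) (\<lambda>j\<in>{1..p}. z j) = (\<Prod>j\<in>{1..p}. indicator (A j) (z j) :: ennreal)" for z
      by (auto simp: indicator_def PiE_iff prod_zero_iff)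
    have [measurable]: "(\<lambda>\<omega>. indicator (A j) (splice u (f \<omega>) (g \<omega>)) :: ennreal) \<in> borel_measurable M"
      if "j \<in> {1..p}" and [measurable]: "f \<in> measurable M walk_space" "g \<in> measurable M walk_space" for j M f and g :: "'z \<Rightarrow> nat \<Rightarrow> real \<times> (int ^ 'd)"
      using A[OF that(1)] by measurable
    have "emeasure (distr (walks p \<Otimes>\<^sub>M walks p) (walks p) ?f) (Pi\<^sub>E {1..p} A) =
      (\<integral>\<^sup>+\<xi>. indicator (Pi\<^sub>E {1..p} A) \<xi> \<partial>distr (walks p \<Otimes>\<^sub>M walks p) (walks p) ?f)"
      using X by (subst nn_integral_indicator) auto
    also have "\<dots> = (\<integral>\<^sup>+x. indicator (Pi\<^sub>E {1..p} A) (?f x) \<partial>(walks p \<Otimes>\<^sub>M walks p))"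
      using X by (intro nn_integral_distr) auto
    also have "\<dots> = (\<integral>\<^sup>+x. (\<Prod>j\<in>{1..p}. indicator (A j) (splice u (fst x j) (snd x j))) \<partial>(walks p \<Otimes>\<^sub>M walks p))"
      by (simp only: ind)
    also have "\<dots> = (\<integral>\<^sup>+\<xi>. \<integral>\<^sup>+\<xi>'. (\<Prod>j\<in>{1..p}. indicator (A j) (splice u (\<xi> j) (\<xi>' j))) \<partial>walks p \<partial>walks p)"
      by (subst P.nn_integral_fst[symmetric]) auto
    also have "\<dots> = (\<integral>\<^sup>+\<xi>. (\<Prod>j\<in>{1..p}. \<integral>\<^sup>+\<omega>. indicator (A j) (splice u (\<xi> j) \<omega>) \<partial>walk_space) \<partial>walks p)"
      by (intro nn_integral_cong nn_integral_walks_prod) auto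
    also have "\<dots> = (\<Prod>j\<in>{1..p}. \<integral>\<^sup>+\<omega>. \<integral>\<^sup>+\<omega>'. indicator (A j) (splice u \<omega> \<omega>') \<partial>walk_space \<partial>walk_space)"
      by (rule nn_integral_walks_prod) measurable
    also have "\<dots> = (\<Prod>j\<in>{1..p}. emeasure walk_space (A j))"
    proof (intro prod.cong refl)
      fix j assume j: "j \<in> {1..p}"
      have "(\<integral>\<^sup>+\<omega>. indicator (A j) \<omega> \<partial>walk_space) = (\<integral>\<^sup>+\<omega>. \<integral>\<^sup>+\<omega>'. (indicator (A j) (splice u \<omega> \<omega>') :: ennreal) \<partial>walk_space \<partial>walk_space)"
        by (rule nn_integral_splice) (use A[OF j] u in auto)
      then show "(\<integral>\<^sup>+\<omega>. \<integral>\<^sup>+\<omega>'. indicator (A j) (splice u \<omega> \<omega>') \<partial>walk_space \<partial>walk_space) = emeasure walk_space (A j)"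
        using A[OF j] by simp
    qed
    finally show "emeasure (distr (walks p \<Otimes>\<^sub>M walks p) (walks p) ?f) (Pi\<^sub>E {1..p} A) = (\<Prod>j\<in>{1..p}. emeasure walk_space (A j))" .
  qed auto
  then have "(\<integral>\<^sup>+\<xi>. F \<xi> \<partial>walks p) = (\<integral>\<^sup>+\<xi>. F \<xi> \<partial>distr (walks p \<Otimes>\<^sub>M walks p) (walks p) ?f)" by simp
  also have "\<dots> = (\<integral>\<^sup>+x. F (?f x) \<partial>(walks p \<Otimes>\<^sub>M walks p))"
    by (rule nn_integral_distr) measurable
  also have "\<dots> = (\<integral>\<^sup>+\<xi>. \<integral>\<^sup>+\<xi>'. F (\<lambda>j\<in>{1..p}. splice u (\<xi> j) (\<xi>' j)) \<partial>walks p \<partial>walks p)"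
    by (subst P.nn_integral_fst[symmetric]) auto
  finally show ?thesis .
qed

text \<open>A map applied in every coordinate carries the product measure to the product of the
  image laws, so only the law of the map matters. It is used for grid paths and their
  reversals.\<close>

lemma nn_integral_walks_cong_distr:
  fixes \<phi> \<psi> :: "(nat \<Rightarrow> real \<times> (int ^ 'd)) \<Rightarrow> 'b"
  assumes \<phi>: "\<phi> \<in> measurable walk_space N" and \<psi>: "\<psi> \<in> measurable walk_space N"
    and eq: "distr walk_space N \<phi> = distr walk_space N \<psi>"
    and G: "G \<in> borel_measurable (\<Pi>\<^sub>M j\<in>{1..p}. N)" and N: "prob_space N"
  shows "(\<integral>\<^sup>+\<xi>. G (\<lambda>j\<in>{1..p}. \<phi> (\<xi> j)) \<partial>walks p) = (\<integral>\<^sup>+\<xi>. G (\<lambda>j\<in>{1..p}. \<psi> (\<xi> j)) \<partial>walks p)"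
proof -
  have *: "(\<integral>\<^sup>+\<xi>. G (\<lambda>j\<in>{1..p}. \<phi> (\<xi> j)) \<partial>walks p) = (\<integral>\<^sup>+z. G z \<partial>(\<Pi>\<^sub>M j\<in>{1..p}. distr walk_space N \<phi>))"
    if [measurable]: "\<phi> \<in> measurable walk_space N" for \<phi>
  proof -
    have m: "(\<lambda>\<xi>. \<lambda>j\<in>{1..p}. \<phi> (\<xi> j)) \<in> measurable (walks p) (\<Pi>\<^sub>M j\<in>{1..p}. N)"
      by (rule measurable_restrict) measurable
    have "distr (walks p) (\<Pi>\<^sub>M j\<in>{1..p}. N) (\<lambda>\<xi>. \<lambda>j\<in>{1..p}. \<phi> (\<xi> j)) = (\<Pi>\<^sub>M j\<in>{1..p}. distr walk_space N \<phi>)"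
    proof -
      have *: "distr (walks p) (\<Pi>\<^sub>M j\<in>{1..p}. N) (compose {1..p} \<phi>) = (\<Pi>\<^sub>M j\<in>{1..p}. distr walk_space N \<phi>)"
        by (rule distr_PiM_finite_prob_space') (use that N walk_space.prob_space_axioms in auto)
      have "(\<lambda>\<xi>. \<lambda>j\<in>{1..p}. \<phi> (\<xi> j)) = compose {1..p} \<phi>" by (simp add: compose_def fun_eq_iff)
      with * show ?thesis by simp
    qed
    then show ?thesis using nn_integral_distr[OF m, of G] G by simp
  qed
  show ?thesis using *[OF \<phi>] *[OF \<psi>] eq by simp
qed

definition grid_path :: "real \<Rightarrow> nat \<Rightarrow> (nat \<Rightarrow> real \<times> (int ^ 'd)) \<Rightarrow> (int ^ 'd) list" where
  "grid_path g N \<omega> = map (\<lambda>m. unit_walk \<omega> (real m * g)) [0..<Suc N]"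

text \<open>The path read backwards from its last grid position and recentred to start at
  \<open>0\<close>. Lists over a countable type have discrete laws, which can be compared atom by
  atom.\<close>

definition reversed_path :: "real \<Rightarrow> nat \<Rightarrow> (nat \<Rightarrow> real \<times> (int ^ 'd)) \<Rightarrow> (int ^ 'd) list" where
  "reversed_path g N \<omega> = map (\<lambda>m. unit_walk \<omega> (real (N - m) * g) - unit_walk \<omega> (real N * g)) [0..<Suc N]"

lemma map_upt_eq_iff: "map f [0..<Suc N] = l \<longleftrightarrow> length l = Suc N \<and> (\<forall>m\<le>N. f m = l ! m)"
  by (auto simp: list_eq_iff_nth_eq less_Suc_eq_le simp del: upt_Suc)

lemma sets_map_upt_eq:
  fixes f :: "'a \<Rightarrow> nat \<Rightarrow> int ^ 'd"
  assumes "\<And>m. (\<lambda>x. f x m) \<in> measurable M (count_space UNIV)"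
  shows "(\<lambda>x. map (f x) [0..<Suc N]) \<in> measurable M (count_space UNIV)"
proof (rule measurable_count_space_eq2_countable[THEN iffD2], intro conjI ballI)
  fix l :: "(int ^ 'd) list"
  have [measurable]: "(\<lambda>x. f x m) \<in> measurable M (count_space UNIV)" for m by (rule assms)
  have "(\<lambda>x. map (f x) [0..<Suc N]) -` {l} \<inter> space M = {x \<in> space M. length l = Suc N \<and> (\<forall>m\<in>{..N}. f x m = l ! m)}"
    by (auto simp: map_upt_eq_iff simp del: upt_Suc)
  also have "\<dots> \<in> sets M" by measurable
  finally show "(\<lambda>x. map (f x) [0..<Suc N]) -` {l} \<inter> space M \<in> sets M" .
qed auto

lemma measurable_grid_path [measurable]: "grid_path g N \<in> measurable walk_space (count_space UNIV)"
  unfolding grid_path_def[abs_def] by (rule sets_map_upt_eq) measurable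

lemma measurable_reversed_path [measurable]: "reversed_path g N \<in> measurable walk_space (count_space UNIV)"
  unfolding reversed_path_def[abs_def] by (rule sets_map_upt_eq) measurable

lemma prod_indicator_singleton: "finite A \<Longrightarrow> (\<Prod>j\<in>A. indicator {z j} (f j)) = (if \<forall>j\<in>A. f j = z j then 1 else 0 :: ennreal)"
proof (cases "\<forall>j\<in>A. f j = z j")
  case False
  assume "finite A"
  obtain j where "j \<in> A" "f j \<noteq> z j" using False by auto
  then have "(\<Prod>j\<in>A. indicator {z j} (f j)) = (0 :: ennreal)"
    using \<open>finite A\<close> by (intro prod_zero) (auto intro!: bexI[of _ j])
  then show ?thesis using False by simp
qed simp

lemma prod_indicator_eq:
  fixes N :: nat
  shows "(\<Prod>m\<le>N. indicator {z m} (f m)) = (if \<forall>m\<le>N. f m = z m then 1 else 0 :: ennreal)"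
  by (subst prod_indicator_singleton) auto

text \<open>The increments over the grid are exchangeable and symmetric.\<close>

lemma distr_grid_path_reversed:
  assumes g: "0 \<le> g"
  shows "distr walk_space (count_space UNIV) (grid_path g N) = distr walk_space (count_space UNIV) (reversed_path g N :: (nat \<Rightarrow> real \<times> (int ^ 'd)) \<Rightarrow> _)"
proof (rule measure_eqI_countable[where A=UNIV])
  fix l :: "(int ^ 'd) list"
  have em: "emeasure (distr walk_space (count_space UNIV) D) {l} = (\<integral>\<^sup>+\<omega>. (if D \<omega> = l then 1 else 0) \<partial>walk_space)"
    if D: "D \<in> measurable walk_space (count_space UNIV)" for D :: "(nat \<Rightarrow> real \<times> (int ^ 'd)) \<Rightarrow> (int ^ 'd) list"
  proof -
    have "emeasure (distr walk_space (count_space UNIV) D) {l} = (\<integral>\<^sup>+y. indicator {l} y \<partial>distr walk_space (count_space UNIV) D)"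
      by (subst nn_integral_indicator) auto
    also have "\<dots> = (\<integral>\<^sup>+\<omega>. indicator {l} (D \<omega>) \<partial>walk_space)"
      by (rule nn_integral_distr[OF D]) auto
    finally show ?thesis by (simp add: indicator_def of_bool_def)
  qed
  show "emeasure (distr walk_space (count_space UNIV) (grid_path g N)) {l} =
    emeasure (distr walk_space (count_space UNIV) (reversed_path g N :: (nat \<Rightarrow> real \<times> (int ^ 'd)) \<Rightarrow> _)) {l}"
  \<comment> \<open>Other lists have probability zero on both sides: both paths have
    \<open>N + 1\<close> entries and start at \<open>0\<close>, the grid path almost surely.\<close>
  proof (cases "length l = Suc N \<and> l ! 0 = 0")
    case True
    have "(\<integral>\<^sup>+\<omega>. (if grid_path g N \<omega> = l then 1 else 0) \<partial>walk_space) =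
      (\<integral>\<^sup>+\<omega>. (\<Prod>m\<le>N. indicator {l ! m} (0 + unit_walk \<omega> (real m * g))) \<partial>walk_space)"
      using True by (simp add: prod_indicator_eq grid_path_def map_upt_eq_iff del: upt_Suc)
    also have "\<dots> = (\<Prod>m<N. ennreal (heat g (l ! Suc m - l ! m)))"
      using True by (subst nn_integral_grid[OF g]) simp
    also have "\<dots> = (\<Prod>m<N. ennreal (heat g (l ! (N - Suc m) - l ! (N - m))))"
    proof (rule prod.reindex_bij_witness[of _ "\<lambda>m. N - Suc m" "\<lambda>m. N - Suc m"])
      fix m assume "m \<in> {..<N}"
      then have "N - Suc (N - Suc m) = m" "N - (N - Suc m) = Suc m" by auto
      then show "ennreal (heat g (l ! (N - Suc (N - Suc m)) - l ! (N - (N - Suc m)))) = ennreal (heat g (l ! Suc m - l ! m))"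
        using heat_uminus[of g "l ! Suc m - l ! m"] by simp
    qed auto
    also have "\<dots> = (\<Prod>m<N. ennreal (heat g ((l ! (N - Suc m) - l ! N) - (l ! (N - m) - l ! N))))" by simp
    also have "\<dots> = (\<integral>\<^sup>+\<omega>. (\<Prod>m\<le>N. indicator {l ! (N - m) - l ! N} (0 + unit_walk \<omega> (real m * g))) \<partial>walk_space)"
      by (subst nn_integral_grid[OF g]) simp
    also have "\<dots> = (\<integral>\<^sup>+\<omega>. (if reversed_path g N \<omega> = l then 1 else 0) \<partial>walk_space)"
    proof (rule nn_integral_cong_AE, use AE_regular in eventually_elim)
      fix \<omega> :: "nat \<Rightarrow> real \<times> (int ^ 'd)" assume "regular \<omega>"
      then have w0: "unit_walk \<omega> 0 = 0" by (simp add: unit_walk_0)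
      have LR: "(\<forall>m\<le>N. unit_walk \<omega> (real m * g) = l ! (N - m) - l ! N) \<longleftrightarrow>
        (\<forall>m\<le>N. unit_walk \<omega> (real (N - m) * g) - unit_walk \<omega> (real N * g) = l ! m)" (is "?L \<longleftrightarrow> ?R")
      proof
        assume L: ?L
        have "unit_walk \<omega> (real N * g) = - l ! N" using L[rule_format, of N] True by simp
        moreover have "unit_walk \<omega> (real (N - m) * g) = l ! m - l ! N" if "m \<le> N" for m
          using L[rule_format, of "N - m"] that by simp
        ultimately show ?R by simp
      next
        assume R: ?R
        have "l ! N = 0 - unit_walk \<omega> (real N * g)"
          unfolding R[rule_format, OF order_refl, symmetric] using w0 by simp
        then have wN: "unit_walk \<omega> (real N * g) = - l ! N" by simp
        show ?L
        proof (intro allI impI)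
          fix m assume "m \<le> N"
          then have "unit_walk \<omega> (real m * g) - unit_walk \<omega> (real N * g) = l ! (N - m)"
            using R[rule_format, of "N - m"] by simp
          then show "unit_walk \<omega> (real m * g) = l ! (N - m) - l ! N"
            unfolding wN diff_minus_eq_add diff_eq_eq[symmetric] by (simp add: eq_diff_eq)
        qed
      qed
      have "reversed_path g N \<omega> = l \<longleftrightarrow> (\<forall>m\<le>N. unit_walk \<omega> (real (N - m) * g) - unit_walk \<omega> (real N * g) = l ! m)"
        unfolding reversed_path_def map_upt_eq_iff using True by simp
      then show "(\<Prod>m\<le>N. indicator {l ! (N - m) - l ! N} (0 + unit_walk \<omega> (real m * g))) = (if reversed_path g N \<omega> = l then 1 else 0 :: ennreal)"
        unfolding prod_indicator_eq add_0_left LR by (simp only:)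
    qed
    finally show ?thesis by (simp add: em)
  next
    case False
    have "AE \<omega> in walk_space. grid_path g N \<omega> \<noteq> l"
      using AE_regular
    proof eventually_elim
      case (elim \<omega>)
      then have "unit_walk \<omega> 0 = 0" by (simp add: unit_walk_0)
      then show ?case using False by (auto simp: grid_path_def map_upt_eq_iff simp del: upt_Suc intro!: exI[of _ 0])
    qed
    moreover have "reversed_path g N \<omega> \<noteq> l" for \<omega> :: "nat \<Rightarrow> real \<times> (int ^ 'd)"
      using False by (auto simp: reversed_path_def map_upt_eq_iff simp del: upt_Suc intro!: exI[of _ 0])
    moreover have "(\<integral>\<^sup>+\<omega>. (if grid_path g N \<omega> = l then 1 else 0) \<partial>walk_space) = (\<integral>\<^sup>+\<omega>. (0 :: ennreal) \<partial>(walk_space :: (nat \<Rightarrow> real \<times> (int ^ 'd)) measure))"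
      by (rule nn_integral_cong_AE) (use calculation(1) in eventually_elim, simp)
    ultimately show ?thesis by (simp add: em)
  qed
qed auto

text \<open>
  The time variable is that of the Feynman--Kac formula, in which the catalysts run backwards: they are
  at \<open>ys\<close> when the \<open>p\<close> walks start from \<open>xs\<close>, and at their own starting points \<open>ys'\<close> when the walks arrive
  at \<open>xs'\<close>. With this convention \<open>pinned\<close> is a kernel from \<open>(xs, ys)\<close> to \<open>(xs', ys')\<close>.
\<close>

definition pinned_weight ::
    "real \<Rightarrow> real \<Rightarrow> nat \<Rightarrow> nat \<Rightarrow> real \<Rightarrow> (nat \<Rightarrow> int ^ 'd) \<Rightarrow> (nat \<Rightarrow> int ^ 'd) \<Rightarrow> (nat \<Rightarrow> int ^ 'd) \<Rightarrow> (nat \<Rightarrow> int ^ 'd) \<Rightarrow>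
      (nat \<Rightarrow> nat \<Rightarrow> real \<times> (int ^ 'd)) \<Rightarrow> (nat \<Rightarrow> nat \<Rightarrow> real \<times> (int ^ 'd)) \<Rightarrow> ennreal" where
  "pinned_weight a b p n t xs ys xs' ys' \<eta> \<xi> =
    (\<Prod>j\<in>{1..p}. indicator {xs' j} (xs j + unit_walk (\<xi> j) (a * t))) *
    (\<Prod>k\<in>{1..n}. indicator {ys k} (ys' k + unit_walk (\<eta> k) (b * t))) *
    ennreal (exp (\<Sum>j\<in>{1..p}. \<Sum>k\<in>{1..n}. overlap a b (xs j - ys' k) t (\<xi> j) (\<eta> k)))"

definition pinned ::
    "real \<Rightarrow> real \<Rightarrow> nat \<Rightarrow> nat \<Rightarrow> real \<Rightarrow> (nat \<Rightarrow> int ^ 'd) \<Rightarrow> (nat \<Rightarrow> int ^ 'd) \<Rightarrow> (nat \<Rightarrow> int ^ 'd) \<Rightarrow> (nat \<Rightarrow> int ^ 'd) \<Rightarrow> ennreal" where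
  "pinned a b p n t xs ys xs' ys' = (\<integral>\<^sup>+\<eta>. \<integral>\<^sup>+\<xi>. pinned_weight a b p n t xs ys xs' ys' \<eta> \<xi> \<partial>walks p \<partial>walks n)"

lemma measurable_pinned_weight [measurable]:
  assumes [measurable]: "f \<in> measurable M (walks n)" "g \<in> measurable M (walks p)"
  shows "(\<lambda>x. pinned_weight a b p n t xs ys xs' ys' (f x) (g x)) \<in> borel_measurable M"
proof -
  have [measurable]: "(\<lambda>x. f x k) \<in> measurable M walk_space" if "k \<in> {1..n}" for k
    by (rule measurable_compose[OF assms(1) measurable_walks_component[OF that]])
  have [measurable]: "(\<lambda>x. g x k) \<in> measurable M walk_space" if "k \<in> {1..p}" for k
    by (rule measurable_compose[OF assms(2) measurable_walks_component[OF that]])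
  show ?thesis unfolding pinned_weight_def by measurable
qed

lemma pinned_weight_eq:
  "pinned_weight a b p n t xs ys xs' ys' \<eta> \<xi> =
    (if (\<forall>j\<in>{1..p}. xs j + unit_walk (\<xi> j) (a * t) = xs' j) \<and> (\<forall>k\<in>{1..n}. ys' k + unit_walk (\<eta> k) (b * t) = ys k)
     then ennreal (exp (\<Sum>j\<in>{1..p}. \<Sum>k\<in>{1..n}. overlap a b (xs j - ys' k) t (\<xi> j) (\<eta> k))) else 0)"
  unfolding pinned_weight_def by (subst (1 2) prod_indicator_singleton) auto

lemma set_integral_split:
  fixes g :: "real \<Rightarrow> real"
  assumes g: "\<And>s. 0 \<le> g s" "\<And>s. g s \<le> 1" "g \<in> borel_measurable borel" and ab: "a \<le> b" "b \<le> c"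
  shows "(LINT s:{a..c}|lborel. g s) = (LINT s:{a..b}|lborel. g s) + (LINT s:{b..c}|lborel. g s)"
proof -
  have i: "g integrable_on {u..v}" "(LINT r:{u..v}|lborel. g r) = integral {u..v} g" if "u \<le> v" for u v
    using set_borel_integral_eq_integral[OF set_integral_bounds(1)[OF g(1,2) g(3) that]] by auto
  show ?thesis
    using Henstock_Kurzweil_Integration.integral_combine[OF ab i(1)] ab by (simp add: i(2))
qed

text \<open>Cut the time interval at \<open>s\<close>. On \<open>{0..s}\<close> the walk still
  follows \<open>\<xi>\<close>, while the catalyst, running backwards, is in its second piece
  \<open>\<eta>\<close>, displaced by the end point of \<open>\<eta>'\<close>; afterwards the walk
  follows \<open>\<xi>'\<close> and the catalyst its first piece \<open>\<eta>'\<close>.\<close>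

lemma overlap_splice:
  assumes a: "0 \<le> a" and b: "0 \<le> b" and s: "0 \<le> s" and t: "0 \<le> t"
    and reg: "regular \<xi>" "regular \<xi>'" "regular \<eta>" "regular \<eta>'"
  shows "overlap a b y (s + t) (splice (a * s) \<xi> \<xi>') (splice (b * t) \<eta>' \<eta>) =
    overlap a b (y - unit_walk \<eta>' (b * t)) s \<xi> \<eta> + overlap a b (y + unit_walk \<xi> (a * s)) t \<xi>' \<eta>'"
proof -
  define f where "f = (\<lambda>r. indicator {unit_walk (splice (b * t) \<eta>' \<eta>) (b * (s + t - r))} (y + unit_walk (splice (a * s) \<xi> \<xi>') (a * r)) :: real)"
  have f: "0 \<le> f r" "f r \<le> 1" for r by (simp_all add: f_def indicator_le_1)
  have fm: "f \<in> borel_measurable borel" unfolding f_def by (rule overlap_integrand_measurable)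
  have "overlap a b y (s + t) (splice (a * s) \<xi> \<xi>') (splice (b * t) \<eta>' \<eta>) = (LINT r:{0..s}|lborel. f r) + (LINT r:{s..s + t}|lborel. f r)"
    unfolding overlap_def f_def[symmetric] using s t by (intro set_integral_split f fm) auto
  also have "(LINT r:{0..s}|lborel. f r) = overlap a b (y - unit_walk \<eta>' (b * t)) s \<xi> \<eta>"
    unfolding overlap_def
  proof (rule set_lebesgue_integral_cong, simp, intro allI impI)
    fix r assume r: "r \<in> {0..s}"
    have "unit_walk (splice (b * t) \<eta>' \<eta>) (b * (s + t - r)) = unit_walk \<eta>' (b * t) + unit_walk \<eta> (b * (s - r))"
    proof -
      have "0 \<le> b * (s - r)" "b * (s + t - r) = b * t + b * (s - r)" using b r by (simp_all add: algebra_simps mult_left_mono)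
      then show ?thesis using unit_walk_splice_after[OF reg(4,3), of "b * t" "b * (s - r)"] b t by simp
    qed
    moreover have "unit_walk (splice (a * s) \<xi> \<xi>') (a * r) = unit_walk \<xi> (a * r)"
      using a s r by (intro unit_walk_splice_before reg) (auto intro: mult_left_mono)
    ultimately show "f r = indicator {unit_walk \<eta> (b * (s - r))} (y - unit_walk \<eta>' (b * t) + unit_walk \<xi> (a * r))"
      by (auto simp: f_def indicator_def algebra_simps)
  qed
  also have "(LINT r:{s..s + t}|lborel. f r) = (LINT r:{0..t}|lborel. f (s + r))"
    by (subst set_integral_shift) simp
  also have "\<dots> = overlap a b (y + unit_walk \<xi> (a * s)) t \<xi>' \<eta>'"
    unfolding overlap_def
  proof (rule set_lebesgue_integral_cong, simp, intro allI impI)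
    fix r assume r: "r \<in> {0..t}"
    have "unit_walk (splice (a * s) \<xi> \<xi>') (a * (s + r)) = unit_walk \<xi> (a * s) + unit_walk \<xi>' (a * r)"
      using unit_walk_splice_after[OF reg(1,2), of "a * s" "a * r"] a s r by (simp add: algebra_simps)
    moreover have "unit_walk (splice (b * t) \<eta>' \<eta>) (b * (t - r)) = unit_walk \<eta>' (b * (t - r))"
      using b t r by (intro unit_walk_splice_before reg) (auto intro: mult_left_mono)
    ultimately show "f (s + r) = indicator {unit_walk \<eta>' (b * (t - r))} (y + unit_walk \<xi> (a * s) + unit_walk \<xi>' (a * r))"
      by (auto simp: f_def indicator_def algebra_simps)
  qed
  finally show ?thesis .
qed

lemma nn_integral_mult_nn_integral:
  assumes f: "case_prod f \<in> borel_measurable (M \<Otimes>\<^sub>M N)" and g: "case_prod g \<in> borel_measurable (M \<Otimes>\<^sub>M N)"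
    and N: "sigma_finite_measure N"
  shows "(\<integral>\<^sup>+x. \<integral>\<^sup>+y. f x y \<partial>N \<partial>M) * (\<integral>\<^sup>+x. \<integral>\<^sup>+y. g x y \<partial>N \<partial>M) =
    (\<integral>\<^sup>+x. \<integral>\<^sup>+y. \<integral>\<^sup>+x'. \<integral>\<^sup>+y'. f x y * g x' y' \<partial>N \<partial>M \<partial>N \<partial>M)"
proof -
  interpret N: sigma_finite_measure N by (rule N)
  have m: "f x \<in> borel_measurable N" "g x \<in> borel_measurable N" if "x \<in> space M" for x
    using measurable_Pair2[OF f that] measurable_Pair2[OF g that] by (simp_all add: case_prod_unfold)
  have i: "(\<lambda>x. \<integral>\<^sup>+y. f x y \<partial>N) \<in> borel_measurable M" "(\<lambda>x. \<integral>\<^sup>+y. g x y \<partial>N) \<in> borel_measurable M"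
    using N.borel_measurable_nn_integral[OF f] N.borel_measurable_nn_integral[OF g] by simp_all
  have "(\<integral>\<^sup>+x. \<integral>\<^sup>+y. f x y \<partial>N \<partial>M) * (\<integral>\<^sup>+x. \<integral>\<^sup>+y. g x y \<partial>N \<partial>M) =
    (\<integral>\<^sup>+x. (\<integral>\<^sup>+y. f x y \<partial>N) * (\<integral>\<^sup>+x. \<integral>\<^sup>+y. g x y \<partial>N \<partial>M) \<partial>M)"
    by (rule nn_integral_multc[OF i(1), symmetric])
  also have "\<dots> = (\<integral>\<^sup>+x. \<integral>\<^sup>+y. f x y * (\<integral>\<^sup>+x. \<integral>\<^sup>+y. g x y \<partial>N \<partial>M) \<partial>N \<partial>M)"
    by (intro nn_integral_cong nn_integral_multc[OF m(1), symmetric])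
  also have "\<dots> = (\<integral>\<^sup>+x. \<integral>\<^sup>+y. \<integral>\<^sup>+x'. f x y * (\<integral>\<^sup>+y'. g x' y' \<partial>N) \<partial>M \<partial>N \<partial>M)"
    by (intro nn_integral_cong nn_integral_cmult[OF i(2), symmetric])
  also have "\<dots> = (\<integral>\<^sup>+x. \<integral>\<^sup>+y. \<integral>\<^sup>+x'. \<integral>\<^sup>+y'. f x y * g x' y' \<partial>N \<partial>M \<partial>N \<partial>M)"
    by (intro nn_integral_cong nn_integral_cmult[OF m(2), symmetric])
  finally show ?thesis .
qed

text \<open>Chapman--Kolmogorov with a single intermediate configuration kept. Feynman--Kac time
  \<open>s\<close> is catalyst time \<open>t\<close>, so the catalysts are spliced in the opposite
  order: the walks follow \<open>\<xi>\<close> and continue with \<open>\<xi>'\<close>, the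
  catalysts follow \<open>\<eta>'\<close> and continue with \<open>\<eta>\<close>.\<close>

theorem pinned_mult_le:
  fixes xs ys xs' ys' xs'' ys'' :: "nat \<Rightarrow> int ^ 'd"
  assumes a: "0 \<le> a" and b: "0 \<le> b" and s: "0 \<le> s" and t: "0 \<le> t"
  shows "pinned a b p n s xs ys xs' ys' * pinned a b p n t xs' ys' xs'' ys'' \<le> pinned a b p n (s + t) xs ys xs'' ys''"
proof -
  interpret P: prob_space "walks p :: (nat \<Rightarrow> nat \<Rightarrow> real \<times> (int ^ 'd)) measure" by (rule prob_space_walks)
  define F where "F = pinned_weight a b p n (s + t) xs ys xs'' ys''"
  define f1 where "f1 = pinned_weight a b p n s xs ys xs' ys'"
  define f2 where "f2 = pinned_weight a b p n t xs' ys' xs'' ys''"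
  define sp where "sp = (\<lambda>n u (\<xi> :: nat \<Rightarrow> nat \<Rightarrow> real \<times> (int ^ 'd)) \<xi>'. \<lambda>j\<in>{1..n}. splice u (\<xi> j) (\<xi>' j))"
  have m: "(\<lambda>x. F (f x) (g x)) \<in> borel_measurable M" "(\<lambda>x. f1 (f x) (g x)) \<in> borel_measurable M" "(\<lambda>x. f2 (f x) (g x)) \<in> borel_measurable M"
    if "f \<in> measurable M (walks n)" "g \<in> measurable M (walks p)" for f g and M :: "'z measure"
    unfolding F_def f1_def f2_def using that by measurable
  have sp_m [measurable]: "(\<lambda>x. sp q u (f x) (g x)) \<in> measurable M (walks q)"
    if [measurable]: "f \<in> measurable M (walks q)" "g \<in> measurable M (walks q)" for f g and M :: "'z measure" and q u
    using measurable_compose[OF measurable_Pair[OF that] measurable_splice_walks[where p = q and u = u]] by (simp add: sp_def)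
  note [measurable] = m
  have "pinned a b p n s xs ys xs' ys' * pinned a b p n t xs' ys' xs'' ys'' =
    (\<integral>\<^sup>+\<eta>. \<integral>\<^sup>+\<xi>. \<integral>\<^sup>+\<eta>'. \<integral>\<^sup>+\<xi>'. f1 \<eta> \<xi> * f2 \<eta>' \<xi>' \<partial>walks p \<partial>walks n \<partial>walks p \<partial>walks n)"
    unfolding pinned_def f1_def[symmetric] f2_def[symmetric]
    by (rule nn_integral_mult_nn_integral) (auto simp: case_prod_unfold prob_space_imp_sigma_finite prob_space_walks intro!: m)
  also have "\<dots> \<le> (\<integral>\<^sup>+\<eta>. \<integral>\<^sup>+\<xi>. \<integral>\<^sup>+\<eta>'. \<integral>\<^sup>+\<xi>'. F (sp n (b * t) \<eta>' \<eta>) (sp p (a * s) \<xi> \<xi>') \<partial>walks p \<partial>walks n \<partial>walks p \<partial>walks n)"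
  proof (rule nn_integral_mono_AE, use AE_walks_regular in eventually_elim, rule nn_integral_mono_AE, use AE_walks_regular in eventually_elim,
      rule nn_integral_mono_AE, use AE_walks_regular in eventually_elim, rule nn_integral_mono_AE, use AE_walks_regular in eventually_elim)
    fix \<eta> \<xi> \<eta>' \<xi>' :: "nat \<Rightarrow> nat \<Rightarrow> real \<times> (int ^ 'd)"
    assume reg: "\<forall>k\<in>{1..n}. regular (\<eta> k)" "\<forall>k\<in>{1..p}. regular (\<xi> k)" "\<forall>k\<in>{1..n}. regular (\<eta>' k)" "\<forall>k\<in>{1..p}. regular (\<xi>' k)"
    show "f1 \<eta> \<xi> * f2 \<eta>' \<xi>' \<le> F (sp n (b * t) \<eta>' \<eta>) (sp p (a * s) \<xi> \<xi>')"
    proof (cases "(\<forall>j\<in>{1..p}. xs j + unit_walk (\<xi> j) (a * s) = xs' j) \<and> (\<forall>k\<in>{1..n}. ys' k + unit_walk (\<eta> k) (b * s) = ys k) \<and>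
        (\<forall>j\<in>{1..p}. xs' j + unit_walk (\<xi>' j) (a * t) = xs'' j) \<and> (\<forall>k\<in>{1..n}. ys'' k + unit_walk (\<eta>' k) (b * t) = ys' k)")
      case False
      then have "f1 \<eta> \<xi> * f2 \<eta>' \<xi>' = 0" by (auto simp: f1_def f2_def pinned_weight_eq)
      then show ?thesis by (simp only: zero_le)
    next
      case True
      have X: "xs j + unit_walk (sp p (a * s) \<xi> \<xi>' j) (a * (s + t)) = xs'' j" if "j \<in> {1..p}" for j
        using that True reg a s t unit_walk_splice_after[of "\<xi> j" "\<xi>' j" "a * s" "a * t"]
        by (simp add: sp_def distrib_left add.assoc[symmetric])
      have Y: "ys'' k + unit_walk (sp n (b * t) \<eta>' \<eta> k) (b * (s + t)) = ys k" if "k \<in> {1..n}" for k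
        using that True reg b s t unit_walk_splice_after[of "\<eta>' k" "\<eta> k" "b * t" "b * s"]
        by (simp add: sp_def distrib_left add.assoc[symmetric] add.commute[of "b * s"])
      have O: "overlap a b (xs j - ys'' k) (s + t) (sp p (a * s) \<xi> \<xi>' j) (sp n (b * t) \<eta>' \<eta> k) =
        overlap a b (xs j - ys' k) s (\<xi> j) (\<eta> k) + overlap a b (xs' j - ys'' k) t (\<xi>' j) (\<eta>' k)"
        if "j \<in> {1..p}" "k \<in> {1..n}" for j k
      proof -
        have 1: "xs j - ys'' k - unit_walk (\<eta>' k) (b * t) = xs j - ys' k"
          using True that by (metis diff_diff_eq)
        have 2: "xs j - ys'' k + unit_walk (\<xi> j) (a * s) = xs' j - ys'' k"
          using True that by (metis add.commute add_diff_eq)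
        have "overlap a b (xs j - ys'' k) (s + t) (splice (a * s) (\<xi> j) (\<xi>' j)) (splice (b * t) (\<eta>' k) (\<eta> k)) =
          overlap a b (xs j - ys' k) s (\<xi> j) (\<eta> k) + overlap a b (xs' j - ys'' k) t (\<xi>' j) (\<eta>' k)"
          unfolding 1[symmetric] 2[symmetric] using that reg by (intro overlap_splice a b s t) auto
        then show ?thesis using that by (simp add: sp_def)
      qed
      have "F (sp n (b * t) \<eta>' \<eta>) (sp p (a * s) \<xi> \<xi>') =
        ennreal (exp (\<Sum>j\<in>{1..p}. \<Sum>k\<in>{1..n}. overlap a b (xs j - ys'' k) (s + t) (sp p (a * s) \<xi> \<xi>' j) (sp n (b * t) \<eta>' \<eta> k)))"
        unfolding F_def pinned_weight_eq using X Y by simp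
      also have "\<dots> = f1 \<eta> \<xi> * f2 \<eta>' \<xi>'"
        unfolding f1_def f2_def pinned_weight_eq using True O
        by (simp add: sum.distrib exp_add ennreal_mult)
      finally show ?thesis by simp
    qed
  qed
  \<comment> \<open>The exchanges of integrals bring together the two families that are spliced, in
    the order in which \<open>nn_integral_walks_splice\<close> takes them.\<close>
  also have "\<dots> = (\<integral>\<^sup>+\<eta>. \<integral>\<^sup>+\<eta>'. \<integral>\<^sup>+\<xi>. \<integral>\<^sup>+\<xi>'. F (sp n (b * t) \<eta>' \<eta>) (sp p (a * s) \<xi> \<xi>') \<partial>walks p \<partial>walks p \<partial>walks n \<partial>walks n)"
  proof (intro nn_integral_cong nn_integral_walks_swap)
    fix \<eta> assume "\<eta> \<in> space (walks n :: (nat \<Rightarrow> nat \<Rightarrow> real \<times> (int ^ 'd)) measure)"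
    then show "(\<lambda>(\<xi>, \<eta>'). \<integral>\<^sup>+\<xi>'. F (sp n (b * t) \<eta>' \<eta>) (sp p (a * s) \<xi> \<xi>') \<partial>walks p) \<in> borel_measurable (walks p \<Otimes>\<^sub>M walks n)"
      unfolding split_beta'
      by (intro P.borel_measurable_nn_integral, unfold split_beta')
        (intro m(1) sp_m measurable_compose[OF measurable_fst measurable_fst] measurable_compose[OF measurable_fst measurable_snd]
          measurable_snd measurable_const)
  qed
  also have "\<dots> = (\<integral>\<^sup>+\<eta>'. \<integral>\<^sup>+\<eta>. \<integral>\<^sup>+\<xi>. \<integral>\<^sup>+\<xi>'. F (sp n (b * t) \<eta>' \<eta>) (sp p (a * s) \<xi> \<xi>') \<partial>walks p \<partial>walks p \<partial>walks n \<partial>walks n)"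
  proof (intro nn_integral_walks_swap)
    show "(\<lambda>(\<eta>, \<eta>'). \<integral>\<^sup>+\<xi>. \<integral>\<^sup>+\<xi>'. F (sp n (b * t) \<eta>' \<eta>) (sp p (a * s) \<xi> \<xi>') \<partial>walks p \<partial>walks p) \<in> borel_measurable (walks n \<Otimes>\<^sub>M walks n)"
      unfolding split_beta'
      by (intro P.borel_measurable_nn_integral, unfold split_beta', intro P.borel_measurable_nn_integral, unfold split_beta')
        (intro m(1) sp_m measurable_compose[OF measurable_compose[OF measurable_fst measurable_fst] measurable_fst]
          measurable_compose[OF measurable_compose[OF measurable_fst measurable_fst] measurable_snd]
          measurable_compose[OF measurable_fst measurable_snd] measurable_snd)
  qed
  also have "\<dots> = (\<integral>\<^sup>+\<eta>'. \<integral>\<^sup>+\<eta>. \<integral>\<^sup>+\<xi>. F (sp n (b * t) \<eta>' \<eta>) \<xi> \<partial>walks p \<partial>walks n \<partial>walks n)"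
  proof (rule nn_integral_cong, rule nn_integral_cong, unfold sp_def, rule nn_integral_walks_splice[symmetric])
    fix \<eta>' \<eta> assume sp: "\<eta>' \<in> space (walks n :: (nat \<Rightarrow> nat \<Rightarrow> real \<times> (int ^ 'd)) measure)"
      "\<eta> \<in> space (walks n :: (nat \<Rightarrow> nat \<Rightarrow> real \<times> (int ^ 'd)) measure)"
    have "sp n (b * t) \<eta>' \<eta> \<in> space (walks n)"
      by (rule measurable_space[OF sp_m[OF measurable_const[OF sp(1)] measurable_const[OF sp(2)]] sp(1)])
    then have "F (sp n (b * t) \<eta>' \<eta>) \<in> borel_measurable (walks p)" by (intro m(1) measurable_const measurable_ident_sets refl)
    then show "F (\<lambda>j\<in>{1..n}. splice (b * t) (\<eta>' j) (\<eta> j)) \<in> borel_measurable (walks p)" by (simp only: sp_def)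
  qed (use a s in simp)
  also have "\<dots> = (\<integral>\<^sup>+\<eta>. \<integral>\<^sup>+\<xi>. F \<eta> \<xi> \<partial>walks p \<partial>walks n)"
    unfolding sp_def
  proof (rule nn_integral_walks_splice[symmetric])
    show "(\<lambda>\<eta>. \<integral>\<^sup>+\<xi>. F \<eta> \<xi> \<partial>walks p) \<in> borel_measurable (walks n)"
      by (intro P.borel_measurable_nn_integral, unfold split_beta', intro m(1) measurable_fst measurable_snd)
  qed (use b t in simp)
  finally show ?thesis unfolding pinned_def F_def .
qed

text \<open>Discretised \<open>pinned_weight\<close>, which sees the paths only through their grid
  positions. The index \<open>N - m\<close> is the reversed clock of the catalysts.\<close>

definition list_weight ::
    "real \<Rightarrow> nat \<Rightarrow> nat \<Rightarrow> nat \<Rightarrow> (nat \<Rightarrow> int ^ 'd) \<Rightarrow> (nat \<Rightarrow> int ^ 'd) \<Rightarrow> (nat \<Rightarrow> int ^ 'd) \<Rightarrow> (nat \<Rightarrow> int ^ 'd) \<Rightarrow>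
      (nat \<Rightarrow> (int ^ 'd) list) \<Rightarrow> (nat \<Rightarrow> (int ^ 'd) list) \<Rightarrow> ennreal" where
  "list_weight h p n N xs ys xs' ys' X Y =
    (if (\<forall>j\<in>{1..p}. xs j + X j ! N = xs' j) \<and> (\<forall>k\<in>{1..n}. ys' k + Y k ! N = ys k)
     then ennreal (exp (\<Sum>j\<in>{1..p}. \<Sum>k\<in>{1..n}. h * (\<Sum>m\<le>N. indicator {Y k ! (N - m)} (xs j - ys' k + X j ! m)))) else 0)"

lemma list_weight_restrict:
  "list_weight h p n N xs ys xs' ys' (\<lambda>j\<in>{1..p}. X j) Y = list_weight h p n N xs ys xs' ys' X Y"
  "list_weight h p n N xs ys xs' ys' X (\<lambda>k\<in>{1..n}. Y k) = list_weight h p n N xs ys xs' ys' X Y"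
  unfolding list_weight_def by (auto intro!: arg_cong[where f=ennreal] arg_cong[where f=exp] sum.cong)

lemma measurable_list_weight:
  assumes X: "\<And>j. j \<in> {1..p} \<Longrightarrow> (\<lambda>x. X x j) \<in> measurable M (count_space UNIV)"
    and Y: "\<And>k. k \<in> {1..n} \<Longrightarrow> (\<lambda>x. Y x k) \<in> measurable M (count_space UNIV)"
  shows "(\<lambda>x. list_weight h p n N xs ys xs' ys' (X x) (Y x)) \<in> borel_measurable M"
proof -
  have [measurable]: "(\<lambda>x. f (X x j)) \<in> measurable M (count_space UNIV)" if "j \<in> {1..p}" for j and f :: "_ \<Rightarrow> int ^ 'd"
    by (rule measurable_compose[OF X[OF that]]) simp
  have [measurable]: "(\<lambda>x. f (Y x k)) \<in> measurable M (count_space UNIV)" if "k \<in> {1..n}" for k and f :: "_ \<Rightarrow> int ^ 'd"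
    by (rule measurable_compose[OF Y[OF that]]) simp
  have [measurable]: "(\<lambda>x. indicator {Y x k ! i} (c + X x j ! m) :: real) \<in> borel_measurable M" if "j \<in> {1..p}" "k \<in> {1..n}" for j k i m c
    using that by (intro measurable_indicator_eq) measurable
  show ?thesis unfolding list_weight_def by measurable
qed

lemma list_weight_le:
  assumes h: "0 \<le> h"
  shows "list_weight h p n N xs ys xs' ys' X Y \<le> ennreal (exp (real p * (real n * (h * (real N + 1)))))"
proof -
  have "(\<Sum>j\<in>{1..p}. \<Sum>k\<in>{1..n}. h * (\<Sum>m\<le>N. indicator {Y k ! (N - m)} (xs j - ys' k + X j ! m))) \<le>
    (\<Sum>j\<in>{1..p}. \<Sum>k\<in>{1..n}. h * (\<Sum>m\<le>N. 1))"
    by (intro sum_mono mult_left_mono h) (auto simp: indicator_def)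
  also have "\<dots> = real p * (real n * (h * (real N + 1)))" by simp
  finally show ?thesis unfolding list_weight_def by (auto intro!: ennreal_leI)
qed

lemma grid_path_nth: "m \<le> N \<Longrightarrow> grid_path g N \<omega> ! m = unit_walk \<omega> (real m * g)"
  by (simp add: grid_path_def del: upt_Suc)

lemma reversed_path_nth: "m \<le> N \<Longrightarrow> reversed_path g N \<omega> ! m = unit_walk \<omega> (real (N - m) * g) - unit_walk \<omega> (real N * g)"
  by (simp add: reversed_path_def del: upt_Suc)

text \<open>Reading all paths backwards exchanges initial and final configurations. The recentring
  shifts \<open>A j\<close> and \<open>B k\<close> are the differences of the two configurations, so
  the collisions are the same up to \<open>m \<mapsto> N - m\<close>.\<close>

lemma list_weight_reversed:
  assumes r: "\<forall>j\<in>{1..p}. regular (\<xi> j)" "\<forall>k\<in>{1..n}. regular (\<eta> k)"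
  shows "list_weight h p n N xs ys xs' ys' (\<lambda>j. reversed_path f N (\<xi> j)) (\<lambda>k. reversed_path g N (\<eta> k)) =
    list_weight h p n N xs' ys' xs ys (\<lambda>j. grid_path f N (\<xi> j)) (\<lambda>k. grid_path g N (\<eta> k))"
proof -
  define A where "A = (\<lambda>j. unit_walk (\<xi> j) (real N * f))"
  define B where "B = (\<lambda>k. unit_walk (\<eta> k) (real N * g))"
  have ends: "((\<forall>j\<in>{1..p}. xs j + reversed_path f N (\<xi> j) ! N = xs' j) \<and> (\<forall>k\<in>{1..n}. ys' k + reversed_path g N (\<eta> k) ! N = ys k)) \<longleftrightarrow>
    ((\<forall>j\<in>{1..p}. xs' j + grid_path f N (\<xi> j) ! N = xs j) \<and> (\<forall>k\<in>{1..n}. ys k + grid_path g N (\<eta> k) ! N = ys' k))"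
    using r by (auto simp: reversed_path_nth grid_path_nth unit_walk_0 algebra_simps)
  have "h * (\<Sum>m\<le>N. indicator {reversed_path g N (\<eta> k) ! (N - m)} (xs j - ys' k + reversed_path f N (\<xi> j) ! m)) =
    h * (\<Sum>m\<le>N. indicator {grid_path g N (\<eta> k) ! (N - m)} (xs' j - ys k + grid_path f N (\<xi> j) ! m))"
    if e: "xs' j + A j = xs j" "ys k + B k = ys' k" for j k
  proof -
    have "(\<Sum>m\<le>N. indicator {reversed_path g N (\<eta> k) ! (N - m)} (xs j - ys' k + reversed_path f N (\<xi> j) ! m)) =
      (\<Sum>m\<le>N. indicator {unit_walk (\<eta> k) (real m * g)} (xs' j - ys k + unit_walk (\<xi> j) (real (N - m) * f)) :: real)"
      unfolding e[symmetric]
      by (intro sum.cong refl) (auto simp: reversed_path_nth A_def B_def indicator_def algebra_simps)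
    also have "\<dots> = (\<Sum>m\<le>N. indicator {unit_walk (\<eta> k) (real (N - m) * g)} (xs' j - ys k + unit_walk (\<xi> j) (real m * f)))"
      by (rule sum.reindex_bij_witness[of _ "\<lambda>m. N - m" "\<lambda>m. N - m"]) auto
    finally show ?thesis by (simp add: grid_path_nth)
  qed
  then show ?thesis
    unfolding list_weight_def ends
    by (auto simp: A_def B_def grid_path_nth intro!: arg_cong[where f=ennreal] arg_cong[where f=exp] sum.cong)
qed

lemma nn_integral_walks_reversed:
  fixes G :: "(nat \<Rightarrow> (int ^ 'd) list) \<Rightarrow> ennreal"
  assumes G: "G \<in> borel_measurable (\<Pi>\<^sub>M j\<in>{1..p}. count_space UNIV)" and g: "0 \<le> g"
  shows "(\<integral>\<^sup>+\<xi>. G (\<lambda>j\<in>{1..p}. grid_path g N (\<xi> j)) \<partial>walks p) = (\<integral>\<^sup>+\<xi>. G (\<lambda>j\<in>{1..p}. reversed_path g N (\<xi> j)) \<partial>walks p)"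
proof (rule nn_integral_walks_cong_distr)
  \<comment> \<open>The product of laws needs a probability space as target; \<open>?L\<close> is
    the discrete space with the law of the grid path.\<close>
  let ?L = "distr walk_space (count_space UNIV) (grid_path g N :: (nat \<Rightarrow> real \<times> (int ^ 'd)) \<Rightarrow> _)"
  have c: "measurable walk_space ?L = measurable walk_space (count_space UNIV)" by (rule measurable_cong_sets) auto
  show "grid_path g N \<in> measurable walk_space ?L" "reversed_path g N \<in> measurable walk_space ?L"
    unfolding c by measurable
  have "distr walk_space ?L D = distr walk_space (count_space UNIV) D" for D :: "(nat \<Rightarrow> real \<times> (int ^ 'd)) \<Rightarrow> _"
    by (rule distr_cong) auto
  then show "distr walk_space ?L (grid_path g N) = distr walk_space ?L (reversed_path g N)"
    using distr_grid_path_reversed[OF g] by simp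
  have "sets (\<Pi>\<^sub>M j\<in>{1..p}. ?L) = sets (\<Pi>\<^sub>M j\<in>{1..p}. count_space UNIV)" by (rule sets_PiM_cong) auto
  then show "G \<in> borel_measurable (\<Pi>\<^sub>M j\<in>{1..p}. ?L)" using G measurable_cong_sets by blast
  show "prob_space ?L" by (rule walk_space.prob_space_distr) measurable
qed

text \<open>The last grid point is exactly time \<open>t\<close>, so for \<open>N > 0\<close> the
  end point conditions are those of \<open>pinned_weight\<close> and only the exponents have to
  converge. Each of their Riemann sums is at most \<open>2 * t\<close>, which gives
  domination.\<close>

lemma nn_integral_list_weight_tendsto:
  fixes xs ys xs' ys' :: "nat \<Rightarrow> int ^ 'd"
  assumes a: "0 \<le> a" and b: "0 \<le> b" and t: "0 < t"
  shows "(\<lambda>N. \<integral>\<^sup>+\<eta>. \<integral>\<^sup>+\<xi>. list_weight (t / real N) p n N xs ys xs' ys' (\<lambda>j. grid_path (a * (t / real N)) N (\<xi> j)) (\<lambda>k. grid_path (b * (t / real N)) N (\<eta> k))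
    \<partial>walks p \<partial>walks n) \<longlonglongrightarrow> pinned a b p n t xs ys xs' ys'"
  unfolding pinned_def
proof (rule nn_integral_dominated_convergence)
  let ?W = "\<lambda>N \<eta> \<xi>. list_weight (t / real N) p n N xs ys xs' ys' (\<lambda>j. grid_path (a * (t / real N)) N (\<xi> j)) (\<lambda>k. grid_path (b * (t / real N)) N (\<eta> k))"
  let ?C = "ennreal (exp (real p * (real n * (2 * t))))"
  interpret N: prob_space "walks n :: (nat \<Rightarrow> nat \<Rightarrow> real \<times> (int ^ 'd)) measure" by (rule prob_space_walks)
  interpret P: prob_space "walks p :: (nat \<Rightarrow> nat \<Rightarrow> real \<times> (int ^ 'd)) measure" by (rule prob_space_walks)
  have m: "(\<lambda>x. ?W N (f x) (g x)) \<in> borel_measurable M" if "f \<in> measurable M (walks n)" "g \<in> measurable M (walks p)" for f g N and M :: "'z measure"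
    by (rule measurable_list_weight)
      (auto intro: measurable_compose[OF measurable_compose[OF that(1) measurable_walks_component] measurable_grid_path]
        measurable_compose[OF measurable_compose[OF that(2) measurable_walks_component] measurable_grid_path])
  have le: "?W N \<eta> \<xi> \<le> ?C" for N \<eta> \<xi>
  proof -
    have "?W N \<eta> \<xi> \<le> ennreal (exp (real p * (real n * (t / real N * (real N + 1)))))"
      using t by (intro list_weight_le) simp
    also have "t / real N * (real N + 1) \<le> 2 * t" using t by (cases "N = 0") (auto simp: field_simps)
    then have "ennreal (exp (real p * (real n * (t / real N * (real N + 1))))) \<le> ?C"
      by (intro ennreal_leI exp_le_cancel_iff[THEN iffD2] mult_left_mono) auto
    finally show ?thesis .
  qed
  show "(\<lambda>\<eta>. \<integral>\<^sup>+\<xi>. pinned_weight a b p n t xs ys xs' ys' \<eta> \<xi> \<partial>walks p) \<in> borel_measurable (walks n)"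
    by (intro P.borel_measurable_nn_integral, unfold split_beta', measurable)
  show "(\<lambda>\<eta>. \<integral>\<^sup>+\<xi>. ?W N \<eta> \<xi> \<partial>walks p) \<in> borel_measurable (walks n)" for N
    by (intro P.borel_measurable_nn_integral, unfold split_beta') (intro m measurable_fst measurable_snd)
  show "AE \<eta> in walks n. (\<integral>\<^sup>+\<xi>. ?W N \<eta> \<xi> \<partial>walks p) \<le> ?C" for N
  proof (rule AE_I2)
    fix \<eta>
    have "(\<integral>\<^sup>+\<xi>. ?W N \<eta> \<xi> \<partial>walks p) \<le> (\<integral>\<^sup>+\<xi>. ?C \<partial>(walks p :: (nat \<Rightarrow> nat \<Rightarrow> real \<times> (int ^ 'd)) measure))"
      by (intro nn_integral_mono le)
    then show "(\<integral>\<^sup>+\<xi>. ?W N \<eta> \<xi> \<partial>walks p) \<le> ?C" by simp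
  qed
  show "(\<integral>\<^sup>+\<eta>. ?C \<partial>(walks n :: (nat \<Rightarrow> nat \<Rightarrow> real \<times> (int ^ 'd)) measure)) < \<infinity>" by (simp add: ennreal_mult_less_top)
  show "AE \<eta> in walks n. (\<lambda>N. \<integral>\<^sup>+\<xi>. ?W N \<eta> \<xi> \<partial>walks p) \<longlonglongrightarrow> (\<integral>\<^sup>+\<xi>. pinned_weight a b p n t xs ys xs' ys' \<eta> \<xi> \<partial>walks p)"
    using AE_walks_regular[where n = n] AE_space
  proof eventually_elim
    fix \<eta> :: "nat \<Rightarrow> nat \<Rightarrow> real \<times> (int ^ 'd)" assume \<eta>: "\<forall>k\<in>{1..n}. regular (\<eta> k)" and sp: "\<eta> \<in> space (walks n)"
    show "(\<lambda>N. \<integral>\<^sup>+\<xi>. ?W N \<eta> \<xi> \<partial>walks p) \<longlonglongrightarrow> (\<integral>\<^sup>+\<xi>. pinned_weight a b p n t xs ys xs' ys' \<eta> \<xi> \<partial>walks p)"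
    proof (rule nn_integral_dominated_convergence)
      show "pinned_weight a b p n t xs ys xs' ys' \<eta> \<in> borel_measurable (walks p)"
        by (rule measurable_pinned_weight[OF measurable_const[OF sp] measurable_ident_sets[OF refl]])
      show "?W N \<eta> \<in> borel_measurable (walks p)" for N
        by (rule m[OF measurable_const[OF sp] measurable_ident_sets[OF refl]])
      show "AE \<xi> in walks p. ?W N \<eta> \<xi> \<le> ?C" for N by (intro AE_I2 le)
      show "(\<integral>\<^sup>+\<xi>. ?C \<partial>(walks p :: (nat \<Rightarrow> nat \<Rightarrow> real \<times> (int ^ 'd)) measure)) < \<infinity>" by (simp add: ennreal_mult_less_top)
      show "AE \<xi> in walks p. (\<lambda>N. ?W N \<eta> \<xi>) \<longlonglongrightarrow> pinned_weight a b p n t xs ys xs' ys' \<eta> \<xi>"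
        using AE_walks_regular[where n = p]
      proof eventually_elim
        fix \<xi> :: "nat \<Rightarrow> nat \<Rightarrow> real \<times> (int ^ 'd)" assume \<xi>: "\<forall>k\<in>{1..p}. regular (\<xi> k)"
        let ?E = "(\<forall>j\<in>{1..p}. xs j + unit_walk (\<xi> j) (a * t) = xs' j) \<and> (\<forall>k\<in>{1..n}. ys' k + unit_walk (\<eta> k) (b * t) = ys k)"
        define g where "g = (\<lambda>j k s. indicator {unit_walk (\<eta> k) (b * (t - s))} (xs j - ys' k + unit_walk (\<xi> j) (a * s)) :: real)"
        let ?S = "\<lambda>N j k. t / real N * (\<Sum>m\<le>N. g j k (real m * (t / real N)))"
        have lim: "(\<lambda>N. ?S N j k) \<longlonglongrightarrow> overlap a b (xs j - ys' k) t (\<xi> j) (\<eta> k)" if "j \<in> {1..p}" "k \<in> {1..n}" for j k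
        proof -
          have "overlap a b (xs j - ys' k) t (\<xi> j) (\<eta> k) = (LINT s:{0..t}|lborel. g j k s)" by (simp add: overlap_def g_def)
          moreover have "(\<lambda>N. ?S N j k) \<longlonglongrightarrow> (LINT s:{0..t}|lborel. g j k s)"
          proof (rule riemann_sum_tendsto[OF _ _ _ _ t])
            show "step_path t (g j k)"
              using step_path_map2[OF step_path_unit_walk[of "\<eta> k" t "b * t" "- b"] step_path_unit_walk[of "\<xi> j" t 0 a],
                  of "\<lambda>u v. indicator {u} (xs j - ys' k + v)"] \<eta> \<xi> that
              by (simp add: g_def algebra_simps)
            show "g j k \<in> borel_measurable borel" unfolding g_def by measurable
          qed (auto simp: g_def indicator_le_1)
          ultimately show ?thesis by simp
        qed
        have W: "?W N \<eta> \<xi> = (if ?E then ennreal (exp (\<Sum>j\<in>{1..p}. \<Sum>k\<in>{1..n}. ?S N j k)) else 0)" if N: "0 < N" for N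
        proof -
          have 1: "real N * (a * (t / real N)) = a * t" "real N * (b * (t / real N)) = b * t" using N by simp_all
          have 2: "real m * (a * (t / real N)) = a * (real m * (t / real N))" for m by simp
          have 3: "real (N - m) * (b * (t / real N)) = b * (t - real m * (t / real N))" if "m \<le> N" for m
            using N that by (simp add: of_nat_diff field_simps)
          have "(\<Sum>m\<le>N. indicator {grid_path (b * (t / real N)) N (\<eta> k) ! (N - m)} (xs j - ys' k + grid_path (a * (t / real N)) N (\<xi> j) ! m)) =
            (\<Sum>m\<le>N. g j k (real m * (t / real N)))" for j k
          proof (intro sum.cong refl)
            fix m assume "m \<in> {..N}"
            then have m: "m \<le> N" by simp
            show "indicator {grid_path (b * (t / real N)) N (\<eta> k) ! (N - m)} (xs j - ys' k + grid_path (a * (t / real N)) N (\<xi> j) ! m) =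
              g j k (real m * (t / real N))"
              unfolding g_def grid_path_nth[OF m] grid_path_nth[OF diff_le_self] 3[OF m] 2 ..
          qed
          then show ?thesis unfolding list_weight_def by (simp only: grid_path_nth order_refl 1)
        qed
        have "(\<lambda>N. \<Sum>j\<in>{1..p}. \<Sum>k\<in>{1..n}. ?S N j k) \<longlonglongrightarrow> (\<Sum>j\<in>{1..p}. \<Sum>k\<in>{1..n}. overlap a b (xs j - ys' k) t (\<xi> j) (\<eta> k))"
          by (intro tendsto_sum lim)
        then have E: "(\<lambda>N. ennreal (exp (\<Sum>j\<in>{1..p}. \<Sum>k\<in>{1..n}. ?S N j k))) \<longlonglongrightarrow>
          ennreal (exp (\<Sum>j\<in>{1..p}. \<Sum>k\<in>{1..n}. overlap a b (xs j - ys' k) t (\<xi> j) (\<eta> k)))"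
          by (intro tendsto_ennrealI tendsto_exp)
        have "(\<lambda>N. if ?E then ennreal (exp (\<Sum>j\<in>{1..p}. \<Sum>k\<in>{1..n}. ?S N j k)) else 0) \<longlonglongrightarrow> pinned_weight a b p n t xs ys xs' ys' \<eta> \<xi>"
          unfolding pinned_weight_eq
        proof (cases ?E)
          case True
          show "(\<lambda>N. if ?E then ennreal (exp (\<Sum>j\<in>{1..p}. \<Sum>k\<in>{1..n}. ?S N j k)) else 0) \<longlonglongrightarrow>
            (if ?E then ennreal (exp (\<Sum>j\<in>{1..p}. \<Sum>k\<in>{1..n}. overlap a b (xs j - ys' k) t (\<xi> j) (\<eta> k))) else 0)"
            unfolding if_P[OF True] by (rule E)
        next
          case False
          show "(\<lambda>N. if ?E then ennreal (exp (\<Sum>j\<in>{1..p}. \<Sum>k\<in>{1..n}. ?S N j k)) else 0) \<longlonglongrightarrow>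
            (if ?E then ennreal (exp (\<Sum>j\<in>{1..p}. \<Sum>k\<in>{1..n}. overlap a b (xs j - ys' k) t (\<xi> j) (\<eta> k))) else 0)"
            unfolding if_not_P[OF False] by (rule tendsto_const)
        qed
        then show "(\<lambda>N. ?W N \<eta> \<xi>) \<longlonglongrightarrow> pinned_weight a b p n t xs ys xs' ys' \<eta> \<xi>"
          by (rule Lim_transform_eventually) (use eventually_gt_at_top[of 0] in \<open>eventually_elim, simp only: W\<close>)
      qed
    qed simp
  qed
qed simp

text \<open>Reversal is carried out on the grid, for the walks with the catalysts fixed and for the
  catalysts with the walks fixed; the symmetry of the discretised kernel survives the limit.\<close>

theorem pinned_sym:
  fixes xs ys xs' ys' :: "nat \<Rightarrow> int ^ 'd"
  assumes a: "0 \<le> a" and b: "0 \<le> b" and t: "0 < t"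
  shows "pinned a b p n t xs ys xs' ys' = pinned a b p n t xs' ys' xs ys"
proof (rule LIMSEQ_unique)
  let ?g = "\<lambda>N j. grid_path (a * (t / real N)) N (j :: nat \<Rightarrow> real \<times> (int ^ 'd))"
  let ?W = "\<lambda>N xs ys xs' ys' \<eta> \<xi>. list_weight (t / real N) p n N xs ys xs' ys' (\<lambda>j. grid_path (a * (t / real N)) N (\<xi> j)) (\<lambda>k. grid_path (b * (t / real N)) N (\<eta> k))"
  let ?H = "\<lambda>N xs ys xs' ys' \<eta> \<xi>. list_weight (t / real N) p n N xs ys xs' ys' (\<lambda>j. reversed_path (a * (t / real N)) N (\<xi> j)) (\<lambda>k. grid_path (b * (t / real N)) N (\<eta> k))"
  let ?R = "\<lambda>N xs ys xs' ys' \<eta> \<xi>. list_weight (t / real N) p n N xs ys xs' ys' (\<lambda>j. reversed_path (a * (t / real N)) N (\<xi> j)) (\<lambda>k. reversed_path (b * (t / real N)) N (\<eta> k))"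
  have Hm: "(\<lambda>x. ?H N xs ys xs' ys' (f x) (g x)) \<in> borel_measurable M" if "f \<in> measurable M (walks n)" "g \<in> measurable M (walks p)" for f g N and M :: "'z measure"
    by (rule measurable_list_weight)
      (auto intro: measurable_compose[OF measurable_compose[OF that(1) measurable_walks_component] measurable_grid_path]
        measurable_compose[OF measurable_compose[OF that(2) measurable_walks_component] measurable_reversed_path])
  have Rm: "(\<lambda>x. ?R N xs ys xs' ys' (f x) (g x)) \<in> borel_measurable M" if "f \<in> measurable M (walks n)" "g \<in> measurable M (walks p)" for f g N and M :: "'z measure"
    by (rule measurable_list_weight)
      (auto intro: measurable_compose[OF measurable_compose[OF that(1) measurable_walks_component] measurable_reversed_path]
        measurable_compose[OF measurable_compose[OF that(2) measurable_walks_component] measurable_reversed_path])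
  have "(\<integral>\<^sup>+\<eta>. \<integral>\<^sup>+\<xi>. ?W N xs ys xs' ys' \<eta> \<xi> \<partial>walks p \<partial>walks n) = (\<integral>\<^sup>+\<eta>. \<integral>\<^sup>+\<xi>. ?W N xs' ys' xs ys \<eta> \<xi> \<partial>walks p \<partial>walks n)" for N
  proof -
    have h: "0 \<le> a * (t / real N)" "0 \<le> b * (t / real N)" using a b t by auto
    have "(\<integral>\<^sup>+\<eta>. \<integral>\<^sup>+\<xi>. ?W N xs ys xs' ys' \<eta> \<xi> \<partial>walks p \<partial>walks n) = (\<integral>\<^sup>+\<eta>. \<integral>\<^sup>+\<xi>. ?H N xs ys xs' ys' \<eta> \<xi> \<partial>walks p \<partial>walks n)"
    proof (rule nn_integral_cong)
      fix \<eta> :: "nat \<Rightarrow> nat \<Rightarrow> real \<times> (int ^ 'd)"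
      show "(\<integral>\<^sup>+\<xi>. ?W N xs ys xs' ys' \<eta> \<xi> \<partial>walks p) = (\<integral>\<^sup>+\<xi>. ?H N xs ys xs' ys' \<eta> \<xi> \<partial>walks p)"
      proof -
        have "(\<lambda>X. list_weight (t / real N) p n N xs ys xs' ys' X (\<lambda>k. grid_path (b * (t / real N)) N (\<eta> k)))
          \<in> borel_measurable (\<Pi>\<^sub>M j\<in>{1..p}. count_space UNIV)"
          by (rule measurable_list_weight) auto
        from nn_integral_walks_reversed[OF this h(1)] show ?thesis by (simp only: list_weight_restrict)
      qed
    qed
    also have "\<dots> = (\<integral>\<^sup>+\<xi>. \<integral>\<^sup>+\<eta>. ?H N xs ys xs' ys' \<eta> \<xi> \<partial>walks n \<partial>walks p)"
      by (rule nn_integral_walks_swap, unfold split_beta', intro Hm measurable_fst measurable_snd)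
    also have "\<dots> = (\<integral>\<^sup>+\<xi>. \<integral>\<^sup>+\<eta>. ?R N xs ys xs' ys' \<eta> \<xi> \<partial>walks n \<partial>walks p)"
    proof (rule nn_integral_cong)
      fix \<xi> :: "nat \<Rightarrow> nat \<Rightarrow> real \<times> (int ^ 'd)"
      show "(\<integral>\<^sup>+\<eta>. ?H N xs ys xs' ys' \<eta> \<xi> \<partial>walks n) = (\<integral>\<^sup>+\<eta>. ?R N xs ys xs' ys' \<eta> \<xi> \<partial>walks n)"
      proof -
        have "(\<lambda>Y. list_weight (t / real N) p n N xs ys xs' ys' (\<lambda>j. reversed_path (a * (t / real N)) N (\<xi> j)) Y)
          \<in> borel_measurable (\<Pi>\<^sub>M k\<in>{1..n}. count_space UNIV)"
          by (rule measurable_list_weight) auto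
        from nn_integral_walks_reversed[OF this h(2)] show ?thesis by (simp only: list_weight_restrict)
      qed
    qed
    also have "\<dots> = (\<integral>\<^sup>+\<eta>. \<integral>\<^sup>+\<xi>. ?R N xs ys xs' ys' \<eta> \<xi> \<partial>walks p \<partial>walks n)"
      by (rule nn_integral_walks_swap[symmetric], unfold split_beta', intro Rm measurable_fst measurable_snd)
    also have "\<dots> = (\<integral>\<^sup>+\<eta>. \<integral>\<^sup>+\<xi>. ?W N xs' ys' xs ys \<eta> \<xi> \<partial>walks p \<partial>walks n)"
      by (rule nn_integral_cong_AE, use AE_walks_regular[where n = n] in eventually_elim,
          rule nn_integral_cong_AE, use AE_walks_regular[where n = p] in eventually_elim)
        (rule list_weight_reversed)
    finally show ?thesis .
  qed
  then show "(\<lambda>N. \<integral>\<^sup>+\<eta>. \<integral>\<^sup>+\<xi>. ?W N xs ys xs' ys' \<eta> \<xi> \<partial>walks p \<partial>walks n) \<longlonglongrightarrow> pinned a b p n t xs' ys' xs ys"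
    by (simp only: nn_integral_list_weight_tendsto[OF a b t])
qed (rule nn_integral_list_weight_tendsto[OF a b t])

lemma nn_integral_walks_component:
  fixes g :: "(nat \<Rightarrow> real \<times> (int ^ 'd)) \<Rightarrow> ennreal"
  assumes j: "j \<in> {1..p}" and g: "g \<in> borel_measurable walk_space"
  shows "(\<integral>\<^sup>+\<xi>. g (\<xi> j) \<partial>walks p) = (\<integral>\<^sup>+\<omega>. g \<omega> \<partial>walk_space)"
proof -
  have "distr (walks p) walk_space (\<lambda>\<xi>. \<xi> j) = (walk_space :: (nat \<Rightarrow> real \<times> (int ^ 'd)) measure)"
    using distr_PiM_component[of "{1..p}" "\<lambda>_. walk_space :: (nat \<Rightarrow> real \<times> (int ^ 'd)) measure" j] j walk_space.prob_space_axioms by simp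
  then have "(\<integral>\<^sup>+\<omega>. g \<omega> \<partial>walk_space) = (\<integral>\<^sup>+\<omega>. g \<omega> \<partial>distr (walks p) walk_space (\<lambda>\<xi>. \<xi> j))" by simp
  also have "\<dots> = (\<integral>\<^sup>+\<xi>. g (\<xi> j) \<partial>walks p)"
    by (rule nn_integral_distr) (use j g in auto)
  finally show ?thesis by simp
qed

lemma sum_overlap_le:
  assumes t: "0 \<le> t"
  shows "(\<Sum>j\<in>{1..p}. \<Sum>k\<in>{1..n}. overlap a b (y j k) t (\<xi> j) (\<eta> k)) \<le> real p * real n * t"
proof -
  have "(\<Sum>j\<in>{1..p}. \<Sum>k\<in>{1..n}. overlap a b (y j k) t (\<xi> j) (\<eta> k)) \<le> (\<Sum>j\<in>{1..p}. \<Sum>k\<in>{1..n}. t)"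
    by (intro sum_mono overlap_le t)
  also have "\<dots> = real p * real n * t" by simp
  finally show ?thesis .
qed

lemma pinned_le:
  fixes xs ys xs' ys' :: "nat \<Rightarrow> int ^ 'd"
  assumes t: "0 \<le> t"
  shows "pinned a b p n t xs ys xs' ys' \<le> ennreal (exp (real p * real n * t))"
proof -
  have "pinned a b p n t xs ys xs' ys' \<le>
    (\<integral>\<^sup>+\<eta>. \<integral>\<^sup>+\<xi>. ennreal (exp (real p * real n * t)) \<partial>(walks p :: (nat \<Rightarrow> nat \<Rightarrow> real \<times> (int ^ 'd)) measure) \<partial>(walks n :: (nat \<Rightarrow> nat \<Rightarrow> real \<times> (int ^ 'd)) measure))"
    unfolding pinned_def pinned_weight_eq by (intro nn_integral_mono) (auto intro!: ennreal_leI exp_le_cancel_iff[THEN iffD2] sum_overlap_le t)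
  also have "\<dots> = ennreal (exp (real p * real n * t))" by simp
  finally show ?thesis .
qed

text \<open>The exponential weight is at least \<open>1\<close>; without it the walks are
  independent and their transition probabilities multiply. This yields positivity of the kernel and
  the lower bound on its diagonal.\<close>

lemma pinned_ge:
  fixes xs ys xs' ys' :: "nat \<Rightarrow> int ^ 'd"
  assumes t: "0 \<le> t"
  shows "ennreal ((\<Prod>j\<in>{1..p}. heat (a * t) (xs' j - xs j)) * (\<Prod>k\<in>{1..n}. heat (b * t) (ys k - ys' k))) \<le> pinned a b p n t xs ys xs' ys'"
proof -
  have ind: "(\<integral>\<^sup>+\<omega>. indicator {z} (x + unit_walk \<omega> u) \<partial>walk_space) = ennreal (heat u (z - x))" for x z :: "int ^ 'd" and u
  proof -
    have "(\<integral>\<^sup>+\<omega>. indicator {z} (x + unit_walk \<omega> u) \<partial>walk_space) = (\<integral>\<^sup>+\<omega>. indicator {z - x} (unit_walk \<omega> u) \<partial>walk_space)"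
      by (intro nn_integral_cong) (auto simp: indicator_def algebra_simps)
    then show ?thesis by (simp add: nn_integral_heat)
  qed
  have "ennreal ((\<Prod>j\<in>{1..p}. heat (a * t) (xs' j - xs j)) * (\<Prod>k\<in>{1..n}. heat (b * t) (ys k - ys' k))) =
    (\<integral>\<^sup>+\<xi>. (\<Prod>j\<in>{1..p}. indicator {xs' j} (xs j + unit_walk (\<xi> j) (a * t))) \<partial>walks p) *
    (\<integral>\<^sup>+\<eta>. (\<Prod>k\<in>{1..n}. indicator {ys k} (ys' k + unit_walk (\<eta> k) (b * t))) \<partial>walks n)"
    using nn_integral_walks_prod[of p "\<lambda>j \<omega>. indicator {xs' j} (xs j + unit_walk \<omega> (a * t))"]
      nn_integral_walks_prod[of n "\<lambda>k \<omega>. indicator {ys k} (ys' k + unit_walk \<omega> (b * t))"]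
    by (simp add: ind ennreal_mult prod_nonneg heat_nonneg flip: prod_ennreal)
  also have "\<dots> = (\<integral>\<^sup>+\<eta>. (\<integral>\<^sup>+\<xi>. (\<Prod>j\<in>{1..p}. indicator {xs' j} (xs j + unit_walk (\<xi> j) (a * t))) \<partial>walks p) *
     (\<Prod>k\<in>{1..n}. indicator {ys k} (ys' k + unit_walk (\<eta> k) (b * t))) \<partial>walks n)"
    by (rule nn_integral_cmult[symmetric]) measurable
  also have "\<dots> = (\<integral>\<^sup>+\<eta>. \<integral>\<^sup>+\<xi>. (\<Prod>j\<in>{1..p}. indicator {xs' j} (xs j + unit_walk (\<xi> j) (a * t))) *
     (\<Prod>k\<in>{1..n}. indicator {ys k} (ys' k + unit_walk (\<eta> k) (b * t))) \<partial>walks p \<partial>walks n)"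
    by (intro nn_integral_cong nn_integral_multc[symmetric]) measurable
  also have "\<dots> \<le> pinned a b p n t xs ys xs' ys'"
    unfolding pinned_def pinned_weight_def
  proof (intro nn_integral_mono)
    fix \<eta> \<xi> :: "nat \<Rightarrow> nat \<Rightarrow> real \<times> (int ^ 'd)"
    have "1 \<le> ennreal (exp (\<Sum>j\<in>{1..p}. \<Sum>k\<in>{1..n}. overlap a b (xs j - ys' k) t (\<xi> j) (\<eta> k)))"
      by (auto simp: overlap_nonneg sum_nonneg simp flip: ennreal_1 intro!: ennreal_leI)
    from mult_left_mono[OF this] show "(\<Prod>j\<in>{1..p}. indicator {xs' j} (xs j + unit_walk (\<xi> j) (a * t))) *
     (\<Prod>k\<in>{1..n}. indicator {ys k} (ys' k + unit_walk (\<eta> k) (b * t))) \<le>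
      (\<Prod>j\<in>{1..p}. indicator {xs' j} (xs j + unit_walk (\<xi> j) (a * t))) *
     (\<Prod>k\<in>{1..n}. indicator {ys k} (ys' k + unit_walk (\<eta> k) (b * t))) *
     ennreal (exp (\<Sum>j\<in>{1..p}. \<Sum>k\<in>{1..n}. overlap a b (xs j - ys' k) t (\<xi> j) (\<eta> k)))"
      by simp
  qed
  finally show ?thesis .
qed

text \<open>The states are pairs of configurations of walks and catalysts. Positive jump rates make
  every entry positive; \<open>p * n\<close> bounds the collision rate, and
  \<open>p * a + n * b\<close> is the total jump rate, the price for nobody to move.\<close>

lemma pinned_growth:
  assumes a: "0 < a" and b: "0 < b"
  obtains \<Lambda> where "\<And>t (xs :: nat \<Rightarrow> int ^ 'd) ys xs' ys'. 0 < t \<Longrightarrow> pinned a b p n t xs ys xs' ys' \<le> ennreal (exp (\<Lambda> * t))"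
    "\<And>(xs :: nat \<Rightarrow> int ^ 'd) ys. ((\<lambda>t. ln (enn2real (pinned a b p n t xs ys xs ys)) / t) \<longlongrightarrow> \<Lambda>) at_top"
proof -
  define K where "K = (\<lambda>t q q'. enn2real (pinned a b p n t (fst q) (snd q) (fst q') (snd q' :: nat \<Rightarrow> int ^ 'd)))"
  have fin: "pinned a b p n t xs ys xs' ys' \<noteq> \<top>" if "0 < t" for t and xs ys xs' ys' :: "nat \<Rightarrow> int ^ 'd"
    using pinned_le[of t a b p n xs ys xs' ys'] that by (auto simp: top_unique)
  have K: "ennreal (K t q q') = pinned a b p n t (fst q) (snd q) (fst q') (snd q')" if "0 < t" for t q q'
    unfolding K_def using fin[OF that] by (simp add: less_top)
  have K0: "0 \<le> K t q q'" for t q q' by (simp add: K_def)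
  obtain \<Lambda> where \<Lambda>: "\<And>t q q'. 0 < t \<Longrightarrow> K t q q' \<le> exp (\<Lambda> * t)" "\<And>q. ((\<lambda>t. ln (K t q q) / t) \<longlongrightarrow> \<Lambda>) at_top"
  proof (rule symmetric_kernel_growth[of K "real p * real n" "real p * a + real n * b"])
    fix s t :: real and x y z :: "(nat \<Rightarrow> int ^ 'd) \<times> (nat \<Rightarrow> int ^ 'd)"
    assume s: "0 < s" and t: "0 < t"
    have "ennreal (K s x y * K t y z) \<le> ennreal (K (s + t) x z)"
      using pinned_mult_le[of a b s t p n "fst x" "snd x" "fst y" "snd y" "fst z" "snd z"] a b s t by (simp add: K K0 ennreal_mult)
    then show "K s x y * K t y z \<le> K (s + t) x z" using K0 by (simp add: ennreal_le_iff)
  next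
    fix t :: real and x y :: "(nat \<Rightarrow> int ^ 'd) \<times> (nat \<Rightarrow> int ^ 'd)"
    assume t: "0 < t"
    show "K t x y = K t y x" unfolding K_def using a b t by (simp add: pinned_sym[of a b t p n "fst x" "snd x" "fst y" "snd y"])
    have "0 < (\<Prod>j\<in>{1..p}. heat (a * t) (fst y j - fst x j)) * (\<Prod>k\<in>{1..n}. heat (b * t) (snd x k - snd y k))"
      using a b t by (intro mult_pos_pos prod_pos heat_pos ballI) auto
    also have "\<dots> \<le> K t x y"
      using pinned_ge[where a=a and b=b and p=p and n=n and t=t and xs="fst x" and xs'="fst y" and ys="snd x" and ys'="snd y"] t K0 by (simp add: K[symmetric] ennreal_le_iff)
    finally show "0 < K t x y" .
  next
    fix t :: real and x :: "(nat \<Rightarrow> int ^ 'd) \<times> (nat \<Rightarrow> int ^ 'd)"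
    assume t: "0 < t"
    show "K t x x \<le> exp (real p * real n * t)"
      using pinned_le[of t a b p n "fst x" "snd x" "fst x" "snd x"] t by (simp add: K[symmetric] ennreal_le_iff)
    have "exp (- (a * t)) ^ p * exp (- (b * t)) ^ n \<le> heat (a * t) (0 :: int ^ 'd) ^ p * heat (b * t) (0 :: int ^ 'd) ^ n"
      using a b t by (intro mult_mono power_mono heat_0_ge) (auto simp: heat_nonneg)
    also have "\<dots> \<le> K t x x"
      using pinned_ge[where a=a and b=b and p=p and n=n and t=t and xs="fst x" and xs'="fst x" and ys="snd x" and ys'="snd x"] t K0 by (simp add: K[symmetric] ennreal_le_iff)
    finally show "exp (- (real p * a + real n * b) * t) \<le> K t x x"
      by (simp add: exp_of_nat_mult[symmetric] exp_add[symmetric] algebra_simps)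
  qed blast
  show ?thesis
  proof (rule that)
    show "pinned a b p n t xs ys xs' ys' \<le> ennreal (exp (\<Lambda> * t))" if "0 < t" for t and xs ys xs' ys' :: "nat \<Rightarrow> int ^ 'd"
      using \<Lambda>(1)[OF that, of "(xs, ys)" "(xs', ys')"] K[OF that, of "(xs, ys)" "(xs', ys')"] by (metis ennreal_leI fst_conv snd_conv)
    show "((\<lambda>t. ln (enn2real (pinned a b p n t xs ys xs ys)) / t) \<longlongrightarrow> \<Lambda>) at_top" for xs ys :: "nat \<Rightarrow> int ^ 'd"
      using \<Lambda>(2)[of "(xs, ys)"] by (simp add: K_def)
  qed
qed

section \<open>From pinned moments to the full moment\<close>

lemma pinned_le_moment:
  assumes t: "0 \<le> t"
  shows "pinned a b p n t (\<lambda>_. y) (\<lambda>_. 0) (\<lambda>_. y) (\<lambda>_. 0) \<le> moment a b p n y t"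
  unfolding pinned_def moment_def pinned_weight_eq by (intro nn_integral_mono) auto

lemma card_l1_ball:
  shows "finite {z :: int ^ 'd. l1 z < int k}" "card {z :: int ^ 'd. l1 z < int k} \<le> (2 * k + 1) ^ CARD('d)"
proof -
  have le: "\<bar>z $ i\<bar> \<le> int k" if "l1 z < int k" for z :: "int ^ 'd" and i
  proof -
    have "\<bar>z $ i\<bar> \<le> l1 z" unfolding l1_def by (rule member_le_sum) auto
    then show ?thesis using that by simp
  qed
  have F: "z $ i \<in> {- int k..int k}" if "z \<in> {z :: int ^ 'd. l1 z < int k}" for z i
    using le[of z i] that by auto
  show "finite {z :: int ^ 'd. l1 z < int k}"
    by (rule sum_prod_vec_le(1)[of "{- int k..int k}" _ "\<lambda>_. 1"]) (use F in auto)
  have "real (card {z :: int ^ 'd. l1 z < int k}) \<le> real ((2 * k + 1) ^ CARD('d))"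
    using sum_prod_vec_le(2)[where S="{- int k..int k}" and F="{z :: int ^ 'd. l1 z < int k}" and w="\<lambda>_. 1"] F by (simp add: algebra_simps)
  then show "card {z :: int ^ 'd. l1 z < int k} \<le> (2 * k + 1) ^ CARD('d)" by (simp only: of_nat_le_iff)
qed

text \<open>Sort by end positions. If all displacements stay below \<open>k\<close> in
  \<open>l1\<close>, the end configuration is one of polynomially many in \<open>k\<close>, each
  contributing at most \<open>c\<close>. Otherwise the exponent is at most \<open>p * n * t\<close>,
  and some walk or catalyst has moved far, which has an exponentially small probability.\<close>

lemma moment_le_of_pinned_le:
  fixes y :: "int ^ 'd"
  assumes a: "0 \<le> a" and b: "0 \<le> b" and t: "0 \<le> t" and c: "0 \<le> c"
    and le: "\<And>(xs :: nat \<Rightarrow> int ^ 'd) ys xs' ys'. pinned a b p n t xs ys xs' ys' \<le> ennreal c"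
  shows "moment a b p n y t \<le> ennreal (real ((2 * k + 1) ^ (CARD('d) * (p + n))) * c +
    exp (real p * real n * t) * (real p * exp (2 * (a * t) - real k) + real n * exp (2 * (b * t) - real k)))"
proof -
  define B where "B = {z :: int ^ 'd. l1 z < int k}"
  define T where "T = {z :: int ^ 'd. int k \<le> l1 z}"
  \<comment> \<open>Extensional functions make the sets of end configurations finite. They record
    displacements, so in \<open>?W\<close> the walks end at \<open>y + X j\<close>, and
    \<open>Y\<close> gives the positions of catalysts started at \<open>0\<close>.\<close>
  define PX where "PX = ({1..p} \<rightarrow>\<^sub>E B)"
  define PY where "PY = ({1..n} \<rightarrow>\<^sub>E B)"
  let ?C = "ennreal (exp (real p * real n * t))"
  let ?W = "\<lambda>X Y. pinned_weight a b p n t (\<lambda>_. y) Y (\<lambda>j. y + X j) (\<lambda>_. 0)"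
  have B: "finite B" "card B \<le> (2 * k + 1) ^ CARD('d)" unfolding B_def by (rule card_l1_ball)+
  have fin: "finite PX" "finite PY" unfolding PX_def PY_def using B by (auto intro!: finite_PiE)
  have card: "real (card PX * card PY) \<le> real ((2 * k + 1) ^ (CARD('d) * (p + n)))"
  proof -
    have "card PX * card PY = card B ^ (p + n)" by (simp add: PX_def PY_def card_PiE power_add)
    also have "\<dots> \<le> ((2 * k + 1) ^ CARD('d)) ^ (p + n)" by (rule power_mono[OF B(2)]) simp
    finally show ?thesis by (simp only: power_mult of_nat_le_iff)
  qed
  interpret N: prob_space "walks n :: (nat \<Rightarrow> nat \<Rightarrow> real \<times> (int ^ 'd)) measure" by (rule prob_space_walks)
  interpret P: prob_space "walks p :: (nat \<Rightarrow> nat \<Rightarrow> real \<times> (int ^ 'd)) measure" by (rule prob_space_walks)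
  have Tm [measurable]: "(\<lambda>x. indicator T (unit_walk (f x) u) :: ennreal) \<in> borel_measurable M"
    if "f \<in> measurable M walk_space" for f u and M :: "'z measure"
  proof -
    have "(\<lambda>x. unit_walk (f x) u) \<in> measurable M (count_space UNIV)" using that by measurable
    from measurable_compose[OF this, of "indicator T :: _ \<Rightarrow> ennreal" borel] show ?thesis by simp
  qed
  have pointwise: "ennreal (exp (\<Sum>j\<in>{1..p}. \<Sum>k\<in>{1..n}. overlap a b y t (\<xi> j) (\<eta> k))) \<le>
    (\<Sum>X\<in>PX. \<Sum>Y\<in>PY. ?W X Y \<eta> \<xi>) +
    ?C * ((\<Sum>j\<in>{1..p}. indicator T (unit_walk (\<xi> j) (a * t))) + (\<Sum>k\<in>{1..n}. indicator T (unit_walk (\<eta> k) (b * t))))"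
    (is "?l \<le> ?w + ?C * (?x + ?y)") for \<eta> \<xi> :: "nat \<Rightarrow> nat \<Rightarrow> real \<times> (int ^ 'd)"
  proof (cases "(\<forall>j\<in>{1..p}. unit_walk (\<xi> j) (a * t) \<in> B) \<and> (\<forall>k\<in>{1..n}. unit_walk (\<eta> k) (b * t) \<in> B)")
    case True
    define X where "X = (\<lambda>j\<in>{1..p}. unit_walk (\<xi> j) (a * t))"
    define Y where "Y = (\<lambda>k\<in>{1..n}. unit_walk (\<eta> k) (b * t))"
    have XY: "X \<in> PX" "Y \<in> PY" using True by (auto simp: PX_def PY_def X_def Y_def)
    have "?l = ?W X Y \<eta> \<xi>" unfolding pinned_weight_eq by (auto simp: X_def Y_def)
    also have "\<dots> \<le> (\<Sum>Y\<in>PY. ?W X Y \<eta> \<xi>)"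
      using XY fin by (intro member_le_sum) auto
    also have "\<dots> \<le> ?w"
      using XY fin by (intro member_le_sum[of X PX "\<lambda>X. \<Sum>Y\<in>PY. ?W X Y \<eta> \<xi>"]) auto
    finally show ?thesis by (rule order_trans) simp
  next
    case False
    then have "(1 :: ennreal) \<le> ?x + ?y"
    proof (cases "\<exists>j\<in>{1..p}. unit_walk (\<xi> j) (a * t) \<notin> B")
      case True
      then obtain j where j: "j \<in> {1..p}" "unit_walk (\<xi> j) (a * t) \<in> T" by (auto simp: B_def T_def not_less)
      then have "(1 :: ennreal) = indicator T (unit_walk (\<xi> j) (a * t))" by simp
      also have "\<dots> \<le> ?x" using j by (intro member_le_sum) auto
      finally show ?thesis by (rule order_trans) simp
    next
      case nX: False
      then obtain j where j: "j \<in> {1..n}" "unit_walk (\<eta> j) (b * t) \<in> T" using False by (auto simp: B_def T_def not_less)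
      then have "(1 :: ennreal) = indicator T (unit_walk (\<eta> j) (b * t))" by simp
      also have "\<dots> \<le> ?y" using j by (intro member_le_sum) auto
      finally show ?thesis by (rule order_trans) simp
    qed
    have "?l \<le> ?C" by (intro ennreal_leI exp_le_cancel_iff[THEN iffD2] sum_overlap_le t)
    also have "\<dots> \<le> ?C * (?x + ?y)" using mult_left_mono[OF \<open>1 \<le> ?x + ?y\<close>, of ?C] by simp
    finally show ?thesis by (rule order_trans) simp
  qed
  have inner: "(\<integral>\<^sup>+\<xi>. ennreal (exp (\<Sum>j\<in>{1..p}. \<Sum>k\<in>{1..n}. overlap a b y t (\<xi> j) (\<eta> k))) \<partial>walks p) \<le>
    (\<Sum>X\<in>PX. \<Sum>Y\<in>PY. \<integral>\<^sup>+\<xi>. ?W X Y \<eta> \<xi> \<partial>walks p) +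
    ?C * (ennreal (real p * exp (2 * (a * t) - real k)) + (\<Sum>k\<in>{1..n}. indicator T (unit_walk (\<eta> k) (b * t))))"
    if \<eta>: "\<eta> \<in> space (walks n)" for \<eta> :: "nat \<Rightarrow> nat \<Rightarrow> real \<times> (int ^ 'd)"
  proof -
    have Wm: "(\<lambda>\<xi>. ?W X Y \<eta> \<xi>) \<in> borel_measurable (walks p)" for X Y
      by (rule measurable_pinned_weight[OF measurable_const[OF \<eta>] measurable_ident_sets[OF refl]])
    have Tj: "(\<lambda>\<xi>. indicator T (unit_walk (\<xi> j) (a * t)) :: ennreal) \<in> borel_measurable (walks p)" if "j \<in> {1..p}" for j
      by (rule Tm[OF measurable_walks_component[OF that]])
    have "(\<integral>\<^sup>+\<xi>. ennreal (exp (\<Sum>j\<in>{1..p}. \<Sum>k\<in>{1..n}. overlap a b y t (\<xi> j) (\<eta> k))) \<partial>walks p) \<le>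
      (\<integral>\<^sup>+\<xi>. (\<Sum>X\<in>PX. \<Sum>Y\<in>PY. ?W X Y \<eta> \<xi>) +
    ?C * ((\<Sum>j\<in>{1..p}. indicator T (unit_walk (\<xi> j) (a * t))) + (\<Sum>k\<in>{1..n}. indicator T (unit_walk (\<eta> k) (b * t)))) \<partial>walks p)"
      by (intro nn_integral_mono pointwise)
    also have "\<dots> = (\<integral>\<^sup>+\<xi>. (\<Sum>X\<in>PX. \<Sum>Y\<in>PY. ?W X Y \<eta> \<xi>) \<partial>walks p) +
      ?C * ((\<integral>\<^sup>+\<xi>. (\<Sum>j\<in>{1..p}. indicator T (unit_walk (\<xi> j) (a * t))) \<partial>walks p) + (\<Sum>k\<in>{1..n}. indicator T (unit_walk (\<eta> k) (b * t))))"
      using Wm Tj by (subst nn_integral_add) (simp_all add: nn_integral_cmult nn_integral_add)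
    also have "(\<integral>\<^sup>+\<xi>. (\<Sum>X\<in>PX. \<Sum>Y\<in>PY. ?W X Y \<eta> \<xi>) \<partial>walks p) = (\<Sum>X\<in>PX. \<Sum>Y\<in>PY. \<integral>\<^sup>+\<xi>. ?W X Y \<eta> \<xi> \<partial>walks p)"
      using Wm by (simp add: nn_integral_sum)
    also have "(\<integral>\<^sup>+\<xi>. (\<Sum>j\<in>{1..p}. indicator T (unit_walk (\<xi> j) (a * t))) \<partial>walks p) =
      (\<Sum>j\<in>{1..p}. \<integral>\<^sup>+\<omega>. indicator T (unit_walk \<omega> (a * t)) \<partial>walk_space)"
    by (rule trans[OF nn_integral_sum[OF Tj] sum.cong[OF refl nn_integral_walks_component[OF _ Tm[OF measurable_ident_sets[OF refl]]]]])
    also have "\<dots> \<le> (\<Sum>j\<in>{1..p}. ennreal (exp (2 * (a * t) - real k)))"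
      unfolding T_def using a t by (intro sum_mono emeasure_l1_unit_walk_ge) simp
    also have "\<dots> = ennreal (real p * exp (2 * (a * t) - real k))" by (simp add: ennreal_mult ennreal_of_nat_eq_real_of_nat)
    finally show ?thesis by this (intro add_mono mult_left_mono order_refl; simp)
  qed
  have Wm: "(\<lambda>\<eta>. \<integral>\<^sup>+\<xi>. ?W X Y \<eta> \<xi> \<partial>walks p) \<in> borel_measurable (walks n)" for X Y
    by (intro P.borel_measurable_nn_integral, unfold split_beta', measurable)
  have Tk: "(\<lambda>\<xi>. indicator T (unit_walk (\<xi> j) (b * t)) :: ennreal) \<in> borel_measurable (walks n)" if "j \<in> {1..n}" for j
    by (rule Tm[OF measurable_walks_component[OF that]])
  have "moment a b p n y t \<le> (\<integral>\<^sup>+\<eta>. (\<Sum>X\<in>PX. \<Sum>Y\<in>PY. \<integral>\<^sup>+\<xi>. ?W X Y \<eta> \<xi> \<partial>walks p) +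
    ?C * (ennreal (real p * exp (2 * (a * t) - real k)) + (\<Sum>k\<in>{1..n}. indicator T (unit_walk (\<eta> k) (b * t)))) \<partial>walks n)"
    unfolding moment_def by (intro nn_integral_mono inner)
  also have "\<dots> = (\<integral>\<^sup>+\<eta>. (\<Sum>X\<in>PX. \<Sum>Y\<in>PY. \<integral>\<^sup>+\<xi>. ?W X Y \<eta> \<xi> \<partial>walks p) \<partial>walks n) +
    ?C * (ennreal (real p * exp (2 * (a * t) - real k)) + (\<integral>\<^sup>+\<eta>. (\<Sum>k\<in>{1..n}. indicator T (unit_walk (\<eta> k) (b * t))) \<partial>walks n))"
    using Wm Tk by (subst nn_integral_add) (simp_all add: nn_integral_cmult nn_integral_add)
  also have "(\<integral>\<^sup>+\<eta>. (\<Sum>X\<in>PX. \<Sum>Y\<in>PY. \<integral>\<^sup>+\<xi>. ?W X Y \<eta> \<xi> \<partial>walks p) \<partial>walks n) =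
    (\<Sum>X\<in>PX. \<Sum>Y\<in>PY. pinned a b p n t (\<lambda>_. y) Y (\<lambda>j. y + X j) (\<lambda>_. 0))"
    using Wm by (simp add: nn_integral_sum pinned_def)
  also have "\<dots> \<le> (\<Sum>X\<in>PX. \<Sum>Y\<in>PY. ennreal c)" by (intro sum_mono le)
  also have "\<dots> = ennreal (real (card PX * card PY) * c)" using c by (simp add: ennreal_mult ennreal_of_nat_eq_real_of_nat mult.assoc)
  also have "\<dots> \<le> ennreal (real ((2 * k + 1) ^ (CARD('d) * (p + n))) * c)" using c by (intro ennreal_leI mult_right_mono card)
  also have "(\<integral>\<^sup>+\<eta>. (\<Sum>k\<in>{1..n}. indicator T (unit_walk (\<eta> k) (b * t))) \<partial>walks n) =
    (\<Sum>j\<in>{1..n}. \<integral>\<^sup>+\<omega>. indicator T (unit_walk \<omega> (b * t)) \<partial>walk_space)"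
    by (rule trans[OF nn_integral_sum[OF Tk] sum.cong[OF refl nn_integral_walks_component[OF _ Tm[OF measurable_ident_sets[OF refl]]]]])
  also have "\<dots> \<le> (\<Sum>j\<in>{1..n}. ennreal (exp (2 * (b * t) - real k)))"
    unfolding T_def using b t by (intro sum_mono emeasure_l1_unit_walk_ge) simp
  also have "\<dots> = ennreal (real n * exp (2 * (b * t) - real k))" by (simp add: ennreal_mult ennreal_of_nat_eq_real_of_nat)
  finally have "moment a b p n y t \<le> ennreal (real ((2 * k + 1) ^ (CARD('d) * (p + n))) * c) +
    ?C * (ennreal (real p * exp (2 * (a * t) - real k)) + ennreal (real n * exp (2 * (b * t) - real k)))"
    by this (intro add_mono mult_left_mono order_refl; simp)+
  then show ?thesis
    using c by (simp add: ennreal_plus[symmetric] ennreal_mult[symmetric] add_mono mult_left_mono del: ennreal_plus)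
qed

text \<open>The factor lost in the box decomposition grows polynomially and is invisible in the
  exponential rate; \<open>E\<close> dominates all coefficients, so that a power of
  \<open>E * t\<close> bounds everything.\<close>

lemma ln_affine_power_over_tendsto:
  fixes A B C :: real
  assumes "0 \<le> A" "0 \<le> B" "0 \<le> C"
  shows "((\<lambda>t. ln (((A * t + B) ^ D) + C + 1) / t) \<longlongrightarrow> 0) at_top"
proof (rule tendsto_sandwich)
  define E where "E = A + B + C + 1"
  have E: "1 \<le> E" using assms by (simp add: E_def)
  show "\<forall>\<^sub>F t in at_top. ln (((A * t + B) ^ D) + C + 1) / t \<le> ln 2 / t + real (Suc D) * (ln E / t + ln t / t)"
    using eventually_ge_at_top[of 1]
  proof eventually_elim
    case (elim t)
    have "A * t + B \<le> E * t" using elim assms mult_left_mono[OF elim, of "B + C + 1"] by (simp add: E_def algebra_simps)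
    then have "(A * t + B) ^ D \<le> (E * t) ^ D" using assms elim by (intro power_mono) auto
    also have "\<dots> \<le> (E * t) ^ Suc D" using E elim mult_mono[of 1 E 1 t] by (intro power_increasing) auto
    finally have 1: "(A * t + B) ^ D \<le> (E * t) ^ Suc D" .
    have "C + 1 \<le> E" using assms by (simp add: E_def)
    also have "E * 1 \<le> E * t" using E elim by (intro mult_left_mono) auto
    also have "\<dots> \<le> (E * t) ^ Suc D" using E elim mult_mono[of 1 E 1 t] by (intro self_le_power) auto
    finally have "(A * t + B) ^ D + C + 1 \<le> 2 * (E * t) ^ Suc D" using 1 by simp
    moreover have "0 < (A * t + B) ^ D + C + 1" using assms elim by (intro add_nonneg_pos) auto
    ultimately have "ln ((A * t + B) ^ D + C + 1) \<le> ln (2 * (E * t) ^ Suc D)" by (subst ln_le_cancel_iff) auto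
    also have "\<dots> = ln 2 + real (Suc D) * (ln E + ln t)" using E elim by (simp add: ln_mult ln_realpow del: power_Suc)
    finally show ?case using elim by (simp add: field_simps)
  qed
  show "\<forall>\<^sub>F t in at_top. 0 \<le> ln (((A * t + B) ^ D) + C + 1) / t"
    using eventually_ge_at_top[of 1] by eventually_elim (use assms in \<open>auto intro!: divide_nonneg_nonneg ln_ge_zero\<close>)
  have "((\<lambda>t. ln 2 / t + real (Suc D) * (ln E / t + ln t / t)) \<longlongrightarrow> 0 + real (Suc D) * (0 + 0)) at_top"
    by (intro tendsto_add tendsto_mult tendsto_const tendsto_divide_0[OF tendsto_const] ln_x_over_x_tendsto_0 filterlim_at_top_imp_at_infinity filterlim_ident)
  then show "((\<lambda>t. ln 2 / t + real (Suc D) * (ln E / t + ln t / t)) \<longlongrightarrow> 0) at_top" by simp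
qed (rule tendsto_const)

text \<open>A diagonal pinned moment bounds the moment from below. Above, the box has radius of
  order \<open>M * t\<close>, large enough for the contribution from outside to be comparable with
  \<open>exp (\<Lambda> * t)\<close>.\<close>

theorem moment_growth_exists:
  fixes y :: "int ^ 'd"
  assumes a: "0 < a" and b: "0 < b"
  obtains \<Lambda> where "((\<lambda>t. ln (enn2real (moment a b p n y t)) / t) \<longlongrightarrow> \<Lambda>) at_top"
proof -
  obtain \<Lambda> where up: "\<And>t (xs :: nat \<Rightarrow> int ^ 'd) ys xs' ys'. 0 < t \<Longrightarrow> pinned a b p n t xs ys xs' ys' \<le> ennreal (exp (\<Lambda> * t))"
    and low: "\<And>(xs :: nat \<Rightarrow> int ^ 'd) ys. ((\<lambda>t. ln (enn2real (pinned a b p n t xs ys xs ys)) / t) \<longlongrightarrow> \<Lambda>) at_top"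
    using pinned_growth[OF a b] by blast
  \<comment> \<open>This gives \<open>p * n + 2 * c - M \<le> - \<bar>\<Lambda>\<bar> \<le>
    \<Lambda>\<close> for both jump rates \<open>c\<close>, the inequality behind
    \<open>tail\<close>.\<close>
  define M where "M = real p * real n + 2 * a + 2 * b + \<bar>\<Lambda>\<bar>"
  define D where "D = CARD('d) * (p + n)"
  define R where "R = (\<lambda>t. (2 * M * t + 3) ^ D + real (p + n) + 1)"
  have M: "0 \<le> M" using a b by (simp add: M_def)
  have R: "1 \<le> R t" if "0 \<le> t" for t using M that by (simp add: R_def)
  have upper: "moment a b p n y t \<le> ennreal (R t * exp (\<Lambda> * t))" if t: "0 < t" for t
  proof -
    define k where "k = nat \<lceil>M * t\<rceil>"
    have Mt: "0 \<le> M * t" using M t by simp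
    have k: "M * t \<le> real k" "real k \<le> M * t + 1" unfolding k_def using Mt by linarith+
    have tail: "exp (real p * real n * t) * exp (2 * (c * t) - real k) \<le> exp (\<Lambda> * t)" if "c \<in> {a, b}" for c
    proof -
      have "real p * real n + 2 * c - M \<le> \<Lambda>" using that a b by (auto simp: M_def)
      then have "(real p * real n + 2 * c - M) * t \<le> \<Lambda> * t" using t by (intro mult_right_mono) auto
      then have "real p * real n * t + (2 * (c * t) - real k) \<le> \<Lambda> * t" using k(1) by (simp add: algebra_simps)
      then show ?thesis by (simp flip: exp_add)
    qed
    have "real ((2 * k + 1) ^ D) \<le> (2 * M * t + 3) ^ D"
      unfolding of_nat_power by (rule power_mono) (use k(2) in auto)
    then have 1: "real ((2 * k + 1) ^ D) * exp (\<Lambda> * t) \<le> (2 * M * t + 3) ^ D * exp (\<Lambda> * t)" by (rule mult_right_mono) simp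
    have "exp (real p * real n * t) * (real p * exp (2 * (a * t) - real k) + real n * exp (2 * (b * t) - real k)) =
      real p * (exp (real p * real n * t) * exp (2 * (a * t) - real k)) + real n * (exp (real p * real n * t) * exp (2 * (b * t) - real k))"
      by (simp only: distrib_left ac_simps)
    also have "\<dots> \<le> real p * exp (\<Lambda> * t) + real n * exp (\<Lambda> * t)"
      by (intro add_mono mult_left_mono tail) auto
    finally have "real ((2 * k + 1) ^ D) * exp (\<Lambda> * t) +
        exp (real p * real n * t) * (real p * exp (2 * (a * t) - real k) + real n * exp (2 * (b * t) - real k)) \<le>
      (2 * M * t + 3) ^ D * exp (\<Lambda> * t) + (real p * exp (\<Lambda> * t) + real n * exp (\<Lambda> * t))"
      by (rule add_mono[OF 1])
    also have "\<dots> \<le> R t * exp (\<Lambda> * t)" by (simp add: R_def algebra_simps)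
    finally have "ennreal (real ((2 * k + 1) ^ D) * exp (\<Lambda> * t) +
        exp (real p * real n * t) * (real p * exp (2 * (a * t) - real k) + real n * exp (2 * (b * t) - real k))) \<le> ennreal (R t * exp (\<Lambda> * t))"
      by (rule ennreal_leI)
    moreover have "moment a b p n y t \<le> ennreal (real ((2 * k + 1) ^ D) * exp (\<Lambda> * t) +
        exp (real p * real n * t) * (real p * exp (2 * (a * t) - real k) + real n * exp (2 * (b * t) - real k)))"
      unfolding D_def using a b t by (intro moment_le_of_pinned_le up) auto
    ultimately show ?thesis by (rule order_trans[rotated])
  qed
  have fin: "moment a b p n y t < \<top>" if "0 < t" for t
    using upper[OF that] by (rule order_le_less_trans) simp
  show ?thesis
  proof (rule that, rule tendsto_sandwich)
    show "((\<lambda>t. ln (enn2real (pinned a b p n t (\<lambda>_. y) (\<lambda>_. 0) (\<lambda>_. y) (\<lambda>_. 0))) / t) \<longlongrightarrow> \<Lambda>) at_top" by (rule low)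
    have "((\<lambda>t. \<Lambda> + ln (R t) / t) \<longlongrightarrow> \<Lambda> + 0) at_top"
      unfolding R_def using M by (intro tendsto_add tendsto_const ln_affine_power_over_tendsto) auto
    then show "((\<lambda>t. \<Lambda> + ln (R t) / t) \<longlongrightarrow> \<Lambda>) at_top" by simp
    show "\<forall>\<^sub>F t in at_top. ln (enn2real (moment a b p n y t)) / t \<le> \<Lambda> + ln (R t) / t"
      using eventually_gt_at_top[of 0]
    proof eventually_elim
      case (elim t)
      have "enn2real (moment a b p n y t) \<le> R t * exp (\<Lambda> * t)"
        using upper[OF elim] R[of t] elim by (intro enn2real_leI) auto
      moreover have "1 \<le> enn2real (moment a b p n y t)"
        using moment_ge_1[of t a b p n y] fin[OF elim] elim enn2real_mono[of 1 "moment a b p n y t"] by simp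
      ultimately have "ln (enn2real (moment a b p n y t)) \<le> ln (R t * exp (\<Lambda> * t))" by simp
      also have "\<dots> = ln (R t) + \<Lambda> * t" using R[of t] elim by (subst ln_mult) auto
      finally show ?case using elim by (simp add: field_simps)
    qed
    show "\<forall>\<^sub>F t in at_top. ln (enn2real (pinned a b p n t (\<lambda>_. y) (\<lambda>_. 0) (\<lambda>_. y) (\<lambda>_. 0))) / t \<le> ln (enn2real (moment a b p n y t)) / t"
      using eventually_gt_at_top[of 0]
    proof eventually_elim
      case (elim t)
      let ?q = "pinned a b p n t (\<lambda>_. y) (\<lambda>_. 0) (\<lambda>_. y) (\<lambda>_. 0)"
      have "0 < (\<Prod>j\<in>{1..p}. heat (a * t) (y - y)) * (\<Prod>k\<in>{1..n}. heat (b * t) (0 - 0 :: int ^ 'd))"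
        using a b elim by (intro mult_pos_pos prod_pos heat_pos ballI) auto
      then have "0 < ennreal ((\<Prod>j\<in>{1..p}. heat (a * t) (y - y)) * (\<Prod>k\<in>{1..n}. heat (b * t) (0 - 0 :: int ^ 'd)))"
        by (simp only: ennreal_less_zero_iff)
      then have "0 < ?q"
        using pinned_ge[where a=a and b=b and p=p and n=n and t=t and xs="\<lambda>_. y" and xs'="\<lambda>_. y" and ys="\<lambda>_. 0" and ys'="\<lambda>_. 0"] elim
        by (intro less_le_trans[of 0 _ ?q]) auto
      moreover have "?q \<le> moment a b p n y t" using elim by (intro pinned_le_moment) simp
      ultimately have "0 < enn2real ?q" "enn2real ?q \<le> enn2real (moment a b p n y t)"
        using fin[OF elim] by (auto simp: enn2real_positive_iff enn2real_mono)
      then show ?case using elim by (auto intro!: divide_right_mono ln_mono)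
    qed
  qed
qed

section \<open>Bounds for the Lyapunov exponents\<close>

lemma integral_catalyst_field:
  assumes t: "0 \<le> t"
  shows "(LINT s:{0..t}|lborel. catalyst_field n \<rho> \<eta> (walk \<kappa> x s \<omega>) (t - s)) =
    (\<Sum>k\<in>{1..n}. overlap (2 * real CARD('d) * \<kappa>) (2 * real CARD('d) * \<rho>) (x :: int ^ 'd) t \<omega> (\<eta> k))"
proof -
  define g where "g = (\<lambda>k s. indicator {unit_walk (\<eta> k) (2 * real CARD('d) * \<rho> * (t - s))} (x + unit_walk \<omega> (2 * real CARD('d) * \<kappa> * s)) :: real)"
  have "catalyst_field n \<rho> \<eta> (walk \<kappa> x s \<omega>) (t - s) = (\<Sum>k\<in>{1..n}. g k s)" for s
    unfolding catalyst_field_def walk_eq g_def by (intro sum.cong refl) (auto simp: indicator_def)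
  moreover have "(LINT s:{0..t}|lborel. (\<Sum>k\<in>{1..n}. g k s)) = (\<Sum>k\<in>{1..n}. LINT s:{0..t}|lborel. g k s)"
  proof -
    have "integrable lborel (\<lambda>s. indicator {0..t} s *\<^sub>R g k s)" for k
      unfolding set_integrable_def[symmetric]
      by (rule set_integral_bounds(1)) (auto simp: g_def indicator_le_1 t)
    then show ?thesis
      unfolding set_lebesgue_integral_def scaleR_sum_right by (intro Bochner_Integration.integral_sum)
  qed
  ultimately show ?thesis by (simp add: overlap_def g_def)
qed

text \<open>Overlaps are at most \<open>t\<close>, so all expectations are finite and the Bochner
  integrals of the model are real values of nonnegative integrals; the power becomes an integral
  over \<open>p\<close> independent walks.\<close>

lemma integral_pam_solution_power:
  fixes x :: "int ^ 'd"
  assumes t: "0 \<le> t"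
  shows "(\<integral>\<eta>. pam_solution n \<kappa> \<rho> \<eta> x t ^ p \<partial>catalysts_space n) =
    enn2real (moment (2 * real CARD('d) * \<kappa>) (2 * real CARD('d) * \<rho>) p n x t)"
proof -
  let ?o = "overlap (2 * real CARD('d) * \<kappa>) (2 * real CARD('d) * \<rho>) x t"
  define X where "X = (\<lambda>\<eta>. \<integral>\<^sup>+\<omega>. ennreal (exp (\<Sum>k\<in>{1..n}. ?o \<omega> (\<eta> k))) \<partial>walk_space)"
  have pm: "(\<lambda>\<omega>. \<Sum>k\<in>{1..n}. ?o \<omega> (\<eta> k)) \<in> borel_measurable walk_space" if \<eta>: "\<eta> \<in> space (walks n)" for \<eta>
  proof (rule borel_measurable_sum)
    fix k assume "k \<in> {1..n}"
    then have "\<eta> k \<in> space walk_space" using \<eta> by (auto simp: space_PiM)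
    then show "(\<lambda>\<omega>. ?o \<omega> (\<eta> k)) \<in> borel_measurable walk_space" by measurable
  qed
  have pam: "pam_solution n \<kappa> \<rho> \<eta> x t = enn2real (X \<eta>)" if \<eta>: "\<eta> \<in> space (walks n)" for \<eta>
    unfolding pam_solution_def integral_catalyst_field[OF t] X_def
    by (rule integral_eq_nn_integral) (use pm[OF \<eta>] in auto)
  have X_le: "X \<eta> \<le> ennreal (exp (real n * t))" for \<eta>
  proof -
    have "X \<eta> \<le> (\<integral>\<^sup>+\<omega>. ennreal (exp (real n * t)) \<partial>(walk_space :: (nat \<Rightarrow> real \<times> (int ^ 'd)) measure))"
      unfolding X_def
    proof (intro nn_integral_mono ennreal_leI exp_le_cancel_iff[THEN iffD2])
      fix \<omega> :: "nat \<Rightarrow> real \<times> (int ^ 'd)"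
      have "(\<Sum>k\<in>{1..n}. ?o \<omega> (\<eta> k)) \<le> (\<Sum>k\<in>{1..n}. t)" by (intro sum_mono overlap_le t)
      then show "(\<Sum>k\<in>{1..n}. ?o \<omega> (\<eta> k)) \<le> real n * t" by simp
    qed
    then show ?thesis by (simp add: walk_space.emeasure_space_1[simplified])
  qed
  have X_fin: "ennreal (enn2real (X \<eta>)) = X \<eta>" for \<eta>
    using X_le[of \<eta>] by (simp add: le_less_trans)
  have Xm: "X \<in> borel_measurable (walks n)"
    unfolding X_def by measurable
  have "(\<integral>\<eta>. pam_solution n \<kappa> \<rho> \<eta> x t ^ p \<partial>walks n) = (\<integral>\<eta>. enn2real (X \<eta>) ^ p \<partial>walks n)"
    by (intro Bochner_Integration.integral_cong refl) (simp add: pam)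
  also have "\<dots> = enn2real (\<integral>\<^sup>+\<eta>. ennreal (enn2real (X \<eta>) ^ p) \<partial>walks n)"
    by (rule integral_eq_nn_integral) (use Xm in auto)
  also have "(\<integral>\<^sup>+\<eta>. ennreal (enn2real (X \<eta>) ^ p) \<partial>walks n) = moment (2 * real CARD('d) * \<kappa>) (2 * real CARD('d) * \<rho>) p n x t"
    unfolding moment_def
  proof (rule nn_integral_cong)
    fix \<eta> :: "nat \<Rightarrow> nat \<Rightarrow> real \<times> (int ^ 'd)" assume \<eta>: "\<eta> \<in> space (walks n)"
    have "ennreal (enn2real (X \<eta>) ^ p) = (\<Prod>j\<in>{1..p}. \<integral>\<^sup>+\<omega>. ennreal (exp (\<Sum>k\<in>{1..n}. ?o \<omega> (\<eta> k))) \<partial>walk_space)"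
      by (simp add: ennreal_power[symmetric] X_fin) (simp add: X_def)
    also have "\<dots> = (\<integral>\<^sup>+\<xi>. (\<Prod>j\<in>{1..p}. ennreal (exp (\<Sum>k\<in>{1..n}. ?o (\<xi> j) (\<eta> k)))) \<partial>walks p)"
      by (rule nn_integral_walks_prod[symmetric]) (use pm[OF \<eta>] in auto)
    also have "\<dots> = (\<integral>\<^sup>+\<xi>. ennreal (exp (\<Sum>j\<in>{1..p}. \<Sum>k\<in>{1..n}. ?o (\<xi> j) (\<eta> k))) \<partial>walks p)"
      by (simp add: ennreal_exp_sum)
    finally show "ennreal (enn2real (X \<eta>) ^ p) = \<dots>" .
  qed
  finally show ?thesis by (simp add: catalysts_space_def)
qed

text \<open>\<open>Lim\<close> yields the limit only where there is one, so the values of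
  \<open>lyapunov\<close> are read off from a proven convergence of the moments.\<close>

lemma lyapunov_eqI:
  fixes x :: "int ^ 'd"
  assumes "1 \<le> p"
    and lim: "((\<lambda>t. ln (enn2real (moment (2 * real CARD('d) * \<kappa>) (2 * real CARD('d) * \<rho>) p n x t)) / t) \<longlongrightarrow> \<Lambda>) at_top"
  shows "lyapunov n p \<kappa> \<rho> x = \<Lambda> / real p"
  unfolding lyapunov_def
proof (rule tendsto_Lim)
  let ?M = "\<lambda>t. enn2real (moment (2 * real CARD('d) * \<kappa>) (2 * real CARD('d) * \<rho>) p n x t)"
  have "((\<lambda>t. ln (?M t) / t / real p) \<longlongrightarrow> \<Lambda> / real p) at_top"
    using assms by (intro tendsto_divide lim tendsto_const) auto
  then show "((\<lambda>t. 1 / (real p * t) * ln (\<integral>\<eta>. pam_solution n \<kappa> \<rho> \<eta> x t ^ p \<partial>catalysts_space n)) \<longlongrightarrow> \<Lambda> / real p) at_top"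
    by (rule Lim_transform_eventually)
      (use eventually_ge_at_top[of 0] in \<open>eventually_elim, simp add: integral_pam_solution_power field_simps\<close>)
qed simp

lemma return_moment_finite:
  assumes "1 \<le> n" "0 \<le> t"
  shows "ennreal (enn2real (return_moment TYPE('d::finite) a (real n) t)) = return_moment TYPE('d) a (real n) t"
    and "1 \<le> enn2real (return_moment TYPE('d::finite) a (real n) t)"
  using assms return_moment_scale[of "real n" a t, where 'd='d] return_moment_real[of "real n * t" "a / real n", where 'd='d] by auto

text \<open>Time scaling carries weight \<open>1\<close> over to weight \<open>n\<close>. The
  version at \<open>t - 1\<close> serves the lower bounds, whose strategies spend one time unit on
  bringing walks and catalysts together.\<close>

lemma return_moment_growth_scaled:
  assumes \<kappa>: "0 \<le> \<kappa>" and n: "1 \<le> n"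
  shows "((\<lambda>t. ln (enn2real (return_moment TYPE('d::finite) (2 * real CARD('d) * \<kappa>) (real n) t)) / t) \<longlongrightarrow>
    real n * spectral_sup TYPE('d) (\<kappa> / real n)) at_top" (is "((\<lambda>t. ln (?V t) / t) \<longlongrightarrow> ?u) at_top")
    and "((\<lambda>t. ln (enn2real (return_moment TYPE('d::finite) (2 * real CARD('d) * \<kappa>) (real n) (t - 1))) / t) \<longlongrightarrow>
    real n * spectral_sup TYPE('d) (\<kappa> / real n)) at_top"
proof -
  let ?W = "\<lambda>t. enn2real (return_moment TYPE('d) (2 * real CARD('d) * (\<kappa> / real n)) 1 t)"
  have VW: "?V t = ?W (real n * t)" for t
    using n by (subst return_moment_scale) (auto simp: field_simps)
  have lim: "filterlim (\<lambda>t. real n * t) at_top at_top"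
    using n by (intro filterlim_tendsto_pos_mult_at_top[OF tendsto_const] filterlim_ident) auto
  have "((\<lambda>t. real n * (ln (?W (real n * t)) / (real n * t))) \<longlongrightarrow> ?u) at_top"
    using \<kappa> by (intro tendsto_mult tendsto_const filterlim_compose[OF return_moment_growth lim]) auto
  moreover have "real n * (ln (?W (real n * t)) / (real n * t)) = ln (?V t) / t" for t
    using n by (simp add: VW)
  ultimately show 1: "((\<lambda>t. ln (?V t) / t) \<longlongrightarrow> ?u) at_top" by simp
  have "filterlim (\<lambda>t::real. t - 1) at_top at_top"
    using filterlim_tendsto_add_at_top[OF tendsto_const[of "-1 :: real"] filterlim_ident] by simp
  from filterlim_compose[OF 1 this] have "((\<lambda>t. ln (?V (t - 1)) / (t - 1)) \<longlongrightarrow> ?u) at_top" .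
  moreover have "((\<lambda>t::real. 1 - 1 / t) \<longlongrightarrow> 1 - 0) at_top"
    by (intro tendsto_diff tendsto_const tendsto_divide_0[OF tendsto_const] filterlim_at_top_imp_at_infinity filterlim_ident)
  ultimately have "((\<lambda>t. ln (?V (t - 1)) / (t - 1) * (1 - 1 / t)) \<longlongrightarrow> ?u * (1 - 0)) at_top"
    by (rule tendsto_mult)
  then have "((\<lambda>t. ln (?V (t - 1)) / (t - 1) * (1 - 1 / t)) \<longlongrightarrow> ?u) at_top" by simp
  then show "((\<lambda>t. ln (?V (t - 1)) / t) \<longlongrightarrow> ?u) at_top"
    by (rule Lim_transform_eventually)
      (use eventually_gt_at_top[of 1] in \<open>eventually_elim, simp add: field_simps\<close>)
qed

lemma moment_finite:
  fixes y :: "int ^ 'd"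
  assumes a: "0 \<le> a" and n: "1 \<le> n" and t: "0 < t"
  shows "ennreal (enn2real (moment a b p n y t)) = moment a b p n y t" "1 \<le> enn2real (moment a b p n y t)"
    and "enn2real (moment a b p n y t) \<le> enn2real (return_moment TYPE('d) a (real n) t) ^ p"
proof -
  let ?V = "enn2real (return_moment TYPE('d) a (real n) t)"
  have le: "moment a b p n y t \<le> ennreal (?V ^ p)"
    using moment_le[OF a t n, of b p y] t return_moment_finite(1)[OF n, of t a, where 'd='d] by (simp add: ennreal_power[symmetric])
  show fin: "ennreal (enn2real (moment a b p n y t)) = moment a b p n y t"
    using le_less_trans[OF le ennreal_less_top] by simp
  show "1 \<le> enn2real (moment a b p n y t)"
  proof -
    have "ennreal 1 \<le> ennreal (enn2real (moment a b p n y t))"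
      unfolding fin using moment_ge_1[of t a b p n y] t by simp
    then show ?thesis by simp
  qed
  show "enn2real (moment a b p n y t) \<le> ?V ^ p" using le by (intro enn2real_leI) auto
qed

text \<open>If the catalysts can reach \<open>y\<close>, they move there; if not, the walks come to
  the resting catalysts. The cost of meeting is a constant \<open>C\<close>, which does not affect
  the rate.\<close>

lemma moment_lower_bound:
  fixes y :: "int ^ 'd"
  assumes a: "0 \<le> a" and b: "0 \<le> b" and n: "1 \<le> n" and pos: "0 < heat a y \<or> 0 < heat b y"
  obtains C where "0 < C"
    "\<And>t. 1 \<le> t \<Longrightarrow> C * exp (- (real n * b) * t) * enn2real (return_moment TYPE('d) a (real n) (t - 1)) ^ p \<le> enn2real (moment a b p n y t)"
proof -
  let ?V = "\<lambda>t. enn2real (return_moment TYPE('d) a (real n) t)"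
  have V: "return_moment TYPE('d) a (real n) (t - 1) = ennreal (?V (t - 1))" if "1 \<le> t" for t
    using return_moment_finite(1)[OF n, of "t - 1" a, where 'd='d] that by simp
  have M: "c \<le> enn2real (moment a b p n y t)" if "ennreal c \<le> moment a b p n y t" "1 \<le> t" for c t
    using that moment_finite(1)[OF a n, of t b p y] by (metis ennreal_le_iff enn2real_nonneg less_le_trans zero_less_one)
  show ?thesis
  proof (cases "0 < heat b y")
    case True
    show ?thesis
    proof (rule that)
      show "0 < heat b y ^ n" using True by simp
      fix t :: real assume t: "1 \<le> t"
      define r where "r = ?V (t - 1)"
      have r: "return_moment TYPE('d) a (real n) (t - 1) = ennreal r" unfolding r_def by (rule V[OF t])
      have r0: "0 \<le> r" by (simp add: r_def)
      have "heat b y ^ n * exp (- (real n * b) * t) * ?V (t - 1) ^ p \<le> heat b y ^ n * exp (- (b * (t - 1))) ^ n * ?V (t - 1) ^ p"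
      proof (intro mult_right_mono mult_left_mono)
        have "exp (- (real n * b) * t) \<le> exp (real n * - (b * (t - 1)))" using b by (simp add: algebra_simps)
        then show "exp (- (real n * b) * t) \<le> exp (- (b * (t - 1))) ^ n" by (simp only: exp_of_nat_mult)
      qed (use True in auto)
      also have "\<dots> \<le> enn2real (moment a b p n y t)"
        using moment_ge_moving[OF b t, of y n a p] t True
        by (intro M) (auto simp: r r0 ennreal_power[symmetric] ennreal_mult power_mult_distrib)
      finally show "heat b y ^ n * exp (- (real n * b) * t) * ?V (t - 1) ^ p \<le> enn2real (moment a b p n y t)" .
    qed
  next
    case False
    then have h: "0 < heat a y" using pos by simp
    show ?thesis
    proof (rule that)
      show "0 < heat a y ^ p" using h by simp
      fix t :: real assume t: "1 \<le> t"
      define r where "r = ?V (t - 1)"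
      have r: "return_moment TYPE('d) a (real n) (t - 1) = ennreal r" unfolding r_def by (rule V[OF t])
      have r0: "0 \<le> r" by (simp add: r_def)
      have "heat a y ^ p * exp (- (real n * b) * t) * ?V (t - 1) ^ p = exp (- (b * t)) ^ n * (heat a y * ?V (t - 1)) ^ p"
        by (simp add: exp_of_nat_mult[symmetric] power_mult_distrib mult.assoc)
      also have "\<dots> \<le> enn2real (moment a b p n y t)"
        using moment_ge_staying[OF a b t, of n y p] t h
        by (intro M) (auto simp: r r0 ennreal_power[symmetric] ennreal_mult power_mult_distrib)
      finally show "heat a y ^ p * exp (- (real n * b) * t) * ?V (t - 1) ^ p \<le> enn2real (moment a b p n y t)" .
    qed
  qed
qed

text \<open>The bounds differ by \<open>n * b\<close>, the cost of keeping all catalysts at rest.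
  Convergence of the rate is still open here, so the bounds are given as functions \<open>l\<close>
  and \<open>u\<close> enclosing it.\<close>

lemma moment_rate_bounds:
  fixes y :: "int ^ 'd"
  assumes \<kappa>: "0 \<le> \<kappa>" and b: "0 \<le> b" and n: "1 \<le> n" and pos: "0 < heat (2 * real CARD('d) * \<kappa>) y \<or> 0 < heat b y"
  obtains l u where "(l \<longlongrightarrow> real p * (real n * spectral_sup TYPE('d) (\<kappa> / real n)) - real n * b) at_top"
    "(u \<longlongrightarrow> real p * (real n * spectral_sup TYPE('d) (\<kappa> / real n))) at_top"
    "\<forall>\<^sub>F t in at_top. l t \<le> ln (enn2real (moment (2 * real CARD('d) * \<kappa>) b p n y t)) / t"
    "\<forall>\<^sub>F t in at_top. ln (enn2real (moment (2 * real CARD('d) * \<kappa>) b p n y t)) / t \<le> u t"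
proof -
  define a where "a = 2 * real CARD('d) * \<kappa>"
  define m where "m = real n * spectral_sup TYPE('d) (\<kappa> / real n)"
  have a: "0 \<le> a" using \<kappa> by (simp add: a_def)
  let ?V = "\<lambda>t. enn2real (return_moment TYPE('d) a (real n) t)"
  let ?M = "\<lambda>t. enn2real (moment a b p n y t)"
  obtain C where C: "0 < C" "\<And>t. 1 \<le> t \<Longrightarrow> C * exp (- (real n * b) * t) * ?V (t - 1) ^ p \<le> ?M t"
    using moment_lower_bound[OF a b n, of y p] pos by (auto simp: a_def)
  have V: "((\<lambda>t. ln (?V t) / t) \<longlongrightarrow> m) at_top" "((\<lambda>t. ln (?V (t - 1)) / t) \<longlongrightarrow> m) at_top"
    unfolding a_def m_def by (rule return_moment_growth_scaled[OF \<kappa> n])+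
  show ?thesis
  proof (rule that[unfolded a_def[symmetric] m_def[symmetric]])
    have "((\<lambda>t. ln C / t + real p * (ln (?V (t - 1)) / t) - real n * b) \<longlongrightarrow> 0 + real p * m - real n * b) at_top"
      by (intro tendsto_intros V tendsto_divide_0[OF tendsto_const] filterlim_at_top_imp_at_infinity filterlim_ident)
    then show "((\<lambda>t. ln C / t + real p * (ln (?V (t - 1)) / t) - real n * b) \<longlongrightarrow> real p * m - real n * b) at_top" by simp
    show "((\<lambda>t. real p * (ln (?V t) / t)) \<longlongrightarrow> real p * m) at_top" by (intro tendsto_intros V)
    show "\<forall>\<^sub>F t in at_top. ln C / t + real p * (ln (?V (t - 1)) / t) - real n * b \<le> ln (?M t) / t"
      using eventually_ge_at_top[of 1]
    proof eventually_elim
      case (elim t)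
      have V1: "1 \<le> ?V (t - 1)" using elim by (intro return_moment_finite(2) n) auto
      then have p: "0 < C * exp (- (real n * b) * t) * ?V (t - 1) ^ p" using C(1) by simp
      have "ln (C * exp (- (real n * b) * t) * ?V (t - 1) ^ p) \<le> ln (?M t)"
        by (rule ln_mono[OF C(2)[OF elim] p])
      moreover have "ln (C * exp (- (real n * b) * t) * ?V (t - 1) ^ p) = ln C - real n * b * t + real p * ln (?V (t - 1))"
        using C(1) V1 by (simp add: ln_mult ln_realpow)
      ultimately have "(ln C - real n * b * t + real p * ln (?V (t - 1))) / t \<le> ln (?M t) / t"
        using elim by (intro divide_right_mono) auto
      then show ?case using elim by (simp add: add_divide_distrib diff_divide_distrib)
    qed
    show "\<forall>\<^sub>F t in at_top. ln (?M t) / t \<le> real p * (ln (?V t) / t)"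
      using eventually_gt_at_top[of 0]
    proof eventually_elim
      case (elim t)
      have V1: "1 \<le> ?V t" using elim by (intro return_moment_finite(2) n) auto
      have "ln (?M t) \<le> ln (?V t ^ p)"
        using moment_finite(2,3)[OF a n elim, of b p y] by (intro ln_mono) auto
      also have "\<dots> = real p * ln (?V t)" using V1 by (simp add: ln_realpow)
      finally show ?case using elim by (simp add: divide_right_mono)
    qed
  qed
qed

text \<open>If both rates vanish nothing moves, and a meeting requires a common starting site; a
  positive rate reaches every site.\<close>

lemma heat_pos_or_pos:
  fixes x :: "int ^ 'd"
  assumes "0 \<le> \<kappa>" "0 \<le> \<rho>" "(\<kappa>, \<rho>) \<noteq> (0, 0) \<or> x = 0"
  shows "0 < heat (2 * real CARD('d) * \<kappa>) x \<or> 0 < heat (2 * real CARD('d) * \<rho>) x"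
proof (cases "(\<kappa>, \<rho>) = (0, 0)")
  case True
  then show ?thesis using assms heat_0_ge[of 0, where 'd='d] by auto
next
  case False
  then have "0 < \<kappa> \<or> 0 < \<rho>" using assms by auto
  then show ?thesis using heat_pos[of "2 * real CARD('d) * \<kappa>" x] heat_pos[of "2 * real CARD('d) * \<rho>" x] by auto
qed

text \<open>For static catalysts the cost of keeping them at rest is zero and the bounds meet;
  static walks are the same case after exchanging the roles. If both move, the kernel is positive
  everywhere and the supermultiplicative argument applies.\<close>

lemma moment_rate_exists:
  fixes x :: "int ^ 'd"
  assumes \<kappa>: "0 \<le> \<kappa>" and \<rho>: "0 \<le> \<rho>" and x: "(\<kappa>, \<rho>) \<noteq> (0, 0) \<or> x = 0" and n: "1 \<le> n" and p: "1 \<le> p"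
  obtains \<Lambda> where "((\<lambda>t. ln (enn2real (moment (2 * real CARD('d) * \<kappa>) (2 * real CARD('d) * \<rho>) p n x t)) / t) \<longlongrightarrow> \<Lambda>) at_top"
proof -
  have static: "\<exists>\<Lambda>. ((\<lambda>t. ln (enn2real (moment (2 * real CARD('d) * \<kappa>) 0 p n x t)) / t) \<longlongrightarrow> \<Lambda>) at_top"
    if s: "0 \<le> \<kappa>" "1 \<le> n" "\<kappa> \<noteq> 0 \<or> x = 0" for \<kappa> p n and x :: "int ^ 'd"
  proof -
    have pos: "0 < heat (2 * real CARD('d) * \<kappa>) x \<or> 0 < heat 0 x"
      using heat_pos_or_pos[of \<kappa> 0 x] s by auto
    obtain l u where lu:
      "(l \<longlongrightarrow> real p * (real n * spectral_sup TYPE('d) (\<kappa> / real n)) - real n * 0) at_top"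
      "(u \<longlongrightarrow> real p * (real n * spectral_sup TYPE('d) (\<kappa> / real n))) at_top"
      "\<forall>\<^sub>F t in at_top. l t \<le> ln (enn2real (moment (2 * real CARD('d) * \<kappa>) 0 p n x t)) / t"
      "\<forall>\<^sub>F t in at_top. ln (enn2real (moment (2 * real CARD('d) * \<kappa>) 0 p n x t)) / t \<le> u t"
      by (rule moment_rate_bounds[OF s(1) order_refl s(2) pos])
    then have "((\<lambda>t. ln (enn2real (moment (2 * real CARD('d) * \<kappa>) 0 p n x t)) / t) \<longlongrightarrow>
      real p * (real n * spectral_sup TYPE('d) (\<kappa> / real n))) at_top"
      using lu(1) by (intro tendsto_sandwich[OF lu(3,4) _ lu(2)]) simp
    then show ?thesis by (rule exI)
  qed
  consider "\<rho> = 0" | "\<kappa> = 0" "\<rho> \<noteq> 0" | "0 < \<kappa>" "0 < \<rho>" using \<kappa> \<rho> by (cases "\<rho> = 0"; cases "\<kappa> = 0") auto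
  then show ?thesis
  proof cases
    case 1
    then have "\<kappa> \<noteq> 0 \<or> x = 0" using x by auto
    then obtain \<Lambda> where "((\<lambda>t. ln (enn2real (moment (2 * real CARD('d) * \<kappa>) 0 p n x t)) / t) \<longlongrightarrow> \<Lambda>) at_top"
      using static[OF \<kappa> n, of x p] by blast
    then show ?thesis by (intro that[of \<Lambda>]) (simp add: 1)
  next
    case 2
    then have "moment (2 * real CARD('d) * \<kappa>) (2 * real CARD('d) * \<rho>) p n x t = moment (2 * real CARD('d) * \<rho>) 0 n p (- x) t" for t
      by (simp add: moment_swap[of 0])
    moreover obtain \<Lambda> where "((\<lambda>t. ln (enn2real (moment (2 * real CARD('d) * \<rho>) 0 n p (- x) t)) / t) \<longlongrightarrow> \<Lambda>) at_top"
      using static[OF \<rho> p, of "- x" n] 2 by blast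
    ultimately show ?thesis by (intro that[of \<Lambda>]) (simp only:)
  next
    case 3
    then have "0 < 2 * real CARD('d) * \<kappa>" "0 < 2 * real CARD('d) * \<rho>" by simp_all
    then show ?thesis by (rule moment_growth_exists) (rule that)
  qed
qed

text \<open>Both pairs of bounds come from one estimate, used directly and with the roles exchanged.
  In the second use, division by \<open>p\<close> turns the defect \<open>p * 2 d \<kappa>\<close>
  into one that is independent of \<open>n\<close> and \<open>p\<close>.\<close>

lemma lyapunov_bounds:
  fixes x :: "int ^ 'd"
  assumes \<kappa>: "0 \<le> \<kappa>" and \<rho>: "0 \<le> \<rho>" and x: "(\<kappa>, \<rho>) \<noteq> (0, 0) \<or> x = 0" and n: "1 \<le> n" and p: "1 \<le> p"
  shows "0 \<le> lyapunov n p \<kappa> \<rho> x"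
    and "real n * spectral_sup TYPE('d) (\<kappa> / real n) - real n * (2 * real CARD('d) * \<rho>) / real p \<le> lyapunov n p \<kappa> \<rho> x"
    and "lyapunov n p \<kappa> \<rho> x \<le> real n * spectral_sup TYPE('d) (\<kappa> / real n)"
    and "real n * spectral_sup TYPE('d) (\<rho> / real p) - 2 * real CARD('d) * \<kappa> \<le> lyapunov n p \<kappa> \<rho> x"
    and "lyapunov n p \<kappa> \<rho> x \<le> real n * spectral_sup TYPE('d) (\<rho> / real p)"
proof -
  let ?a = "2 * real CARD('d) * \<kappa>" and ?b = "2 * real CARD('d) * \<rho>"
  have ab: "0 \<le> ?a" "0 \<le> ?b" using \<kappa> \<rho> by auto
  obtain \<Lambda> where \<Lambda>: "((\<lambda>t. ln (enn2real (moment ?a ?b p n x t)) / t) \<longlongrightarrow> \<Lambda>) at_top"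
    using moment_rate_exists[OF assms] .
  have L: "lyapunov n p \<kappa> \<rho> x = \<Lambda> / real p" by (rule lyapunov_eqI[OF p \<Lambda>])
  have "0 \<le> \<Lambda>"
  proof (rule tendsto_lowerbound[OF \<Lambda>])
    show "\<forall>\<^sub>F t in at_top. 0 \<le> ln (enn2real (moment ?a ?b p n x t)) / t"
      using eventually_gt_at_top[of 0]
    proof eventually_elim
      case (elim t)
      show ?case using moment_finite(2)[of ?a n t ?b p x] \<kappa> n elim by (auto intro!: divide_nonneg_nonneg ln_ge_zero)
    qed
  qed simp
  then show "0 \<le> lyapunov n p \<kappa> \<rho> x" unfolding L by simp
  obtain l u where lu: "(l \<longlongrightarrow> real p * (real n * spectral_sup TYPE('d) (\<kappa> / real n)) - real n * ?b) at_top"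
      "(u \<longlongrightarrow> real p * (real n * spectral_sup TYPE('d) (\<kappa> / real n))) at_top"
      "\<forall>\<^sub>F t in at_top. l t \<le> ln (enn2real (moment ?a ?b p n x t)) / t"
      "\<forall>\<^sub>F t in at_top. ln (enn2real (moment ?a ?b p n x t)) / t \<le> u t"
    using moment_rate_bounds[OF \<kappa> ab(2) n heat_pos_or_pos[OF \<kappa> \<rho> x], of p] .
  have 1: "real p * (real n * spectral_sup TYPE('d) (\<kappa> / real n)) - real n * ?b \<le> \<Lambda>"
    "\<Lambda> \<le> real p * (real n * spectral_sup TYPE('d) (\<kappa> / real n))"
    using tendsto_le[OF _ \<Lambda> lu(1) lu(3)] tendsto_le[OF _ lu(2) \<Lambda> lu(4)] by auto
  have x': "(\<rho>, \<kappa>) \<noteq> (0, 0) \<or> - x = 0" using x by auto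
  obtain l u where lu: "(l \<longlongrightarrow> real n * (real p * spectral_sup TYPE('d) (\<rho> / real p)) - real p * ?a) at_top"
      "(u \<longlongrightarrow> real n * (real p * spectral_sup TYPE('d) (\<rho> / real p))) at_top"
      "\<forall>\<^sub>F t in at_top. l t \<le> ln (enn2real (moment ?b ?a n p (- x) t)) / t"
      "\<forall>\<^sub>F t in at_top. ln (enn2real (moment ?b ?a n p (- x) t)) / t \<le> u t"
    using moment_rate_bounds[OF \<rho> ab(1) p heat_pos_or_pos[OF \<rho> \<kappa> x'], of n] .
  have \<Lambda>': "((\<lambda>t. ln (enn2real (moment ?b ?a n p (- x) t)) / t) \<longlongrightarrow> \<Lambda>) at_top"
    using \<Lambda> by (simp only: moment_swap[of ?a ?b p n x])
  have 2: "real n * (real p * spectral_sup TYPE('d) (\<rho> / real p)) - real p * ?a \<le> \<Lambda>"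
    "\<Lambda> \<le> real n * (real p * spectral_sup TYPE('d) (\<rho> / real p))"
    using tendsto_le[OF _ \<Lambda>' lu(1) lu(3)] tendsto_le[OF _ lu(2) \<Lambda>' lu(4)] by auto
  have *: "c \<le> \<Lambda> / real p" if "real p * c \<le> \<Lambda>" for c
    using that p by (simp add: le_divide_eq mult.commute)
  have **: "\<Lambda> / real p \<le> c" if "\<Lambda> \<le> real p * c" for c
    using that p by (simp add: divide_le_eq mult.commute)
  show "real n * spectral_sup TYPE('d) (\<kappa> / real n) - real n * (2 * real CARD('d) * \<rho>) / real p \<le> lyapunov n p \<kappa> \<rho> x"
    unfolding L using 1(1) p by (intro *) (simp add: right_diff_distrib)
  show "lyapunov n p \<kappa> \<rho> x \<le> real n * spectral_sup TYPE('d) (\<kappa> / real n)"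
    unfolding L by (rule **[OF 1(2)])
  show "real n * spectral_sup TYPE('d) (\<rho> / real p) - 2 * real CARD('d) * \<kappa> \<le> lyapunov n p \<kappa> \<rho> x"
    unfolding L using 2(1) by (intro *) (simp add: right_diff_distrib mult.left_commute[of "real p"])
  show "lyapunov n p \<kappa> \<rho> x \<le> real n * spectral_sup TYPE('d) (\<rho> / real p)"
    unfolding L using 2(2) by (intro **) (simp add: mult.left_commute[of "real p"])
qed

text \<open>For an infinite Green function both sides hold, the quotient being \<open>0\<close>.
  Otherwise \<open>green 0\<close> is a positive real and the inequality can be rearranged.\<close>

lemma critical_moment_iff:
  assumes \<rho>: "0 \<le> \<rho>" and p: "1 \<le> p"
  shows "ennreal \<rho> / green (0 :: int ^ 'd) < of_nat p \<longleftrightarrow> ennreal (\<rho> / real p) < green (0 :: int ^ 'd)"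
proof (cases "green (0 :: int ^ 'd) = \<top>")
  case True
  then show ?thesis using p by simp
next
  case False
  then obtain g where g: "green (0 :: int ^ 'd) = ennreal g" "0 < g"
    using green_neq_0[where 'd='d] by (cases "green (0 :: int ^ 'd)") auto
  have "ennreal \<rho> / ennreal g < ennreal (real p) \<longleftrightarrow> \<rho> < real p * g"
    using g \<rho> by (simp add: divide_ennreal ennreal_less_iff divide_less_eq)
  also have "\<dots> \<longleftrightarrow> \<rho> / real p < g" using p by (simp add: divide_less_eq mult.commute)
  finally show ?thesis using g \<rho> by (simp add: ennreal_less_iff ennreal_of_nat_eq_real_of_nat)
qed

theorem theorem1p3:
  fixes \<kappa> \<rho> :: real and x :: "int ^ 'd"
  assumes "0 \<le> \<kappa>" and "0 \<le> \<rho>"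
    and "(\<kappa>, \<rho>) \<noteq> (0, 0) \<or> x = 0"
  shows "(\<forall>n::nat. 1 \<le> n \<longrightarrow>
            (\<lambda>p. lyapunov n p \<kappa> \<rho> x) \<longlonglongrightarrow> real n * spectral_sup TYPE('d) (\<kappa> / real n)) \<and>
         (\<forall>p::nat. 1 \<le> p \<longrightarrow> of_nat p > ennreal \<rho> / green (0 :: int ^ 'd) \<longrightarrow>
            filterlim (\<lambda>n. lyapunov n p \<kappa> \<rho> x) at_top sequentially) \<and>
         (\<forall>p::nat. 1 \<le> p \<longrightarrow> of_nat p \<le> ennreal \<rho> / green (0 :: int ^ 'd) \<longrightarrow>
            (\<forall>n::nat. 1 \<le> n \<longrightarrow> lyapunov n p \<kappa> \<rho> x = 0))"
proof (intro conjI allI impI)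
  fix n :: nat assume n: "1 \<le> n"
  let ?m = "real n * spectral_sup TYPE('d) (\<kappa> / real n)"
  show "(\<lambda>p. lyapunov n p \<kappa> \<rho> x) \<longlonglongrightarrow> ?m"
  proof (rule tendsto_sandwich)
    \<comment> \<open>The gap between the two bounds is of order \<open>1 / p\<close> for fixed
      \<open>n\<close>.\<close>
    have "(\<lambda>p. ?m - real n * (2 * real CARD('d) * \<rho>) / real p) \<longlonglongrightarrow> ?m - 0"
      by (intro tendsto_diff tendsto_const lim_const_over_n)
    then show "(\<lambda>p. ?m - real n * (2 * real CARD('d) * \<rho>) / real p) \<longlonglongrightarrow> ?m" by simp
    show "\<forall>\<^sub>F p in sequentially. ?m - real n * (2 * real CARD('d) * \<rho>) / real p \<le> lyapunov n p \<kappa> \<rho> x"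
      using eventually_ge_at_top[of 1] by eventually_elim (rule lyapunov_bounds(2)[OF assms n])
    show "\<forall>\<^sub>F p in sequentially. lyapunov n p \<kappa> \<rho> x \<le> ?m"
      using eventually_ge_at_top[of 1] by eventually_elim (rule lyapunov_bounds(3)[OF assms n])
  qed (rule tendsto_const)
next
  fix p :: nat assume p: "1 \<le> p" and "of_nat p > ennreal \<rho> / green (0 :: int ^ 'd)"
  then have "0 < spectral_sup TYPE('d) (\<rho> / real p)"
    using critical_moment_iff[OF assms(2) p, where 'd='d] spectral_sup_pos_iff(1)[of "\<rho> / real p", where 'd='d] assms by simp
  then have "filterlim (\<lambda>n. spectral_sup TYPE('d) (\<rho> / real p) * real n) at_top sequentially"
    by (intro filterlim_tendsto_pos_mult_at_top[OF tendsto_const] filterlim_real_sequentially)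
  \<comment> \<open>The defect does not grow with \<open>n\<close>, so the linear term wins.\<close>
  then have "filterlim (\<lambda>n. - (2 * real CARD('d) * \<kappa>) + spectral_sup TYPE('d) (\<rho> / real p) * real n) at_top sequentially"
    by (intro filterlim_tendsto_add_at_top[OF tendsto_const])
  then show "filterlim (\<lambda>n. lyapunov n p \<kappa> \<rho> x) at_top sequentially"
  proof (rule filterlim_at_top_mono)
    show "\<forall>\<^sub>F n in sequentially. - (2 * real CARD('d) * \<kappa>) + spectral_sup TYPE('d) (\<rho> / real p) * real n \<le> lyapunov n p \<kappa> \<rho> x"
      using eventually_ge_at_top[of 1]
    proof eventually_elim
      case (elim n)
      then show ?case using lyapunov_bounds(4)[OF assms elim p] by (simp add: mult.commute)
    qed
  qed
next
  fix p n :: nat assume p: "1 \<le> p" and "of_nat p \<le> ennreal \<rho> / green (0 :: int ^ 'd)" and n: "1 \<le> n"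
  then have "\<not> 0 < spectral_sup TYPE('d) (\<rho> / real p)"
    using critical_moment_iff[OF assms(2) p, where 'd='d] spectral_sup_pos_iff(1)[of "\<rho> / real p", where 'd='d] assms(2)
    by (metis divide_nonneg_nonneg leD of_nat_0_le_iff)
  then have "spectral_sup TYPE('d) (\<rho> / real p) = 0"
    using spectral_sup_pos_iff(2)[of "\<rho> / real p", where 'd='d] assms by simp
  \<comment> \<open>The exponent is nonnegative, and the upper bound with roles exchanged is
    \<open>n\<close> times the value just shown to be \<open>0\<close>.\<close>
  then show "lyapunov n p \<kappa> \<rho> x = 0"
    using lyapunov_bounds(1,5)[OF assms n p] by simp
qed

end
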